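(* Let $N\ge2$, $1<p\le N$, $q>p-1$, $q_c:=\frac{N(p-1)}{N-1}$, let $\Omega\subset\mathbb{R}^N$ be a domain containing $0$ and let $u$ be a negative $C^1$ solution of $-\Delta_p u+|\nabla u|^q=0$ in $\Omega\setminus\{0\}$. (i) When $p-1<q<q_c$, there exists $c\le0$ such that $$\lim_{x\to0}\frac{u(x)}{\mu_p(x)}=c\quad\text{and}\quad -\Delta_p u+|\nabla u|^q=c_{N,p}\,|c|^{p-2}c\,\delta_0\ \text{ in }\mathcal{D}'(\Omega)$$ (with $|c|^{p-2}c:=0$ if $c=0$). (ii) When $q>q_c$, the two relations in (i) hold with $c=0$, i.e. $\lim_{x\to 0}u(x)/\mu_p(x)=0$ and $-\Delta_pu+|\nabla u|^q=0$ in $\mathcal{D}'(\Omega)$. Furthermore, when $u$ is radial and $q<p$, the following hold: (iii) When $q=q_c$, either $$\lim_{x\to0}\frac{(-\ln|x|)^{\frac{N-1}{p-1}}\,u(x)}{\mu_p(x)}=\gamma_{N,p}$$ for a constant $\gamma_{N,p}<0$ depending only on $N$ and $p$, or $u$ is regular at $0$. (iv) When $q>q_c$, either $$\lim_{x\to0}|x|^{\beta_q}u(x)=-\tilde\lambda_{N,p,q},$$ or $u$ is regular at $0$, where $\beta_q=\frac{p-q}{q+1-p}$ and $\tilde\lambda_{N,p,q}=\beta_q^{-1}\big(N-p-\beta_q(p-1)\big)^{\frac{1}{q+1-p}}$.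
   Context: $\Delta_p u=\operatorname{div}(|\nabla u|^{p-2}\nabla u)$; $C^1$ solutions are understood in the distributional sense. $\mu_p(x)=\frac{p-1}{N-p}|x|^{\frac{p-N}{p-1}}$ if $1<p<N$ and $\mu_N(x)=-\ln|x|$ if $p=N$. $c_{N,p}>0$ is the constant such that $-\Delta_p\mu_p=c_{N,p}\delta_0$ in $\mathcal{D}'(\mathbb{R}^N)$. "Regular at $0$" means that $u$ extends as a $C^1$ solution of the equation in a neighbourhood of $0$. *)

theory Defs
  imports "HOL-Analysis.Analysis"
begin

text \<open>The gradient as a function; meaningful at points of differentiability.\<close>

definition grad :: "('a::euclidean_space \<Rightarrow> real) \<Rightarrow> 'a \<Rightarrow> 'a" where
  "grad u x = (THE D. GDERIV u x :> D)"

lemma GDERIV_grad: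
  assumes "u differentiable (at x)"
  shows "GDERIV u x :> grad u x"
proof -
  obtain L where L: "(u has_derivative L) (at x)"
    using assms by (auto simp: differentiable_def)
  then have lin: "linear L" by (rule has_derivative_linear)
  have "L h = h \<bullet> (\<Sum>b\<in>Basis. L b *\<^sub>R b)" for h
  proof -
    have "L h = L (\<Sum>b\<in>Basis. (h \<bullet> b) *\<^sub>R b)" by (simp add: euclidean_representation)
    also have "\<dots> = (\<Sum>b\<in>Basis. (h \<bullet> b) * L b)"
      using lin by (simp add: linear_sum linear_cmul)
    finally show ?thesis by (simp add: inner_sum_right mult.commute)
  qed
  then have "L = (\<lambda>h. h \<bullet> (\<Sum>b\<in>Basis. L b *\<^sub>R b))" by (rule ext)
  with L have "GDERIV u x :> (\<Sum>b\<in>Basis. L b *\<^sub>R b)" by (metis gderiv_def)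
  moreover have "D = E" if "GDERIV u x :> D" "GDERIV u x :> E" for D E
  proof -
    have "(\<lambda>h. h \<bullet> D) = (\<lambda>h. h \<bullet> E)"
      using that unfolding gderiv_def by (rule has_derivative_unique)
    then show ?thesis by (metis vector_eq_ldot)
  qed
  ultimately show ?thesis unfolding grad_def by (metis (full_types) theI)
qed

text \<open>To be used on open sets only, where differentiability at a point does not
  involve values outside the set.\<close>

definition C1_on :: "'a::euclidean_space set \<Rightarrow> ('a \<Rightarrow> real) \<Rightarrow> bool" where
  "C1_on S u \<longleftrightarrow> (\<forall>x\<in>S. u differentiable (at x)) \<and> continuous_on S (grad u)"

primrec Ck :: "nat \<Rightarrow> ('a::euclidean_space \<Rightarrow> real) \<Rightarrow> bool" where
  "Ck 0 f \<longleftrightarrow> continuous_on UNIV f"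
| "Ck (Suc k) f \<longleftrightarrow> (\<forall>x. f differentiable (at x)) \<and>
     (\<forall>v. Ck k (\<lambda>x. frechet_derivative f (at x) v))"

definition test_functions :: "'a::euclidean_space set \<Rightarrow> ('a \<Rightarrow> real) set" where
  "test_functions \<Omega> = {\<phi>. (\<forall>k. Ck k \<phi>) \<and>
     compact (closure {x. \<phi> x \<noteq> 0}) \<and> closure {x. \<phi> x \<noteq> 0} \<subseteq> \<Omega>}"

definition L1_loc :: "'a::euclidean_space set \<Rightarrow> ('a \<Rightarrow> 'b::euclidean_space) \<Rightarrow> bool" where
  "L1_loc \<Omega> F \<longleftrightarrow> (\<forall>K. compact K \<and> K \<subseteq> \<Omega> \<longrightarrow> set_integrable lborel K F)"

text \<open>The field \<open>|\<nabla>u|\<^sup>p\<^sup>-\<^sup>2 \<nabla>u\<close>, which is \<open>0\<close> where \<open>\<nabla>u\<close> vanishes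
  (also for \<open>p < 2\<close>).\<close>

definition p_flux :: "real \<Rightarrow> ('a::euclidean_space \<Rightarrow> real) \<Rightarrow> 'a \<Rightarrow> 'a" where
  "p_flux p u x = norm (grad u x) powr (p - 2) *\<^sub>R grad u x"

text \<open>Distributions are rendered as functionals on test functions. The functionals below are
  meaningful when \<open>p_flux p u\<close>, respectively \<open>f\<close>, is locally integrable on \<open>\<Omega>\<close>; this is part
  of the equations that use them. Values on null sets are irrelevant, so \<open>u\<close> need not be
  differentiable at \<open>0\<close>.\<close>

definition neg_p_laplacian ::
  "real \<Rightarrow> 'a::euclidean_space set \<Rightarrow> ('a \<Rightarrow> real) \<Rightarrow> ('a \<Rightarrow> real) \<Rightarrow> real" where
  "neg_p_laplacian p \<Omega> u \<phi> = (LINT x:\<Omega>|lborel. p_flux p u x \<bullet> grad \<phi> x)"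

definition regular_distr ::
  "'a::euclidean_space set \<Rightarrow> ('a \<Rightarrow> real) \<Rightarrow> ('a \<Rightarrow> real) \<Rightarrow> real" where
  "regular_distr \<Omega> f \<phi> = (LINT x:\<Omega>|lborel. f x * \<phi> x)"

definition dirac0 :: "('a::euclidean_space \<Rightarrow> real) \<Rightarrow> real" where
  "dirac0 \<phi> = \<phi> 0"

text \<open>\<open>-\<Delta>\<^sub>p u + |\<nabla>u|\<^sup>q = a \<delta>\<^sub>0\<close> in \<open>\<D>'(\<Omega>)\<close>. The two local integrability conditions hold
  automatically if \<open>u\<close> is \<open>C\<^sup>1\<close> on the open set \<open>\<Omega>\<close>, \<open>p > 1\<close> and \<open>q > 0\<close>.\<close>

definition distr_eq ::
  "real \<Rightarrow> real \<Rightarrow> 'a::euclidean_space set \<Rightarrow> ('a \<Rightarrow> real) \<Rightarrow> real \<Rightarrow> bool" where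
  "distr_eq p q \<Omega> u a \<longleftrightarrow>
     L1_loc \<Omega> (p_flux p u) \<and> L1_loc \<Omega> (\<lambda>x. norm (grad u x) powr q) \<and>
     (\<forall>\<phi>\<in>test_functions \<Omega>.
        neg_p_laplacian p \<Omega> u \<phi> + regular_distr \<Omega> (\<lambda>x. norm (grad u x) powr q) \<phi> = a * dirac0 \<phi>)"

definition C1_solution ::
  "real \<Rightarrow> real \<Rightarrow> 'a::euclidean_space set \<Rightarrow> ('a \<Rightarrow> real) \<Rightarrow> bool" where
  "C1_solution p q \<Omega> u \<longleftrightarrow> C1_on \<Omega> u \<and> distr_eq p q \<Omega> u 0"

definition regular_at_0 ::
  "real \<Rightarrow> real \<Rightarrow> 'a::euclidean_space set \<Rightarrow> ('a \<Rightarrow> real) \<Rightarrow> bool" where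
  "regular_at_0 p q \<Omega> u \<longleftrightarrow>
     (\<exists>V v. open V \<and> 0 \<in> V \<and> V \<subseteq> \<Omega> \<and> (\<forall>x\<in>V - {0}. v x = u x) \<and> C1_solution p q V v)"

definition radial_on :: "'a::euclidean_space set \<Rightarrow> ('a \<Rightarrow> real) \<Rightarrow> bool" where
  "radial_on S u \<longleftrightarrow> (\<exists>f. \<forall>x\<in>S. u x = f (norm x))"

definition mu :: "real \<Rightarrow> 'a::euclidean_space \<Rightarrow> real" where
  "mu p x = (let N = real DIM('a) in
     if p < N then (p - 1) / (N - p) * norm x powr ((p - N) / (p - 1)) else - ln (norm x))"

text \<open>The constant \<open>c\<^sub>N\<^sub>,\<^sub>p\<close>; the dimension enters through the type argument.\<close>

definition fund_const :: "'a::euclidean_space itself \<Rightarrow> real \<Rightarrow> real" where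
  "fund_const _ p = (THE c. c > 0 \<and> L1_loc UNIV (p_flux p (mu p :: 'a \<Rightarrow> real)) \<and>
     (\<forall>\<phi>\<in>test_functions UNIV.
        neg_p_laplacian p UNIV (mu p :: 'a \<Rightarrow> real) \<phi> = c * dirac0 \<phi>))"

definition q_crit :: "real \<Rightarrow> real \<Rightarrow> real" where
  "q_crit N p = N * (p - 1) / (N - 1)"

definition beta :: "real \<Rightarrow> real \<Rightarrow> real" where
  "beta p q = (p - q) / (q + 1 - p)"

definition lambda_tilde :: "real \<Rightarrow> real \<Rightarrow> real \<Rightarrow> real" where
  "lambda_tilde N p q = inverse (beta p q) * (N - p - beta p q * (p - 1)) powr (1 / (q + 1 - p))"

end

theory Submission
  imports Defs "HOL-Real_Asymp.Real_Asymp"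
begin

text \<open>
  Put \<open>v = -u > 0\<close>, so \<open>-\<Delta>\<^sub>p v = |\<nabla>v|\<^sup>q\<close> away from \<open>0\<close>. Testing with \<open>(L - v)\<^sub>+\<^sup>2\<close> times a cutoff that removes the
  origin, which costs nothing since a point has \<open>p\<close>-capacity zero for \<open>p \<le> N\<close>, shows that \<open>|\<nabla>v|\<^sup>q\<close> and \<open>|\<nabla>v|\<^sup>p\<^sup>-\<^sup>1\<close>
  are integrable at \<open>0\<close> and that \<open>v\<close> solves the equation with right-hand side \<open>|\<nabla>v|\<^sup>q + m \<delta>\<^sub>0\<close>, where the mass \<open>m \<ge> 0\<close>
  is the limit of the energies \<open>L\<^sup>-\<^sup>2 \<integral> 2 (L - v)\<^sub>+ |\<nabla>v|\<^sup>p\<close>. For \<open>q \<ge> q\<^sub>c\<close>, Young's inequality on small balls gives \<open>m = 0\<close>.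

  The limit of \<open>v / \<mu>\<^sub>p\<close> exists: comparison with \<open>p\<close>-harmonic functions makes the difference quotients of the minima of
  \<open>v\<close> over spheres against \<open>\<mu>\<^sub>p\<close> monotone, and reflections in hyperplanes bound the oscillation of \<open>v\<close> over small
  spheres. Comparing the energies of \<open>v\<close> and \<open>\<mu>\<^sub>p\<close> by Young's inequality then identifies \<open>m\<close> with \<open>c\<^sub>N\<^sub>,\<^sub>p c\<^sup>p\<^sup>-\<^sup>1\<close>.

  In the radial case with \<open>m = 0\<close> the flux \<open>W(r) = -r\<^sup>N\<^sup>-\<^sup>1 |v'|\<^sup>p\<^sup>-\<^sup>2 v'\<close> satisfies a separable differential equation that is
  solved explicitly; \<open>v\<close> is constant near \<open>0\<close> if \<open>W\<close> vanishes somewhere, and the asymptotics follow from l'Hopital's rule otherwise.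
\<close>

text \<open>All test functions stay continuously differentiable, and this dictates the squares:
  (t_+)^2 is of class C^1 while t_+ is not. Truncation at a level L is needed because nothing is
  known beforehand about the growth of v at the origin; on {v <= L} the energy is finite, and
  division by L^2 keeps the estimates uniform in L. The sign of the equation makes v a
  p-supersolution, so functions \<alpha> + b \<mu> can be put below v; this controls minima over
  spheres and gives nothing from above. Reflections supply the upper half: v exceeds its spherical
  minimum by a bounded amount, and a bounded error disappears after division by \<mu>. The critical
  exponent enters through q / (q + 1 - p) <= N, equivalent to q >= q_c, which keeps the product of
  (1 / \<rho>)^(q / (q + 1 - p)) and the volume of a ball of radius \<rho> bounded. For q = q_c the
  radial flux solves W' = W^(N / (N - 1)) / r, so W^(-1 / (N - 1)) grows like -ln r / (N - 1); this
  is where the constant -(N - 1)^((N - 1) / (p - 1)) comes from.\<close>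

lemma eq_zero_if_le_mult_eps:
  fixes a C :: real
  assumes "\<And>e. e > 0 \<Longrightarrow> \<bar>a\<bar> \<le> e * C"
  shows "a = 0"
proof (rule ccontr)
  assume "a \<noteq> 0"
  then have "C > 0" using assms[of 1] by simp
  with assms[of "\<bar>a\<bar> / (2 * C)"] \<open>a \<noteq> 0\<close> show False by simp
qed

section \<open>Gradients and compactly supported test functions of class C^1\<close>

lemma gderiv_unique: "GDERIV f x :> D \<Longrightarrow> GDERIV f x :> E \<Longrightarrow> D = E"
  for f :: "'a::euclidean_space \<Rightarrow> real"
  unfolding gderiv_def by (drule (1) has_derivative_unique) (metis vector_eq_ldot)

lemma grad_eqI: "GDERIV u x :> D \<Longrightarrow> grad u x = D"
  for u :: "'a::euclidean_space \<Rightarrow> real"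
  unfolding grad_def by (blast intro: the_equality gderiv_unique)

lemma gderiv_transform:
  fixes f :: "'a::euclidean_space \<Rightarrow> real"
  assumes "GDERIV f x :> D" "open S" "x \<in> S" "\<And>y. y \<in> S \<Longrightarrow> f y = g y"
  shows "GDERIV g x :> D"
  using assms unfolding gderiv_def by (metis has_derivative_transform_within_open)

lemma gderiv_mvt:
  fixes f :: "'a::euclidean_space \<Rightarrow> real"
  assumes "\<And>t. 0 \<le> t \<Longrightarrow> t \<le> 1 \<Longrightarrow> GDERIV f (x + t *\<^sub>R h) :> df (x + t *\<^sub>R h)"
  obtains t where "0 < t" "t < 1" "f (x + h) - f x = df (x + t *\<^sub>R h) \<bullet> h"
proof -
  have "DERIV (\<lambda>t. f (x + t *\<^sub>R h)) t :> df (x + t *\<^sub>R h) \<bullet> h" if "0 \<le> t" "t \<le> 1" for t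
  proof -
    have "((\<lambda>t. x + t *\<^sub>R h) has_derivative (\<lambda>s. s *\<^sub>R h)) (at t)"
      by (auto intro!: derivative_eq_intros)
    moreover have "(f has_derivative (\<lambda>k. k \<bullet> df (x + t *\<^sub>R h))) (at (x + t *\<^sub>R h))"
      using assms[OF that] by (simp add: gderiv_def)
    ultimately have "((\<lambda>t. f (x + t *\<^sub>R h)) has_derivative (\<lambda>s. (s *\<^sub>R h) \<bullet> df (x + t *\<^sub>R h))) (at t)"
      by (rule has_derivative_compose)
    then show ?thesis
      unfolding has_field_derivative_def
      by (rule has_derivative_eq_rhs) (simp add: fun_eq_iff inner_commute)
  qed
  then have "\<exists>t. 0 < t \<and> t < 1 \<and> f (x + 1 *\<^sub>R h) - f (x + 0 *\<^sub>R h) = (1 - 0) * (df (x + t *\<^sub>R h) \<bullet> h)"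
    by (intro MVT2) auto
  with that show ?thesis
    by (metis add.right_neutral diff_zero mult_1 scaleR_one scaleR_zero_left)
qed

text \<open>The gradient is carried as an argument, so that sums and products of test functions come
  with explicit gradients. The class is larger than \<open>test_functions\<close> because products
  such as (L - v)_+^2 \<xi> are only once differentiable.\<close>

definition C1_test :: "'a::euclidean_space set \<Rightarrow> ('a \<Rightarrow> real) \<Rightarrow> ('a \<Rightarrow> 'a) \<Rightarrow> bool" where
  "C1_test S \<phi> d\<phi> \<longleftrightarrow> (\<forall>x. GDERIV \<phi> x :> d\<phi> x) \<and> continuous_on UNIV d\<phi> \<and>
     (\<exists>K. compact K \<and> K \<subseteq> S \<and> (\<forall>x. x \<notin> K \<longrightarrow> \<phi> x = 0 \<and> d\<phi> x = 0))"

lemma C1_testD: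
  assumes "C1_test S \<phi> d\<phi>"
  shows C1_test_gderiv: "GDERIV \<phi> x :> d\<phi> x" and C1_test_cont_grad: "continuous_on A d\<phi>"
    and C1_test_cont: "continuous_on A \<phi>"
proof -
  show g: "GDERIV \<phi> x :> d\<phi> x" for x using assms by (auto simp: C1_test_def)
  show "continuous_on A d\<phi>" using assms by (auto simp: C1_test_def intro: continuous_on_subset)
  show "continuous_on A \<phi>"
    by (meson g gderiv_def has_derivative_continuous continuous_at_imp_continuous_on)
qed

lemma C1_test_support:
  assumes "C1_test S \<phi> d\<phi>"
  obtains K where "compact K" "K \<subseteq> S" "\<And>x. x \<notin> K \<Longrightarrow> \<phi> x = 0" "\<And>x. x \<notin> K \<Longrightarrow> d\<phi> x = 0"
  using assms by (auto simp: C1_test_def)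

lemma C1_test_mono: "C1_test S \<phi> d\<phi> \<Longrightarrow> S \<subseteq> T \<Longrightarrow> C1_test T \<phi> d\<phi>"
  unfolding C1_test_def by blast

text \<open>The open sets \<open>S\<close> and \<open>- K\<close> cover the space, so regularity on
  \<open>S\<close> and vanishing off \<open>K\<close> glue together. That \<open>d\<phi>\<close>
  vanishes on \<open>S - K\<close> follows from uniqueness of gradients; the last assumption fixes
  its values outside \<open>S\<close>, which are otherwise arbitrary.\<close>

lemma C1_testI:
  assumes S: "open S" and K: "compact K" "K \<subseteq> S"
    and d: "\<And>x. x \<in> S \<Longrightarrow> GDERIV \<phi> x :> d\<phi> x" "continuous_on S d\<phi>"
    and 0: "\<And>x. x \<notin> K \<Longrightarrow> \<phi> x = 0" "\<And>x. x \<notin> S \<Longrightarrow> d\<phi> x = 0"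
  shows "C1_test S \<phi> d\<phi>"
proof -
  have K': "open (- K)" using K by (simp add: compact_imp_closed open_Compl)
  have g0: "GDERIV \<phi> x :> 0" if "x \<notin> K" for x
    by (rule gderiv_transform[OF GDERIV_const[where k=0] K']) (use that 0 in auto)
  have d0: "d\<phi> x = 0" if "x \<notin> K" for x
    using d(1)[of x] g0[OF that] 0(2)[of x] gderiv_unique by blast
  have "continuous_on (S \<union> (- K)) d\<phi>"
    by (intro continuous_on_open_Un S K' d continuous_on_cong[THEN iffD2, OF refl _ continuous_on_const[of _ 0]] d0) auto
  moreover have "S \<union> (- K) = UNIV" using K by auto
  moreover have "GDERIV \<phi> x :> d\<phi> x" for x
    using d(1)[of x] g0[of x] d0[of x] K(2) by (cases "x \<in> K") auto
  ultimately show ?thesis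
    unfolding C1_test_def using d0 0 K(1,2) by auto
qed

lemma integrable_compact_support:
  fixes f :: "'a::euclidean_space \<Rightarrow> 'b::{banach, second_countable_topology}"
  assumes "compact K" "continuous_on K f" "\<And>x. x \<notin> K \<Longrightarrow> f x = 0"
  shows "integrable lborel f"
proof -
  have "(\<lambda>x. indicator K x *\<^sub>R f x) = f" using assms(3) by (auto simp: indicator_def)
  with borel_integrable_compact[OF assms(1,2)] show ?thesis by simp
qed

lemma C1_test_integrable:
  fixes F :: "'a::euclidean_space \<Rightarrow> 'a" and f :: "'a \<Rightarrow> real"
  assumes "C1_test S \<phi> d\<phi>"
  shows "continuous_on S F \<Longrightarrow> integrable lborel (\<lambda>x. F x \<bullet> d\<phi> x)"
    and "continuous_on S f \<Longrightarrow> integrable lborel (\<lambda>x. f x * \<phi> x)"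
proof -
  obtain K where K: "compact K" "K \<subseteq> S" "\<And>x. x \<notin> K \<Longrightarrow> \<phi> x = 0" "\<And>x. x \<notin> K \<Longrightarrow> d\<phi> x = 0"
    using C1_test_support[OF assms] by blast
  show "integrable lborel (\<lambda>x. F x \<bullet> d\<phi> x)" if "continuous_on S F"
    by (rule integrable_compact_support[OF K(1)])
      (use K that C1_test_cont_grad[OF assms] in \<open>auto intro!: continuous_intros intro: continuous_on_subset\<close>)
  show "integrable lborel (\<lambda>x. f x * \<phi> x)" if "continuous_on S f"
    by (rule integrable_compact_support[OF K(1)])
      (use K that C1_test_cont[OF assms] in \<open>auto intro!: continuous_intros intro: continuous_on_subset\<close>)
qed

lemma C1_test_add:
  assumes "C1_test S \<phi> d\<phi>" "C1_test S \<psi> d\<psi>"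
  shows "C1_test S (\<lambda>x. \<phi> x + \<psi> x) (\<lambda>x. d\<phi> x + d\<psi> x)"
proof -
  obtain K where K: "compact K" "K \<subseteq> S" "\<And>x. x \<notin> K \<Longrightarrow> \<phi> x = 0" "\<And>x. x \<notin> K \<Longrightarrow> d\<phi> x = 0"
    using C1_test_support[OF assms(1)] by blast
  obtain L where L: "compact L" "L \<subseteq> S" "\<And>x. x \<notin> L \<Longrightarrow> \<psi> x = 0" "\<And>x. x \<notin> L \<Longrightarrow> d\<psi> x = 0"
    using C1_test_support[OF assms(2)] by blast
  show ?thesis unfolding C1_test_def
    using C1_testD[OF assms(1)] C1_testD[OF assms(2)] K L
    by (intro conjI allI GDERIV_add continuous_intros exI[of _ "K \<union> L"]) auto
qed

text \<open>The second factor need only be \<open>C\<^sup>1\<close> near the support of the first.\<close>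

lemma C1_test_mult:
  assumes S: "open S" and "C1_test S \<phi> d\<phi>"
    and g: "\<And>x. x \<in> S \<Longrightarrow> GDERIV g x :> dg x" "continuous_on S dg"
  shows "C1_test S (\<lambda>x. g x * \<phi> x) (\<lambda>x. g x *\<^sub>R d\<phi> x + \<phi> x *\<^sub>R dg x)"
proof -
  obtain K where K: "compact K" "K \<subseteq> S" "\<And>x. x \<notin> K \<Longrightarrow> \<phi> x = 0" "\<And>x. x \<notin> K \<Longrightarrow> d\<phi> x = 0"
    using C1_test_support[OF assms(2)] by blast
  have "continuous_on S g"
    by (meson g(1) gderiv_def has_derivative_continuous continuous_at_imp_continuous_on)
  have K0: "x \<notin> K" if "x \<notin> S" for x using that K(2) by blast
  show ?thesis
    by (rule C1_testI[OF S K(1,2)])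
      (use K K0 g \<open>continuous_on S g\<close> C1_testD[OF assms(2)] in \<open>auto intro!: GDERIV_mult continuous_intros\<close>)
qed

text \<open>Shifts are kept shorter than 1, so either both points lie in the compact unit
  neighbourhood \<open>K'\<close> of \<open>K\<close>, where uniform continuity holds, or both lie
  outside \<open>K\<close> and the difference is 0.\<close>

lemma uniform_continuity_compact_support:
  fixes f :: "'a::euclidean_space \<Rightarrow> 'b::real_normed_vector"
  assumes "continuous_on UNIV f" and K: "compact K" "\<And>x. x \<notin> K \<Longrightarrow> f x = 0" and "e > 0"
  obtains d where "d > 0" "\<And>x h. norm h < d \<Longrightarrow> norm (f (x + h) - f x) < e"
proof -
  define K' where "K' = {x + y | x y. x \<in> K \<and> y \<in> cball 0 (1::real)}"
  have "compact K'" unfolding K'_def using compact_sums[OF K(1) compact_cball] .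
  then have "uniformly_continuous_on K' f"
    using assms(1) by (intro compact_uniformly_continuous) (auto intro: continuous_on_subset)
  then obtain d where d: "d > 0" "\<And>x y. x \<in> K' \<Longrightarrow> y \<in> K' \<Longrightarrow> dist x y < d \<Longrightarrow> dist (f x) (f y) < e"
    using \<open>e > 0\<close> unfolding uniformly_continuous_on_def by (metis dist_commute)
  have "norm (f (x + h) - f x) < e" if h: "norm h < min d 1" for x h
  proof (cases "x \<in> K \<or> x + h \<in> K")
    case True
    have "x \<in> K'" "x + h \<in> K'"
    proof -
      have *: "y \<in> K'" if "y \<in> K" for y
        unfolding K'_def using that by (intro CollectI exI[of _ y] exI[of _ 0]) auto
      have **: "x + h \<in> K'" if "x \<in> K"
        unfolding K'_def using that h by (intro CollectI exI[of _ x] exI[of _ h]) auto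
      have ***: "x \<in> K'" if "x + h \<in> K"
        unfolding K'_def using that h by (intro CollectI exI[of _ "x + h"] exI[of _ "- h"]) auto
      show "x \<in> K'" "x + h \<in> K'" using True * ** *** by auto
    qed
    then show ?thesis using d(2)[of "x + h" x] h by (auto simp: dist_norm)
  next
    case False
    then show ?thesis using K \<open>e > 0\<close> by simp
  qed
  then show ?thesis using that[of "min d 1"] d(1) by auto
qed

text \<open>The mean value theorem with uniform continuity of the gradient. A linearization error
  uniform in the base point lets differentiation pass under integrals by a plain norm
  estimate.\<close>

lemma C1_test_uniformly_differentiable:
  assumes "C1_test S \<phi> d\<phi>" "e > 0"
  obtains d where "d > 0" "\<And>x h. norm h < d \<Longrightarrow> \<bar>\<phi> (x + h) - \<phi> x - d\<phi> x \<bullet> h\<bar> \<le> e * norm h"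
proof -
  obtain K where K: "compact K" "K \<subseteq> S" "\<And>x. x \<notin> K \<Longrightarrow> \<phi> x = 0" "\<And>x. x \<notin> K \<Longrightarrow> d\<phi> x = 0"
    using C1_test_support[OF assms(1)] by blast
  obtain d where d: "d > 0" "\<And>x h. norm h < d \<Longrightarrow> norm (d\<phi> (x + h) - d\<phi> x) < e"
    using uniform_continuity_compact_support[OF C1_test_cont_grad[OF assms(1)] K(1,4) assms(2)] by blast
  have "\<bar>\<phi> (x + h) - \<phi> x - d\<phi> x \<bullet> h\<bar> \<le> e * norm h" if h: "norm h < d" for x h
  proof -
    obtain t where t: "0 < t" "t < 1" "\<phi> (x + h) - \<phi> x = d\<phi> (x + t *\<^sub>R h) \<bullet> h"
      using gderiv_mvt[of \<phi> x h d\<phi>] C1_test_gderiv[OF assms(1)] by blast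
    have "norm (t *\<^sub>R h) \<le> norm h"
      using t by (simp add: mult_left_le_one_le)
    then have "norm (d\<phi> (x + t *\<^sub>R h) - d\<phi> x) < e" using d(2) h by fastforce
    then have "\<bar>(d\<phi> (x + t *\<^sub>R h) - d\<phi> x) \<bullet> h\<bar> \<le> e * norm h"
      by (intro order_trans[OF Cauchy_Schwarz_ineq2] mult_right_mono) auto
    then show ?thesis using t by (simp add: inner_diff_left)
  qed
  with d(1) that show ?thesis by blast
qed

section \<open>Translations, convolutions and integrals of gradients\<close>

lemma integral_translation:
  fixes f :: "'a::euclidean_space \<Rightarrow> 'b::{banach, second_countable_topology}"
  assumes [measurable]: "f \<in> borel_measurable borel"
  shows "(LINT x|lborel. f (c + x)) = (LINT x|lborel. f x)"
    "integrable lborel (\<lambda>x. f (c + x)) \<longleftrightarrow> integrable lborel f"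
proof -
  have "integral\<^sup>L (distr lborel borel ((+) c)) f = (LINT x|lborel. f (c + x))"
    by (rule integral_distr) auto
  then show "(LINT x|lborel. f (c + x)) = (LINT x|lborel. f x)" by (simp add: lborel_distr_plus)
  have "integrable (distr lborel borel ((+) c)) f \<longleftrightarrow> integrable lborel (\<lambda>x. f (c + x))"
    by (rule integrable_distr_eq) auto
  then show "integrable lborel (\<lambda>x. f (c + x)) \<longleftrightarrow> integrable lborel f" by (simp add: lborel_distr_plus)
qed

text \<open>The linearization error of \<phi> is uniform in the base point, so after integration
  against \<open>k\<close> it is at most the L1 norm of \<open>k\<close> times that error.\<close>

lemma convolution_gderiv:
  fixes \<phi> k :: "'a::euclidean_space \<Rightarrow> real"
  assumes t: "C1_test S \<phi> d\<phi>" and k: "continuous_on UNIV k" "compact L" "\<And>y. y \<notin> L \<Longrightarrow> k y = 0"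
  shows "GDERIV (\<lambda>x. LINT y|lborel. k y * \<phi> (x - y)) x :> (LINT y|lborel. k y *\<^sub>R d\<phi> (x - y))"
proof -
  let ?g = "\<lambda>x. LINT y|lborel. k y * \<phi> (x - y)"
  let ?D = "LINT y|lborel. k y *\<^sub>R d\<phi> (x - y)"
  have kc: "continuous_on A k" for A using k(1) by (rule continuous_on_subset) simp
  have cp: "continuous_on A (\<lambda>y. \<phi> (x - y))" "continuous_on A (\<lambda>y. d\<phi> (x - y))" for x A
    by (rule continuous_on_compose2[OF C1_test_cont[OF t, of UNIV]] continuous_on_compose2[OF C1_test_cont_grad[OF t, of UNIV]]; auto intro!: continuous_intros)+
  have i1: "integrable lborel (\<lambda>y. k y * \<phi> (x - y))" for x
    by (rule integrable_compact_support[OF k(2)]) (auto intro!: continuous_intros kc cp simp: k)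
  have i2: "integrable lborel (\<lambda>y. k y *\<^sub>R d\<phi> (x - y))" for x
    by (rule integrable_compact_support[OF k(2)]) (auto intro!: continuous_intros kc cp simp: k)
  have i3: "integrable lborel (\<lambda>y. \<bar>k y\<bar>)"
    by (rule integrable_compact_support[OF k(2)]) (auto intro!: continuous_intros kc simp: k)
  define M where "M = (LINT y|lborel. \<bar>k y\<bar>)"
  have "M \<ge> 0" unfolding M_def by simp
  have "(?g has_derivative (\<lambda>h. h \<bullet> ?D)) (at x)"
    unfolding has_derivative_at_alt
  proof (intro conjI allI impI)
    show "bounded_linear (\<lambda>h. h \<bullet> ?D)" by (rule bounded_linear_inner_left)
    fix e :: real assume "e > 0"
    \<comment> \<open>The denominator \<open>M + 1\<close> instead of \<open>M\<close> covers the
      case that \<open>k\<close> is almost everywhere 0.\<close>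
    obtain d where d: "d > 0" "\<And>x h. norm h < d \<Longrightarrow> \<bar>\<phi> (x + h) - \<phi> x - d\<phi> x \<bullet> h\<bar> \<le> e / (M + 1) * norm h"
      using C1_test_uniformly_differentiable[OF t, of "e / (M + 1)"] \<open>e > 0\<close> \<open>M \<ge> 0\<close>
      by (metis add_nonneg_pos divide_pos_pos zero_less_one)
    show "\<exists>d>0. \<forall>z. norm (z - x) < d \<longrightarrow> norm (?g z - ?g x - (z - x) \<bullet> ?D) \<le> e * norm (z - x)"
    proof (intro exI[of _ d] conjI allI impI d)
      fix z assume z: "norm (z - x) < d"
      have j: "integrable lborel (\<lambda>y. (z - x) \<bullet> (k y *\<^sub>R d\<phi> (x - y)))"
        by (rule integrable_inner_right) (rule i2)
      have "(z - x) \<bullet> ?D = (LINT y|lborel. (z - x) \<bullet> (k y *\<^sub>R d\<phi> (x - y)))"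
        by (rule integral_inner_right[symmetric]) (rule i2)
      then have eq: "?g z - ?g x - (z - x) \<bullet> ?D =
          (LINT y|lborel. k y * \<phi> (z - y) - k y * \<phi> (x - y) - (z - x) \<bullet> (k y *\<^sub>R d\<phi> (x - y)))"
        using Bochner_Integration.integral_diff[OF Bochner_Integration.integrable_diff[OF i1[of z] i1[of x]] j]
          Bochner_Integration.integral_diff[OF i1[of z] i1[of x]] by linarith
      have "norm (LINT y|lborel. k y * \<phi> (z - y) - k y * \<phi> (x - y) - (z - x) \<bullet> (k y *\<^sub>R d\<phi> (x - y))) \<le> (LINT y|lborel. \<bar>k y\<bar> * (e / (M + 1) * norm (z - x)))"
      proof (rule Bochner_Integration.integral_norm_bound_integral)
        show "integrable lborel (\<lambda>y. k y * \<phi> (z - y) - k y * \<phi> (x - y) - (z - x) \<bullet> (k y *\<^sub>R d\<phi> (x - y)))"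
          by (intro Bochner_Integration.integrable_diff i1 j)
        show "integrable lborel (\<lambda>y. \<bar>k y\<bar> * (e / (M + 1) * norm (z - x)))" using i3 by auto
        fix y
        have "k y * \<phi> (z - y) - k y * \<phi> (x - y) - (z - x) \<bullet> (k y *\<^sub>R d\<phi> (x - y))
          = k y * (\<phi> ((x - y) + (z - x)) - \<phi> (x - y) - d\<phi> (x - y) \<bullet> (z - x))"
          by (simp add: algebra_simps inner_commute)
        then show "norm (k y * \<phi> (z - y) - k y * \<phi> (x - y) - (z - x) \<bullet> (k y *\<^sub>R d\<phi> (x - y))) \<le> \<bar>k y\<bar> * (e / (M + 1) * norm (z - x))"
          using mult_left_mono[OF d(2)[OF z, of "x - y"] abs_ge_zero[of "k y"]] by (simp add: abs_mult)
      qed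
      also have "\<dots> = M / (M + 1) * e * norm (z - x)" by (simp add: M_def)
      also have "\<dots> \<le> 1 * e * norm (z - x)"
        using \<open>M \<ge> 0\<close> \<open>e > 0\<close> by (intro mult_right_mono) (auto simp: field_simps)
      finally show "norm (?g z - ?g x - (z - x) \<bullet> ?D) \<le> e * norm (z - x)" unfolding eq by simp
    qed
  qed
  then show ?thesis unfolding gderiv_def .
qed

text \<open>Translation invariance gives the increment of \<phi> along s e the integral 0, and that
  increment is s times the directional derivative up to a uniformly small error. For s <= 1
  everything lives in the fixed compact set \<open>K'\<close>, so the error integrates to something
  small. All divergence identities below rest on this.\<close>

lemma integral_gradient_zero:
  assumes t: "C1_test S \<phi> d\<phi>"
  shows "(LINT x|lborel. d\<phi> x \<bullet> e) = 0"
proof -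
  obtain K where K: "compact K" "K \<subseteq> S" "\<And>x. x \<notin> K \<Longrightarrow> \<phi> x = 0" "\<And>x. x \<notin> K \<Longrightarrow> d\<phi> x = 0"
    using C1_test_support[OF t] by blast
  have cont: "continuous_on A \<phi>" "continuous_on A d\<phi>" for A by (rule C1_testD[OF t])+
  have m: "\<phi> \<in> borel_measurable borel" using cont by (intro borel_measurable_continuous_onI)
  have i1: "integrable lborel \<phi>" by (rule integrable_compact_support[OF K(1)]) (auto simp: K cont)
  have i1': "integrable lborel (\<lambda>x. \<phi> (x + h))" for h
    using i1 integral_translation(2)[OF m, of h] by (simp add: add.commute)
  have i2: "integrable lborel (\<lambda>x. d\<phi> x \<bullet> h)" for h
    by (rule integrable_compact_support[OF K(1)]) (auto intro!: continuous_intros simp: K cont)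
  let ?I = "LINT x|lborel. d\<phi> x \<bullet> e"
  define K' where "K' = {x + y | x y. x \<in> K \<and> y \<in> cball 0 (norm e)}"
  have cK': "compact K'" unfolding K'_def using compact_sums[OF K(1) compact_cball] .
  define M where "M = measure lborel K'"
  have small: "\<bar>?I\<bar> \<le> \<epsilon> * norm e * M" if "\<epsilon> > 0" for \<epsilon>
  proof -
    obtain d where d: "d > 0" "\<And>x h. norm h < d \<Longrightarrow> \<bar>\<phi> (x + h) - \<phi> x - d\<phi> x \<bullet> h\<bar> \<le> \<epsilon> * norm h"
      using C1_test_uniformly_differentiable[OF t \<open>\<epsilon> > 0\<close>] by blast
    define s where "s = min 1 (d / (2 * (norm e + 1)))"
    have s: "s > 0" "s \<le> 1" using d(1) by (auto simp: s_def add_nonneg_pos)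
    have "s * norm e \<le> d / (2 * (norm e + 1)) * norm e" unfolding s_def by (intro mult_right_mono) auto
    also have "\<dots> < d"
    proof -
      have p: "0 < 2 * (norm e + 1)" by (simp add: add_nonneg_pos)
      have "norm e < 2 * (norm e + 1)" using zero_le_mult_iff[of 1 "norm e"] norm_ge_zero[of e] by (simp only: distrib_left mult_1_right)
      then have "d * norm e < d * (2 * (norm e + 1))" using d(1) by (rule mult_strict_left_mono)
      then show ?thesis using p by (simp add: divide_simps)
    qed
    finally have sd: "norm (s *\<^sub>R e) < d" using s by simp
    have "(LINT x|lborel. \<phi> (x + s *\<^sub>R e)) = (LINT x|lborel. \<phi> x)"
      using integral_translation(1)[OF m, of "s *\<^sub>R e"] by (simp add: add.commute)
    then have "(LINT x|lborel. \<phi> (x + s *\<^sub>R e) - \<phi> x - d\<phi> x \<bullet> (s *\<^sub>R e)) = - s * ?I"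
      using i1 i1' i2 by simp
    then have "s * \<bar>?I\<bar> = norm (LINT x|lborel. \<phi> (x + s *\<^sub>R e) - \<phi> x - d\<phi> x \<bullet> (s *\<^sub>R e))"
      using s by (simp add: abs_mult)
    also have "\<dots> \<le> (LINT x|lborel. indicator K' x * (\<epsilon> * (s * norm e)))"
    proof (rule Bochner_Integration.integral_norm_bound_integral)
      show "integrable lborel (\<lambda>x. \<phi> (x + s *\<^sub>R e) - \<phi> x - d\<phi> x \<bullet> (s *\<^sub>R e))" using i1 i1' i2 by auto
      show "integrable lborel (\<lambda>x. indicator K' x * (\<epsilon> * (s * norm e)))"
        using cK' by (auto intro!: emeasure_compact_finite borel_compact integrable_mult_left)
      fix x
      show "norm (\<phi> (x + s *\<^sub>R e) - \<phi> x - d\<phi> x \<bullet> (s *\<^sub>R e)) \<le> indicator K' x * (\<epsilon> * (s * norm e))"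
      proof (cases "x \<in> K'")
        case True
        then show ?thesis using d(2)[OF sd, of x] s by simp
      next
        case False
        have "x \<notin> K" using False unfolding K'_def by (auto dest: spec[of _ x] spec[of _ 0])
        moreover have "x + s *\<^sub>R e \<notin> K"
        proof
          assume "x + s *\<^sub>R e \<in> K"
          then have "x \<in> K'" unfolding K'_def using s
            by (intro CollectI exI[of _ "x + s *\<^sub>R e"] exI[of _ "- (s *\<^sub>R e)"]) (auto simp: mult_left_le_one_le)
          with False show False by simp
        qed
        ultimately show ?thesis using False by (simp add: K)
      qed
    qed
    also have "\<dots> = s * (\<epsilon> * norm e * M)" using cK' by (simp add: M_def)
    finally show ?thesis using s by simp
  qed
  show ?thesis by (rule eq_zero_if_le_mult_eps[of _ "norm e * M"]) (use small in \<open>simp add: mult.assoc\<close>)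
qed

text \<open>Nonnegativity and a nonpositive integral force \<open>f\<close> to vanish almost
  everywhere; a nonzero value at a point of continuity would persist on a ball, which has positive
  measure. Comparison arguments use this to pass from an integral identity to one chosen
  point.\<close>

lemma continuous_integral_zero:
  fixes f :: "'a::euclidean_space \<Rightarrow> real"
  assumes f: "integrable lborel f" "\<And>x. f x \<ge> 0" "integral\<^sup>L lborel f \<le> 0"
    and S: "open S" "continuous_on S f" "x \<in> S"
  shows "f x = 0"
proof -
  have "integral\<^sup>L lborel f = 0" using f by (simp add: integral_nonneg order_antisym)
  then have "AE y in lborel. f y = 0" using integral_nonneg_eq_0_iff_AE[OF f(1)] f(2) by auto
  then have "AE y in lebesgue. y \<in> S \<longrightarrow> f y = 0"
    using AE_completion by fastforce
  show ?thesis
  proof (rule ccontr)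
    assume "f x \<noteq> 0"
    define U where "U = S \<inter> f -` (- {0})"
    have "open U" unfolding U_def using S by (intro continuous_open_preimage) auto
    moreover have "x \<in> U" using S \<open>f x \<noteq> 0\<close> by (auto simp: U_def)
    moreover have "AE y in lborel. y \<notin> U" using \<open>AE y in lborel. f y = 0\<close> by eventually_elim (auto simp: U_def)
    then have "emeasure lborel U = 0" using \<open>open U\<close> by (simp add: AE_iff_measurable[of U lborel] borel_open)
    moreover obtain e where "e > 0" "ball x e \<subseteq> U" using calculation openE by blast
    ultimately have "emeasure lborel (ball x e) = 0"
      by (metis borel_open emeasure_mono le_zero_eq sets_lborel)
    moreover have "measure lborel (ball x e) > 0" using \<open>e > 0\<close> content_ball_gt_0_iff[of x e] by auto
    ultimately show False by (simp add: measure_def)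
  qed
qed

subsection \<open>Smooth test functions and mollification\<close>

text \<open>The function exp(-1/t) / t^j on t > 0, extended by 0. The powers of 1/t are included so
  that the family, up to linear combinations, is closed under differentiation.\<close>

definition flat_exp :: "nat \<Rightarrow> real \<Rightarrow> real" where
  "flat_exp j t = (if t > 0 then exp (- inverse t) * inverse t ^ j else 0)"

lemma flat_exp_tendsto: "((\<lambda>t. exp (- inverse t) * inverse t ^ j) \<longlongrightarrow> 0) (at_right (0::real))"
proof -
  have "((\<lambda>x::real. x ^ j / exp x) \<longlongrightarrow> 0) at_top" by (rule tendsto_power_div_exp_0)
  from filterlim_compose[OF this filterlim_inverse_at_top_right] show ?thesis
    by (simp add: exp_minus divide_inverse mult.commute)
qed

text \<open>At 0 the right difference quotient is exp(-1/t) / t^(j+1), again a function of the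
  family and thus tending to 0; the left one is identically 0.\<close>

lemma flat_exp_deriv: "DERIV (flat_exp j) t :> flat_exp (j + 2) t - real j * flat_exp (j + 1) t"
proof (cases t "0::real" rule: linorder_cases)
  case less
  have "DERIV (\<lambda>_. 0) t :> 0" by simp
  then have "DERIV (flat_exp j) t :> 0"
    by (rule has_field_derivative_transform_within_open[of _ _ _ "{..<0}"]) (use less in \<open>auto simp: flat_exp_def\<close>)
  then show ?thesis using less by (simp add: flat_exp_def)
next
  case greater
  have "DERIV (\<lambda>t. inverse t ^ j) t :> - real j * inverse t ^ (j + 1)"
  proof (cases j)
    case (Suc n)
    have "DERIV (\<lambda>t. inverse t ^ Suc n) t :> (1 + real n) * (- (inverse t ^ Suc (Suc 0)) * inverse t ^ n)"
      by (rule DERIV_power_Suc, rule DERIV_inverse) (use greater in auto)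
    then show ?thesis unfolding Suc by (rule DERIV_cong) (simp add: algebra_simps)
  qed simp
  moreover have "DERIV (\<lambda>t. exp (- inverse t)) t :> exp (- inverse t) * inverse t ^ 2"
    using greater by (auto intro!: derivative_eq_intros simp: power2_eq_square)
  ultimately have "DERIV (\<lambda>t. exp (- inverse t) * inverse t ^ j) t :>
      exp (- inverse t) * inverse t ^ 2 * inverse t ^ j + (- real j * inverse t ^ (j + 1)) * exp (- inverse t)"
    by (intro DERIV_mult)
  also have "exp (- inverse t) * inverse t ^ 2 * inverse t ^ j + (- real j * inverse t ^ (j + 1)) * exp (- inverse t)
      = flat_exp (j + 2) t - real j * flat_exp (j + 1) t"
    using greater by (simp add: flat_exp_def power_add power2_eq_square mult_ac)
  finally have "DERIV (\<lambda>t. exp (- inverse t) * inverse t ^ j) t :> flat_exp (j + 2) t - real j * flat_exp (j + 1) t" .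
  then show ?thesis
    by (rule has_field_derivative_transform_within_open[of _ _ _ "{0<..}"]) (use greater in \<open>auto simp: flat_exp_def\<close>)
next
  case equal
  have "((\<lambda>t. exp (- inverse t) * inverse t ^ (Suc j)) \<longlongrightarrow> 0) (at_right (0::real))"
    by (rule flat_exp_tendsto)
  then have r: "((\<lambda>t. (flat_exp j t - flat_exp j 0) / (t - 0)) \<longlongrightarrow> 0) (at_right 0)"
    by (rule Lim_transform_eventually)
      (auto simp: flat_exp_def divide_inverse mult_ac intro!: eventually_at_right_less[THEN eventually_mono])
  have l: "((\<lambda>t. (flat_exp j t - flat_exp j 0) / (t - 0)) \<longlongrightarrow> 0) (at_left 0)"
    by (rule Lim_transform_eventually[of "\<lambda>_. 0"])
      (auto simp: flat_exp_def eventually_at_filter intro!: always_eventually)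
  show ?thesis unfolding equal
    using l r by (simp add: flat_exp_def has_field_derivative_iff filterlim_split_at)
qed

text \<open>The functions obtained from \<open>exp (-1 / (r - |x|\<^sup>2))\<close> by taking derivatives all have this form.\<close>

inductive bump_like :: "real \<Rightarrow> ('a::euclidean_space \<Rightarrow> real) \<Rightarrow> bool" for r where
  base: "bump_like r (\<lambda>x. flat_exp j (r - x \<bullet> x))"
| add: "bump_like r f \<Longrightarrow> bump_like r g \<Longrightarrow> bump_like r (\<lambda>x. f x + g x)"
| scale: "bump_like r f \<Longrightarrow> bump_like r (\<lambda>x. c * f x)"
| lin: "bump_like r f \<Longrightarrow> bump_like r (\<lambda>x. (x \<bullet> w) * f x)"

lemma gderiv_norm_sq: "GDERIV (\<lambda>x. x \<bullet> x) x :> 2 *\<^sub>R x"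
  unfolding gderiv_def by (auto intro!: derivative_eq_intros simp: inner_commute fun_eq_iff)

lemma gderiv_inner_left: "GDERIV (\<lambda>x. x \<bullet> w) x :> w"
  unfolding gderiv_def by (auto intro!: derivative_eq_intros)

lemma bump_like_outside: "bump_like r f \<Longrightarrow> x \<notin> cball 0 (sqrt r) \<Longrightarrow> f x = 0"
proof (induction rule: bump_like.induct)
  case (base j)
  then have "sqrt r < norm x" by simp
  then have "r < x \<bullet> x" by (metis norm_eq_sqrt_inner real_sqrt_less_iff)
  then show ?case by (simp add: flat_exp_def)
qed auto

text \<open>Closure under directional derivatives is the point, since iterating it gives smoothness
  of every order. The rule \<open>lin\<close> is present because the chain rule applied to the base
  function produces the factor -2 (x . v).\<close>

lemma bump_like_C1:
  "bump_like r f \<Longrightarrow> \<exists>df. C1_test UNIV f df \<and> (\<forall>v. bump_like r (\<lambda>x. df x \<bullet> v))"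
proof (induction rule: bump_like.induct)
  case (base j)
  let ?h = "\<lambda>t. flat_exp (j + 2) t - real j * flat_exp (j + 1) t"
  let ?df = "\<lambda>x. ?h (r - x \<bullet> x) *\<^sub>R (0 - 2 *\<^sub>R x)"
  have c: "continuous_on UNIV (flat_exp i)" for i
    by (rule DERIV_continuous_on[where D="\<lambda>t. flat_exp (i + 2) t - real i * flat_exp (i + 1) t"])
      (rule has_field_derivative_at_within, rule flat_exp_deriv)
  have "continuous_on UNIV ?df"
    by (intro continuous_intros continuous_on_compose2[OF c]) auto
  moreover have "GDERIV (\<lambda>x. flat_exp j (r - x \<bullet> x)) x :> ?df x" for x :: 'a
    by (rule GDERIV_DERIV_compose[OF GDERIV_diff[OF GDERIV_const gderiv_norm_sq] flat_exp_deriv])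
  ultimately have "C1_test UNIV (\<lambda>x::'a. flat_exp j (r - x \<bullet> x)) ?df"
    by (intro C1_testI[where K="cball 0 (sqrt r)"])
      (auto intro: bump_like_outside[OF bump_like.base] simp del: mem_cball)
  moreover have "bump_like r (\<lambda>x. ?df x \<bullet> v)" for v
  proof -
    have "bump_like r (\<lambda>x. (-2) * ((x \<bullet> v) * (flat_exp (j + 2) (r - x \<bullet> x) + (- real j) * flat_exp (j + 1) (r - x \<bullet> x))))"
      by (intro bump_like.intros)
    then show ?thesis by (simp add: algebra_simps)
  qed
  ultimately show ?case by blast
next
  case (add f g)
  then obtain df dg where "C1_test UNIV f df" "\<forall>v. bump_like r (\<lambda>x. df x \<bullet> v)"
    "C1_test UNIV g dg" "\<forall>v. bump_like r (\<lambda>x. dg x \<bullet> v)" by blast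
  then have "C1_test UNIV (\<lambda>x. f x + g x) (\<lambda>x. df x + dg x)"
    "\<forall>v. bump_like r (\<lambda>x. (df x + dg x) \<bullet> v)"
    by (auto simp: inner_add_left intro: C1_test_add bump_like.add)
  then show ?case by blast
next
  case (scale f c)
  then obtain df where "C1_test UNIV f df" "\<forall>v. bump_like r (\<lambda>x. df x \<bullet> v)" by blast
  then have "C1_test UNIV (\<lambda>x. c * f x) (\<lambda>x. c *\<^sub>R df x)" "\<forall>v. bump_like r (\<lambda>x. (c *\<^sub>R df x) \<bullet> v)"
    using C1_test_mult[of UNIV f df "\<lambda>_. c" "\<lambda>_. 0"] by (auto intro: bump_like.scale GDERIV_const)
  then show ?case by blast
next
  case (lin f w)
  then obtain df where d: "C1_test UNIV f df" "\<forall>v. bump_like r (\<lambda>x. df x \<bullet> v)" by blast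
  then have "C1_test UNIV (\<lambda>x. (x \<bullet> w) * f x) (\<lambda>x. (x \<bullet> w) *\<^sub>R df x + f x *\<^sub>R w)"
    by (intro C1_test_mult) (auto intro: gderiv_inner_left)
  moreover have "bump_like r (\<lambda>x. ((x \<bullet> w) *\<^sub>R df x + f x *\<^sub>R w) \<bullet> v)" for v
  proof -
    have "bump_like r (\<lambda>x. (x \<bullet> w) * (df x \<bullet> v) + (w \<bullet> v) * f x)"
      using d lin by (intro bump_like.intros) auto
    then show ?thesis by (simp add: inner_add_left mult.commute)
  qed
  ultimately show ?case by blast
qed

lemma frechet_derivative_gderiv: "GDERIV f x :> D \<Longrightarrow> frechet_derivative f (at x) = (\<lambda>v. v \<bullet> D)"
  unfolding gderiv_def by (metis frechet_derivative_at)

lemma gderiv_differentiable: "GDERIV f x :> D \<Longrightarrow> f differentiable (at x)"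
  unfolding gderiv_def differentiable_def by blast

lemma bump_like_Ck: "bump_like r f \<Longrightarrow> Ck k f"
proof (induction k arbitrary: f)
  case 0
  then show ?case using bump_like_C1 C1_test_cont by fastforce
next
  case (Suc k)
  then obtain df where d: "C1_test UNIV f df" "\<And>v. bump_like r (\<lambda>x. df x \<bullet> v)" using bump_like_C1 by blast
  have "frechet_derivative f (at x) v = df x \<bullet> v" for x v
    using frechet_derivative_gderiv[OF C1_test_gderiv[OF d(1)]] by (simp add: inner_commute)
  then show ?case
    using Suc.IH[OF d(2)] gderiv_differentiable[OF C1_test_gderiv[OF d(1)]] by simp
qed

text \<open>Derivatives fall on the smooth factor: the derivative in direction \<open>v\<close> is
  the convolution of \<open>g\<close> with another \<open>bump_like\<close> function, so the
  induction runs over all such \<open>f\<close> while \<open>g\<close> is only continuous.\<close>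

lemma convolution_Ck:
  fixes f :: "'a::euclidean_space \<Rightarrow> real"
  assumes "continuous_on UNIV g" "compact L" "\<And>y. y \<notin> L \<Longrightarrow> g y = 0"
  shows "bump_like r f \<Longrightarrow> Ck k (\<lambda>x. LINT y|lborel. g y * f (x - y))"
proof (induction k arbitrary: f)
  case (Suc k)
  then obtain df where d: "C1_test UNIV f df" "\<And>v. bump_like r (\<lambda>x. df x \<bullet> v)" using bump_like_C1 by blast
  have gd: "GDERIV (\<lambda>x. LINT y|lborel. g y * f (x - y)) x :> (LINT y|lborel. g y *\<^sub>R df (x - y))" for x
    by (rule convolution_gderiv[OF d(1) assms])
  have cont: "continuous_on A g" for A using assms(1) by (rule continuous_on_subset) simp
  have cd: "continuous_on A (\<lambda>y. df (x - y))" for A x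
    by (rule continuous_on_compose2[OF C1_test_cont_grad[OF d(1), of UNIV]]) (auto intro!: continuous_intros)
  have "integrable lborel (\<lambda>y. g y *\<^sub>R df (x - y))" for x
    by (rule integrable_compact_support[OF assms(2)]) (auto intro!: continuous_intros cont cd simp: assms)
  then have "v \<bullet> (LINT y|lborel. g y *\<^sub>R df (x - y)) = (LINT y|lborel. g y * (df (x - y) \<bullet> v))" for x v
    by (subst integral_inner_right[symmetric]) (auto simp: inner_commute)
  then have "frechet_derivative (\<lambda>x. LINT y|lborel. g y * f (x - y)) (at x) v
      = (LINT y|lborel. g y * (df (x - y) \<bullet> v))" for x v
    using frechet_derivative_gderiv[OF gd] by simp
  then show ?case
    using Suc.IH[OF d(2)] gderiv_differentiable[OF gd] by simp
next
  case 0
  then obtain df where d: "C1_test UNIV f df" using bump_like_C1 by blast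
  show ?case
    unfolding Ck.simps using convolution_gderiv[OF d assms]
    by (meson gderiv_def has_derivative_continuous continuous_at_imp_continuous_on)
qed

lemma integral_reflect:
  fixes f :: "'a::euclidean_space \<Rightarrow> 'b::{banach, second_countable_topology}"
  assumes [measurable]: "f \<in> borel_measurable borel"
  shows "(LINT y|lborel. f (x - y)) = (LINT y|lborel. f y)"
proof -
  have "lborel = distr lborel borel (\<lambda>y::'a. x - y)"
    using lborel_affine[of "-1" x] by (simp add: density_1)
  then have "(LINT y|lborel. f y) = integral\<^sup>L (distr lborel borel (\<lambda>y::'a. x - y)) f" by simp
  also have "\<dots> = (LINT y|lborel. f (x - y))" by (rule integral_distr) auto
  finally show ?thesis by simp
qed

text \<open>The value at 0 is required to be positive so that the mollifier also serves as a test
  function that detects the coefficient of a Dirac mass.\<close>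

lemma mollifier_exists:
  assumes "\<epsilon> > 0"
  obtains \<rho> :: "'a::euclidean_space \<Rightarrow> real" and r where "bump_like r \<rho>" "sqrt r = \<epsilon>" "\<And>x. \<rho> x \<ge> 0"
    "integrable lborel \<rho>" "integral\<^sup>L lborel \<rho> = 1" "\<rho> 0 > 0" "\<And>x. norm x > \<epsilon> \<Longrightarrow> \<rho> x = 0"
proof -
  let ?f = "\<lambda>x::'a. flat_exp 0 (\<epsilon>\<^sup>2 - x \<bullet> x)"
  have b: "bump_like (\<epsilon>\<^sup>2) ?f" by (rule bump_like.base)
  have s: "sqrt (\<epsilon>\<^sup>2) = \<epsilon>" using assms by simp
  obtain df where d: "C1_test UNIV ?f df" using bump_like_C1[OF b] by blast
  have i: "integrable lborel ?f"
    by (rule integrable_compact_support[of "cball 0 \<epsilon>"])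
      (use bump_like_outside[OF b] C1_test_cont[OF d] s in auto)
  have nn: "?f x \<ge> 0" for x by (simp add: flat_exp_def)
  have p0: "?f 0 > 0" using assms by (simp add: flat_exp_def)
  have pos: "integral\<^sup>L lborel ?f > 0"
  proof (rule ccontr)
    assume "\<not> ?thesis"
    then have "?f 0 = 0"
      by (intro continuous_integral_zero[OF i nn _ open_UNIV C1_test_cont[OF d]]) auto
    with p0 show False by simp
  qed
  define \<rho> where "\<rho> x = inverse (integral\<^sup>L lborel ?f) * ?f x" for x
  show ?thesis
  proof (rule that[of "\<epsilon>\<^sup>2" \<rho>])
    show "bump_like (\<epsilon>\<^sup>2) \<rho>" unfolding \<rho>_def by (intro bump_like.scale b)
    show "integrable lborel \<rho>" unfolding \<rho>_def using i by simp
    show "integral\<^sup>L lborel \<rho> = 1" unfolding \<rho>_def using pos by simp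
    show "\<rho> x \<ge> 0" for x unfolding \<rho>_def using pos nn by simp
    show "\<rho> 0 > 0" unfolding \<rho>_def using pos p0 by simp
    show "\<rho> x = 0" if "norm x > \<epsilon>" for x
      using bump_like_outside[OF b, of x] that s by (simp add: \<rho>_def)
  qed (rule s)
qed

lemma average_close:
  fixes g :: "'a::euclidean_space \<Rightarrow> 'b::euclidean_space"
  assumes \<rho>: "\<And>x. \<rho> x \<ge> 0" "integrable lborel \<rho>" "integral\<^sup>L lborel \<rho> = 1" "\<And>x. norm x > \<epsilon> \<Longrightarrow> \<rho> x = 0"
    and i: "integrable lborel (\<lambda>y. \<rho> y *\<^sub>R g (x - y))"
    and g: "\<And>y. norm y \<le> \<epsilon> \<Longrightarrow> norm (g (x - y) - g x) \<le> \<eta>"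
  shows "norm ((LINT y|lborel. \<rho> y *\<^sub>R g (x - y)) - g x) \<le> \<eta>"
proof -
  have "(LINT y|lborel. \<rho> y *\<^sub>R g (x - y)) - g x = (LINT y|lborel. \<rho> y *\<^sub>R g (x - y) - \<rho> y *\<^sub>R g x)"
    using i \<rho>(2,3) by (subst Bochner_Integration.integral_diff) auto
  also have "norm \<dots> \<le> (LINT y|lborel. \<rho> y * \<eta>)"
  proof (rule Bochner_Integration.integral_norm_bound_integral)
    show "integrable lborel (\<lambda>y. \<rho> y *\<^sub>R g (x - y) - \<rho> y *\<^sub>R g x)"
      by (intro Bochner_Integration.integrable_diff i integrable_scaleR_left) (rule \<rho>)
    show "integrable lborel (\<lambda>y. \<rho> y * \<eta>)" using \<rho>(2) by simp
    fix y
    show "norm (\<rho> y *\<^sub>R g (x - y) - \<rho> y *\<^sub>R g x) \<le> \<rho> y * \<eta>"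
    proof (cases "norm y \<le> \<epsilon>")
      case True
      then show ?thesis using g[of y] \<rho>(1)[of y]
        by (simp flip: scaleR_diff_right add: mult_left_mono)
    next
      case False
      then show ?thesis using \<rho>(4)[of y] by simp
    qed
  qed
  also have "\<dots> = \<eta>" using \<rho>(3) by simp
  finally show ?thesis .
qed

lemma test_functionsI:
  assumes "compact K" "K \<subseteq> S" "\<And>x. x \<notin> K \<Longrightarrow> \<phi> x = 0" "\<And>k. Ck k \<phi>"
  shows "\<phi> \<in> test_functions S"
proof -
  have "closure {x. \<phi> x \<noteq> 0} \<subseteq> K"
    using assms by (intro closure_minimal compact_imp_closed) auto
  then have "compact (closure {x. \<phi> x \<noteq> 0})" "closure {x. \<phi> x \<noteq> 0} \<subseteq> S"
    using assms(1,2) by (metis closed_Int_compact closed_closure inf.absorb_iff1, blast)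
  then show ?thesis using assms(4) unfolding test_functions_def by auto
qed

text \<open>\<open>Ck\<close> speaks of directional derivatives only; continuity of the gradient is
  recovered by expanding it in the basis.\<close>

lemma gderiv_euclidean_expansion:
  fixes \<phi> :: "'a::euclidean_space \<Rightarrow> real"
  assumes "Ck (Suc 0) \<phi>"
  shows "GDERIV \<phi> x :> grad \<phi> x" and "continuous_on UNIV (grad \<phi>)"
proof -
  show g: "GDERIV \<phi> x :> grad \<phi> x" for x using assms by (auto intro: GDERIV_grad)
  have "grad \<phi> = (\<lambda>x. \<Sum>b\<in>Basis. frechet_derivative \<phi> (at x) b *\<^sub>R b)"
    using frechet_derivative_gderiv[OF g]
    by (simp add: fun_eq_iff inner_commute[of _ "grad \<phi> _"] euclidean_representation)
  moreover have "continuous_on UNIV (\<lambda>x. frechet_derivative \<phi> (at x) b)" for b using assms by auto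
  ultimately show "continuous_on UNIV (grad \<phi>)" by (auto intro!: continuous_intros)
qed

lemma test_functions_C1_test:
  assumes "open S" "\<phi> \<in> test_functions S"
  shows "C1_test S \<phi> (grad \<phi>)"
proof -
  have c: "Ck (Suc 0) \<phi>" using assms(2) unfolding test_functions_def by blast
  let ?K = "closure {x. \<phi> x \<noteq> 0}"
  have K: "compact ?K" "?K \<subseteq> S" using assms(2) unfolding test_functions_def by auto
  have "C1_test UNIV \<phi> (grad \<phi>)"
    by (rule C1_testI[OF open_UNIV K(1)])
      (use gderiv_euclidean_expansion[OF c] closure_subset[of "{x. \<phi> x \<noteq> 0}"] in auto)
  moreover have "grad \<phi> x = 0" if "x \<notin> ?K" for x
    by (rule grad_eqI, rule gderiv_transform[OF GDERIV_const[where k=0], of "- ?K"])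
      (use that closure_subset[of "{x. \<phi> x \<noteq> 0}"] in auto)
  ultimately show ?thesis unfolding C1_test_def using K closure_subset[of "{x. \<phi> x \<noteq> 0}"]
    by (intro conjI exI[of _ ?K]) auto
qed

text \<open>A weak equation with continuous data that holds for smooth test functions also holds
  for \<open>C\<^sup>1\<close> ones.\<close>

lemma weak_equation_C1:
  fixes F :: "'a::euclidean_space \<Rightarrow> 'a" and f :: "'a \<Rightarrow> real"
  assumes S: "open S" "continuous_on S F" "continuous_on S f"
    and w: "\<And>\<phi>. \<phi> \<in> test_functions S \<Longrightarrow> (LINT x|lborel. F x \<bullet> grad \<phi> x) = (LINT x|lborel. f x * \<phi> x)"
    and t: "C1_test S \<phi> d\<phi>"
  shows "(LINT x|lborel. F x \<bullet> d\<phi> x) = (LINT x|lborel. f x * \<phi> x)"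
proof -
  obtain K where K: "compact K" "K \<subseteq> S" "\<And>x. x \<notin> K \<Longrightarrow> \<phi> x = 0" "\<And>x. x \<notin> K \<Longrightarrow> d\<phi> x = 0"
    using C1_test_support[OF t] by blast
  obtain \<delta> where \<delta>: "\<delta> > 0" "{x + y | x y. x \<in> K \<and> y \<in> cball 0 \<delta>} \<subseteq> S"
  proof -
    obtain e where e: "e > 0" "(\<Union>x\<in>K. ball x e) \<subseteq> S"
      using compact_subset_open_imp_ball_epsilon_subset[OF K(1) S(1) K(2)] by blast
    have "{x + y | x y. x \<in> K \<and> y \<in> cball 0 (e/2)} \<subseteq> (\<Union>x\<in>K. ball x e)"
      using e(1) by (force simp: dist_norm)
    with e show ?thesis by (intro that[of "e/2"]) auto
  qed
  define K' where "K' = {x + y | x y. x \<in> K \<and> y \<in> cball 0 \<delta>}"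
  have K': "compact K'" "K' \<subseteq> S" unfolding K'_def using compact_sums[OF K(1) compact_cball[of 0 \<delta>]] \<delta> by blast+
  have K'0: "x \<in> K'" if "x - y \<in> K" "norm y \<le> \<delta>" for x y
    unfolding K'_def using that by (intro CollectI exI[of _ "x - y"] exI[of _ y]) auto
  \<comment> \<open>All functions in the approximation vanish off \<open>K'\<close>, so the L1 norm
    of the data over this one compact set bounds the error for every mollification
    parameter.\<close>
  define M where "M = (LINT x|lborel. indicator K' x * (norm (F x) + \<bar>f x\<bar>))"
  have iM: "integrable lborel (\<lambda>x. indicator K' x * (norm (F x) + \<bar>f x\<bar>))"
    using borel_integrable_compact[OF K'(1), of "\<lambda>x. norm (F x) + \<bar>f x\<bar>"]
      continuous_on_subset[OF S(2) K'(2)] continuous_on_subset[OF S(3) K'(2)]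
    by (simp add: continuous_intros)
  let ?E = "(LINT x|lborel. F x \<bullet> d\<phi> x) - (LINT x|lborel. f x * \<phi> x)"
  have small: "\<bar>?E\<bar> \<le> \<eta> * M" if eta: "\<eta> > 0" for \<eta>
  proof -
    obtain d1 where d1: "d1 > 0" "\<And>x h. norm h < d1 \<Longrightarrow> norm (\<phi> (x + h) - \<phi> x) < \<eta>"
      using uniform_continuity_compact_support[OF C1_test_cont[OF t] K(1,3) eta] by blast
    obtain d2 where d2: "d2 > 0" "\<And>x h. norm h < d2 \<Longrightarrow> norm (d\<phi> (x + h) - d\<phi> x) < \<eta>"
      using uniform_continuity_compact_support[OF C1_test_cont_grad[OF t] K(1,4) eta] by blast
    define \<epsilon> where "\<epsilon> = min \<delta> (min d1 d2 / 2)"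
    have \<epsilon>: "\<epsilon> > 0" "\<epsilon> \<le> \<delta>" "\<epsilon> < d1" "\<epsilon> < d2" using \<delta>(1) d1(1) d2(1) by (auto simp: \<epsilon>_def min_def)
    obtain \<rho> :: "'a \<Rightarrow> real" and r where \<rho>: "bump_like r \<rho>" "sqrt r = \<epsilon>" "\<And>x. \<rho> x \<ge> 0"
      "integrable lborel \<rho>" "integral\<^sup>L lborel \<rho> = 1" "\<And>x. norm x > \<epsilon> \<Longrightarrow> \<rho> x = 0"
      using mollifier_exists[OF \<epsilon>(1)] by metis
    obtain d\<rho> where d\<rho>: "C1_test UNIV \<rho> d\<rho>" using bump_like_C1[OF \<rho>(1)] by blast
    have c\<rho>: "continuous_on A \<rho>" for A by (rule C1_test_cont[OF d\<rho>])
    have cp: "continuous_on A (\<lambda>y. \<phi> (x - y))" "continuous_on A (\<lambda>y. d\<phi> (x - y))" for x A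
      by (rule continuous_on_compose2[OF C1_test_cont[OF t, of UNIV]] continuous_on_compose2[OF C1_test_cont_grad[OF t, of UNIV]]; auto intro!: continuous_intros)+
    have \<rho>0: "y \<notin> cball 0 \<epsilon> \<Longrightarrow> \<rho> y = 0" for y using \<rho>(6) by auto
    define \<psi> where "\<psi> x = (LINT y|lborel. \<rho> y * \<phi> (x - y))" for x
    define d\<psi> where "d\<psi> x = (LINT y|lborel. \<rho> y *\<^sub>R d\<phi> (x - y))" for x
    have g: "GDERIV \<psi> x :> d\<psi> x" for x
      unfolding \<psi>_def d\<psi>_def by (rule convolution_gderiv[OF t c\<rho> compact_cball \<rho>0])
    \<comment> \<open>The convolution is needed in both orders: with the derivative on \<phi> the
      gradient is visibly close to \<open>d\<phi>\<close>, and with the derivative on the mollifier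
      \<psi> is seen to be smooth.\<close>
    have \<psi>2: "\<psi> = (\<lambda>x. LINT y|lborel. \<phi> y * \<rho> (x - y))"
    proof
      fix x
      have "continuous_on UNIV (\<lambda>y. \<phi> y * \<rho> (x - y))"
        by (intro continuous_intros C1_test_cont[OF t] continuous_on_compose2[OF c\<rho>[of UNIV]]) auto
      then have "(\<lambda>y. \<phi> y * \<rho> (x - y)) \<in> borel_measurable borel" by (rule borel_measurable_continuous_onI)
      from integral_reflect[OF this, of x] show "\<psi> x = (LINT y|lborel. \<phi> y * \<rho> (x - y))"
        by (simp add: \<psi>_def mult.commute)
    qed
    have i1: "integrable lborel (\<lambda>y. \<rho> y *\<^sub>R \<phi> (x - y))" for x
      by (rule integrable_compact_support[OF compact_cball[of 0 \<epsilon>]]) (auto intro!: continuous_intros c\<rho> cp simp: \<rho>0 simp del: mem_cball)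
    have i2: "integrable lborel (\<lambda>y. \<rho> y *\<^sub>R d\<phi> (x - y))" for x
      by (rule integrable_compact_support[OF compact_cball[of 0 \<epsilon>]]) (auto intro!: continuous_intros c\<rho> cp simp: \<rho>0 simp del: mem_cball)
    have out: "\<psi> x = 0" "d\<psi> x = 0" "\<phi> x = 0" "d\<phi> x = 0" if "x \<notin> K'" for x
    proof -
      have *: "\<rho> y = 0 \<or> x - y \<notin> K" for y
        using K'0[of x y] that \<rho>(6)[of y] \<epsilon>(2) by force
      have "(\<lambda>y. \<rho> y * \<phi> (x - y)) = (\<lambda>_. 0)" "(\<lambda>y. \<rho> y *\<^sub>R d\<phi> (x - y)) = (\<lambda>_. 0)"
        using * K by (auto simp: fun_eq_iff)
      then show "\<psi> x = 0" "d\<psi> x = 0" by (simp_all add: \<psi>_def d\<psi>_def)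
      have "x \<notin> K" using K'0[of x 0] that \<delta>(1) by auto
      then show "\<phi> x = 0" "d\<phi> x = 0" by (auto simp: K)
    qed
    have "Ck k \<psi>" for k
      unfolding \<psi>2 by (rule convolution_Ck[OF C1_test_cont[OF t] K(1,3) \<rho>(1)])
    then have "\<psi> \<in> test_functions S"
      by (auto intro!: test_functionsI[OF K'] out(1))
    from w[OF this] have eq: "(LINT x|lborel. F x \<bullet> d\<psi> x) = (LINT x|lborel. f x * \<psi> x)"
      using grad_eqI[OF g] by simp
    have cl: "\<bar>\<psi> x - \<phi> x\<bar> \<le> \<eta>" "norm (d\<psi> x - d\<phi> x) \<le> \<eta>" for x
    proof -
      have "norm ((LINT y|lborel. \<rho> y *\<^sub>R \<phi> (x - y)) - \<phi> x) \<le> \<eta>"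
        by (rule average_close[OF \<rho>(3-6) i1]) (use d1(2)[of "- y" x for y] \<epsilon> in \<open>auto intro: less_imp_le\<close>)
      then show "\<bar>\<psi> x - \<phi> x\<bar> \<le> \<eta>" by (simp add: \<psi>_def)
      show "norm (d\<psi> x - d\<phi> x) \<le> \<eta>" unfolding d\<psi>_def
        by (rule average_close[OF \<rho>(3-6) i2]) (use d2(2)[of "- y" x for y] \<epsilon> in \<open>auto intro: less_imp_le\<close>)
    qed
    have "grad \<psi> = d\<psi>" using grad_eqI[OF g] by auto
    then have "C1_test S \<psi> d\<psi>" using test_functions_C1_test[OF S(1) \<open>\<psi> \<in> test_functions S\<close>] by simp
    note j = C1_test_integrable(1)[OF this S(2)] C1_test_integrable(2)[OF this S(3)]
    note j' = C1_test_integrable(1)[OF t S(2)] C1_test_integrable(2)[OF t S(3)]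
    have "?E = (LINT x|lborel. (F x \<bullet> d\<phi> x - F x \<bullet> d\<psi> x) - (f x * \<phi> x - f x * \<psi> x))"
      using eq j j' by simp
    also have "\<bar>\<dots>\<bar> \<le> (LINT x|lborel. indicator K' x * (norm (F x) + \<bar>f x\<bar>) * \<eta>)"
    proof (rule Bochner_Integration.integral_norm_bound_integral[where 'b=real, unfolded real_norm_def])
      show "integrable lborel (\<lambda>x. (F x \<bullet> d\<phi> x - F x \<bullet> d\<psi> x) - (f x * \<phi> x - f x * \<psi> x))"
        using j j' by auto
      show "integrable lborel (\<lambda>x. indicator K' x * (norm (F x) + \<bar>f x\<bar>) * \<eta>)"
        using iM by (rule integrable_mult_left)
      fix x
      show "\<bar>(F x \<bullet> d\<phi> x - F x \<bullet> d\<psi> x) - (f x * \<phi> x - f x * \<psi> x)\<bar> \<le> indicator K' x * (norm (F x) + \<bar>f x\<bar>) * \<eta>"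
      proof (cases "x \<in> K'")
        case True
        have "\<bar>F x \<bullet> (d\<psi> x - d\<phi> x)\<bar> \<le> norm (F x) * \<eta>"
          by (rule order_trans[OF Cauchy_Schwarz_ineq2 mult_left_mono[OF cl(2)]]) simp
        moreover have "\<bar>f x * (\<psi> x - \<phi> x)\<bar> \<le> \<bar>f x\<bar> * \<eta>"
          unfolding abs_mult by (rule mult_left_mono[OF cl(1)]) simp
        ultimately show ?thesis using True by (simp add: inner_diff_right right_diff_distrib distrib_right abs_le_iff)
      next
        case False
        then show ?thesis by (simp add: out)
      qed
    qed
    also have "\<dots> = \<eta> * M" by (simp add: M_def)
    finally show ?thesis .
  qed
  have "?E = 0" by (rule eq_zero_if_le_mult_eps[OF small])
  then show ?thesis by simp
qed

subsection \<open>The \<open>p\<close>-Laplacian field and the fundamental solution\<close>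

definition p_field :: "real \<Rightarrow> 'a::euclidean_space \<Rightarrow> 'a" where
  "p_field p \<xi> = norm \<xi> powr (p - 2) *\<^sub>R \<xi>"

lemma p_flux_eq: "p_flux p u x = p_field p (grad u x)"
  by (simp add: p_flux_def p_field_def)

lemma powr_mult_self: "x \<ge> 0 \<Longrightarrow> x powr a * x = x powr (a + 1)" for x :: real
  using powr_mult_base[of x a] by (simp add: mult.commute add.commute)

lemma norm_p_field: "norm (p_field p \<xi>) = norm \<xi> powr (p - 1)"
  by (cases "\<xi> = 0") (auto simp: p_field_def powr_mult_self)

lemma p_field_inner_self: "p_field p \<xi> \<bullet> \<xi> = norm \<xi> powr p"
proof (cases "\<xi> = 0")
  case False
  have "norm \<xi> powr p = norm \<xi> powr (p - 2) * norm \<xi> ^ 2"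
    using False by (simp add: powr_mult_self power2_eq_square flip: mult.assoc)
  with False show ?thesis by (simp add: p_field_def power2_norm_eq_inner)
qed (simp add: p_field_def)

lemma p_field_minus: "p_field p (- \<xi>) = - p_field p \<xi>"
  by (simp add: p_field_def)

lemma p_field_scale: "c > 0 \<Longrightarrow> p_field p (c *\<^sub>R \<xi>) = c powr (p - 1) *\<^sub>R p_field p \<xi>"
proof -
  assume c: "c > 0"
  then have "c powr (p - 1) = c powr (p - 2) * c"
    using powr_mult_self[of c "p - 2"] by simp
  with c show ?thesis by (simp add: p_field_def powr_mult)
qed

lemma continuous_on_p_field:
  fixes f :: "'b::topological_space \<Rightarrow> 'a::euclidean_space"
  assumes "p > 1" "continuous_on S f"
  shows "continuous_on S (\<lambda>x. p_field p (f x))"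
proof -
  have "isCont (p_field p) (\<xi>::'a)" for \<xi>
  proof (cases "\<xi> = 0")
    case True
    have "((\<lambda>\<xi>::'a. norm \<xi> powr (p - 1)) \<longlongrightarrow> 0) (at 0)"
      by (rule tendsto_eq_rhs, rule tendsto_powr2[where a=0 and b="p - 1"]) (use assms in \<open>auto intro!: tendsto_eq_intros\<close>)
    then have "(p_field p \<longlongrightarrow> (0::'a)) (at 0)"
      by (rule Lim_null_comparison[rotated]) (simp add: norm_p_field)
    then show ?thesis using True by (simp add: isCont_def p_field_def)
  next
    case False
    then have "isCont (\<lambda>\<xi>. norm \<xi> powr (p - 2) *\<^sub>R \<xi>) \<xi>" by (intro continuous_intros) auto
    then show ?thesis by (simp add: p_field_def[abs_def])
  qed
  then have "continuous_on UNIV (p_field p :: 'a \<Rightarrow> 'a)" by (simp add: continuous_at_imp_continuous_on)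
  then show ?thesis by (rule continuous_on_compose2[OF _ assms(2)]) auto
qed

text \<open>Cauchy-Schwarz on the two mixed products. The bound depends on the norms alone and is
  therefore quantitative as soon as the two norms differ by a definite factor, which strict
  comparison exploits.\<close>

lemma p_field_monotone:
  "(p_field p a - p_field p b) \<bullet> (a - b) \<ge> (norm a powr (p - 1) - norm b powr (p - 1)) * (norm a - norm b)"
proof -
  have pw: "norm c powr p = norm c powr (p - 1) * norm c" for c :: 'a
    by (cases "c = 0") (auto simp: powr_mult_base mult.commute)
  have "p_field p a \<bullet> b \<le> norm a powr (p - 1) * norm b" "p_field p b \<bullet> a \<le> norm b powr (p - 1) * norm a"
    using norm_cauchy_schwarz[of "p_field p a" b] norm_cauchy_schwarz[of "p_field p b" a] by (simp_all add: norm_p_field)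
  then show ?thesis
    by (simp add: inner_diff_left inner_diff_right p_field_inner_self pw algebra_simps)
qed

lemma p_field_monotone_nonneg: 
  fixes a b :: "'a::euclidean_space"
  shows "p \<ge> 1 \<Longrightarrow> (p_field p a - p_field p b) \<bullet> (a - b) \<ge> 0"
proof -
  assume "p \<ge> 1"
  then have "norm x powr (p - 1) \<le> norm y powr (p - 1)" if "norm x \<le> norm y" for x y :: 'a
    using that by (intro powr_mono2) auto
  then have "(norm a powr (p - 1) - norm b powr (p - 1)) * (norm a - norm b) \<ge> 0"
    by (cases "norm a \<le> norm b") (simp_all add: mult_nonneg_nonneg mult_nonpos_nonpos)
  then show ?thesis using p_field_monotone[where p=p and a=a and b=b] by linarith
qed

text \<open>The field x / |x|^N, divergence free away from 0: up to a factor the gradient of the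
  Newtonian potential, and the negative of the flux of \<open>mu p\<close> for every p.\<close>

definition radial_field :: "'a::euclidean_space \<Rightarrow> 'a" where
  "radial_field x = norm x powr (- real DIM('a)) *\<^sub>R x"

text \<open>A single formula covers both branches of \<open>mu\<close>: the gradient has length
  |x|^((1 - N) / (p - 1)) whether p < N or p = N.\<close>

definition dmu :: "real \<Rightarrow> 'a::euclidean_space \<Rightarrow> 'a" where
  "dmu p x = - (norm x powr ((1 - real DIM('a)) / (p - 1) - 1) *\<^sub>R x)"

lemma norm_radial_field: "norm (radial_field (x::'a::euclidean_space)) = norm x powr (1 - real DIM('a))"
  by (cases "x = 0") (auto simp: radial_field_def powr_mult_self)

lemma norm_dmu: "norm (dmu p (x::'a::euclidean_space)) = norm x powr ((1 - real DIM('a)) / (p - 1))"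
  by (cases "x = 0") (auto simp: dmu_def powr_mult_self)

lemma gderiv_norm_powr:
  fixes x :: "'a::euclidean_space"
  assumes "x \<noteq> 0"
  shows "GDERIV (\<lambda>x. norm x powr a) x :> (a * norm x powr (a - 2)) *\<^sub>R x"
proof -
  have "DERIV (\<lambda>t. t powr a) (norm x) :> a * norm x powr (a - 1)"
    using assms by (auto intro!: derivative_eq_intros)
  from GDERIV_DERIV_compose[OF GDERIV_norm[OF assms] this]
  have "GDERIV (\<lambda>x. norm x powr a) x :> (a * norm x powr (a - 1)) *\<^sub>R sgn x" .
  moreover have "norm x powr (a - 1) = norm x powr (a - 2) * norm x"
    by (simp add: powr_mult_self)
  ultimately show ?thesis using assms by (simp add: sgn_div_norm mult.assoc)
qed

lemma gderiv_mu:
  fixes x :: "'a::euclidean_space"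
  assumes "1 < p" "p \<le> real DIM('a)" "x \<noteq> 0"
  shows "GDERIV (mu p) x :> dmu p x"
proof (cases "p < real DIM('a)")
  case True
  let ?N = "real DIM('a)"
  have eq: "(p - ?N) / (p - 1) - 2 = (1 - ?N) / (p - 1) - 1" using assms by (simp add: field_simps)
  have "GDERIV (\<lambda>x::'a. (p - 1) / (?N - p) * norm x powr ((p - ?N) / (p - 1))) x :>
      ((p - 1) / (?N - p)) *\<^sub>R (((p - ?N) / (p - 1) * norm x powr ((p - ?N) / (p - 1) - 2)) *\<^sub>R x)
      + norm x powr ((p - ?N) / (p - 1)) *\<^sub>R 0"
    by (rule GDERIV_mult[OF GDERIV_const gderiv_norm_powr[OF assms(3)]])
  moreover have "(p - 1) / (?N - p) * ((p - ?N) / (p - 1)) = -1"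
  proof -
    have "(p - ?N) / (p - 1) = - ((?N - p) / (p - 1))" by (simp add: minus_divide_left)
    then show ?thesis using True assms by simp
  qed
  then have "((p - 1) / (?N - p)) *\<^sub>R (((p - ?N) / (p - 1) * norm x powr ((p - ?N) / (p - 1) - 2)) *\<^sub>R x)
      + norm x powr ((p - ?N) / (p - 1)) *\<^sub>R 0 = dmu p x"
    by (simp only: scaleR_scaleR mult.assoc[symmetric]) (simp add: dmu_def eq)
  ultimately show ?thesis using True by (simp only: mu_def[abs_def] Let_def if_True)
next
  case False
  then have p: "p = real DIM('a)" using assms by simp
  have "DERIV (\<lambda>t. - ln t) (norm x) :> - inverse (norm x)"
    using assms by (auto intro!: derivative_eq_intros simp: divide_inverse)
  from GDERIV_DERIV_compose[OF GDERIV_norm[OF assms(3)] this]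
  have "GDERIV (\<lambda>x. - ln (norm x)) x :> (- inverse (norm x)) *\<^sub>R sgn x" .
  moreover have "(1 - real DIM('a)) / (p - 1) - 1 = - 2" using assms p by (simp add: field_simps)
  then have "(- inverse (norm x)) *\<^sub>R sgn x = dmu p x" using assms(3)
    by (simp only: dmu_def) (simp add: sgn_div_norm powr_minus power2_eq_square)
  ultimately show ?thesis using False by (simp only: mu_def[abs_def] Let_def if_False)
qed

text \<open>The exponent (1 - N) / (p - 1) is cancelled by the power p - 1, so the flux no longer
  depends on p. Hence one flux constant serves all p, and no separate study of the p-Laplacian of
  \<mu> is necessary.\<close>

lemma p_field_dmu:
  fixes x :: "'a::euclidean_space"
  assumes "1 < p"
  shows "p_field p (dmu p x) = - radial_field x"
proof (cases "x = 0")
  case False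
  let ?N = "real DIM('a)"
  have "(1 - ?N) / (p - 1) * (p - 2) + ((1 - ?N) / (p - 1) - 1) = (1 - ?N) / (p - 1) * (p - 1) - 1"
    by (simp only: right_diff_distrib)
  also have "\<dots> = - ?N" using assms by simp
  finally have "(1 - ?N) / (p - 1) * (p - 2) + ((1 - ?N) / (p - 1) - 1) = - ?N" .
  then have "norm x powr ((1 - ?N) / (p - 1) * (p - 2)) * norm x powr ((1 - ?N) / (p - 1) - 1) = norm x powr (- ?N)"
    using False by (simp flip: powr_add)
  then show ?thesis
    unfolding p_field_def norm_dmu powr_powr by (simp add: dmu_def radial_field_def)
qed (simp add: p_field_def dmu_def radial_field_def)

lemma continuous_on_radial_field: "0 \<notin> S \<Longrightarrow> continuous_on S radial_field"
  unfolding radial_field_def[abs_def] by (intro continuous_intros) auto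

lemma continuous_on_dmu: "0 \<notin> S \<Longrightarrow> continuous_on S (dmu p)"
  unfolding dmu_def[abs_def] by (intro continuous_intros) auto

lemma radial_field_measurable [measurable]: "radial_field \<in> borel_measurable borel"
  unfolding radial_field_def[abs_def] by measurable

lemma dmu_measurable [measurable]: "dmu p \<in> borel_measurable borel"
  unfolding dmu_def[abs_def] by measurable

lemma mu_tendsto:
  assumes "1 < p" "p \<le> real DIM('a)"
  shows "filterlim (mu p :: 'a::euclidean_space \<Rightarrow> real) at_top (at 0)"
proof -
  let ?N = "real DIM('a)"
  have n: "filterlim (norm :: 'a \<Rightarrow> real) (at_right 0) (at 0)"
    unfolding filterlim_at by (auto intro!: tendsto_eq_intros simp: eventually_at_filter)
  show ?thesis
  proof (cases "p < ?N")
    case True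
    have "filterlim (\<lambda>r::real. (?N - p) / (p - 1) * (- ln r)) at_top (at_right 0)"
      using True assms ln_at_0 by (intro filterlim_tendsto_pos_mult_at_top[OF tendsto_const]) (auto simp: filterlim_uminus_at_top)
    note e = filterlim_compose[OF exp_at_top this]
    have ev: "\<forall>\<^sub>F r in at_right 0. exp ((?N - p) / (p - 1) * (- ln r)) = r powr ((p - ?N) / (p - 1))"
        using eventually_at_right_less[of 0]
      proof eventually_elim
        case (elim r)
        have "(?N - p) / (p - 1) * (- ln r) = (p - ?N) / (p - 1) * ln r"
        proof -
          have "(p - ?N) / (p - 1) = - ((?N - p) / (p - 1))" by (simp add: minus_divide_left)
          then show ?thesis by (simp only: mult_minus_left mult_minus_right)
        qed
        then show ?case using elim by (simp add: powr_def)
      qed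
    have "filterlim (\<lambda>r::real. r powr ((p - ?N) / (p - 1))) at_top (at_right 0)"
      using e filterlim_cong[OF refl refl ev] by (simp only:)
    then have "filterlim (\<lambda>r. (p - 1) / (?N - p) * r powr ((p - ?N) / (p - 1))) at_top (at_right 0)"
      using True assms by (intro filterlim_tendsto_pos_mult_at_top[OF tendsto_const]) auto
    from filterlim_compose[OF this n] True show ?thesis by (simp add: mu_def[abs_def] Let_def)
  next
    case False
    have "filterlim (\<lambda>r::real. - ln r) at_top (at_right 0)"
      using ln_at_0 by (simp add: filterlim_uminus_at_top)
    from filterlim_compose[OF this n] False show ?thesis by (simp add: mu_def[abs_def] Let_def)
  qed
qed

lemma mu_radial: "norm x = norm y \<Longrightarrow> mu p x = mu p y"
  for x y :: "'a::euclidean_space" by (simp add: mu_def Let_def)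

lemma mu_less:
  fixes x y :: "'a::euclidean_space"
  assumes "1 < p" "p \<le> real DIM('a)" "0 < norm x" "norm x < norm y"
  shows "mu p y < mu p x"
proof (cases "p < real DIM('a)")
  case True
  have "norm y powr ((p - real DIM('a)) / (p - 1)) < norm x powr ((p - real DIM('a)) / (p - 1))"
    using assms True by (intro powr_less_mono2_neg) (auto simp: field_simps)
  then show ?thesis using True assms by (simp add: mu_def Let_def divide_strict_right_mono mult_strict_left_mono)
next
  case False
  moreover have "ln (norm x) < ln (norm y)" using assms by (subst ln_less_cancel_iff) auto
  ultimately show ?thesis by (simp add: mu_def Let_def)
qed

subsection \<open>Local integrability of \<open>|x|\<^sup>1\<^sup>-\<^sup>N\<close>\<close>

text \<open>Dyadic shells in place of polar coordinates: on the shell between radii 2^(-n-1) and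
  2^(-n) the integrand times the volume is at most a constant times 2^(-n-1). The geometric series
  bounds the truncated integrals, and monotone convergence finishes.\<close>

lemma integrable_norm_powr_ball:
  "integrable lborel (\<lambda>x::'a::euclidean_space. indicator (ball 0 1) x * norm x powr (1 - real DIM('a)))"
proof -
  let ?N = "real DIM('a)"
  let ?B = "\<lambda>n. {x::'a. inverse 2 ^ n \<le> norm x \<and> norm x < 1}"
  let ?f = "\<lambda>n (x::'a). indicator (?B n) x * norm x powr (1 - ?N)"
  have [measurable]: "?B n \<in> sets borel" for n by measurable
  have fin: "emeasure lborel (ball (0::'a) r) < \<infinity>" for r by (rule emeasure_lborel_ball_finite)
  have fB: "emeasure lborel (?B n) < \<infinity>" for n
    by (rule le_less_trans[OF emeasure_mono fin[of 1]]) auto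
  have i: "integrable lborel (?f n)" for n
  proof (rule Bochner_Integration.integrable_bound)
    show "integrable lborel (\<lambda>x. indicator (?B n) x * (inverse 2 ^ n) powr (1 - ?N))"
      using fB by (auto intro!: integrable_mult_left integrable_real_indicator)
    show "AE x in lborel. norm (?f n x) \<le> norm (indicator (?B n) x * (inverse 2 ^ n) powr (1 - ?N))"
      by (auto split: split_indicator intro!: AE_I2 powr_mono2')
  qed measurable
  define \<omega> where "\<omega> = measure lborel (ball (0::'a) 1)"
  have step: "integral\<^sup>L lborel (?f (Suc n)) \<le> integral\<^sup>L lborel (?f n) + \<omega> * 2 powr ?N * inverse 2 ^ Suc n" for n
  proof -
    let ?C = "ball (0::'a) (inverse 2 ^ n)"
    have mC: "measure lborel ?C = (inverse 2 ^ n) ^ DIM('a) * \<omega>"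
      unfolding \<omega>_def by (subst content_ball_conv_unit_ball) auto
    \<comment> \<open>The exponents add up to (n + 1)(N - 1) - n N = N - (n + 1).\<close>
    have ex: "(inverse 2 ^ Suc n) powr (1 - ?N) * (inverse 2 ^ n) ^ DIM('a) = 2 powr ?N * inverse 2 ^ Suc n"
    proof -
      have h: "inverse 2 ^ k = (2::real) powr (- real k)" for k
        by (simp only: powr_minus powr_realpow power_inverse zero_less_numeral)
      have "(2 powr (- real n)) ^ DIM('a) = (2::real) powr (- (real n * ?N))"
        by (subst powr_realpow[symmetric]) (auto simp: powr_powr)
      then show ?thesis unfolding h powr_powr by (simp only: flip: powr_add) (simp add: algebra_simps)
    qed
    have "integral\<^sup>L lborel (?f (Suc n)) \<le> (LINT x|lborel. ?f n x + indicator ?C x * (inverse 2 ^ Suc n) powr (1 - ?N))"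
    proof (rule integral_mono)
      show "integrable lborel (\<lambda>x. ?f n x + indicator ?C x * (inverse 2 ^ Suc n) powr (1 - ?N))"
        using i fin by (auto intro!: Bochner_Integration.integrable_add integrable_mult_left integrable_real_indicator)
      fix x :: 'a
      show "?f (Suc n) x \<le> ?f n x + indicator ?C x * (inverse 2 ^ Suc n) powr (1 - ?N)"
        by (auto split: split_indicator intro!: powr_mono2')
    qed (rule i)
    also have "\<dots> = integral\<^sup>L lborel (?f n) + (inverse 2 ^ Suc n) powr (1 - ?N) * measure lborel ?C"
      using i fin by (subst Bochner_Integration.integral_add) (auto intro!: integrable_mult_left integrable_real_indicator)
    also have "(inverse 2 ^ Suc n) powr (1 - ?N) * measure lborel ?C = \<omega> * 2 powr ?N * inverse 2 ^ Suc n"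
      unfolding mC using ex by (metis mult.assoc mult.commute)
    finally show ?thesis .
  qed
  have bound: "integral\<^sup>L lborel (?f n) \<le> \<omega> * 2 powr ?N * (1 - inverse 2 ^ n)" for n
  proof (induction n)
    case 0
    have "?f 0 = (\<lambda>_. 0)" by (auto simp: fun_eq_iff indicator_def)
    then show ?case by simp
  next
    case (Suc n)
    have "\<omega> * 2 powr ?N * (1 - inverse 2 ^ n) + \<omega> * 2 powr ?N * inverse 2 ^ Suc n = \<omega> * 2 powr ?N * (1 - inverse 2 ^ Suc n)"
      by (simp add: field_simps)
    then show ?case using step[of n] Suc by linarith
  qed
  have mono: "incseq (\<lambda>n. ?f n x)" for x
  proof (rule incseq_SucI)
    fix n
    have "inverse 2 ^ Suc n \<le> (inverse 2 ^ n :: real)" by (rule power_decreasing) auto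
    then show "?f n x \<le> ?f (Suc n) x" by (auto split: split_indicator) (use norm_ge_zero[of x] in linarith)
  qed
  have inc: "incseq (\<lambda>n. integral\<^sup>L lborel (?f n))"
    by (rule incseq_SucI, rule integral_mono[OF i i]) (rule incseq_SucD[OF mono])
  have bd: "\<forall>n. integral\<^sup>L lborel (?f n) \<le> \<omega> * 2 powr ?N"
  proof (rule allI, rule order_trans[OF bound])
    fix n
    have "\<omega> \<ge> 0" by (simp add: \<omega>_def)
    moreover have "1 - inverse 2 ^ n \<le> (1::real)" by simp
    ultimately show "\<omega> * 2 powr ?N * (1 - inverse 2 ^ n) \<le> \<omega> * 2 powr ?N"
      by (intro mult_left_le) auto
  qed
  obtain l where l: "(\<lambda>n. integral\<^sup>L lborel (?f n)) \<longlonglongrightarrow> l"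
    using incseq_convergent[OF inc bd] by blast
  have [measurable]: "ball (0::'a) 1 \<in> sets borel" by simp
  have m: "(\<lambda>x::'a. indicator (ball 0 1) x * norm x powr (1 - ?N)) \<in> borel_measurable borel" by measurable
  show ?thesis
  proof (rule integrable_monotone_convergence[OF i _ _ l])
    show "AE x in lborel. mono (\<lambda>n. ?f n x)" using mono by simp
    show "AE x in lborel. (\<lambda>n. ?f n x) \<longlonglongrightarrow> indicator (ball 0 1) x * norm x powr (1 - ?N)"
    proof (rule AE_I2)
      fix x :: 'a
      show "(\<lambda>n. ?f n x) \<longlonglongrightarrow> indicator (ball 0 1) x * norm x powr (1 - ?N)"
      proof (cases "x = 0")
        case False
        have "(\<lambda>n. inverse (2::real) ^ n) \<longlonglongrightarrow> 0" by (rule LIMSEQ_power_zero) simp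
        then have "\<forall>\<^sub>F n in sequentially. inverse (2::real) ^ n < norm x"
          using False by (intro order_tendstoD) auto
        then have "\<forall>\<^sub>F n in sequentially. ?f n x = indicator (ball 0 1) x * norm x powr (1 - ?N)"
          by eventually_elim (auto split: split_indicator)
        then show ?thesis by (rule tendsto_eventually)
      qed simp
    qed
  qed (use m in simp)
qed

lemma integrable_norm_powr_compact:
  fixes K :: "'a::euclidean_space set"
  assumes "compact K"
  shows "integrable lborel (\<lambda>x. indicator K x * norm x powr (1 - real DIM('a)))"
proof (rule Bochner_Integration.integrable_bound)
  show "integrable lborel (\<lambda>x::'a. indicator (ball 0 1) x * norm x powr (1 - real DIM('a)) + indicator K x * 1)"
    using emeasure_compact_finite[OF assms] assms
    by (intro Bochner_Integration.integrable_add integrable_norm_powr_ball integrable_mult_left integrable_real_indicator)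
      (auto simp: borel_compact)
  have [measurable]: "K \<in> sets borel" using assms by (rule borel_compact)
  show "(\<lambda>x. indicator K x * norm x powr (1 - real DIM('a))) \<in> borel_measurable lborel" by measurable
  have "norm x powr (1 - real DIM('a)) \<le> 1" if "norm x \<ge> 1" for x :: 'a
    using powr_mono2'[of "1 - real DIM('a)" 1 "norm x"] that DIM_positive[where 'a='a] by simp
  then show "AE x in lborel. norm (indicator K x * norm x powr (1 - real DIM('a)))
      \<le> norm (indicator (ball 0 1) x * norm x powr (1 - real DIM('a)) + indicator K x * 1)"
    by (auto split: split_indicator intro!: AE_I2 simp: not_less)
qed

subsection \<open>Cutoff functions\<close>

text \<open>The squared positive part replaces the positive part throughout, because its derivative
  2 t_+ is continuous across 0.\<close>

lemma deriv_pos_sq: "DERIV (\<lambda>t::real. (max 0 t)\<^sup>2) t :> 2 * max 0 t"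
proof (cases t "0::real" rule: linorder_cases)
  case less
  have "DERIV (\<lambda>_::real. 0::real) t :> 0" by simp
  then have "DERIV (\<lambda>t::real. (max 0 t)\<^sup>2) t :> 0"
    by (rule has_field_derivative_transform_within_open[of _ _ _ "{..<0}"]) (use less in auto)
  then show ?thesis using less by simp
next
  case greater
  have "DERIV (\<lambda>t::real. t\<^sup>2) t :> 2 * t" by (auto intro!: derivative_eq_intros)
  then have "DERIV (\<lambda>t::real. (max 0 t)\<^sup>2) t :> 2 * t"
    by (rule has_field_derivative_transform_within_open[of _ _ _ "{0<..}"]) (use greater in auto)
  then show ?thesis using greater by simp
next
  case equal
  have "((\<lambda>h::real. ((max 0 h)\<^sup>2 - (max 0 0)\<^sup>2) / (h - 0)) \<longlongrightarrow> 0) (at 0)"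
  proof (rule Lim_null_comparison)
    show "\<forall>\<^sub>F h in at 0. norm (((max 0 h)\<^sup>2 - (max 0 0)\<^sup>2) / (h - 0)) \<le> \<bar>h::real\<bar>"
      by (rule always_eventually) (auto simp: max_def power2_eq_square)
    show "((\<lambda>h::real. \<bar>h\<bar>) \<longlongrightarrow> 0) (at 0)" by (rule tendsto_rabs_zero) (rule tendsto_ident_at)
  qed
  then show ?thesis using equal by (simp add: has_field_derivative_iff)
qed

text \<open>A C^1 step from 1 on t <= 0 down to 0 on t >= 1, obtained by applying the squared
  positive part twice: once to leave the value 1 smoothly and once to arrive at 0 smoothly.
  \<open>dcut\<close> is its derivative.\<close>

definition cut :: "real \<Rightarrow> real" where "cut t = (max 0 (1 - (max 0 t)\<^sup>2))\<^sup>2"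
definition dcut :: "real \<Rightarrow> real" where "dcut t = - 4 * max 0 (1 - (max 0 t)\<^sup>2) * max 0 t"

lemma cut_deriv: "DERIV cut t :> dcut t"
proof -
  have "DERIV (\<lambda>t. 1 - (max 0 t)\<^sup>2) t :> 0 - 2 * max 0 t"
    by (intro DERIV_diff DERIV_const deriv_pos_sq)
  from DERIV_chain2[OF deriv_pos_sq this] show ?thesis
    by (simp add: cut_def[abs_def] dcut_def mult_ac)
qed

lemma cut_bounds: "0 \<le> cut t" "cut t \<le> 1"
  by (auto simp: cut_def power_le_one)

lemma cut_left: "t \<le> 0 \<Longrightarrow> cut t = 1" "t \<le> 0 \<Longrightarrow> dcut t = 0"
  by (auto simp: cut_def dcut_def)

lemma cut_right: "t \<ge> 1 \<Longrightarrow> cut t = 0" "t \<ge> 1 \<Longrightarrow> dcut t = 0"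
proof -
  assume "t \<ge> 1"
  then have "1 \<le> (max 0 t)\<^sup>2" by (simp add: max_def one_le_power)
  then have "max 0 (1 - (max 0 t)\<^sup>2) = 0" by simp
  then show "cut t = 0" "dcut t = 0" by (simp_all add: cut_def dcut_def)
qed

lemma dcut_bounds: "dcut t \<le> 0" "\<bar>dcut t\<bar> \<le> 4"
proof -
  have "max 0 (1 - (max 0 t)\<^sup>2) * max 0 t \<le> 1 * 1"
  proof (cases "t \<le> 1")
    case False
    then have "1 - (max 0 t)\<^sup>2 \<le> 0" by (simp add: max_def)
    then show ?thesis by (simp add: max_def)
  qed (intro mult_mono, auto)
  moreover have "0 \<le> max 0 (1 - (max 0 t)\<^sup>2) * max 0 t" by simp
  ultimately show "dcut t \<le> 0" "\<bar>dcut t\<bar> \<le> 4" unfolding dcut_def by linarith+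
qed

lemma dcut_neg: "0 < t \<Longrightarrow> t < 1 \<Longrightarrow> dcut t < 0"
  by (simp add: dcut_def power_less_one_iff mult_neg_pos)

lemma continuous_on_cut: "continuous_on S cut" "continuous_on S dcut"
  unfolding cut_def[abs_def] dcut_def[abs_def] by (intro continuous_intros)+

text \<open>The step is taken in |x|^2 rather than in |x|, so that differentiability at the origin
  is not an issue. It is 1 on the ball of radius \<open>r\<close> and 0 outside the ball of radius
  \<open>R\<close>.\<close>

definition ball_cut :: "real \<Rightarrow> real \<Rightarrow> 'a::euclidean_space \<Rightarrow> real" where
  "ball_cut r R x = cut ((x \<bullet> x - r\<^sup>2) / (R\<^sup>2 - r\<^sup>2))"
definition dball_cut :: "real \<Rightarrow> real \<Rightarrow> 'a::euclidean_space \<Rightarrow> 'a" where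
  "dball_cut r R x = (2 * dcut ((x \<bullet> x - r\<^sup>2) / (R\<^sup>2 - r\<^sup>2)) / (R\<^sup>2 - r\<^sup>2)) *\<^sub>R x"

lemma ball_cut:
  fixes x :: "'a::euclidean_space"
  assumes "0 \<le> r" "r < R"
  shows ball_cut_C1_test: "cball 0 R \<subseteq> S \<Longrightarrow> open S \<Longrightarrow> C1_test S (ball_cut r R :: 'a \<Rightarrow> real) (dball_cut r R)"
    and ball_cut_bounds: "0 \<le> ball_cut r R x" "ball_cut r R x \<le> 1"
    and ball_cut_inside: "norm x \<le> r \<Longrightarrow> ball_cut r R x = 1" "norm x \<le> r \<Longrightarrow> dball_cut r R x = 0"
    and ball_cut_outside: "R \<le> norm x \<Longrightarrow> ball_cut r R x = 0" "R \<le> norm x \<Longrightarrow> dball_cut r R x = 0"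
    and dball_cut_bound: "norm (dball_cut r R x) \<le> 8 * R / (R\<^sup>2 - r\<^sup>2)"
proof -
  have d: "R\<^sup>2 - r\<^sup>2 > 0" using assms by (simp add: power_strict_mono)
  show "0 \<le> ball_cut r R x" "ball_cut r R x \<le> 1" by (simp_all add: ball_cut_def cut_bounds)
  show "ball_cut r R x = 1" "dball_cut r R x = 0" if "norm x \<le> r"
  proof -
    have "x \<bullet> x \<le> r\<^sup>2" using that by (simp add: power_mono flip: power2_norm_eq_inner)
    then have "(x \<bullet> x - r\<^sup>2) / (R\<^sup>2 - r\<^sup>2) \<le> 0" using d by (simp add: divide_nonpos_pos)
    then show "ball_cut r R x = 1" "dball_cut r R x = 0" by (simp_all add: ball_cut_def dball_cut_def cut_left)
  qed
  have out: "ball_cut r R x = 0" "dball_cut r R x = 0" if "R \<le> norm x" for x :: 'a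
  proof -
    have "R\<^sup>2 \<le> x \<bullet> x" using that assms by (simp add: power_mono flip: power2_norm_eq_inner)
    then have "(x \<bullet> x - r\<^sup>2) / (R\<^sup>2 - r\<^sup>2) \<ge> 1" using d by simp
    then show "ball_cut r R x = 0" "dball_cut r R x = 0" by (simp_all add: ball_cut_def dball_cut_def cut_right)
  qed
  then show "R \<le> norm x \<Longrightarrow> ball_cut r R x = 0" "R \<le> norm x \<Longrightarrow> dball_cut r R x = 0" by auto
  show "norm (dball_cut r R x) \<le> 8 * R / (R\<^sup>2 - r\<^sup>2)"
  proof (cases "R \<le> norm x")
    case True
    then show ?thesis using out(2)[OF True] d assms by simp
  next
    case False
    have "norm (dball_cut r R x) = 2 * \<bar>dcut ((x \<bullet> x - r\<^sup>2) / (R\<^sup>2 - r\<^sup>2))\<bar> * norm x / (R\<^sup>2 - r\<^sup>2)"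
      using d by (simp add: dball_cut_def abs_mult)
    also have "\<dots> \<le> 2 * 4 * R / (R\<^sup>2 - r\<^sup>2)"
      using d False dcut_bounds(2) assms by (intro divide_right_mono mult_mono) auto
    finally show ?thesis by simp
  qed
  show "C1_test S (ball_cut r R :: 'a \<Rightarrow> real) (dball_cut r R)" if "cball 0 R \<subseteq> S" "open S"
  proof (rule C1_testI[OF that(2) compact_cball that(1)])
    fix x :: 'a
    have "GDERIV (\<lambda>x. (x \<bullet> x - r\<^sup>2) * inverse (R\<^sup>2 - r\<^sup>2)) x :>
        (x \<bullet> x - r\<^sup>2) *\<^sub>R 0 + inverse (R\<^sup>2 - r\<^sup>2) *\<^sub>R (2 *\<^sub>R x - 0)"
      by (intro GDERIV_mult GDERIV_diff GDERIV_const gderiv_norm_sq)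
    from GDERIV_DERIV_compose[OF this cut_deriv]
    show "GDERIV (ball_cut r R) x :> dball_cut r R x"
      by (simp add: ball_cut_def[abs_def] dball_cut_def divide_inverse mult_ac)
    show "x \<notin> cball 0 R \<Longrightarrow> ball_cut r R x = 0" using out by simp
    show "x \<notin> S \<Longrightarrow> dball_cut r R x = 0"
      by (rule out) (use that(1) in force)
  next
    show "continuous_on S (dball_cut r R)"
      unfolding dball_cut_def[abs_def]
      by (intro continuous_intros continuous_on_compose2[OF continuous_on_cut(2)[of UNIV]]) (use d in auto)
  qed
qed

lemma C1_test_const_mult:
  assumes t: "C1_test S \<phi> d\<phi>"
  shows "C1_test S (\<lambda>x. c * \<phi> x) (\<lambda>x. c *\<^sub>R d\<phi> x)"
proof -
  obtain K where K: "compact K" "K \<subseteq> S" "\<forall>x. x \<notin> K \<longrightarrow> \<phi> x = 0 \<and> d\<phi> x = 0"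
    using t unfolding C1_test_def by blast
  have g: "GDERIV (\<lambda>x. c * \<phi> x) x :> c *\<^sub>R d\<phi> x" for x
    using GDERIV_mult[OF GDERIV_const[of c] C1_test_gderiv[OF t]] by simp
  have d: "continuous_on UNIV (\<lambda>x. c *\<^sub>R d\<phi> x)"
    by (intro continuous_intros C1_test_cont_grad[OF t])
  show ?thesis
    unfolding C1_test_def
  proof (intro conjI allI exI[of _ K] impI)
    show "GDERIV (\<lambda>x. c * \<phi> x) x :> c *\<^sub>R d\<phi> x" for x by (rule g)
    show "continuous_on UNIV (\<lambda>x. c *\<^sub>R d\<phi> x)" by (rule d)
    show "compact K" "K \<subseteq> S" by (rule K(1), rule K(2))
    show "c * \<phi> x = 0" "c *\<^sub>R d\<phi> x = 0" if "x \<notin> K" for x using K(3) that by simp_all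
  qed
qed

subsection \<open>The flux through the origin\<close>

lemma C1_test_bounded:
  assumes "C1_test S \<phi> d\<phi>"
  obtains M where "M > 0" "\<And>x. norm (d\<phi> x) \<le> M" "\<And>x. \<bar>\<phi> x\<bar> \<le> M"
proof -
  obtain K where "compact K" "K \<subseteq> S" "\<And>x. x \<notin> K \<Longrightarrow> \<phi> x = 0" "\<And>x. x \<notin> K \<Longrightarrow> d\<phi> x = 0"
    using C1_test_support[OF assms] by blast
  note K = this(1,3,4)
  have "bounded (d\<phi> ` K)" "bounded (\<phi> ` K)"
    using C1_testD[OF assms] K(1) by (auto intro!: compact_imp_bounded compact_continuous_image)
  then obtain A B where A: "A > 0" "\<And>x. x \<in> K \<Longrightarrow> norm (d\<phi> x) \<le> A" and B: "B > 0" "\<And>x. x \<in> K \<Longrightarrow> \<bar>\<phi> x\<bar> \<le> B"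
    unfolding bounded_pos by auto
  show ?thesis
  proof (rule that[of "A + B"])
    show "norm (d\<phi> x) \<le> A + B" for x using A B K(3)[of x] by (cases "x \<in> K") (auto intro: add_increasing2)
    show "\<bar>\<phi> x\<bar> \<le> A + B" for x using A B K(2)[of x] by (cases "x \<in> K") (auto intro: add_increasing)
  qed (use A B in auto)
qed

lemma integrable_radial_field:
  fixes G :: "'a::euclidean_space \<Rightarrow> 'a"
  assumes [measurable]: "G \<in> borel_measurable borel" and "\<And>x. norm (G x) \<le> M" "compact K" "\<And>x. x \<notin> K \<Longrightarrow> G x = 0"
  shows "integrable lborel (\<lambda>x. radial_field x \<bullet> G x)"
proof (rule Bochner_Integration.integrable_bound)
  show "integrable lborel (\<lambda>x. M * (indicator K x * norm x powr (1 - real DIM('a))))"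
    by (intro integrable_mult_right integrable_norm_powr_compact assms)
  have "norm (radial_field x \<bullet> G x) \<le> norm x powr (1 - real DIM('a)) * M" for x :: 'a
  proof -
    have "\<bar>radial_field x \<bullet> G x\<bar> \<le> norm (radial_field x) * norm (G x)" by (rule Cauchy_Schwarz_ineq2)
    also have "\<dots> \<le> norm x powr (1 - real DIM('a)) * M"
      unfolding norm_radial_field by (intro mult_left_mono assms) simp
    finally show ?thesis by simp
  qed
  then show "AE x in lborel. norm (radial_field x \<bullet> G x) \<le> norm (M * (indicator K x * norm x powr (1 - real DIM('a))))"
    using assms(4) order_trans[OF norm_ge_zero assms(2)]
    by (intro AE_I2) (auto split: split_indicator simp: mult.commute)
qed measurable

lemma integral_small_balls:
  fixes g :: "'a::euclidean_space \<Rightarrow> real"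
  assumes "integrable lborel g"
  shows "(\<lambda>n. LINT x|lborel. indicator (cball 0 (inverse (real (Suc n)))) x * g x) \<longlonglongrightarrow> 0"
proof -
  have "(\<lambda>n. LINT x|lborel. indicator (cball 0 (inverse (real (Suc n)))) x * g x) \<longlonglongrightarrow> (LINT x::'a|lborel. 0)"
  proof (rule integral_dominated_convergence[where w="\<lambda>x. \<bar>g x\<bar>"])
    show "AE x in lborel. (\<lambda>n. indicator (cball 0 (inverse (real (Suc n)))) x * g x) \<longlonglongrightarrow> 0"
      using AE_lborel_singleton[of "0::'a"]
    proof eventually_elim
      case (elim x)
      have "\<forall>\<^sub>F n in sequentially. inverse (real (Suc n)) < norm x"
        using elim by (intro order_tendstoD[OF LIMSEQ_inverse_real_of_nat]) auto
      then have "\<forall>\<^sub>F n in sequentially. indicator (cball 0 (inverse (real (Suc n)))) x * g x = 0"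
        by eventually_elim auto
      then show ?case by (rule tendsto_eventually)
    qed
    show "integrable lborel (\<lambda>x. \<bar>g x\<bar>)" using assms by simp
    have [measurable]: "g \<in> borel_measurable lborel" using assms by auto
    have [measurable]: "cball (0::'a) r \<in> sets borel" for r by simp
    show "(\<lambda>x. indicator (cball 0 (inverse (real (Suc n)))) x * g x) \<in> borel_measurable lborel" for n by measurable
    show "AE x in lborel. norm (indicator (cball 0 (inverse (real (Suc n)))) x * g x) \<le> \<bar>g x\<bar>" for n
      by (auto split: split_indicator)
  qed auto
  then show ?thesis by simp
qed

text \<open>The components x_b |x|^(-N) are smooth near the support, so their products with \<phi>
  are admissible in \<open>integral_gradient_zero\<close>. Summed over the basis, the terms without
  derivatives of \<phi> cancel because the field is divergence free.\<close>

lemma radial_flux_away: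
  fixes \<phi> :: "'a::euclidean_space \<Rightarrow> real"
  assumes t: "C1_test (- {0}) \<phi> d\<phi>"
  shows "(LINT x|lborel. radial_field x \<bullet> d\<phi> x) = 0"
proof -
  let ?N = "real DIM('a)"
  obtain K where K: "compact K" "K \<subseteq> - {0}" "\<And>x. x \<notin> K \<Longrightarrow> \<phi> x = 0" "\<And>x. x \<notin> K \<Longrightarrow> d\<phi> x = 0"
    using C1_test_support[OF t] by blast
  define g where "g b x = (x \<bullet> b) * norm x powr (- ?N)" for b x :: 'a
  define dg where "dg b x = (x \<bullet> b) *\<^sub>R ((- ?N * norm x powr (- ?N - 2)) *\<^sub>R x) + norm x powr (- ?N) *\<^sub>R b" for b x :: 'a
  have T: "C1_test (- {0}) (\<lambda>x. g b x * \<phi> x) (\<lambda>x. g b x *\<^sub>R d\<phi> x + \<phi> x *\<^sub>R dg b x)" for b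
  proof (rule C1_test_mult[OF _ t])
    show "GDERIV (g b) x :> dg b x" if "x \<in> - {0}" for x
      unfolding g_def dg_def by (rule GDERIV_mult[OF gderiv_inner_left gderiv_norm_powr]) (use that in auto)
    show "continuous_on (- {0}) (dg b)" unfolding dg_def by (intro continuous_intros) auto
  qed auto
  have i: "integrable lborel (\<lambda>x. (g b x *\<^sub>R d\<phi> x + \<phi> x *\<^sub>R dg b x) \<bullet> b)" for b
    using C1_test_integrable(1)[OF T[of b], of "\<lambda>_. b"] by (simp add: inner_commute)
  have "(\<Sum>b\<in>Basis. LINT x|lborel. (g b x *\<^sub>R d\<phi> x + \<phi> x *\<^sub>R dg b x) \<bullet> b) = 0"
    by (simp add: integral_gradient_zero[OF T])
  then have "(LINT x|lborel. (\<Sum>b\<in>Basis. (g b x *\<^sub>R d\<phi> x + \<phi> x *\<^sub>R dg b x) \<bullet> b)) = 0"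
    using i by (subst Bochner_Integration.integral_sum) auto
  moreover have "(\<Sum>b\<in>Basis. (g b x *\<^sub>R d\<phi> x + \<phi> x *\<^sub>R dg b x) \<bullet> b) = radial_field x \<bullet> d\<phi> x" for x
  proof (cases "x = 0")
    case False
    have n2: "norm x powr (- ?N - 2) * norm x ^ 2 = norm x powr (- ?N)"
    proof -
      have "norm x powr (- ?N - 2) * norm x = norm x powr (- ?N - 1)"
      proof -
        have "norm x powr (- ?N - 2) * norm x = norm x powr ((- ?N - 2) + 1)" by (rule powr_mult_self) simp
        also have "(- ?N - 2) + 1 = - ?N - 1" by simp
        finally show ?thesis .
      qed
      moreover have "norm x powr (- ?N - 1) * norm x = norm x powr (- ?N)"
        using powr_mult_self[of "norm x" "- ?N - 1"] by simp
      ultimately show ?thesis unfolding power2_eq_square by (simp only: flip: mult.assoc)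
    qed
    have s: "(\<Sum>b\<in>Basis. (x \<bullet> b) * (y \<bullet> b)) = x \<bullet> y" for y by (simp add: euclidean_inner[of x y])
    have "(\<Sum>b\<in>Basis. dg b x \<bullet> b) = (\<Sum>b\<in>Basis. (- ?N * norm x powr (- ?N - 2)) * ((x \<bullet> b) * (x \<bullet> b)) + norm x powr (- ?N))"
      by (rule sum.cong) (auto simp: dg_def inner_add_left algebra_simps)
    also have "\<dots> = (- ?N * norm x powr (- ?N - 2)) * (x \<bullet> x) + ?N * norm x powr (- ?N)"
      by (simp only: sum.distrib sum_distrib_left[symmetric] s) simp
    also have "\<dots> = 0" using n2 by (simp add: power2_norm_eq_inner mult.assoc)
    finally have "(\<Sum>b\<in>Basis. dg b x \<bullet> b) = 0" .
    moreover have "(\<Sum>b\<in>Basis. g b x * (d\<phi> x \<bullet> b)) = norm x powr (- ?N) * (\<Sum>b\<in>Basis. (x \<bullet> b) * (d\<phi> x \<bullet> b))"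
      unfolding sum_distrib_left by (rule sum.cong) (auto simp: g_def)
    moreover have "(\<Sum>b\<in>Basis. (g b x *\<^sub>R d\<phi> x + \<phi> x *\<^sub>R dg b x) \<bullet> b) = (\<Sum>b\<in>Basis. g b x * (d\<phi> x \<bullet> b)) + \<phi> x * (\<Sum>b\<in>Basis. dg b x \<bullet> b)"
      by (simp add: inner_add_left sum.distrib sum_distrib_left)
    ultimately show ?thesis by (simp add: s radial_field_def)
  next
    case True
    then show ?thesis using K(2-4) by (auto simp: radial_field_def)
  qed
  ultimately show ?thesis by simp
qed

text \<open>A cutoff at scale e around 0 has gradient of order 1/e, and |\<phi>| <= M |x|
  compensates exactly this factor. What remains is bounded by the integral of |x|^(1 - N) over a
  shrinking ball.\<close>

lemma radial_flux_vanishing: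
  fixes \<phi> :: "'a::euclidean_space \<Rightarrow> real"
  assumes t: "C1_test UNIV \<phi> d\<phi>" and 0: "\<phi> 0 = 0"
  shows "(LINT x|lborel. radial_field x \<bullet> d\<phi> x) = 0"
proof -
  let ?N = "real DIM('a)"
  obtain K where "compact K" "K \<subseteq> UNIV" "\<And>x. x \<notin> K \<Longrightarrow> \<phi> x = 0" "\<And>x. x \<notin> K \<Longrightarrow> d\<phi> x = 0"
    using C1_test_support[OF t] by blast
  note K = this(1,3,4)
  obtain M where "M > 0" "\<And>x. norm (d\<phi> x) \<le> M" "\<And>x. \<bar>\<phi> x\<bar> \<le> M" using C1_test_bounded[OF t] by blast
  note M = this(1,2)
  have \<phi>x: "\<bar>\<phi> x\<bar> \<le> M * norm x" for x
  proof -
    obtain s where "\<phi> (0 + x) - \<phi> 0 = d\<phi> (0 + s *\<^sub>R x) \<bullet> x"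
      using gderiv_mvt[of \<phi> 0 x d\<phi>] C1_test_gderiv[OF t] by blast
    then have "\<bar>\<phi> x\<bar> = \<bar>d\<phi> (s *\<^sub>R x) \<bullet> x\<bar>" using 0 by simp
    also have "\<dots> \<le> M * norm x"
      by (rule order_trans[OF Cauchy_Schwarz_ineq2 mult_right_mono[OF M(2)]]) simp
    finally show ?thesis .
  qed
  have md: "d\<phi> \<in> borel_measurable borel" "\<phi> \<in> borel_measurable borel"
    using C1_testD[OF t] by (auto intro: borel_measurable_continuous_onI)
  let ?g = "\<lambda>x::'a. indicator (cball 0 1) x * norm x powr (1 - ?N)"
  let ?I = "LINT x|lborel. radial_field x \<bullet> d\<phi> x"
  have ig: "integrable lborel ?g" by (rule integrable_norm_powr_compact) simp
  \<comment> \<open>13 = 1 + 12: the cut-off gradient of \<phi> contributes M, and |\<phi>| <= 2 e M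
    times the cutoff gradient <= 6 / e contributes 12 M. The 6 rounds up 16 / 3.\<close>
  have bound: "\<bar>?I\<bar> \<le> 13 * M * (LINT x|lborel. indicator (cball 0 (inverse (real (Suc n)))) x * ?g x)" for n
  proof -
    define e where "e = inverse (real (Suc n)) / 2"
    have e: "0 < e" "e < 2 * e" "2 * e = inverse (real (Suc n))" "2 * e \<le> 1" by (auto simp: e_def field_simps)
    let ?z = "ball_cut e (2 * e) :: 'a \<Rightarrow> real" and ?dz = "dball_cut e (2 * e) :: 'a \<Rightarrow> 'a"
    note z = ball_cut[OF less_imp_le[OF e(1)] e(2)]
    have tz: "C1_test UNIV ?z ?dz" by (rule z(1)) auto
    have mz: "?z \<in> borel_measurable borel" "?dz \<in> borel_measurable borel"
      using C1_testD[OF tz] by (auto intro: borel_measurable_continuous_onI)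
    have dz: "norm (?dz x) \<le> 6 / e" for x
    proof -
      have "8 * (2 * e) / ((2 * e)\<^sup>2 - e\<^sup>2) = (16 / 3) / e" using e(1) by (simp add: power2_eq_square field_simps)
      also have "\<dots> \<le> 6 / e" using e(1) by (intro divide_right_mono) auto
      finally show ?thesis using z(8)[of x] by linarith
    qed
    have T: "C1_test (- {0}) (\<lambda>x. (1 - ?z x) * \<phi> x) (\<lambda>x. (1 - ?z x) *\<^sub>R d\<phi> x + \<phi> x *\<^sub>R (0 - ?dz x))"
    proof (rule C1_testI[of _ "K - ball 0 e"])
      show "compact (K - ball 0 e)" using K(1) by (simp add: compact_diff)
      show "continuous_on (- {0}) (\<lambda>x. (1 - ?z x) *\<^sub>R d\<phi> x + \<phi> x *\<^sub>R (0 - ?dz x))"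
        by (intro continuous_intros C1_testD[OF t] C1_testD[OF tz])
      show "GDERIV (\<lambda>x. (1 - ?z x) * \<phi> x) x :> (1 - ?z x) *\<^sub>R d\<phi> x + \<phi> x *\<^sub>R (0 - ?dz x)" for x
        by (intro GDERIV_mult GDERIV_diff GDERIV_const C1_test_gderiv[OF t] C1_test_gderiv[OF tz])
      show "x \<notin> K - ball 0 e \<Longrightarrow> (1 - ?z x) * \<phi> x = 0" for x using K(2)[of x] z(4)[of x] by auto
      show "x \<notin> - {0} \<Longrightarrow> (1 - ?z x) *\<^sub>R d\<phi> x + \<phi> x *\<^sub>R (0 - ?dz x) = 0" for x
        using z(4)[of x] e 0 by auto
    qed (use e in auto)
    have i1: "integrable lborel (\<lambda>x. radial_field x \<bullet> (?z x *\<^sub>R d\<phi> x))"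
    proof (rule integrable_radial_field[where M=M, OF _ _ K(1)])
      show "norm (?z x *\<^sub>R d\<phi> x) \<le> M" for x
        using mult_mono[OF z(3)[of x] M(2)[of x]] z(2)[of x] by simp
    qed (use md mz K in auto)
    have i2: "integrable lborel (\<lambda>x. radial_field x \<bullet> (\<phi> x *\<^sub>R ?dz x))"
    proof -
      obtain B where "B > 0" "\<And>x. norm (d\<phi> x) \<le> B" "\<And>x. \<bar>\<phi> x\<bar> \<le> B" using C1_test_bounded[OF t] by blast
      note B = this(3,1)
      show ?thesis
      proof (rule integrable_radial_field[where M="B * (6 / e)", OF _ _ K(1)])
        show "norm (\<phi> x *\<^sub>R ?dz x) \<le> B * (6 / e)" for x
          using mult_mono[OF B(1)[of x] dz[of x]] B(2) by simp
      qed (use md mz K in auto)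
    qed
    have i3: "integrable lborel (\<lambda>x. radial_field x \<bullet> d\<phi> x)"
      by (rule integrable_radial_field[where M=M, OF md(1) M(2) K(1)]) (use K in auto)
    have "0 = (LINT x|lborel. radial_field x \<bullet> d\<phi> x - radial_field x \<bullet> (?z x *\<^sub>R d\<phi> x) - radial_field x \<bullet> (\<phi> x *\<^sub>R ?dz x))"
      using radial_flux_away[OF T] by (simp add: algebra_simps inner_diff_right inner_add_right scaleR_diff_left)
    also have "\<dots> = ?I - (LINT x|lborel. radial_field x \<bullet> (?z x *\<^sub>R d\<phi> x)) - (LINT x|lborel. radial_field x \<bullet> (\<phi> x *\<^sub>R ?dz x))"
      by (simp only: Bochner_Integration.integral_diff Bochner_Integration.integrable_diff i1 i2 i3)
    finally have "?I = (LINT x|lborel. radial_field x \<bullet> (?z x *\<^sub>R d\<phi> x)) + (LINT x|lborel. radial_field x \<bullet> (\<phi> x *\<^sub>R ?dz x))" by simp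
    also have "\<dots> = (LINT x|lborel. radial_field x \<bullet> (?z x *\<^sub>R d\<phi> x) + radial_field x \<bullet> (\<phi> x *\<^sub>R ?dz x))"
      by (simp only: Bochner_Integration.integral_add i1 i2)
    finally have I: "?I = \<dots>" .
    have "norm \<dots> \<le> (LINT x|lborel. 13 * M * (indicator (cball 0 (2 * e)) x * ?g x))"
    proof (rule Bochner_Integration.integral_norm_bound_integral)
      show "integrable lborel (\<lambda>x. radial_field x \<bullet> (?z x *\<^sub>R d\<phi> x) + radial_field x \<bullet> (\<phi> x *\<^sub>R ?dz x))"
        using i1 i2 by (rule Bochner_Integration.integrable_add)
      show "integrable lborel (\<lambda>x. 13 * M * (indicator (cball 0 (2 * e)) x * ?g x))"
      proof (rule integrable_mult_right)
        show "integrable lborel (\<lambda>x. indicator (cball 0 (2 * e)) x * ?g x)"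
        proof (rule Bochner_Integration.integrable_bound[OF ig])
          have [measurable]: "cball (0::'a) r \<in> sets borel" for r by simp
          have "(\<lambda>x::'a. indicator (cball 0 (2 * e)) x * ?g x) \<in> borel_measurable borel" by measurable
          then show "(\<lambda>x. indicator (cball 0 (2 * e)) x * ?g x) \<in> borel_measurable lborel" by simp
        qed (auto split: split_indicator)
      qed
      fix x :: 'a
      show "norm (radial_field x \<bullet> (?z x *\<^sub>R d\<phi> x) + radial_field x \<bullet> (\<phi> x *\<^sub>R ?dz x))
          \<le> 13 * M * (indicator (cball 0 (2 * e)) x * ?g x)"
      proof (cases "norm x \<le> 2 * e")
        case True
        let ?w = "norm x powr (1 - ?N)"
        have "\<bar>radial_field x \<bullet> (?z x *\<^sub>R d\<phi> x)\<bar> \<le> ?w * M"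
        proof (rule order_trans[OF Cauchy_Schwarz_ineq2])
          have "norm (?z x *\<^sub>R d\<phi> x) \<le> M"
            using mult_mono[OF z(3)[of x] M(2)[of x]] z(2)[of x] by simp
          then show "norm (radial_field x) * norm (?z x *\<^sub>R d\<phi> x) \<le> ?w * M"
            unfolding norm_radial_field by (rule mult_left_mono) simp
        qed
        moreover have "\<bar>radial_field x \<bullet> (\<phi> x *\<^sub>R ?dz x)\<bar> \<le> ?w * (12 * M)"
        proof (rule order_trans[OF Cauchy_Schwarz_ineq2])
          have "\<bar>\<phi> x\<bar> \<le> M * (2 * e)"
            using \<phi>x[of x] mult_left_mono[OF True, of M] M(1) by linarith
          then have "norm (\<phi> x *\<^sub>R ?dz x) \<le> (M * (2 * e)) * (6 / e)"
            using mult_mono[OF \<open>\<bar>\<phi> x\<bar> \<le> M * (2 * e)\<close> dz[of x]] M(1) e(1) by simp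
          then have "norm (\<phi> x *\<^sub>R ?dz x) \<le> 12 * M" using e(1) by simp
          then show "norm (radial_field x) * norm (\<phi> x *\<^sub>R ?dz x) \<le> ?w * (12 * M)"
            unfolding norm_radial_field by (rule mult_left_mono) simp
        qed
        ultimately have "\<bar>radial_field x \<bullet> (?z x *\<^sub>R d\<phi> x) + radial_field x \<bullet> (\<phi> x *\<^sub>R ?dz x)\<bar> \<le> 13 * M * ?w"
          by (simp add: algebra_simps)
        then show ?thesis using True e(4) by simp
      next
        case False
        then show ?thesis using z(6,7)[of x] by simp
      qed
    qed
    also have "\<dots> = 13 * M * (LINT x|lborel. indicator (cball 0 (2 * e)) x * ?g x)"
      by (rule integral_mult_right_zero)
    finally show ?thesis unfolding I e(3) real_norm_def .
  qed
  have "\<bar>?I\<bar> \<le> 13 * M * 0"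
    by (rule LIMSEQ_le_const[OF tendsto_mult[OF tendsto_const integral_small_balls[OF ig]]]) (use bound in blast)
  then show ?thesis by simp
qed

text \<open>The flux of x / |x|^N through a sphere around 0, that is, the area of the unit sphere.
  It is defined by testing with one cutoff of value 1 at the origin; the closed form is established
  in \<open>flux_const_eq_volume\<close>.\<close>

definition flux_const :: "'a::euclidean_space itself \<Rightarrow> real" where
  "flux_const _ = - (LINT x::'a|lborel. radial_field x \<bullet> dball_cut 0 1 x)"

text \<open>Subtracting \<phi>(0) times the reference cutoff leaves a test function vanishing at the
  origin, which carries no flux.\<close>

lemma radial_flux:
  fixes \<phi> :: "'a::euclidean_space \<Rightarrow> real"
  assumes t: "C1_test S \<phi> d\<phi>"
  shows "(LINT x|lborel. radial_field x \<bullet> d\<phi> x) = - flux_const TYPE('a) * \<phi> 0"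
    and "integrable lborel (\<lambda>x. radial_field x \<bullet> d\<phi> x)"
proof -
  have int: "integrable lborel (\<lambda>x. radial_field x \<bullet> d\<psi> x)" if t: "C1_test S \<psi> d\<psi>" for \<psi> d\<psi> and S :: "'a set"
  proof -
    obtain K where "compact K" "K \<subseteq> S" "\<And>x. x \<notin> K \<Longrightarrow> \<psi> x = 0" "\<And>x. x \<notin> K \<Longrightarrow> d\<psi> x = 0"
      using C1_test_support[OF t] by blast
    note K = this(1,4)
    obtain M where "M > 0" "\<And>x. norm (d\<psi> x) \<le> M" "\<And>x. \<bar>\<psi> x\<bar> \<le> M" using C1_test_bounded[OF t] by blast
  note M = this(1,2)
    have "d\<psi> \<in> borel_measurable borel" using C1_testD[OF t] by (auto intro: borel_measurable_continuous_onI)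
    then show ?thesis by (rule integrable_radial_field[OF _ M(2) K])
  qed
  show i: "integrable lborel (\<lambda>x. radial_field x \<bullet> d\<phi> x)" by (rule int[OF t])
  have z: "C1_test UNIV (ball_cut 0 1 :: 'a \<Rightarrow> real) (dball_cut 0 1)" by (rule ball_cut_C1_test) auto
  have z0: "ball_cut 0 1 (0::'a) = 1" by (rule ball_cut_inside) auto
  have "C1_test UNIV (\<lambda>x. \<phi> x + (- \<phi> 0) * ball_cut 0 1 x) (\<lambda>x. d\<phi> x + (- \<phi> 0) *\<^sub>R dball_cut 0 1 x)"
    by (intro C1_test_add C1_test_const_mult z C1_test_mono[OF t]) auto
  from radial_flux_vanishing[OF this] z0
  have "0 = (LINT x|lborel. radial_field x \<bullet> d\<phi> x - \<phi> 0 * (radial_field x \<bullet> dball_cut 0 1 x))"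
    by (simp add: inner_add_right inner_diff_right)
  also have "\<dots> = (LINT x|lborel. radial_field x \<bullet> d\<phi> x) - \<phi> 0 * (LINT x::'a|lborel. radial_field x \<bullet> dball_cut 0 1 x)"
    using i int[OF z] by (subst Bochner_Integration.integral_diff) auto
  finally show "(LINT x|lborel. radial_field x \<bullet> d\<phi> x) = - flux_const TYPE('a) * \<phi> 0"
    by (simp add: flux_const_def)
qed

text \<open>The integrand has a sign because the cutoff decreases radially, and it is strictly
  positive on the sphere of radius 1/2, where \<open>dcut\<close> is evaluated at 1/4.\<close>

lemma flux_const_pos: "flux_const TYPE('a::euclidean_space) > 0"
proof (rule ccontr)
  assume "\<not> ?thesis"
  let ?f = "\<lambda>x::'a. - (radial_field x \<bullet> dball_cut 0 1 x)"
  have z: "C1_test UNIV (ball_cut 0 1 :: 'a \<Rightarrow> real) (dball_cut 0 1)" by (rule ball_cut_C1_test) auto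
  have f: "?f x = norm x powr (- real DIM('a)) * (- 2 * dcut (x \<bullet> x)) * (x \<bullet> x)" for x
    by (simp add: radial_field_def dball_cut_def)
  obtain b :: 'a where b: "b \<in> Basis" using nonempty_Basis by blast
  define x where "x = (1/2) *\<^sub>R b"
  have xx: "x \<bullet> x = 1/4" "norm x = 1/2" using b by (simp_all add: x_def)
  have "?f x = 0"
  proof (rule continuous_integral_zero[of ?f "- {0}"])
    show "integrable lborel ?f" using radial_flux(2)[OF z] by simp
    show "0 \<le> ?f y" for y 
    proof -
      have "- 2 * dcut (y \<bullet> y) \<ge> 0" using dcut_bounds(1)[of "y \<bullet> y"] by linarith
      then show ?thesis unfolding f by (intro mult_nonneg_nonneg[OF mult_nonneg_nonneg]) auto
    qed
    show "integral\<^sup>L lborel ?f \<le> 0" using \<open>\<not> _\<close> by (simp add: flux_const_def)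
    show "continuous_on (- {0}) ?f"
      using continuous_on_radial_field[of "- {0::'a}"] C1_test_cont_grad[OF z] by (intro continuous_intros) auto
  qed (use xx in auto)
  moreover have "?f x > 0" unfolding f xx using dcut_neg[of "1/4"] by (simp add: mult_neg_pos)
  ultimately show False by simp
qed

text \<open>\<open>fund_const\<close> is a definite description, so uniqueness is needed besides the
  equation; it comes from one test function with \<rho>(0) > 0. The value of \<open>p_flux\<close>
  at 0 is unspecified but concerns a null set only.\<close>

lemma fund_const_eq:
  assumes p: "1 < p" "p \<le> real DIM('a::euclidean_space)"
  shows "fund_const TYPE('a) p = flux_const TYPE('a)"
proof -
  let ?F = "p_flux p (mu p :: 'a \<Rightarrow> real)"
  have F: "?F x = - radial_field x" if "x \<noteq> 0" for x
    using grad_eqI[OF gderiv_mu[OF p that]] by (simp add: p_flux_eq p_field_dmu p)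
  then have "?F = (\<lambda>x. if x = 0 then ?F 0 else - radial_field x)" by auto
  moreover have "(\<lambda>x. if x = 0 then ?F 0 else - radial_field x) \<in> borel_measurable borel" by measurable
  ultimately have [measurable]: "?F \<in> borel_measurable borel" by simp
  have AE: "AE x in lborel. ?F x = - radial_field x"
    using AE_lborel_singleton[of "0::'a"] by eventually_elim (rule F)
  have "L1_loc UNIV ?F"
    unfolding L1_loc_def set_integrable_def
  proof (intro allI impI)
    fix K :: "'a set" assume K: "compact K \<and> K \<subseteq> UNIV"
    have [measurable]: "K \<in> sets borel" using K by (simp add: borel_compact)
    show "integrable lborel (\<lambda>x. indicator K x *\<^sub>R ?F x)"
    proof (rule Bochner_Integration.integrable_bound)
      show "integrable lborel (\<lambda>x. indicator K x * norm x powr (1 - real DIM('a)))"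
        using integrable_norm_powr_compact K by blast
      show "AE x in lborel. norm (indicator K x *\<^sub>R ?F x) \<le> norm (indicator K x * norm x powr (1 - real DIM('a)))"
        using AE by eventually_elim (auto split: split_indicator simp: norm_radial_field)
    qed measurable
  qed
  have eq: "neg_p_laplacian p UNIV (mu p :: 'a \<Rightarrow> real) \<phi> = flux_const TYPE('a) * dirac0 \<phi>"
    if "\<phi> \<in> test_functions UNIV" for \<phi>
  proof -
    have t: "C1_test UNIV \<phi> (grad \<phi>)" using that by (intro test_functions_C1_test) auto
    have [measurable]: "grad \<phi> \<in> borel_measurable borel" using C1_testD[OF t] by (auto intro: borel_measurable_continuous_onI)
    have "neg_p_laplacian p UNIV (mu p :: 'a \<Rightarrow> real) \<phi> = (LINT x|lborel. - (radial_field x \<bullet> grad \<phi> x))"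
      unfolding neg_p_laplacian_def set_lebesgue_integral_def
      by (rule integral_cong_AE) (use AE in \<open>auto elim!: eventually_mono\<close>)
    then show ?thesis using radial_flux(1)[OF t] by (simp add: dirac0_def)
  qed
  obtain \<rho> :: "'a \<Rightarrow> real" and r where \<rho>: "bump_like r \<rho>" "\<rho> 0 > 0" "\<And>x. norm x > 1 \<Longrightarrow> \<rho> x = 0"
    using mollifier_exists[of 1] by (metis zero_less_one)
  have "\<rho> \<in> test_functions UNIV"
    by (rule test_functionsI[of "cball 0 1"]) (use \<rho> bump_like_Ck in auto)
  show ?thesis
    unfolding fund_const_def
  proof (rule the_equality)
    fix c assume "c > 0 \<and> L1_loc UNIV ?F \<and> (\<forall>\<phi>\<in>test_functions UNIV. neg_p_laplacian p UNIV (mu p :: 'a \<Rightarrow> real) \<phi> = c * dirac0 \<phi>)"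
    then have "c * \<rho> 0 = flux_const TYPE('a) * \<rho> 0"
      using eq[OF \<open>\<rho> \<in> test_functions UNIV\<close>] \<open>\<rho> \<in> test_functions UNIV\<close> by (simp add: dirac0_def)
    then show "c = flux_const TYPE('a)" using \<rho>(2) by simp
  qed (use flux_const_pos \<open>L1_loc UNIV ?F\<close> eq in auto)
qed

subsection \<open>Cutting off a point\<close>

text \<open>(1 - \<mu> / L)_+^2 removes the origin, since \<mu> exceeds L near 0, and increases to 1
  as L grows wherever \<mu> >= 0. The origin is a separate case because \<open>mu p 0\<close> is a
  default value and not infinity.\<close>

definition eta :: "real \<Rightarrow> real \<Rightarrow> 'a::euclidean_space \<Rightarrow> real" where
  "eta p L x = (if x = 0 then 0 else (max 0 (1 - mu p x / L))\<^sup>2)"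
definition deta :: "real \<Rightarrow> real \<Rightarrow> 'a::euclidean_space \<Rightarrow> 'a" where
  "deta p L x = (2 * max 0 (1 - mu p x / L) / L) *\<^sub>R (- dmu p x)"

lemma gderiv_continuous_on:
  fixes f :: "'a::euclidean_space \<Rightarrow> real"
  shows "(\<And>x. x \<in> S \<Longrightarrow> GDERIV f x :> df x) \<Longrightarrow> continuous_on S f"
  by (meson gderiv_def has_derivative_continuous continuous_at_imp_continuous_on)

lemma gderiv_pos_sq:
  assumes "GDERIV f x :> D"
  shows "GDERIV (\<lambda>x. (max 0 (f x))\<^sup>2) x :> (2 * max 0 (f x)) *\<^sub>R D"
  by (rule GDERIV_DERIV_compose[OF assms deriv_pos_sq])

locale fund_exp =
  fixes p :: real and dim :: "'a::euclidean_space itself"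
  assumes p: "1 < p" "p \<le> real DIM('a)"
begin

lemma continuous_on_mu: "0 \<notin> S \<Longrightarrow> continuous_on S (mu p :: 'a \<Rightarrow> real)"
  by (rule gderiv_continuous_on[where df="dmu p"]) (metis gderiv_mu p)

lemma eta_near_0:
  assumes "L > 0"
  obtains \<rho> where "\<rho> > 0" "\<And>x::'a. norm x < \<rho> \<Longrightarrow> eta p L x = 0" "\<And>x::'a. norm x < \<rho> \<Longrightarrow> deta p L x = 0"
proof -
  have "\<forall>\<^sub>F x::'a in at 0. mu p x \<ge> L" using mu_tendsto[OF p] by (simp add: filterlim_at_top)
  then obtain \<rho> where \<rho>: "\<rho> > 0" "\<And>x::'a. x \<noteq> 0 \<Longrightarrow> norm x < \<rho> \<Longrightarrow> mu p x \<ge> L"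
    unfolding eventually_at by auto
  have z: "eta p L x = 0 \<and> deta p L x = 0" if "norm x < \<rho>" for x :: 'a
  proof (cases "x = 0")
    case False
    then have "1 - mu p x / L \<le> 0" using \<rho>(2)[of x] that assms by simp
    then have "max 0 (1 - mu p x / L) = 0" by simp
    then show ?thesis by (simp add: eta_def deta_def)
  qed (simp add: eta_def deta_def dmu_def)
  show ?thesis by (rule that[OF \<rho>(1)]) (use z in blast)+
qed

lemma eta_gderiv:
  assumes "L > 0"
  shows "GDERIV (eta p L) (x::'a) :> deta p L x"
proof (cases "x = 0")
  case True
  obtain \<rho> where \<rho>: "\<rho> > 0" "\<And>x::'a. norm x < \<rho> \<Longrightarrow> eta p L x = 0" "\<And>x::'a. norm x < \<rho> \<Longrightarrow> deta p L x = 0"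
    using eta_near_0[OF assms] by blast
  have "GDERIV (eta p L) (0::'a) :> 0"
    by (rule gderiv_transform[OF GDERIV_const[where k=0], of "ball 0 \<rho>"]) (use \<rho> in auto)
  moreover have "deta p L (0::'a) = 0" by (simp add: deta_def dmu_def)
  ultimately show ?thesis using True by simp
next
  case False
  have "GDERIV (\<lambda>x. mu p x * inverse L) x :> mu p x *\<^sub>R 0 + inverse L *\<^sub>R dmu p x"
    by (rule GDERIV_mult[OF gderiv_mu[OF p False] GDERIV_const])
  then have "GDERIV (\<lambda>x. 1 - mu p x / L) x :> 0 - inverse L *\<^sub>R dmu p x"
    by (intro GDERIV_diff GDERIV_const) (simp add: divide_inverse)
  from gderiv_pos_sq[OF this]
  have "GDERIV (\<lambda>x. (max 0 (1 - mu p x / L))\<^sup>2) x :> deta p L x"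
    by (simp add: deta_def divide_inverse)
  then show ?thesis
    by (rule gderiv_transform[of _ _ _ "- {0}"]) (use False in \<open>auto simp: eta_def\<close>)
qed

lemma eta_continuous:
  assumes "L > 0"
  shows "continuous_on S (eta p L :: 'a \<Rightarrow> real)" and "continuous_on S (deta p L :: 'a \<Rightarrow> 'a)"
proof -
  show "continuous_on S (eta p L :: 'a \<Rightarrow> real)"
    by (rule gderiv_continuous_on) (rule eta_gderiv[OF assms])
  obtain \<rho> where \<rho>: "\<rho> > 0" "\<And>x::'a. norm x < \<rho> \<Longrightarrow> eta p L x = 0" "\<And>x::'a. norm x < \<rho> \<Longrightarrow> deta p L x = 0"
    using eta_near_0[OF assms] by blast
  have "continuous_on (- {0::'a}) (deta p L)"
    unfolding deta_def[abs_def]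
    by (intro continuous_intros continuous_on_mu continuous_on_dmu) (use assms in auto)
  moreover have "continuous_on (ball (0::'a) \<rho>) (deta p L)"
    by (rule continuous_on_eq[OF continuous_on_const[of _ 0]]) (use \<rho>(3) in auto)
  ultimately have "continuous_on (- {0::'a} \<union> ball 0 \<rho>) (deta p L)"
    by (intro continuous_on_open_Un) auto
  moreover have "- {0::'a} \<union> ball 0 \<rho> = UNIV" using \<rho>(1) by auto
  ultimately show "continuous_on S (deta p L :: 'a \<Rightarrow> 'a)" by (metis continuous_on_subset subset_UNIV)
qed

lemma eta_C1_test:
  assumes S: "open S" and t: "C1_test S \<phi> d\<phi>" and L: "L > 0"
  shows "C1_test (S - {0::'a}) (\<lambda>x. eta p L x * \<phi> x) (\<lambda>x. eta p L x *\<^sub>R d\<phi> x + \<phi> x *\<^sub>R deta p L x)"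
proof -
  obtain K where K: "compact K" "K \<subseteq> S" "\<And>x. x \<notin> K \<Longrightarrow> \<phi> x = 0" "\<And>x. x \<notin> K \<Longrightarrow> d\<phi> x = 0"
    using C1_test_support[OF t] by blast
  obtain \<rho> where \<rho>: "\<rho> > 0" "\<And>x::'a. norm x < \<rho> \<Longrightarrow> eta p L x = 0" "\<And>x::'a. norm x < \<rho> \<Longrightarrow> deta p L x = 0"
    using eta_near_0[OF L] by blast
  show ?thesis
  proof (rule C1_testI[of _ "K - ball 0 \<rho>"])
    show "open (S - {0})" using S by (simp add: open_delete)
    show "compact (K - ball 0 \<rho>)" using K(1) by (simp add: compact_diff)
    show "K - ball 0 \<rho> \<subseteq> S - {0}" using K(2) \<rho>(1) by auto
    show "GDERIV (\<lambda>x. eta p L x * \<phi> x) x :> eta p L x *\<^sub>R d\<phi> x + \<phi> x *\<^sub>R deta p L x" for x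
      by (rule GDERIV_mult[OF eta_gderiv[OF L] C1_test_gderiv[OF t]])
    show "continuous_on (S - {0}) (\<lambda>x. eta p L x *\<^sub>R d\<phi> x + \<phi> x *\<^sub>R deta p L x)"
      by (intro continuous_intros eta_continuous[OF L] C1_testD[OF t])
    show "eta p L x * \<phi> x = 0" if "x \<notin> K - ball 0 \<rho>" for x
      using that \<rho>(2)[of x] K(3)[of x] by (cases "x \<in> K") auto
    show "eta p L x *\<^sub>R d\<phi> x + \<phi> x *\<^sub>R deta p L x = 0" if "x \<notin> S - {0}" for x
    proof (cases "x = 0")
      case True
      then show ?thesis using \<rho> by simp
    next
      case False
      then have "x \<notin> K" using that K(2) by blast
      then show ?thesis by (simp add: K)
    qed
  qed
qed

lemma mu_nonneg: "norm (x::'a) \<le> 1 \<Longrightarrow> mu p x \<ge> 0"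
  using p by (cases "x = 0") (auto simp: mu_def Let_def)

lemma eta_bounds:
  shows "0 \<le> eta p L x" and "L > 0 \<Longrightarrow> norm (x::'a) \<le> 1 \<Longrightarrow> eta p L x \<le> 1"
proof -
  show "0 \<le> eta p L x" by (simp add: eta_def)
  assume "L > 0" "norm x \<le> 1"
  then have "0 \<le> mu p x / L" using mu_nonneg[of x] by simp
  then have "max 0 (1 - mu p x / L) \<le> 1" by simp
  then show "eta p L x \<le> 1" by (simp add: eta_def power_le_one)
qed

lemma eta_tendsto: "x \<noteq> 0 \<Longrightarrow> (\<lambda>k. eta p (real (Suc k)) (x::'a)) \<longlonglongrightarrow> 1"
proof -
  assume x: "x \<noteq> 0"
  have "(\<lambda>k. mu p x * inverse (real (Suc k))) \<longlonglongrightarrow> mu p x * 0"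
    by (intro tendsto_intros LIMSEQ_inverse_real_of_nat)
  then have "(\<lambda>k. (max 0 (1 - mu p x * inverse (real (Suc k))))\<^sup>2) \<longlonglongrightarrow> (max 0 (1 - mu p x * 0))\<^sup>2"
    by (rule tendsto_power[OF tendsto_max[OF tendsto_const tendsto_diff[OF tendsto_const]]])
  with x show ?thesis by (simp add: eta_def divide_inverse)
qed

text \<open>The weighted energies of \<open>\<mu>\<^sub>p\<close> are the flux of \<open>\<mu>\<^sub>p\<close> through the cutoff region of \<open>\<phi>\<close>.\<close>

lemma mu_energy_identity:
  assumes t: "C1_test UNIV \<phi> d\<phi>" and L: "L > 0"
  shows "(LINT x|lborel. \<phi> x * (2 * max 0 (1 - mu p x / L) / L) * norm (dmu p (x::'a)) powr p)
      = - (LINT x|lborel. eta p L x * (radial_field x \<bullet> d\<phi> x))"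
    and "integrable lborel (\<lambda>x. \<phi> x * (2 * max 0 (1 - mu p x / L) / L) * norm (dmu p (x::'a)) powr p)"
    and "integrable lborel (\<lambda>x. eta p L x * (radial_field x \<bullet> d\<phi> (x::'a)))"
proof -
  have T: "C1_test (- {0}) (\<lambda>x. eta p L x * \<phi> x) (\<lambda>x. eta p L x *\<^sub>R d\<phi> x + \<phi> x *\<^sub>R deta p L x)"
    using eta_C1_test[OF open_UNIV t L] by (simp add: Compl_eq_Diff_UNIV)
  obtain K where K: "compact K" "K \<subseteq> UNIV" "\<And>x. x \<notin> K \<Longrightarrow> \<phi> x = 0" "\<And>x. x \<notin> K \<Longrightarrow> d\<phi> x = 0"
    using C1_test_support[OF t] by blast
  obtain \<rho> where \<rho>: "\<rho> > 0" "\<And>x::'a. norm x < \<rho> \<Longrightarrow> eta p L x = 0" "\<And>x::'a. norm x < \<rho> \<Longrightarrow> deta p L x = 0"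
    using eta_near_0[OF L] by blast
  have cK: "compact (K - ball 0 \<rho>)" using K(1) by (simp add: compact_diff)
  have c0: "0 \<notin> K - ball 0 \<rho>" using \<rho>(1) by simp
  show i1: "integrable lborel (\<lambda>x. eta p L x * (radial_field x \<bullet> d\<phi> x))"
    by (rule integrable_compact_support[OF cK])
      (use c0 \<rho> K in \<open>auto intro!: continuous_intros eta_continuous[OF L] continuous_on_radial_field C1_testD[OF t]\<close>)
  have pw: "\<phi> x * (2 * max 0 (1 - mu p x / L) / L) * norm (dmu p x) powr p = \<phi> x * (radial_field x \<bullet> deta p L x)" for x :: 'a
  proof -
    have "radial_field x \<bullet> dmu p x = - (norm (dmu p x) powr p)"
      using p_field_inner_self[of p "dmu p x"] by (simp add: p_field_dmu p)
    then show ?thesis by (simp add: deta_def)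
  qed
  show i2: "integrable lborel (\<lambda>x. \<phi> x * (2 * max 0 (1 - mu p x / L) / L) * norm (dmu p (x::'a)) powr p)"
    unfolding pw
    by (rule integrable_compact_support[OF cK])
      (use c0 \<rho> K in \<open>auto intro!: continuous_intros eta_continuous[OF L] continuous_on_radial_field C1_testD[OF t]\<close>)
  have "0 = (LINT x|lborel. eta p L x * (radial_field x \<bullet> d\<phi> x) + \<phi> x * (2 * max 0 (1 - mu p x / L) / L) * norm (dmu p (x::'a)) powr p)"
    using radial_flux_away[OF T] unfolding pw by (simp add: inner_add_right)
  also have "\<dots> = (LINT x|lborel. eta p L x * (radial_field x \<bullet> d\<phi> x))
      + (LINT x|lborel. \<phi> x * (2 * max 0 (1 - mu p x / L) / L) * norm (dmu p (x::'a)) powr p)"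
    by (rule Bochner_Integration.integral_add[OF i1 i2])
  finally show "(LINT x|lborel. \<phi> x * (2 * max 0 (1 - mu p x / L) / L) * norm (dmu p (x::'a)) powr p)
      = - (LINT x|lborel. eta p L x * (radial_field x \<bullet> d\<phi> x))" by simp
qed

text \<open>For m in [0, 1] one has m^p <= m, so the p-energy density of the cutoff is dominated by
  a density linear in m, which \<open>mu_energy_identity\<close> evaluates. The excess powers of 1/L
  become the decaying prefactor.\<close>

lemma deta_powr: "L > 0 \<Longrightarrow> norm (x::'a) \<le> 1 \<Longrightarrow>
    norm (deta p L x) powr p \<le> (2 / L) powr (p - 1) * ((2 * max 0 (1 - mu p x / L) / L) * norm (dmu p x) powr p)"
proof -
  assume L: "L > 0" and x: "norm x \<le> 1"
  let ?m = "max 0 (1 - mu p x / L)"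
  have "0 \<le> mu p x / L" using mu_nonneg[OF x] L by simp
  then have m: "0 \<le> ?m" "?m \<le> 1" by auto
  have "norm (deta p L x) = (2 / L) * ?m * norm (dmu p x)" using L m by (simp add: deta_def)
  then have "norm (deta p L x) powr p = (2 / L) powr p * ?m powr p * norm (dmu p x) powr p"
    by (simp only: powr_mult)
  also have "\<dots> \<le> (2 / L) powr p * ?m * norm (dmu p x) powr p"
  proof -
    have "y powr p \<le> y" if "0 \<le> y" "y \<le> 1" for y :: real
      using powr_le_one_le[of y p] that p by (cases "y = 0") auto
    from this[OF m] have "?m powr p \<le> ?m" .
    then show ?thesis by (intro mult_right_mono mult_left_mono) auto
  qed
  also have "(2 / L) powr p = (2 / L) powr (p - 1) * (2 / L)" using powr_mult_self[of "2 / L" "p - 1"] L by simp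
  finally show ?thesis by (simp add: mult_ac)
qed

text \<open>The flux identity bounds the weighted energy of \<mu> by a constant independent of L,
  because the flux is only measured where the outer cutoff varies. The energy of \<open>eta\<close>
  is therefore O(L^(1 - p)): a point has p-capacity zero.\<close>

lemma deta_capacity:
  assumes r: "0 < r" "r < 1"
  obtains C where "\<And>L. L > 0 \<Longrightarrow> integrable lborel (\<lambda>x::'a. indicator (cball 0 r) x * norm (deta p L x) powr p)"
    "\<And>L. L > 0 \<Longrightarrow> (LINT x::'a|lborel. indicator (cball 0 r) x * norm (deta p L x) powr p) \<le> (2 / L) powr (p - 1) * C"
proof -
  let ?z = "ball_cut r 1 :: 'a \<Rightarrow> real" and ?dz = "dball_cut r 1 :: 'a \<Rightarrow> 'a"
  note z = ball_cut[OF less_imp_le[OF r(1)] r(2)]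
  have t: "C1_test UNIV ?z ?dz" by (rule z(1)) auto
  define C where "C = (LINT x::'a|lborel. \<bar>radial_field x \<bullet> ?dz x\<bar>)"
  have i: "integrable lborel (\<lambda>x::'a. indicator (cball 0 r) x * norm (deta p L x) powr p)" if L: "L > 0" for L
  proof -
    have "continuous_on (cball 0 r) (\<lambda>x::'a. norm (deta p L x) powr p)"
      by (intro continuous_on_powr' continuous_intros eta_continuous[OF L]) (use p in auto)
    from borel_integrable_compact[OF compact_cball this] show ?thesis by simp
  qed
  have "(LINT x::'a|lborel. indicator (cball 0 r) x * norm (deta p L x) powr p) \<le> (2 / L) powr (p - 1) * C" if L: "L > 0" for L
  proof -
    let ?e = "\<lambda>x. ?z x * (2 * max 0 (1 - mu p x / L) / L) * norm (dmu p x) powr p"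
    note me = mu_energy_identity[OF t L]
    have "(LINT x::'a|lborel. indicator (cball 0 r) x * norm (deta p L x) powr p) \<le> (LINT x|lborel. (2 / L) powr (p - 1) * ?e x)"
    proof (rule integral_mono[OF i[OF L]])
      show "integrable lborel (\<lambda>x. (2 / L) powr (p - 1) * ?e x)" using me(2) by (rule integrable_mult_right)
      fix x :: 'a
      show "indicator (cball 0 r) x * norm (deta p L x) powr p \<le> (2 / L) powr (p - 1) * ?e x"
      proof (cases "norm x \<le> r")
        case True
        then show ?thesis using deta_powr[OF L, of x] z(4)[of x] r by simp
      next
        case False
        have "?e x \<ge> 0" using z(2)[of x] L by simp
        then have "0 \<le> (2 / L) powr (p - 1) * ?e x" by (rule mult_nonneg_nonneg[rotated]) simp
        then show ?thesis using False by simp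
      qed
    qed
    also have "\<dots> = (2 / L) powr (p - 1) * - (LINT x|lborel. eta p L x * (radial_field x \<bullet> ?dz x))"
      by (simp only: integral_mult_right_zero me(1))
    also have "\<dots> \<le> (2 / L) powr (p - 1) * C"
    proof (rule mult_left_mono)
      have "- (LINT x|lborel. eta p L x * (radial_field x \<bullet> ?dz x)) \<le> norm (LINT x|lborel. eta p L x * (radial_field x \<bullet> ?dz x))"
        by simp
      also have "\<dots> \<le> C" unfolding C_def
      proof (rule Bochner_Integration.integral_norm_bound_integral[OF me(3)])
        show "integrable lborel (\<lambda>x. \<bar>radial_field x \<bullet> ?dz x\<bar>)" using radial_flux(2)[OF t] by simp
        fix x :: 'a
        show "norm (eta p L x * (radial_field x \<bullet> ?dz x)) \<le> \<bar>radial_field x \<bullet> ?dz x\<bar>"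
        proof (cases "norm x \<le> 1")
          case True
          then show ?thesis using eta_bounds[of L x] L by (simp add: abs_mult mult_left_le_one_le)
        next
          case False
          then show ?thesis using z(7)[of x] by simp
        qed
      qed
      finally show "- (LINT x|lborel. eta p L x * (radial_field x \<bullet> ?dz x)) \<le> C" .
    qed simp
    finally show ?thesis .
  qed
  with i show ?thesis by (rule that)
qed

lemma deta_capacity_tendsto:
  assumes r: "0 < r" "r < 1"
  shows "(\<lambda>k. LINT x::'a|lborel. indicator (cball 0 r) x * norm (deta p (real (Suc k)) x) powr p) \<longlonglongrightarrow> 0"
proof -
  obtain C where C: "\<And>L. L > 0 \<Longrightarrow> integrable lborel (\<lambda>x::'a. indicator (cball 0 r) x * norm (deta p L x) powr p)"
    "\<And>L. L > 0 \<Longrightarrow> (LINT x::'a|lborel. indicator (cball 0 r) x * norm (deta p L x) powr p) \<le> (2 / L) powr (p - 1) * C"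
    using deta_capacity[OF r] by blast
  have "(\<lambda>k. 2 * inverse (real (Suc k))) \<longlonglongrightarrow> 2 * 0"
    by (intro tendsto_intros LIMSEQ_inverse_real_of_nat)
  then have "(\<lambda>k. (2 * inverse (real (Suc k))) powr (p - 1) * C) \<longlonglongrightarrow> 0 powr (p - 1) * C"
    using p by (intro tendsto_intros) auto
  then have lim: "(\<lambda>k. (2 / real (Suc k)) powr (p - 1) * C) \<longlonglongrightarrow> 0" by (simp add: divide_inverse)
  show ?thesis
    by (rule tendsto_sandwich[OF _ _ tendsto_const lim]) (auto intro!: always_eventually C(2))
qed

end

subsection \<open>Auxiliary inequalities and convergence lemmas\<close>

text \<open>Split according to whether K y <= x, replacing the larger quantity in each case. The
  constants are not sharp; only their dependence on K matters.\<close>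

lemma young_simple:
  fixes x y K :: real
  assumes "p > 1" "x \<ge> 0" "y \<ge> 0" "K > 0"
  shows "x powr (p - 1) * y \<le> x powr p / K + K powr (p - 1) * y powr p"
proof (cases "K * y \<le> x")
  case True
  have "x powr (p - 1) * (K * y) \<le> x powr (p - 1) * x" using True by (intro mult_left_mono) auto
  also have "\<dots> = x powr p" using powr_mult_self[of x "p - 1"] assms by simp
  finally have "x powr (p - 1) * y \<le> x powr p / K" using assms by (simp add: field_simps)
  moreover have "0 \<le> K powr (p - 1) * y powr p" by simp
  ultimately show ?thesis by linarith
next
  case False
  then have "x powr (p - 1) * y \<le> (K * y) powr (p - 1) * y"
    using assms by (intro mult_right_mono powr_mono2) auto
  also have "\<dots> = K powr (p - 1) * y powr p"
    using assms powr_mult_self[of y "p - 1"] by (simp add: powr_mult)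
  finally show ?thesis using assms by (simp add: add_increasing)
qed

lemma powr_add_le:
  fixes a b :: real
  assumes "a \<ge> 0" "b \<ge> 0" "p \<ge> 0"
  shows "(a + b) powr p \<le> 2 powr p * (a powr p + b powr p)"
proof -
  have "(a + b) powr p \<le> (2 * max a b) powr p" using assms by (intro powr_mono2) auto
  also have "\<dots> = 2 powr p * (max a b) powr p" using assms by (simp add: powr_mult)
  also have "\<dots> \<le> 2 powr p * (a powr p + b powr p)" by (intro mult_left_mono) (auto simp: max_def)
  finally show ?thesis .
qed

lemma integrable_fatou:
  fixes f :: "'a \<Rightarrow> real"
  assumes i: "\<And>k. integrable M (g k)" and nn: "\<And>k x. g k x \<ge> 0"
    and m: "f \<in> borel_measurable M" and lim: "AE x in M. (\<lambda>k. g k x) \<longlonglongrightarrow> f x"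
    and b: "\<And>k. integral\<^sup>L M (g k) \<le> c k" "c \<longlonglongrightarrow> C"
  shows "integrable M f" and "integral\<^sup>L M f \<le> C"
proof -
  have fnn: "AE x in M. f x \<ge> 0" using lim by eventually_elim (rule LIMSEQ_le_const, auto simp: nn)
  have mg: "g k \<in> borel_measurable M" for k using i[of k] by auto
  have cnn: "c k \<ge> 0" for k using b(1)[of k] Bochner_Integration.integral_nonneg[of M "g k", OF nn] by linarith
  have "C \<ge> 0" by (rule LIMSEQ_le_const[OF b(2)]) (use cnn in blast)
  have "(\<integral>\<^sup>+x. ennreal (f x) \<partial>M) = (\<integral>\<^sup>+x. liminf (\<lambda>k. ennreal (g k x)) \<partial>M)"
  proof (rule nn_integral_cong_AE)
    show "AE x in M. ennreal (f x) = liminf (\<lambda>k. ennreal (g k x))"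
      using lim by eventually_elim (metis tendsto_ennrealI lim_imp_Liminf sequentially_bot)
  qed
  also have "\<dots> \<le> liminf (\<lambda>k. \<integral>\<^sup>+x. ennreal (g k x) \<partial>M)"
    by (rule nn_integral_liminf) (use mg in measurable)
  also have "\<dots> \<le> liminf (\<lambda>k. ennreal (c k))"
    by (rule Liminf_mono) (auto simp: nn_integral_eq_integral[OF i] nn b(1) intro!: always_eventually ennreal_leI)
  also have "\<dots> = ennreal C" by (intro lim_imp_Liminf tendsto_ennrealI b(2)) simp
  finally have le: "(\<integral>\<^sup>+x. ennreal (f x) \<partial>M) \<le> ennreal C" .
  then show int: "integrable M f"
    using m fnn by (intro integrableI_nonneg) (auto simp: le_less_trans[OF _ ennreal_less_top])
  have "ennreal (integral\<^sup>L M f) \<le> ennreal C"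
    using le nn_integral_eq_integral[OF int fnn] by simp
  then show "integral\<^sup>L M f \<le> C" using \<open>C \<ge> 0\<close> by (simp add: ennreal_le_iff)
qed

lemma borel_measurable_zero_outside:
  fixes g :: "'a::euclidean_space \<Rightarrow> 'b::euclidean_space"
  assumes "open S" "continuous_on S g" "\<And>x. x \<notin> S \<Longrightarrow> g x = 0"
  shows "g \<in> borel_measurable borel"
proof -
  have "(\<lambda>x. indicator S x *\<^sub>R g x) \<in> borel_measurable borel"
    using assms by (intro borel_measurable_continuous_on_indicator) auto
  moreover have "(\<lambda>x. indicator S x *\<^sub>R g x) = g" using assms(3) by (auto simp: indicator_def fun_eq_iff)
  ultimately show ?thesis by simp
qed

subsection \<open>Energy estimates for positive solutions in a punctured domain\<close>

lemma C1_test_power: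
  assumes t: "C1_test S \<phi> d\<phi>" and n: "n \<ge> 1"
  shows "C1_test S (\<lambda>x. \<phi> x ^ n) (\<lambda>x. (real n * \<phi> x ^ (n - 1)) *\<^sub>R d\<phi> x)"
proof -
  obtain K where K: "compact K" "K \<subseteq> S" "\<forall>x. x \<notin> K \<longrightarrow> \<phi> x = 0 \<and> d\<phi> x = 0"
    using t unfolding C1_test_def by blast
  show ?thesis
    unfolding C1_test_def
  proof (intro conjI allI exI[of _ K] impI)
    have "DERIV (\<lambda>t. t ^ n) y :> real n * y ^ (n - 1)" for y :: real by (rule DERIV_pow[unfolded One_nat_def[symmetric]])
    then show "GDERIV (\<lambda>x. \<phi> x ^ n) x :> (real n * \<phi> x ^ (n - 1)) *\<^sub>R d\<phi> x" for x
      by (rule GDERIV_DERIV_compose[OF C1_test_gderiv[OF t]])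
    show "continuous_on UNIV (\<lambda>x. (real n * \<phi> x ^ (n - 1)) *\<^sub>R d\<phi> x)"
      by (intro continuous_intros C1_testD[OF t])
    show "compact K" "K \<subseteq> S" by (rule K(1), rule K(2))
    show "\<phi> x ^ n = 0" "(real n * \<phi> x ^ (n - 1)) *\<^sub>R d\<phi> x = 0" if "x \<notin> K" for x using K(3) that n by simp_all
  qed
qed

text \<open>First K is chosen large to make E / K small, then k large at this fixed K. It is applied
  to a product of a bounded energy and a vanishing capacity in place of Hoelder's
  inequality.\<close>

lemma tendsto_zero_by_tradeoff:
  fixes a c :: "nat \<Rightarrow> real"
  assumes a: "\<And>k. a k \<ge> 0" and b: "\<And>k K. K > 0 \<Longrightarrow> a k \<le> E / K + K powr s * c k" and c: "c \<longlonglongrightarrow> 0" and E: "E \<ge> 0"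
  shows "a \<longlonglongrightarrow> 0"
proof (rule LIMSEQ_I)
  fix e :: real assume e: "e > 0"
  define K where "K = 2 * (E + 1) / e"
  have K: "K > 0" using e E by (simp add: K_def)
  have "E / K < e / 2"
  proof -
    have "E / K = e / 2 * (E / (E + 1))" using e E by (simp add: K_def field_simps)
    also have "\<dots> < e / 2 * 1" using e E by (intro mult_strict_left_mono) auto
    finally show ?thesis by simp
  qed
  have "(\<lambda>k. K powr s * c k) \<longlonglongrightarrow> K powr s * 0" by (intro tendsto_intros c)
  then have "\<forall>\<^sub>F k in sequentially. K powr s * c k < e / 2" using e by (intro order_tendstoD) auto
  then obtain n0 where n0: "\<And>k. k \<ge> n0 \<Longrightarrow> K powr s * c k < e / 2" unfolding eventually_sequentially by blast
  show "\<exists>no. \<forall>n\<ge>no. norm (a n - 0) < e"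
  proof (intro exI[of _ n0] allI impI)
    fix n assume "n0 \<le> n"
    then have "a n < e" using n0[of n] b[OF K, of n] \<open>E / K < e / 2\<close> by linarith
    then show "norm (a n - 0) < e" using a[of n] by simp
  qed
qed

text \<open>\<open>v\<close> and \<open>dv\<close> are 0 outside the punctured domain, so that they
  are Borel functions on the whole space and all integrals run over it. \<open>R0 < 1\<close> makes
  \<mu> nonnegative on the ball in use.\<close>

locale hj_solution = fund_exp p dim for p :: real and dim :: "'a::euclidean_space itself" +
  fixes q R0 :: real and \<Omega> :: "'a set" and v :: "'a \<Rightarrow> real" and dv :: "'a \<Rightarrow> 'a"
  assumes dim2: "DIM('a) \<ge> 2" and q: "p - 1 < q"
    and \<Omega>: "open \<Omega>" "cball 0 R0 \<subseteq> \<Omega>" and R0: "0 < R0" "R0 < 1"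
    and gd: "\<And>x. x \<in> \<Omega> - {0} \<Longrightarrow> GDERIV v x :> dv x"
    and cont: "continuous_on (\<Omega> - {0}) dv"
    and out: "\<And>x. x \<notin> \<Omega> - {0} \<Longrightarrow> v x = 0" "\<And>x. x \<notin> \<Omega> - {0} \<Longrightarrow> dv x = 0"
    and pos: "\<And>x. x \<in> \<Omega> - {0} \<Longrightarrow> v x > 0"
    and weak: "\<And>\<phi> d\<phi>. C1_test (\<Omega> - {0}) \<phi> d\<phi> \<Longrightarrow>
      (LINT x|lborel. p_field p (dv x) \<bullet> d\<phi> x) = (LINT x|lborel. norm (dv x) powr q * \<phi> x)"
begin

abbreviation "U \<equiv> \<Omega> - {0::'a}"

lemma openU: "open U" using \<Omega> by (simp add: open_delete)

lemma cont_v: "continuous_on U v" by (rule gderiv_continuous_on[OF gd])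

lemma v_nonneg: "v x \<ge> 0" using pos[of x] out(1)[of x] by (cases "x \<in> U") auto

lemma v_measurable [measurable]: "v \<in> borel_measurable borel"
  using borel_measurable_zero_outside[OF openU cont_v out(1)] by blast

lemma dv_measurable [measurable]: "dv \<in> borel_measurable borel"
  using borel_measurable_zero_outside[OF openU cont out(2)] by blast

lemma p_field_measurable [measurable]: "p_field p \<in> borel_measurable (borel :: 'a measure)"
  by (rule borel_measurable_continuous_onI) (intro continuous_on_p_field continuous_intros p)

lemma cont_flux: "continuous_on U (\<lambda>x. p_field p (dv x))"
  by (rule continuous_on_p_field[OF p(1) cont])

lemma cont_powr: "a > 0 \<Longrightarrow> continuous_on U (\<lambda>x. norm (dv x) powr a)"
  by (intro continuous_on_powr' continuous_intros cont) auto

lemma ball_subset: "r \<le> R0 \<Longrightarrow> cball 0 r \<subseteq> \<Omega>" using \<Omega>(2) by force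

text \<open>Testing the equation with \<open>(B - v)\<^sub>+\<^sup>2 \<xi>\<close>.\<close>

lemma truncated_identity:
  assumes t: "C1_test U \<xi> d\<xi>"
  shows "(LINT x|lborel. (2 * max 0 (B - v x) * norm (dv x) powr p) * \<xi> x)
     = (LINT x|lborel. (max 0 (B - v x))\<^sup>2 * (p_field p (dv x) \<bullet> d\<xi> x))
       - (LINT x|lborel. ((max 0 (B - v x))\<^sup>2 * norm (dv x) powr q) * \<xi> x)"
    and "integrable lborel (\<lambda>x. (2 * max 0 (B - v x) * norm (dv x) powr p) * \<xi> x)"
    and "integrable lborel (\<lambda>x. (max 0 (B - v x))\<^sup>2 * (p_field p (dv x) \<bullet> d\<xi> x))"
    and "integrable lborel (\<lambda>x. ((max 0 (B - v x))\<^sup>2 * norm (dv x) powr q) * \<xi> x)"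
proof -
  let ?s = "\<lambda>x. max 0 (B - v x)"
  have T: "C1_test U (\<lambda>x. (?s x)\<^sup>2 * \<xi> x) (\<lambda>x. (?s x)\<^sup>2 *\<^sub>R d\<xi> x + \<xi> x *\<^sub>R ((2 * ?s x) *\<^sub>R (0 - dv x)))"
  proof (rule C1_test_mult[OF openU t])
    show "GDERIV (\<lambda>x. (?s x)\<^sup>2) x :> (2 * ?s x) *\<^sub>R (0 - dv x)" if "x \<in> U" for x
      by (rule gderiv_pos_sq[OF GDERIV_diff[OF GDERIV_const gd[OF that]]])
    show "continuous_on U (\<lambda>x. (2 * ?s x) *\<^sub>R (0 - dv x))" by (intro continuous_intros cont cont_v)
  qed
  show i1: "integrable lborel (\<lambda>x. (2 * ?s x * norm (dv x) powr p) * \<xi> x)"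
    by (rule C1_test_integrable(2)[OF t]) (use p in \<open>auto intro!: continuous_intros cont_powr cont_v\<close>)
  have "integrable lborel (\<lambda>x. ((?s x)\<^sup>2 *\<^sub>R p_field p (dv x)) \<bullet> d\<xi> x)"
    by (rule C1_test_integrable(1)[OF t]) (auto intro!: continuous_intros cont_flux cont_v)
  then show i2: "integrable lborel (\<lambda>x. (?s x)\<^sup>2 * (p_field p (dv x) \<bullet> d\<xi> x))" by simp
  show i3: "integrable lborel (\<lambda>x. ((?s x)\<^sup>2 * norm (dv x) powr q) * \<xi> x)"
    by (rule C1_test_integrable(2)[OF t]) (use p q in \<open>auto intro!: continuous_intros cont_powr cont_v\<close>)
  have eq: "p_field p (dv x) \<bullet> ((?s x)\<^sup>2 *\<^sub>R d\<xi> x + \<xi> x *\<^sub>R ((2 * ?s x) *\<^sub>R (0 - dv x)))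
      = (?s x)\<^sup>2 * (p_field p (dv x) \<bullet> d\<xi> x) - (2 * ?s x * norm (dv x) powr p) * \<xi> x" for x
    using p_field_inner_self[of p "dv x"] by (simp add: inner_add_right inner_diff_right algebra_simps)
  have "(LINT x|lborel. (?s x)\<^sup>2 * (p_field p (dv x) \<bullet> d\<xi> x) - (2 * ?s x * norm (dv x) powr p) * \<xi> x)
     = (LINT x|lborel. ((?s x)\<^sup>2 * norm (dv x) powr q) * \<xi> x)"
    using weak[OF T] unfolding eq by (simp add: mult_ac)
  then show "(LINT x|lborel. (2 * ?s x * norm (dv x) powr p) * \<xi> x)
     = (LINT x|lborel. (?s x)\<^sup>2 * (p_field p (dv x) \<bullet> d\<xi> x))
       - (LINT x|lborel. ((?s x)\<^sup>2 * norm (dv x) powr q) * \<xi> x)"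
    using Bochner_Integration.integral_diff[OF i2 i1] by linarith
qed

lemma ball_cut_eta:
  assumes r: "0 \<le> r" "r < R" "R \<le> R0" and L: "L > 0"
  defines "\<xi> \<equiv> \<lambda>x::'a. eta p L x * ball_cut r R x"
    and "d\<xi> \<equiv> \<lambda>x::'a. eta p L x *\<^sub>R dball_cut r R x + ball_cut r R x *\<^sub>R deta p L x"
  shows "C1_test U \<xi> d\<xi>" "0 \<le> \<xi> x" "\<xi> x \<le> 1" "R \<le> norm x \<Longrightarrow> \<xi> x = 0" "R \<le> norm x \<Longrightarrow> d\<xi> x = 0"
    "norm (d\<xi> x) \<le> norm (dball_cut r R x) + indicator (cball 0 R) x * norm (deta p L x)"
proof -
  note z = ball_cut[OF r(1,2)]
  have t: "C1_test \<Omega> (ball_cut r R :: 'a \<Rightarrow> real) (dball_cut r R)"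
    by (rule z(1)[OF ball_subset[OF r(3)] \<Omega>(1)])
  show "C1_test U \<xi> d\<xi>" unfolding \<xi>_def d\<xi>_def by (rule eta_C1_test[OF \<Omega>(1) t L])
  show "0 \<le> \<xi> x" unfolding \<xi>_def using eta_bounds(1)[of L x] z(2)[of x] by simp
  show "R \<le> norm x \<Longrightarrow> \<xi> x = 0" "R \<le> norm x \<Longrightarrow> d\<xi> x = 0" by (simp_all add: \<xi>_def d\<xi>_def z(6,7))
  show "\<xi> x \<le> 1"
  proof (cases "norm x \<le> 1")
    case True
    then show ?thesis unfolding \<xi>_def using eta_bounds[of L x] L z(2,3)[of x] by (intro mult_le_one) auto
  next
    case False
    then show ?thesis using z(6)[of x] r R0 by (simp add: \<xi>_def)
  qed
  show "norm (d\<xi> x) \<le> norm (dball_cut r R x) + indicator (cball 0 R) x * norm (deta p L x)"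
  proof (cases "norm x \<le> R")
    case True
    then have "norm x \<le> 1" using r R0 by simp
    have "norm (eta p L x *\<^sub>R dball_cut r R x) \<le> norm (dball_cut r R x)"
      using eta_bounds[of L x] L \<open>norm x \<le> 1\<close> by (simp add: mult_left_le_one_le)
    moreover have "norm (ball_cut r R x *\<^sub>R deta p L x) \<le> norm (deta p L x)"
      using z(2,3)[of x] by (simp add: mult_left_le_one_le)
    ultimately show ?thesis unfolding d\<xi>_def using True norm_triangle_ineq[of "eta p L x *\<^sub>R dball_cut r R x" "ball_cut r R x *\<^sub>R deta p L x"] by simp
  next
    case False
    then show ?thesis by (simp add: d\<xi>_def z(6,7))
  qed
qed

text \<open>A Caccioppoli estimate: the q-term has the favourable sign and is dropped, and half of
  the energy absorbs the gradient part of the term with the cutoff gradient. The bound is uniform in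
  the origin cutoff by the capacity estimate, and Fatou's lemma removes that cutoff.\<close>

lemma truncated_energy_aux:
  assumes r: "0 < r" "r < R0" and B: "B > 0"
  shows "integrable lborel (\<lambda>x. indicator (cball 0 r) x * (max 0 (B - v x) * norm (dv x) powr p))"
proof -
  let ?s = "\<lambda>x. max 0 (B - v x)"
  let ?z = "ball_cut r R0 :: 'a \<Rightarrow> real" and ?dz = "dball_cut r R0 :: 'a \<Rightarrow> 'a"
  note z = ball_cut[OF less_imp_le[OF r(1)] r(2)]
  \<comment> \<open>The cutoff is raised to a power n >= p so that differentiation still leaves
    \<xi>^(n - 1) <= \<xi>^(p - 1), which pairs with |\<nabla>v|^(p - 1).\<close>
  obtain n :: nat where n: "real n \<ge> p" "n \<ge> 1" using p real_arch_simple[of p] by (metis max.cobounded1 max.cobounded2 of_nat_le_iff order_trans)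
  define \<xi> where "\<xi> k x = eta p (real (Suc k)) x * ?z x" for k x
  define d\<xi> where "d\<xi> k x = eta p (real (Suc k)) x *\<^sub>R ?dz x + ?z x *\<^sub>R deta p (real (Suc k)) x" for k x
  note ce = ball_cut_eta[OF less_imp_le[OF r(1)] r(2) order_refl, of "real (Suc _)", folded \<xi>_def d\<xi>_def, OF of_nat_0_less_iff[THEN iffD2, OF zero_less_Suc]]
  have T: "C1_test U (\<lambda>x. \<xi> k x ^ n) (\<lambda>x. (real n * \<xi> k x ^ (n - 1)) *\<^sub>R d\<xi> k x)" for k
    by (rule C1_test_power[OF ce(1) n(2)])
  note ti = truncated_identity[OF T, of B]
  have idz: "integrable lborel (\<lambda>x. norm (?dz x) powr p)"
  proof (rule integrable_compact_support[of "cball 0 R0"])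
    have "C1_test UNIV ?z ?dz" by (rule z(1)) auto
    then show "continuous_on (cball 0 R0) (\<lambda>x. norm (?dz x) powr p)"
      by (intro continuous_on_powr' continuous_intros C1_testD) (use p in auto)
    show "norm (?dz x) powr p = 0" if "x \<notin> cball 0 R0" for x using z(7)[of x] that p by simp
  qed simp
  obtain C where C: "\<And>L. L > 0 \<Longrightarrow> integrable lborel (\<lambda>x::'a. indicator (cball 0 R0) x * norm (deta p L x) powr p)"
    "\<And>L. L > 0 \<Longrightarrow> (LINT x::'a|lborel. indicator (cball 0 R0) x * norm (deta p L x) powr p) \<le> (2 / L) powr (p - 1) * C"
    using deta_capacity[OF R0] by blast
  let ?cap = "\<lambda>k. LINT x::'a|lborel. indicator (cball 0 R0) x * norm (deta p (real (Suc k)) x) powr p"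
  define M where "M = B * (real n * B) powr p * 2 powr p"
  have M: "M \<ge> 0" using B by (simp add: M_def)
  have "integrable lborel (\<lambda>x. ?s x * ?z x ^ n * norm (dv x) powr p)"
  proof (rule integrable_fatou(1))
    show "integrable lborel (\<lambda>x. ?s x * \<xi> k x ^ n * norm (dv x) powr p)" for k
      using ti(2)[of k] by (simp add: mult_ac)
    show "0 \<le> ?s x * \<xi> k x ^ n * norm (dv x) powr p" for k x using ce(2)[of k x] by simp
    have [measurable]: "?z \<in> borel_measurable borel"
      by (rule borel_measurable_continuous_onI, rule C1_test_cont, rule z(1)[of UNIV]) auto
    have "(\<lambda>x. ?s x * ?z x ^ n * norm (dv x) powr p) \<in> borel_measurable borel" by measurable
    then show "(\<lambda>x. ?s x * ?z x ^ n * norm (dv x) powr p) \<in> borel_measurable lborel" by simp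
    show "AE x in lborel. (\<lambda>k. ?s x * \<xi> k x ^ n * norm (dv x) powr p) \<longlonglongrightarrow> ?s x * ?z x ^ n * norm (dv x) powr p"
      using AE_lborel_singleton[of "0::'a"]
    proof eventually_elim
      case (elim x)
      have "(\<lambda>k. ?s x * (eta p (real (Suc k)) x * ?z x) ^ n * norm (dv x) powr p) \<longlonglongrightarrow> ?s x * (1 * ?z x) ^ n * norm (dv x) powr p"
        by (intro tendsto_mult tendsto_power tendsto_const eta_tendsto[OF elim])
      then show ?case by (simp add: \<xi>_def)
    qed
    show "(LINT x|lborel. ?s x * \<xi> k x ^ n * norm (dv x) powr p) \<le> M * ((LINT x|lborel. norm (?dz x) powr p) + ?cap k)" for k
    proof -
      let ?I = "\<lambda>x. ?s x * \<xi> k x ^ n * norm (dv x) powr p"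
      let ?J = "\<lambda>x. M * (norm (?dz x) powr p + indicator (cball 0 R0) x * norm (deta p (real (Suc k)) x) powr p)"
      have iI: "integrable lborel ?I" using ti(2)[of k] by (simp add: mult_ac)
      have iJ: "integrable lborel ?J"
        by (intro integrable_mult_right Bochner_Integration.integrable_add idz C(1)) simp
      \<comment> \<open>The factor 2 comes from differentiating the square (B - v)_+^2. One copy of
        the energy is absorbed below and one remains.\<close>
      have "2 * integral\<^sup>L lborel ?I = (LINT x|lborel. (2 * ?s x * norm (dv x) powr p) * \<xi> k x ^ n)"
        by (simp add: mult_ac)
      also have "\<dots> \<le> (LINT x|lborel. (?s x)\<^sup>2 * (p_field p (dv x) \<bullet> ((real n * \<xi> k x ^ (n - 1)) *\<^sub>R d\<xi> k x)))"
      proof -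
        have "(LINT x|lborel. ((?s x)\<^sup>2 * norm (dv x) powr q) * \<xi> k x ^ n) \<ge> 0"
          using ce(2)[of k] by (intro Bochner_Integration.integral_nonneg) simp
        then show ?thesis using ti(1)[of k] by linarith
      qed
      also have "\<dots> \<le> (LINT x|lborel. ?I x + ?J x)"
      proof (rule integral_mono[OF ti(3) Bochner_Integration.integrable_add[OF iI iJ]])
        fix x :: 'a
        let ?c = "\<xi> k x" and ?a = "norm (dv x)" and ?d = "norm (d\<xi> k x)"
        have s: "0 \<le> ?s x" "?s x \<le> B" using v_nonneg[of x] B by auto
        have c: "0 \<le> ?c" "?c \<le> 1" using ce(2,3)[of k x] by auto
        have "(?s x)\<^sup>2 * (p_field p (dv x) \<bullet> ((real n * ?c ^ (n - 1)) *\<^sub>R d\<xi> k x))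
            \<le> (?s x)\<^sup>2 * (?a powr (p - 1) * (real n * ?c ^ (n - 1) * ?d))"
        proof (rule mult_left_mono)
          show "p_field p (dv x) \<bullet> ((real n * ?c ^ (n - 1)) *\<^sub>R d\<xi> k x) \<le> ?a powr (p - 1) * (real n * ?c ^ (n - 1) * ?d)"
            using norm_cauchy_schwarz[of "p_field p (dv x)" "(real n * ?c ^ (n - 1)) *\<^sub>R d\<xi> k x"] c
            by (simp add: norm_p_field)
        qed simp
        also have "\<dots> \<le> ?s x * (?c ^ n * ?a powr p + (real n * B * ?d) powr p)"
        proof -
          \<comment> \<open>Young's inequality by cases: if n B |\<nabla>\<xi>| <= \<xi>
            |\<nabla>v|, the product is at most \<xi>^n |\<nabla>v|^p; otherwise it is at most (n B
            |\<nabla>\<xi>|)^p.\<close>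
          have "?s x * (?a powr (p - 1) * (real n * ?c ^ (n - 1) * ?d)) \<le> ?c ^ n * ?a powr p + (real n * B * ?d) powr p"
          proof (cases "real n * B * ?d \<le> ?c * ?a")
            case True
            have "?s x * (?a powr (p - 1) * (real n * ?c ^ (n - 1) * ?d)) \<le> B * (?a powr (p - 1) * (real n * ?c ^ (n - 1) * ?d))"
              using s c by (intro mult_right_mono) auto
            also have "\<dots> = (?a powr (p - 1) * ?c ^ (n - 1)) * (real n * B * ?d)" by (simp add: mult_ac)
            also have "\<dots> \<le> (?a powr (p - 1) * ?c ^ (n - 1)) * (?c * ?a)"
              using True c by (intro mult_left_mono) auto
            also have "\<dots> = (?c * ?c ^ (n - 1)) * (?a powr (p - 1) * ?a)" by (simp add: mult_ac)
            also have "?a powr (p - 1) * ?a = ?a powr p" using powr_mult_self[of ?a "p - 1"] by simp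
            also have "?c * ?c ^ (n - 1) = ?c ^ n" using n(2) by (simp flip: power_Suc)
            finally show ?thesis by (simp add: add_increasing2)
          next
            case False
            have "?c ^ (n - 1) \<le> ?c powr (p - 1)"
            proof (cases "?c = 0")
              case False
              then have "?c ^ (n - 1) = ?c powr (real (n - 1))" using c by (simp add: powr_realpow)
              also have "\<dots> \<le> ?c powr (p - 1)" using c n by (intro powr_mono') (auto simp: of_nat_diff)
              finally show ?thesis .
            next
              case True
              have "n - 1 \<noteq> 0" using n(1) p(1) by (cases n) auto
              then show ?thesis using True by (simp add: power_0_left)
            qed
            then have "?a powr (p - 1) * ?c ^ (n - 1) \<le> ?a powr (p - 1) * ?c powr (p - 1)" by (intro mult_left_mono) auto
            also have "\<dots> = (?c * ?a) powr (p - 1)" by (simp add: powr_mult)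
            also have "\<dots> \<le> (real n * B * ?d) powr (p - 1)" using False c p by (intro powr_mono2) auto
            finally have h: "?a powr (p - 1) * ?c ^ (n - 1) \<le> (real n * B * ?d) powr (p - 1)" .
            have "?s x * (?a powr (p - 1) * (real n * ?c ^ (n - 1) * ?d)) \<le> B * (?a powr (p - 1) * (real n * ?c ^ (n - 1) * ?d))"
              using s c by (intro mult_right_mono) auto
            also have "\<dots> = (?a powr (p - 1) * ?c ^ (n - 1)) * (real n * B * ?d)" by (simp add: mult_ac)
            also have "\<dots> \<le> (real n * B * ?d) powr (p - 1) * (real n * B * ?d)"
              using h B by (intro mult_right_mono) auto
            also have "\<dots> = (real n * B * ?d) powr p" using powr_mult_self[of "real n * B * ?d" "p - 1"] B by simp
            finally show ?thesis using c by (simp add: add_increasing)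
          qed
          from mult_left_mono[OF this s(1)] show ?thesis by (simp add: power2_eq_square mult.assoc)
        qed
        also have "\<dots> \<le> ?I x + B * (real n * B * ?d) powr p"
          using mult_right_mono[OF s(2), of "(real n * B * ?d) powr p"] by (simp add: algebra_simps)
        also have "B * (real n * B * ?d) powr p \<le> ?J x"
        proof -
          have "?d powr p \<le> (norm (?dz x) + indicator (cball 0 R0) x * norm (deta p (real (Suc k)) x)) powr p"
            using ce(6)[of k x] p by (intro powr_mono2) auto
          also have "\<dots> \<le> 2 powr p * (norm (?dz x) powr p + (indicator (cball 0 R0) x * norm (deta p (real (Suc k)) x)) powr p)"
            using p by (intro powr_add_le) auto
          also have "(indicator (cball 0 R0) x * norm (deta p (real (Suc k)) x)) powr p = indicator (cball 0 R0) x * norm (deta p (real (Suc k)) x) powr p"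
            by (auto split: split_indicator)
          finally have "B * (real n * B) powr p * ?d powr p \<le> B * (real n * B) powr p * (2 powr p * (norm (?dz x) powr p + indicator (cball 0 R0) x * norm (deta p (real (Suc k)) x) powr p))"
            using B by (intro mult_left_mono) auto
          then show ?thesis by (simp add: M_def powr_mult mult_ac)
        qed
        finally show "(?s x)\<^sup>2 * (p_field p (dv x) \<bullet> ((real n * ?c ^ (n - 1)) *\<^sub>R d\<xi> k x)) \<le> ?I x + ?J x" by simp
      qed
      also have "\<dots> = integral\<^sup>L lborel ?I + integral\<^sup>L lborel ?J" by (rule Bochner_Integration.integral_add[OF iI iJ])
      also have "integral\<^sup>L lborel ?J = M * ((LINT x|lborel. norm (?dz x) powr p) + ?cap k)"
        using idz C(1)[of "real (Suc k)"] by simp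
      finally show ?thesis by simp
    qed
    show "(\<lambda>k. M * ((LINT x|lborel. norm (?dz x) powr p) + ?cap k)) \<longlonglongrightarrow> M * ((LINT x|lborel. norm (?dz x) powr p) + 0)"
      by (intro tendsto_intros deta_capacity_tendsto R0)
  qed
  then show ?thesis
  proof (rule Bochner_Integration.integrable_bound)
    have [measurable]: "cball (0::'a) r \<in> sets borel" by simp
    have "(\<lambda>x. indicator (cball 0 r) x * (?s x * norm (dv x) powr p)) \<in> borel_measurable borel" by measurable
    then show "(\<lambda>x. indicator (cball 0 r) x * (?s x * norm (dv x) powr p)) \<in> borel_measurable lborel" by simp
    show "AE x in lborel. norm (indicator (cball 0 r) x * (?s x * norm (dv x) powr p)) \<le> norm (?s x * ?z x ^ n * norm (dv x) powr p)"
    proof (rule AE_I2)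
      fix x
      show "norm (indicator (cball 0 r) x * (?s x * norm (dv x) powr p)) \<le> norm (?s x * ?z x ^ n * norm (dv x) powr p)"
        using z(4)[of x] by (cases "norm x \<le> r") simp_all
    qed
  qed
qed

definition low :: "real \<Rightarrow> real \<Rightarrow> 'a set" where "low r B = {x. norm x \<le> r \<and> v x \<le> B}"

lemma low_measurable [measurable]: "low r B \<in> sets borel"
  unfolding low_def by measurable

text \<open>Truncation one unit above the level makes the weight at least 1 on the sublevel set, so
  the weighted bound becomes an unweighted one.\<close>

lemma truncated_energy:
  assumes r: "0 < r" "r < R0"
  shows "integrable lborel (\<lambda>x. indicator (low r B) x * norm (dv x) powr p)"
proof (rule Bochner_Integration.integrable_bound[OF truncated_energy_aux[OF r, of "max 0 B + 1"]])
  have "(\<lambda>x. indicator (low r B) x * norm (dv x) powr p) \<in> borel_measurable borel" by measurable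
  then show "(\<lambda>x. indicator (low r B) x * norm (dv x) powr p) \<in> borel_measurable lborel" by simp
  have "norm (indicator (low r B) x * norm (dv x) powr p)
      \<le> norm (indicator (cball 0 r) x * (max 0 (max 0 B + 1 - v x) * norm (dv x) powr p))" for x
  proof (cases "x \<in> low r B")
    case True
    then have "norm x \<le> r" "max 0 (max 0 B + 1 - v x) \<ge> 1" by (auto simp: low_def)
    then show ?thesis using True mult_right_mono[of 1 "max 0 (max 0 B + 1 - v x)" "norm (dv x) powr p"] by simp
  qed simp
  then show "AE x in lborel. norm (indicator (low r B) x * norm (dv x) powr p)
      \<le> norm (indicator (cball 0 r) x * (max 0 (max 0 B + 1 - v x) * norm (dv x) powr p))" by simp
qed simp

text \<open>These integrals arise whenever the gradient hits the origin cutoff. Young's inequality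
  splits them into the finite truncated energy over K and a power of K times the vanishing
  capacity.\<close>

lemma cross_term:
  assumes r: "0 < r" "r < R0"
  shows "integrable lborel (\<lambda>x. indicator (low r B) x * (norm (dv x) powr (p - 1) * norm (deta p (real (Suc k)) x)))"
    and "(\<lambda>k. LINT x|lborel. indicator (low r B) x * (norm (dv x) powr (p - 1) * norm (deta p (real (Suc k)) x))) \<longlonglongrightarrow> 0"
proof -
  let ?f = "\<lambda>k x. indicator (low r B) x * (norm (dv x) powr (p - 1) * norm (deta p (real (Suc k)) x))"
  let ?E = "\<lambda>x. indicator (low r B) x * norm (dv x) powr p"
  let ?c = "\<lambda>k (x::'a). indicator (cball 0 r) x * norm (deta p (real (Suc k)) x) powr p"
  have r1: "r < 1" using r R0 by simp
  obtain C where C: "\<And>L. L > 0 \<Longrightarrow> integrable lborel (\<lambda>x::'a. indicator (cball 0 r) x * norm (deta p L x) powr p)"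
    "\<And>L. L > 0 \<Longrightarrow> (LINT x::'a|lborel. indicator (cball 0 r) x * norm (deta p L x) powr p) \<le> (2 / L) powr (p - 1) * C"
    using deta_capacity[OF r(1) r1] by blast
  have iE: "integrable lborel ?E" by (rule truncated_energy[OF r])
  have ic: "integrable lborel (?c k)" for k by (rule C(1)) simp
  have pw: "?f k x \<le> ?E x / K + K powr (p - 1) * ?c k x" if K: "K > 0" for K k x
  proof (cases "x \<in> low r B")
    case True
    then have "x \<in> cball 0 r" by (simp add: low_def)
    then show ?thesis using True young_simple[OF p(1) norm_ge_zero[of "dv x"] norm_ge_zero[of "deta p (real (Suc k)) x"] K] by simp
  qed simp
  have iR: "integrable lborel (\<lambda>x. ?E x / K + K powr (p - 1) * ?c k x)" for K k
    by (intro Bochner_Integration.integrable_add integrable_divide integrable_mult_right iE ic)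
  have nn: "?f k x \<ge> 0" for k x by simp
  show i: "integrable lborel (?f k)" for k
  proof (rule Bochner_Integration.integrable_bound[OF iR[of 1 k]])
    have [measurable]: "deta p (real (Suc k)) \<in> borel_measurable (borel :: 'a measure)"
      by (rule borel_measurable_continuous_onI) (rule eta_continuous, simp)
    have "?f k \<in> borel_measurable borel" by measurable
    then show "?f k \<in> borel_measurable lborel" by simp
    show "AE x in lborel. norm (?f k x) \<le> norm (?E x / 1 + 1 powr (p - 1) * ?c k x)"
    proof (rule AE_I2)
      fix x
      show "norm (?f k x) \<le> norm (?E x / 1 + 1 powr (p - 1) * ?c k x)"
        using pw[where K=1 and k=k and x=x] nn[where k=k and x=x] by simp
    qed
  qed
  show "(\<lambda>k. integral\<^sup>L lborel (?f k)) \<longlonglongrightarrow> 0"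
  proof (rule tendsto_zero_by_tradeoff)
    show "0 \<le> integral\<^sup>L lborel (?f k)" for k by (rule Bochner_Integration.integral_nonneg) (rule nn)
    show "0 \<le> integral\<^sup>L lborel ?E" by (rule Bochner_Integration.integral_nonneg) simp
    show "(\<lambda>k. integral\<^sup>L lborel (?c k)) \<longlonglongrightarrow> 0" by (rule deta_capacity_tendsto[OF r(1) r1])
    show "integral\<^sup>L lborel (?f k) \<le> integral\<^sup>L lborel ?E / K + K powr (p - 1) * integral\<^sup>L lborel (?c k)" if "K > 0" for k K
    proof -
      have "integral\<^sup>L lborel (?f k) \<le> (LINT x|lborel. ?E x / K + K powr (p - 1) * ?c k x)"
        by (rule integral_mono[OF i iR pw[OF that]])
      also have "\<dots> = (LINT x|lborel. ?E x / K) + (LINT x|lborel. K powr (p - 1) * ?c k x)"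
        by (rule Bochner_Integration.integral_add) (intro integrable_divide integrable_mult_right iE ic)+
      finally show ?thesis by simp
    qed
  qed
qed

end

subsection \<open>The flux of a solution through the origin\<close>

lemma LIMSEQ_max_ratio: "(\<lambda>k. (max 0 (real (Suc k) - t) / real (Suc k))) \<longlonglongrightarrow> 1"
proof -
  have "(\<lambda>k. max 0 (1 - t * inverse (real (Suc k)))) \<longlonglongrightarrow> max 0 (1 - t * 0)"
    by (intro tendsto_max tendsto_diff tendsto_mult tendsto_const LIMSEQ_inverse_real_of_nat)
  moreover have "max 0 (1 - t * inverse (real (Suc k))) = max 0 (real (Suc k) - t) / real (Suc k)" for k
  proof -
    have "1 - t * inverse (real (Suc k)) = (real (Suc k) - t) / real (Suc k)" by (simp add: field_simps)
    moreover have "max 0 (a / real (Suc k)) = max 0 a / real (Suc k)" for a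
      by (cases "a \<ge> 0") (auto simp: max_def divide_nonpos_pos dest: antisym)
    ultimately show ?thesis by simp
  qed
  ultimately show ?thesis by simp
qed

context hj_solution
begin

lemma max_ratio_bounds: "L > 0 \<Longrightarrow> 0 \<le> max 0 (L - v x) / L" "L > 0 \<Longrightarrow> max 0 (L - v x) / L \<le> 1"
  using v_nonneg[of x] by auto

text \<open>The same test function, used differently: now the energy term is dropped and the q-term
  is kept. After division by L^2 the right side is bounded independently of L, so Fatou's lemma
  applies twice, first to the origin cutoff and then to L.\<close>

lemma integrable_powr_q:
  assumes r: "0 < r" "r < R0"
  shows "integrable lborel (\<lambda>x. indicator (cball 0 r) x * norm (dv x) powr q)"
proof -
  define R where "R = (r + R0) / 2"
  have R: "r < R" "R < R0" "0 < R" "R \<le> R0" using r by (auto simp: R_def)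
  let ?z = "ball_cut r R :: 'a \<Rightarrow> real" and ?dz = "dball_cut r R :: 'a \<Rightarrow> 'a"
  note z = ball_cut[OF less_imp_le[OF r(1)] R(1)]
  note ce = ball_cut_eta[OF less_imp_le[OF r(1)] R(1) R(4), of "real (Suc _)", OF of_nat_0_less_iff[THEN iffD2, OF zero_less_Suc]]
  let ?s = "\<lambda>L x. max 0 (L - v x)"
  \<comment> \<open>The gradient of the outer cutoff lives on the annulus r <= |x| <= R, where
    \<open>dv\<close> is continuous; hence this constant is finite and free of L and k.\<close>
  define C0 where "C0 = (LINT x|lborel. norm (dv x) powr (p - 1) * norm (?dz x))"
  have i0: "integrable lborel (\<lambda>x. norm (dv x) powr (p - 1) * norm (?dz x))"
  proof (rule integrable_compact_support[of "cball 0 R - ball 0 r"])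
    show "compact (cball (0::'a) R - ball 0 r)" by (simp add: compact_diff)
    have sub: "cball 0 R - ball 0 r \<subseteq> U" using ball_subset[OF R(4)] r by auto
    have "C1_test UNIV ?z ?dz" by (rule z(1)[of UNIV]) auto
    then show "continuous_on (cball 0 R - ball 0 r) (\<lambda>x. norm (dv x) powr (p - 1) * norm (?dz x))"
      by (intro continuous_intros continuous_on_subset[OF cont_powr sub] C1_testD) (use p in auto)
    show "norm (dv x) powr (p - 1) * norm (?dz x) = 0" if "x \<notin> cball 0 R - ball 0 r" for x
      using z(5)[of x] z(7)[of x] that by (cases "norm x \<le> r") auto
  qed
  let ?X = "\<lambda>k x. eta p (real (Suc k)) x * ?z x"
  let ?dX = "\<lambda>k x. eta p (real (Suc k)) x *\<^sub>R ?dz x + ?z x *\<^sub>R deta p (real (Suc k)) x"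
  have mz [measurable]: "?z \<in> borel_measurable borel"
    by (rule borel_measurable_continuous_onI, rule C1_test_cont, rule z(1)[of UNIV]) auto
  have step1: "integrable lborel (\<lambda>x. (?s L x / L)\<^sup>2 * norm (dv x) powr q * ?z x) \<and>
      (LINT x|lborel. (?s L x / L)\<^sup>2 * norm (dv x) powr q * ?z x) \<le> C0" if L: "L > 0" for L
  proof -
    note ti = truncated_identity[OF ce(1), of L]
    let ?g = "\<lambda>k x. (?s L x / L)\<^sup>2 * norm (dv x) powr q * ?X k x"
    let ?cr = "\<lambda>k x. indicator (low R L) x * (norm (dv x) powr (p - 1) * norm (deta p (real (Suc k)) x))"
    note ct = cross_term[OF R(3,2), of L]
    have g: "?g k = (\<lambda>x. (((?s L x)\<^sup>2 * norm (dv x) powr q) * ?X k x) / L\<^sup>2)" for k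
      by (simp add: power_divide fun_eq_iff)
    have ig: "integrable lborel (?g k)" for k unfolding g by (intro integrable_divide ti(4))
    have nn: "0 \<le> ?g k x" for k x using ce(2)[of k x] by simp
    have m: "(\<lambda>x. (?s L x / L)\<^sup>2 * norm (dv x) powr q * ?z x) \<in> borel_measurable lborel"
    proof -
      have "(\<lambda>x. (?s L x / L)\<^sup>2 * norm (dv x) powr q * ?z x) \<in> borel_measurable borel" by measurable
      then show ?thesis by simp
    qed
    have lim: "AE x in lborel. (\<lambda>k. ?g k x) \<longlonglongrightarrow> (?s L x / L)\<^sup>2 * norm (dv x) powr q * ?z x"
      using AE_lborel_singleton[of "0::'a"]
    proof eventually_elim
      case (elim x)
      have "(\<lambda>k. ?g k x) \<longlonglongrightarrow> (?s L x / L)\<^sup>2 * norm (dv x) powr q * (1 * ?z x)"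
        by (intro tendsto_mult tendsto_const eta_tendsto[OF elim])
      then show ?case by simp
    qed
    have bd: "integral\<^sup>L lborel (?g k) \<le> C0 + integral\<^sup>L lborel (?cr k)" for k
    proof -
      have "(LINT x|lborel. (2 * ?s L x * norm (dv x) powr p) * ?X k x) \<ge> 0"
        using ce(2)[of k] by (intro Bochner_Integration.integral_nonneg) simp
      then have "(LINT x|lborel. ((?s L x)\<^sup>2 * norm (dv x) powr q) * ?X k x)
          \<le> (LINT x|lborel. (?s L x)\<^sup>2 * (p_field p (dv x) \<bullet> ?dX k x))"
        using ti(1)[of k] by linarith
      also have "\<dots> \<le> (LINT x|lborel. L\<^sup>2 * (norm (dv x) powr (p - 1) * norm (?dz x) + ?cr k x))"
      proof (rule integral_mono[OF ti(3)])
        show "integrable lborel (\<lambda>x. L\<^sup>2 * (norm (dv x) powr (p - 1) * norm (?dz x) + ?cr k x))"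
          by (intro integrable_mult_right Bochner_Integration.integrable_add i0 ct(1))
        fix x :: 'a
        show "(?s L x)\<^sup>2 * (p_field p (dv x) \<bullet> ?dX k x) \<le> L\<^sup>2 * (norm (dv x) powr (p - 1) * norm (?dz x) + ?cr k x)"
        proof (cases "v x \<le> L")
          case True
          have s: "0 \<le> ?s L x" "?s L x \<le> L" using v_nonneg[of x] L by auto
          have "norm (dv x) powr (p - 1) * norm (?dX k x)
            \<le> norm (dv x) powr (p - 1) * (norm (?dz x) + indicator (cball 0 R) x * norm (deta p (real (Suc k)) x))"
            by (intro mult_left_mono ce(6)) simp
          also have "\<dots> = norm (dv x) powr (p - 1) * norm (?dz x) + ?cr k x"
            using True by (auto simp: low_def distrib_left split: split_indicator)
          finally have *: "norm (dv x) powr (p - 1) * norm (?dX k x) \<le> norm (dv x) powr (p - 1) * norm (?dz x) + ?cr k x" .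
          have "p_field p (dv x) \<bullet> ?dX k x \<le> norm (dv x) powr (p - 1) * norm (?dX k x)"
            using norm_cauchy_schwarz[of "p_field p (dv x)" "?dX k x"] by (simp only: norm_p_field)
          then have "p_field p (dv x) \<bullet> ?dX k x \<le> norm (dv x) powr (p - 1) * norm (?dz x) + ?cr k x" using * by linarith
          then have "(?s L x)\<^sup>2 * (p_field p (dv x) \<bullet> ?dX k x) \<le> (?s L x)\<^sup>2 * (norm (dv x) powr (p - 1) * norm (?dz x) + ?cr k x)"
            by (intro mult_left_mono) auto
          also have "\<dots> \<le> L\<^sup>2 * (norm (dv x) powr (p - 1) * norm (?dz x) + ?cr k x)"
            using s by (intro mult_right_mono power_mono add_nonneg_nonneg) auto
          finally show ?thesis .
        next
          case False
          then have "?s L x = 0" by simp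
          moreover have "0 \<le> L\<^sup>2 * (norm (dv x) powr (p - 1) * norm (?dz x) + ?cr k x)"
            by (intro mult_nonneg_nonneg add_nonneg_nonneg) auto
          ultimately show ?thesis by (simp only: power2_eq_square mult_zero_left)
        qed
      qed
      also have "\<dots> = L\<^sup>2 * (C0 + integral\<^sup>L lborel (?cr k))"
        unfolding C0_def by (simp only: integral_mult_right_zero Bochner_Integration.integral_add[OF i0 ct(1)])
      finally have "(LINT x|lborel. ((?s L x)\<^sup>2 * norm (dv x) powr q) * ?X k x) / L\<^sup>2 \<le> C0 + integral\<^sup>L lborel (?cr k)"
        using L by (simp add: pos_divide_le_eq mult.commute)
      then show ?thesis unfolding g by simp
    qed
    have cl: "(\<lambda>k. C0 + integral\<^sup>L lborel (?cr k)) \<longlonglongrightarrow> C0 + 0" by (intro tendsto_add tendsto_const ct(2))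
    show ?thesis using integrable_fatou[OF ig nn m lim bd cl] by simp
  qed
  have lim: "AE x in lborel. (\<lambda>k. (?s (real (Suc k)) x / real (Suc k))\<^sup>2 * norm (dv x) powr q * ?z x) \<longlonglongrightarrow> norm (dv x) powr q * ?z x"
  proof (rule AE_I2)
    fix x
    have "(\<lambda>k. (?s (real (Suc k)) x / real (Suc k))\<^sup>2 * norm (dv x) powr q * ?z x) \<longlonglongrightarrow> 1\<^sup>2 * norm (dv x) powr q * ?z x"
      by (intro tendsto_mult tendsto_power tendsto_const LIMSEQ_max_ratio)
    then show "(\<lambda>k. (?s (real (Suc k)) x / real (Suc k))\<^sup>2 * norm (dv x) powr q * ?z x) \<longlonglongrightarrow> norm (dv x) powr q * ?z x" by simp
  qed
  have m2: "(\<lambda>x. norm (dv x) powr q * ?z x) \<in> borel_measurable lborel"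
  proof -
    have "(\<lambda>x. norm (dv x) powr q * ?z x) \<in> borel_measurable borel" by measurable
    then show ?thesis by simp
  qed
  have "integrable lborel (\<lambda>x. norm (dv x) powr q * ?z x)"
  proof (rule integrable_fatou(1)[OF _ _ m2 lim _ tendsto_const])
    show "integrable lborel (\<lambda>x. (?s (real (Suc k)) x / real (Suc k))\<^sup>2 * norm (dv x) powr q * ?z x)"
      "(LINT x|lborel. (?s (real (Suc k)) x / real (Suc k))\<^sup>2 * norm (dv x) powr q * ?z x) \<le> C0" for k
      using step1[of "real (Suc k)"] by auto
    show "0 \<le> (?s (real (Suc k)) x / real (Suc k))\<^sup>2 * norm (dv x) powr q * ?z x" for k x using z(2)[of x] by simp
  qed
  then show ?thesis
  proof (rule Bochner_Integration.integrable_bound)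
    have [measurable]: "cball (0::'a) r \<in> sets borel" by simp
    have "(\<lambda>x. indicator (cball 0 r) x * norm (dv x) powr q) \<in> borel_measurable borel" by measurable
    then show "(\<lambda>x. indicator (cball 0 r) x * norm (dv x) powr q) \<in> borel_measurable lborel" by simp
    show "AE x in lborel. norm (indicator (cball 0 r) x * norm (dv x) powr q) \<le> norm (norm (dv x) powr q * ?z x)"
    proof (rule AE_I2)
      fix x
      show "norm (indicator (cball 0 r) x * norm (dv x) powr q) \<le> norm (norm (dv x) powr q * ?z x)"
        using z(4)[of x] by (cases "norm x \<le> r") simp_all
    qed
  qed
qed

lemma powr_p1_le: "norm (dv x) powr (p - 1) \<le> 1 + norm (dv x) powr q"
proof (cases "norm (dv x) \<le> 1")
  case True
  then have "norm (dv x) powr (p - 1) \<le> 1" using p by (intro powr_le1) auto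
  then show ?thesis by (simp add: add_increasing2)
next
  case False
  then have "norm (dv x) powr (p - 1) \<le> norm (dv x) powr q" using q by (intro powr_mono) auto
  then show ?thesis by simp
qed

lemma integrable_flux:
  assumes r: "0 < r" "r < R0"
  shows "integrable lborel (\<lambda>x. indicator (cball 0 r) x * norm (dv x) powr (p - 1))"
proof (rule Bochner_Integration.integrable_bound)
  have m [measurable]: "cball (0::'a) r \<in> sets borel" by simp
  have "integrable lborel (indicator (cball (0::'a) r) :: 'a \<Rightarrow> real)"
    using emeasure_compact_finite[of "cball (0::'a) r"] by (intro integrable_real_indicator) auto
  then show "integrable lborel (\<lambda>x. indicator (cball 0 r) x + indicator (cball 0 r) x * norm (dv x) powr q)"
    by (intro Bochner_Integration.integrable_add integrable_powr_q r)
  have "(\<lambda>x. indicator (cball 0 r) x * norm (dv x) powr (p - 1)) \<in> borel_measurable borel" by measurable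
  then show "(\<lambda>x. indicator (cball 0 r) x * norm (dv x) powr (p - 1)) \<in> borel_measurable lborel" by simp
  show "AE x in lborel. norm (indicator (cball 0 r) x * norm (dv x) powr (p - 1))
      \<le> norm (indicator (cball 0 r) x + indicator (cball 0 r) x * norm (dv x) powr q)"
    using powr_p1_le by (auto split: split_indicator)
qed

lemma C1_test_ball_support:
  assumes "C1_test (ball 0 R0) \<phi> d\<phi>"
  obtains r M where "0 < r" "r < R0" "M > 0" "\<And>x::'a. r < norm x \<Longrightarrow> \<phi> x = 0" "\<And>x. r < norm x \<Longrightarrow> d\<phi> x = 0"
    "\<And>x. \<bar>\<phi> x\<bar> \<le> M * indicator (cball 0 r) x" "\<And>x. norm (d\<phi> x) \<le> M * indicator (cball 0 r) x"
proof -
  obtain K where K: "compact K" "K \<subseteq> ball 0 R0" "\<And>x. x \<notin> K \<Longrightarrow> \<phi> x = 0" "\<And>x. x \<notin> K \<Longrightarrow> d\<phi> x = 0"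
    using C1_test_support[OF assms] by blast
  obtain M where M: "M > 0" "\<And>x. norm (d\<phi> x) \<le> M" "\<And>x. \<bar>\<phi> x\<bar> \<le> M" using C1_test_bounded[OF assms] by blast
  obtain r where r: "0 < r" "r < R0" "K \<subseteq> cball 0 r"
  proof (cases "K = {}")
    case True
    then show ?thesis using that[of "R0 / 2"] R0 by auto
  next
    case False
    obtain x0 where x0: "x0 \<in> K" "\<And>x. x \<in> K \<Longrightarrow> norm x \<le> norm x0"
      using continuous_attains_sup[OF K(1) False continuous_on_norm[OF continuous_on_id]] by blast
    have "norm x0 < R0" using x0(1) K(2) by auto
    moreover have "K \<subseteq> cball 0 (max (norm x0) (R0 / 2))" using x0(2) by (auto simp: le_max_iff_disj)
    ultimately show ?thesis using R0 by (intro that[of "max (norm x0) (R0 / 2)"]) auto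
  qed
  show ?thesis
  proof (rule that[OF r(1,2) M(1)])
    have o: "x \<notin> K" if "r < norm x" for x using r(3) that by auto
    show o1: "\<phi> x = 0" "d\<phi> x = 0" if "r < norm x" for x using K(3,4) o[OF that] by auto
    show "\<bar>\<phi> x\<bar> \<le> M * indicator (cball 0 r) x" "norm (d\<phi> x) \<le> M * indicator (cball 0 r) x" for x
      using M(2,3)[of x] o1[of x] by (auto split: split_indicator)
  qed
qed

lemma integrable_by_bound:
  assumes "integrable lborel w" "g \<in> borel_measurable borel" "\<And>x::'a. \<bar>g x\<bar> \<le> (w x :: real)"
  shows "integrable lborel g"
  using assms(1)
proof (rule Bochner_Integration.integrable_bound)
  show "g \<in> borel_measurable lborel" using assms(2) by simp
  show "AE x in lborel. norm (g x) \<le> norm (w x)" using assms(3) by (auto intro: order_trans[OF _ abs_ge_self])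
qed

lemma test_integrable:
  assumes t: "C1_test (ball 0 R0) \<phi> d\<phi>" and h: "h \<in> borel_measurable borel" "\<And>x. \<bar>h x\<bar> \<le> M"
  shows "integrable lborel (\<lambda>x. h x * (p_field p (dv x) \<bullet> d\<phi> x))"
    and "integrable lborel (\<lambda>x. h x * norm (dv x) powr q * \<phi> x)"
    and "integrable lborel (\<lambda>x. indicator {x. v x \<le> B} x * h x * norm (dv x) powr p * \<phi> x)"
proof -
  obtain r M' where r: "0 < r" "r < R0" and "M' > 0" "\<And>x::'a. r < norm x \<Longrightarrow> \<phi> x = 0" "\<And>x. r < norm x \<Longrightarrow> d\<phi> x = 0"
    and b: "\<And>x. \<bar>\<phi> x\<bar> \<le> M' * indicator (cball 0 r) x" "\<And>x. norm (d\<phi> x) \<le> M' * indicator (cball 0 r) x"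
    using C1_test_ball_support[OF t] by blast
  have M: "0 \<le> M" using h(2)[of 0] by linarith
  note [measurable] = h(1)
  have [measurable]: "\<phi> \<in> borel_measurable borel" "d\<phi> \<in> borel_measurable borel"
    using C1_testD[OF t] by (auto intro: borel_measurable_continuous_onI)
  show "integrable lborel (\<lambda>x. h x * (p_field p (dv x) \<bullet> d\<phi> x))"
  proof (rule integrable_by_bound)
    show "integrable lborel (\<lambda>x. M * M' * (indicator (cball 0 r) x * norm (dv x) powr (p - 1)))"
      by (intro integrable_mult_right integrable_flux r)
    show "\<bar>h x * (p_field p (dv x) \<bullet> d\<phi> x)\<bar> \<le> M * M' * (indicator (cball 0 r) x * norm (dv x) powr (p - 1))" for x
    proof -
      have "\<bar>p_field p (dv x) \<bullet> d\<phi> x\<bar> \<le> norm (dv x) powr (p - 1) * norm (d\<phi> x)"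
        using Cauchy_Schwarz_ineq2[of "p_field p (dv x)" "d\<phi> x"] by (simp only: norm_p_field)
      also have "\<dots> \<le> norm (dv x) powr (p - 1) * (M' * indicator (cball 0 r) x)" by (intro mult_left_mono b(2)) simp
      finally have "\<bar>h x\<bar> * \<bar>p_field p (dv x) \<bullet> d\<phi> x\<bar> \<le> M * (norm (dv x) powr (p - 1) * (M' * indicator (cball 0 r) x))"
        using h(2)[of x] M by (intro mult_mono) auto
      then show ?thesis by (simp add: abs_mult mult_ac)
    qed
  qed measurable
  show "integrable lborel (\<lambda>x. h x * norm (dv x) powr q * \<phi> x)"
  proof (rule integrable_by_bound)
    show "integrable lborel (\<lambda>x. M * M' * (indicator (cball 0 r) x * norm (dv x) powr q))"
      by (intro integrable_mult_right integrable_powr_q r)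
    show "\<bar>h x * norm (dv x) powr q * \<phi> x\<bar> \<le> M * M' * (indicator (cball 0 r) x * norm (dv x) powr q)" for x
    proof -
      have "\<bar>h x\<bar> * norm (dv x) powr q * \<bar>\<phi> x\<bar> \<le> M * norm (dv x) powr q * (M' * indicator (cball 0 r) x)"
        using h(2)[of x] b(1)[of x] M by (intro mult_mono) auto
      then show ?thesis by (simp add: abs_mult mult_ac)
    qed
  qed measurable
  have [measurable]: "{x. v x \<le> B} \<in> sets borel" by measurable
  show "integrable lborel (\<lambda>x. indicator {x. v x \<le> B} x * h x * norm (dv x) powr p * \<phi> x)"
  proof (rule integrable_by_bound)
    show "integrable lborel (\<lambda>x. M * M' * (indicator (low r B) x * norm (dv x) powr p))"
      by (intro integrable_mult_right truncated_energy r)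
    show "\<bar>indicator {x. v x \<le> B} x * h x * norm (dv x) powr p * \<phi> x\<bar> \<le> M * M' * (indicator (low r B) x * norm (dv x) powr p)" for x
    proof (cases "v x \<le> B")
      case True
      have "\<bar>h x\<bar> * norm (dv x) powr p * \<bar>\<phi> x\<bar> \<le> M * norm (dv x) powr p * (M' * indicator (cball 0 r) x)"
        using h(2)[of x] b(1)[of x] M by (intro mult_mono) auto
      then show ?thesis using True by (cases "norm x \<le> r") (simp_all add: abs_mult mult_ac low_def)
    qed (use M \<open>M' > 0\<close> in simp)
  qed measurable
qed

text \<open>The truncated identity persists for test functions that do not vanish near the origin,
  because a point has zero \<open>p\<close>-capacity.\<close>

lemma truncated_identity_origin:
  assumes t: "C1_test (ball 0 R0) \<phi> d\<phi>" and B: "B > 0"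
  shows "(LINT x|lborel. 2 * max 0 (B - v x) * norm (dv x) powr p * \<phi> x)
     = (LINT x|lborel. (max 0 (B - v x))\<^sup>2 * (p_field p (dv x) \<bullet> d\<phi> x))
       - (LINT x|lborel. (max 0 (B - v x))\<^sup>2 * norm (dv x) powr q * \<phi> x)"
    and "integrable lborel (\<lambda>x. 2 * max 0 (B - v x) * norm (dv x) powr p * \<phi> x)"
    and "integrable lborel (\<lambda>x. (max 0 (B - v x))\<^sup>2 * (p_field p (dv x) \<bullet> d\<phi> x))"
    and "integrable lborel (\<lambda>x. (max 0 (B - v x))\<^sup>2 * norm (dv x) powr q * \<phi> x)"
proof -
  let ?s = "\<lambda>x. max 0 (B - v x)"
  obtain r M where r: "0 < r" "r < R0" and "M > 0" and s0: "\<And>x::'a. r < norm x \<Longrightarrow> \<phi> x = 0" "\<And>x. r < norm x \<Longrightarrow> d\<phi> x = 0"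
    and b: "\<And>x. \<bar>\<phi> x\<bar> \<le> M * indicator (cball 0 r) x" "\<And>x. norm (d\<phi> x) \<le> M * indicator (cball 0 r) x"
    using C1_test_ball_support[OF t] by blast
  have [measurable]: "\<phi> \<in> borel_measurable borel" "d\<phi> \<in> borel_measurable borel"
    using C1_testD[OF t] by (auto intro: borel_measurable_continuous_onI)
  have sb: "0 \<le> ?s x" "?s x \<le> B" for x using v_nonneg[of x] B by auto
  have s2: "\<bar>(?s x)\<^sup>2\<bar> \<le> B\<^sup>2" for x using power_mono[OF sb(2,1), of x 2] by simp
  show iA: "integrable lborel (\<lambda>x. (?s x)\<^sup>2 * (p_field p (dv x) \<bullet> d\<phi> x))"
    by (rule test_integrable(1)[OF t _ s2]) measurable
  show iF: "integrable lborel (\<lambda>x. (?s x)\<^sup>2 * norm (dv x) powr q * \<phi> x)"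
    by (rule test_integrable(2)[OF t _ s2]) measurable
  have "integrable lborel (\<lambda>x. indicator {x. v x \<le> B} x * (2 * ?s x) * norm (dv x) powr p * \<phi> x)"
    by (rule test_integrable(3)[OF t, where M="2 * B"]) (measurable, use sb B in auto)
  moreover have "indicator {x. v x \<le> B} x * (2 * ?s x) * norm (dv x) powr p * \<phi> x = 2 * ?s x * norm (dv x) powr p * \<phi> x" for x
    by (auto split: split_indicator)
  ultimately show iE: "integrable lborel (\<lambda>x. 2 * ?s x * norm (dv x) powr p * \<phi> x)" by simp
  let ?e = "\<lambda>k x. eta p (real (Suc k)) (x::'a)" and ?de = "\<lambda>k x. deta p (real (Suc k)) (x::'a)"
  have me [measurable]: "?e k \<in> borel_measurable borel" for k
    by (rule borel_measurable_continuous_onI[OF eta_continuous(1)]) simp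
  have [measurable]: "?de k \<in> borel_measurable borel" for k
    by (rule borel_measurable_continuous_onI[OF eta_continuous(2)]) simp
  have T: "C1_test U (\<lambda>x. ?e k x * \<phi> x) (\<lambda>x. ?e k x *\<^sub>R d\<phi> x + \<phi> x *\<^sub>R ?de k x)" for k
  proof -
    have "C1_test (ball 0 R0 - {0}) (\<lambda>x. ?e k x * \<phi> x) (\<lambda>x. ?e k x *\<^sub>R d\<phi> x + \<phi> x *\<^sub>R ?de k x)"
      by (rule eta_C1_test[OF _ t]) auto
    then show ?thesis by (rule C1_test_mono) (use \<Omega>(2) in auto)
  qed
  note ti = truncated_identity[OF T, of B]
  have dom: "(\<lambda>k. LINT x|lborel. g x * ?e k x) \<longlonglongrightarrow> (LINT x|lborel. g x)"
    if g: "integrable lborel g" "\<And>x. r < norm x \<Longrightarrow> g x = 0" for g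
  proof (rule integral_dominated_convergence[where w="\<lambda>x. \<bar>g x\<bar>"])
    have [measurable]: "g \<in> borel_measurable lborel" using g by auto
    show "g \<in> borel_measurable lborel" by fact
    have [measurable]: "?e k \<in> borel_measurable lborel" for k using me[of k] by simp
    show "(\<lambda>x. g x * ?e k x) \<in> borel_measurable lborel" for k by measurable
    show "integrable lborel (\<lambda>x. \<bar>g x\<bar>)" using g by simp
    show "AE x in lborel. (\<lambda>k. g x * ?e k x) \<longlonglongrightarrow> g x"
      using AE_lborel_singleton[of "0::'a"]
    proof eventually_elim
      case (elim x)
      have "(\<lambda>k. g x * ?e k x) \<longlonglongrightarrow> g x * 1" by (intro tendsto_mult tendsto_const eta_tendsto[OF elim])
      then show ?case by simp
    qed
    show "AE x in lborel. norm (g x * ?e k x) \<le> \<bar>g x\<bar>" for k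
    proof (rule AE_I2)
      fix x
      show "norm (g x * ?e k x) \<le> \<bar>g x\<bar>"
      proof (cases "norm x \<le> r")
        case True
        then show ?thesis using eta_bounds[of "real (Suc k)" x] r R0 by (simp add: abs_mult mult_left_le)
      next
        case False
        then show ?thesis using g(2)[of x] by simp
      qed
    qed
  qed
  have l1: "(\<lambda>k. LINT x|lborel. (2 * ?s x * norm (dv x) powr p * \<phi> x) * ?e k x) \<longlonglongrightarrow> (LINT x|lborel. 2 * ?s x * norm (dv x) powr p * \<phi> x)"
    by (rule dom[OF iE]) (simp add: s0)
  have l2: "(\<lambda>k. LINT x|lborel. ((?s x)\<^sup>2 * (p_field p (dv x) \<bullet> d\<phi> x)) * ?e k x) \<longlonglongrightarrow> (LINT x|lborel. (?s x)\<^sup>2 * (p_field p (dv x) \<bullet> d\<phi> x))"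
    by (rule dom[OF iA]) (simp add: s0)
  have l3: "(\<lambda>k. LINT x|lborel. ((?s x)\<^sup>2 * norm (dv x) powr q * \<phi> x) * ?e k x) \<longlonglongrightarrow> (LINT x|lborel. (?s x)\<^sup>2 * norm (dv x) powr q * \<phi> x)"
    by (rule dom[OF iF]) (simp add: s0)
  \<comment> \<open>The one term without a fixed dominating function. The truncation confines it to
    {v <= B}, where \<open>cross_term\<close> makes it disappear in the limit.\<close>
  let ?cr = "\<lambda>k x. (?s x)\<^sup>2 * \<phi> x * (p_field p (dv x) \<bullet> ?de k x)"
  note ct = cross_term[OF r, of B]
  have crb: "\<bar>?cr k x\<bar> \<le> B\<^sup>2 * M * (indicator (low r B) x * (norm (dv x) powr (p - 1) * norm (?de k x)))" for k x
  proof (cases "norm x \<le> r \<and> v x \<le> B")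
    case True
    have f1: "\<bar>p_field p (dv x) \<bullet> ?de k x\<bar> \<le> norm (dv x) powr (p - 1) * norm (?de k x)"
      using Cauchy_Schwarz_ineq2[of "p_field p (dv x)" "?de k x"] by (simp only: norm_p_field)
    have f2: "\<bar>(?s x)\<^sup>2\<bar> * \<bar>\<phi> x\<bar> \<le> B\<^sup>2 * M"
      using s2[of x] b(1)[of x] True by (intro mult_mono) auto
    have "(\<bar>(?s x)\<^sup>2\<bar> * \<bar>\<phi> x\<bar>) * \<bar>p_field p (dv x) \<bullet> ?de k x\<bar> \<le> (B\<^sup>2 * M) * (norm (dv x) powr (p - 1) * norm (?de k x))"
      by (rule mult_mono[OF f2 f1]) (use \<open>M > 0\<close> in auto)
    then show ?thesis using True by (simp add: abs_mult low_def)
  next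
    case False
    then have "?s x = 0 \<or> \<phi> x = 0" using s0(1)[of x] by (auto simp: not_le)
    then have "?cr k x = 0" by auto
    moreover have "0 \<le> B\<^sup>2 * M * (indicator (low r B) x * (norm (dv x) powr (p - 1) * norm (?de k x)))"
      using \<open>M > 0\<close> by (intro mult_nonneg_nonneg) auto
    ultimately show ?thesis by (simp only: abs_zero)
  qed
  have icr: "integrable lborel (?cr k)" for k
    by (rule integrable_by_bound[OF integrable_mult_right[OF ct(1)] _ crb]) measurable
  have l4: "(\<lambda>k. integral\<^sup>L lborel (?cr k)) \<longlonglongrightarrow> 0"
  proof (rule Lim_null_comparison)
    have "(\<lambda>k. B\<^sup>2 * M * (LINT x|lborel. indicator (low r B) x * (norm (dv x) powr (p - 1) * norm (?de k x)))) \<longlonglongrightarrow> B\<^sup>2 * M * 0"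
      by (intro tendsto_mult tendsto_const ct(2))
    then show "(\<lambda>k. B\<^sup>2 * M * (LINT x|lborel. indicator (low r B) x * (norm (dv x) powr (p - 1) * norm (?de k x)))) \<longlonglongrightarrow> 0" by simp
    have "norm (integral\<^sup>L lborel (?cr k)) \<le> (LINT x|lborel. B\<^sup>2 * M * (indicator (low r B) x * (norm (dv x) powr (p - 1) * norm (?de k x))))" for k
      by (rule Bochner_Integration.integral_norm_bound_integral[OF icr integrable_mult_right[OF ct(1)]]) (use crb in simp)
    then show "\<forall>\<^sub>F k in sequentially. norm (integral\<^sup>L lborel (?cr k))
        \<le> B\<^sup>2 * M * (LINT x|lborel. indicator (low r B) x * (norm (dv x) powr (p - 1) * norm (?de k x)))"
      by (intro always_eventually allI) (simp only: integral_mult_right_zero)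
  qed
  have eq: "(LINT x|lborel. (2 * ?s x * norm (dv x) powr p * \<phi> x) * ?e k x)
     = (LINT x|lborel. ((?s x)\<^sup>2 * (p_field p (dv x) \<bullet> d\<phi> x)) * ?e k x) + integral\<^sup>L lborel (?cr k)
       - (LINT x|lborel. ((?s x)\<^sup>2 * norm (dv x) powr q * \<phi> x) * ?e k x)" for k
  proof -
    have sp: "(?s x)\<^sup>2 * (p_field p (dv x) \<bullet> (?e k x *\<^sub>R d\<phi> x + \<phi> x *\<^sub>R ?de k x))
        = ((?s x)\<^sup>2 * (p_field p (dv x) \<bullet> d\<phi> x)) * ?e k x + ?cr k x" for x
      by (simp add: inner_add_right algebra_simps)
    have "integrable lborel (\<lambda>x. ((?s x)\<^sup>2 * (p_field p (dv x) \<bullet> d\<phi> x)) * ?e k x + ?cr k x - ?cr k x)"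
      using ti(3)[of k] unfolding sp by (rule Bochner_Integration.integrable_diff) (rule icr)
    then have "integrable lborel (\<lambda>x. ((?s x)\<^sup>2 * (p_field p (dv x) \<bullet> d\<phi> x)) * ?e k x)" by simp
    from Bochner_Integration.integral_add[OF this icr] ti(1)[of k]
    show ?thesis unfolding sp by (simp add: mult_ac)
  qed
  have "(\<lambda>k. LINT x|lborel. (2 * ?s x * norm (dv x) powr p * \<phi> x) * ?e k x) \<longlonglongrightarrow>
     (LINT x|lborel. (?s x)\<^sup>2 * (p_field p (dv x) \<bullet> d\<phi> x)) + 0
       - (LINT x|lborel. (?s x)\<^sup>2 * norm (dv x) powr q * \<phi> x)"
    unfolding eq by (intro tendsto_diff tendsto_add l2 l3 l4)
  from LIMSEQ_unique[OF l1 this]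
  show "(LINT x|lborel. 2 * ?s x * norm (dv x) powr p * \<phi> x)
     = (LINT x|lborel. (?s x)\<^sup>2 * (p_field p (dv x) \<bullet> d\<phi> x))
       - (LINT x|lborel. (?s x)\<^sup>2 * norm (dv x) powr q * \<phi> x)" by simp
qed

end

lemma tendsto_max_ratio: "((\<lambda>L::real. max 0 (L - t) / L) \<longlongrightarrow> 1) at_top"
proof -
  have "((\<lambda>L::real. max 0 (1 - t * inverse L)) \<longlongrightarrow> max 0 (1 - t * 0)) at_top"
    by (intro tendsto_max tendsto_diff tendsto_mult tendsto_const tendsto_inverse_0_at_top filterlim_ident)
  moreover have "\<forall>\<^sub>F L in at_top. max 0 (1 - t * inverse L) = max 0 (L - t) / L"
    using eventually_gt_at_top[of "0::real"]
  proof eventually_elim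
    case (elim L)
    have "1 - t * inverse L = (L - t) / L" using elim by (simp add: field_simps)
    moreover have "max 0 (a / L) = max 0 a / L" for a
      using elim by (cases "a \<ge> 0") (auto simp: max_def divide_nonpos_pos dest: antisym)
    ultimately show ?case by simp
  qed
  ultimately show ?thesis by (simp add: tendsto_cong)
qed

section \<open>The mass of the equation at the origin\<close>

context hj_solution
begin

definition energy_mean :: "real \<Rightarrow> ('a \<Rightarrow> real) \<Rightarrow> real" where
  "energy_mean L \<phi> = (LINT x|lborel. 2 * max 0 (L - v x) * norm (dv x) powr p * \<phi> x) / L\<^sup>2"

text \<open>The distribution -\<Delta>_p v - |\<nabla>v|^q tested with \<phi>; it can only see the
  origin, because the equation holds elsewhere.\<close>

definition defect :: "('a \<Rightarrow> real) \<Rightarrow> ('a \<Rightarrow> 'a) \<Rightarrow> real" where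
  "defect \<phi> d\<phi> = (LINT x|lborel. p_field p (dv x) \<bullet> d\<phi> x) - (LINT x|lborel. norm (dv x) powr q * \<phi> x)"

lemma energy_mean_eq:
  assumes t: "C1_test (ball 0 R0) \<phi> d\<phi>" and L: "L > 0"
  shows "energy_mean L \<phi> = (LINT x|lborel. (max 0 (L - v x) / L)\<^sup>2 * (p_field p (dv x) \<bullet> d\<phi> x))
       - (LINT x|lborel. (max 0 (L - v x) / L)\<^sup>2 * norm (dv x) powr q * \<phi> x)"
proof -
  have e: "(\<lambda>x. (max 0 (L - v x) / L)\<^sup>2 * (p_field p (dv x) \<bullet> d\<phi> x)) = (\<lambda>x. (max 0 (L - v x))\<^sup>2 * (p_field p (dv x) \<bullet> d\<phi> x) / L\<^sup>2)"
    "(\<lambda>x. (max 0 (L - v x) / L)\<^sup>2 * norm (dv x) powr q * \<phi> x) = (\<lambda>x. (max 0 (L - v x))\<^sup>2 * norm (dv x) powr q * \<phi> x / L\<^sup>2)"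
    by (simp_all add: power_divide)
  show ?thesis unfolding energy_mean_def truncated_identity_origin(1)[OF t L] e
    by (simp add: diff_divide_distrib)
qed

lemma sq_ratio_bounds:
  assumes "L > 0" shows "\<bar>(max 0 (L - v x) / L)\<^sup>2\<bar> \<le> 1"
  using max_ratio_bounds[OF assms, of x] by (simp add: power_le_one)

lemma one_le_const: "\<bar>1::real\<bar> \<le> 1" by simp

lemma flux_integrable:
  assumes t: "C1_test (ball 0 R0) \<phi> d\<phi>"
  shows "integrable lborel (\<lambda>x. p_field p (dv x) \<bullet> d\<phi> x)" "integrable lborel (\<lambda>x. norm (dv x) powr q * \<phi> x)"
proof -
  have m: "(\<lambda>_. 1::real) \<in> borel_measurable (borel :: 'a measure)" by simp
  show "integrable lborel (\<lambda>x. p_field p (dv x) \<bullet> d\<phi> x)"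
    using test_integrable(1)[OF t m one_le_const] by simp
  show "integrable lborel (\<lambda>x. norm (dv x) powr q * \<phi> x)"
    using test_integrable(2)[OF t m one_le_const] by simp
qed

text \<open>After division by L^2 the truncation enters as the weight (1 - v / L)_+^2, which tends
  to 1 and is at most 1, and both integrands are integrable by the estimates above. The energies
  thus have a limit without being finite for v itself.\<close>

lemma energy_mean_tendsto:
  assumes t: "C1_test (ball 0 R0) \<phi> d\<phi>"
  shows "((\<lambda>L. energy_mean L \<phi>) \<longlongrightarrow> defect \<phi> d\<phi>) at_top"
proof -
  have dom: "((\<lambda>L. LINT x|lborel. (max 0 (L - v x) / L)\<^sup>2 * g x) \<longlongrightarrow> (LINT x|lborel. g x)) at_top"
    if g: "integrable lborel g" for g
  proof (rule integral_dominated_convergence_at_top[where w="\<lambda>x. \<bar>g x\<bar>"])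
    show gm [measurable]: "g \<in> borel_measurable lborel" using g by auto
    have [measurable]: "v \<in> borel_measurable lborel" by simp
    show "(\<lambda>x. (max 0 (L - v x) / L)\<^sup>2 * g x) \<in> borel_measurable lborel" for L by measurable
    show "integrable lborel (\<lambda>x. \<bar>g x\<bar>)" using g by simp
    show "AE x in lborel. ((\<lambda>L. (max 0 (L - v x) / L)\<^sup>2 * g x) \<longlongrightarrow> g x) at_top"
    proof (rule AE_I2)
      fix x
      have "((\<lambda>L. (max 0 (L - v x) / L)\<^sup>2 * g x) \<longlongrightarrow> 1\<^sup>2 * g x) at_top"
        by (intro tendsto_mult tendsto_power tendsto_const tendsto_max_ratio)
      then show "((\<lambda>L. (max 0 (L - v x) / L)\<^sup>2 * g x) \<longlongrightarrow> g x) at_top" by simp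
    qed
    show "\<forall>\<^sub>F L in at_top. AE x in lborel. norm ((max 0 (L - v x) / L)\<^sup>2 * g x) \<le> \<bar>g x\<bar>"
      using eventually_gt_at_top[of "0::real"]
    proof eventually_elim
      case (elim L)
      show ?case
      proof (rule AE_I2)
        fix x
        show "norm ((max 0 (L - v x) / L)\<^sup>2 * g x) \<le> \<bar>g x\<bar>"
          using sq_ratio_bounds[OF elim, of x] mult_right_mono[of "\<bar>(max 0 (L - v x) / L)\<^sup>2\<bar>" 1 "\<bar>g x\<bar>"] by (simp only: real_norm_def abs_mult) simp
      qed
    qed
  qed
  have "((\<lambda>L. (LINT x|lborel. (max 0 (L - v x) / L)\<^sup>2 * (p_field p (dv x) \<bullet> d\<phi> x))
       - (LINT x|lborel. (max 0 (L - v x) / L)\<^sup>2 * (norm (dv x) powr q * \<phi> x))) \<longlongrightarrow> defect \<phi> d\<phi>) at_top"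
    unfolding defect_def by (intro tendsto_diff dom flux_integrable[OF t])
  moreover have "\<forall>\<^sub>F L in at_top. (LINT x|lborel. (max 0 (L - v x) / L)\<^sup>2 * (p_field p (dv x) \<bullet> d\<phi> x))
       - (LINT x|lborel. (max 0 (L - v x) / L)\<^sup>2 * (norm (dv x) powr q * \<phi> x)) = energy_mean L \<phi>"
    using eventually_gt_at_top[of "0::real"]
    by eventually_elim (simp only: energy_mean_eq[OF t] mult.assoc)
  ultimately show ?thesis by (rule Lim_transform_eventually)
qed

abbreviation "\<zeta> \<equiv> ball_cut (R0 / 3) (R0 / 2) :: 'a \<Rightarrow> real"
abbreviation "d\<zeta> \<equiv> dball_cut (R0 / 3) (R0 / 2) :: 'a \<Rightarrow> 'a"

lemma zeta_radii: "0 \<le> R0 / 3" "R0 / 3 < R0 / 2" using R0 by auto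

lemmas zeta = ball_cut[where 'a='a, OF zeta_radii]

lemma zeta_test: "C1_test (ball 0 R0) \<zeta> d\<zeta>" "C1_test UNIV \<zeta> d\<zeta>" "C1_test \<Omega> \<zeta> d\<zeta>"
proof -
  show "C1_test (ball 0 R0) \<zeta> d\<zeta>" by (rule zeta(1)) (use R0 in auto)
  then show "C1_test UNIV \<zeta> d\<zeta>" "C1_test \<Omega> \<zeta> d\<zeta>"
    by (rule C1_test_mono, use \<Omega>(2) in auto)+
qed

definition mass :: real where "mass = defect \<zeta> d\<zeta>"

lemma energy_mean_zeta_nonneg: "energy_mean L \<zeta> \<ge> 0"
  unfolding energy_mean_def using zeta(2) by (intro divide_nonneg_nonneg Bochner_Integration.integral_nonneg) auto

lemma mass_nonneg: "mass \<ge> 0"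
  unfolding mass_def
  by (rule tendsto_lowerbound[OF energy_mean_tendsto[OF zeta_test(1)]])
    (auto simp: energy_mean_zeta_nonneg)

lemma annulus_integrable:
  assumes "0 < \<delta>" "r \<le> R0" "a > 0"
  shows "integrable lborel (\<lambda>x. indicator (cball 0 r - ball 0 \<delta>) x * norm (dv x) powr a)"
proof -
  have "continuous_on (cball 0 r - ball 0 \<delta>) (\<lambda>x. norm (dv x) powr a)"
    by (rule continuous_on_subset[OF cont_powr[OF assms(3)]]) (use ball_subset[OF assms(2)] assms(1) in auto)
  from borel_integrable_compact[OF _ this] show ?thesis by (simp add: compact_diff)
qed

text \<open>Near the origin |\<phi>| <= \<epsilon>, so the energy mean is at most \<epsilon> times
  that of the reference cutoff. Away from the origin the gradient is bounded and the energy mean is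
  O(1 / L). In the limit the defect is at most \<epsilon> times the mass.\<close>

lemma defect_vanishing:
  assumes t: "C1_test (ball 0 R0) \<phi> d\<phi>" and 0: "\<phi> 0 = 0"
  shows "defect \<phi> d\<phi> = 0"
proof (rule eq_zero_if_le_mult_eps[of _ mass])
  fix \<epsilon> :: real assume \<epsilon>: "\<epsilon> > 0"
  obtain r M where r: "0 < r" "r < R0" and M: "M > 0" and s0: "\<And>x::'a. r < norm x \<Longrightarrow> \<phi> x = 0" "\<And>x. r < norm x \<Longrightarrow> d\<phi> x = 0"
    and b: "\<And>x. \<bar>\<phi> x\<bar> \<le> M * indicator (cball 0 r) x" "\<And>x. norm (d\<phi> x) \<le> M * indicator (cball 0 r) x"
    using C1_test_ball_support[OF t] by blast
  have "continuous_on UNIV \<phi>" by (rule C1_test_cont[OF t])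
  then have "isCont \<phi> 0" by (simp add: continuous_on_eq_continuous_at)
  then obtain d where d: "d > 0" "\<And>x. dist x 0 < d \<Longrightarrow> dist (\<phi> x) (\<phi> 0) < \<epsilon>"
    unfolding continuous_at_eps_delta using \<epsilon> by (metis dist_commute)
  define \<delta> where "\<delta> = min (d / 2) (R0 / 3)"
  have \<delta>: "0 < \<delta>" "\<delta> \<le> R0 / 3" "\<delta> < d" using d(1) R0 by (auto simp: \<delta>_def min_def)
  define E where "E = (LINT x|lborel. indicator (cball 0 r - ball 0 \<delta>) x * norm (dv x) powr p)"
  have iE: "integrable lborel (\<lambda>x. indicator (cball 0 r - ball 0 \<delta>) x * norm (dv x) powr p)"
    by (rule annulus_integrable) (use \<delta> r p in auto)
  \<comment> \<open>\<open>E\<close> is the energy on the annulus from \<delta> to \<open>r\<close>;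
    there the weight 2 (L - v)_+ / L^2 is at most 2 / L, whence the last term.\<close>
  have main: "\<bar>energy_mean L \<phi>\<bar> \<le> \<epsilon> * energy_mean L \<zeta> + 2 * M * E * inverse L" if L: "L > 0" for L
  proof -
    let ?s = "\<lambda>x. max 0 (L - v x)"
    have s: "0 \<le> ?s x" "?s x \<le> L" for x using v_nonneg[of x] L by auto
    note iz = truncated_identity_origin(2)[OF zeta_test(1) L] and i = truncated_identity_origin(2)[OF t L]
    have "\<bar>LINT x|lborel. 2 * ?s x * norm (dv x) powr p * \<phi> x\<bar>
      \<le> (LINT x|lborel. \<epsilon> * (2 * ?s x * norm (dv x) powr p * \<zeta> x) + (2 * L * M) * (indicator (cball 0 r - ball 0 \<delta>) x * norm (dv x) powr p))"
      unfolding real_norm_def[symmetric]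
    proof (rule Bochner_Integration.integral_norm_bound_integral[OF i])
      show "integrable lborel (\<lambda>x. \<epsilon> * (2 * ?s x * norm (dv x) powr p * \<zeta> x) + (2 * L * M) * (indicator (cball 0 r - ball 0 \<delta>) x * norm (dv x) powr p))"
        by (intro Bochner_Integration.integrable_add integrable_mult_right iz iE)
      fix x :: 'a
      have nz: "0 \<le> \<epsilon> * (2 * ?s x * norm (dv x) powr p * \<zeta> x)" using \<epsilon> s(1)[of x] zeta(2)[of x] by simp
      consider "norm x < \<delta>" | "\<delta> \<le> norm x" "norm x \<le> r" | "r < norm x" by linarith
      then show "norm (2 * ?s x * norm (dv x) powr p * \<phi> x)
         \<le> \<epsilon> * (2 * ?s x * norm (dv x) powr p * \<zeta> x) + (2 * L * M) * (indicator (cball 0 r - ball 0 \<delta>) x * norm (dv x) powr p)"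
      proof cases
        case 1
        then have "\<bar>\<phi> x\<bar> \<le> \<epsilon>" using d(2)[of x] \<delta>(3) 0 by simp
        then have "2 * ?s x * norm (dv x) powr p * \<bar>\<phi> x\<bar> \<le> 2 * ?s x * norm (dv x) powr p * \<epsilon>"
          using s(1)[of x] by (intro mult_left_mono) auto
        moreover have "\<zeta> x = 1" using zeta(4)[of x] 1 \<delta>(2) by simp
        moreover have "(2 * L * M) * (indicator (cball 0 r - ball 0 \<delta>) x * norm (dv x) powr p) \<ge> 0" using L M by simp
        moreover have "norm (2 * ?s x * norm (dv x) powr p * \<phi> x) = 2 * ?s x * norm (dv x) powr p * \<bar>\<phi> x\<bar>"
          using s(1)[of x] by (simp add: abs_mult)
        ultimately show ?thesis by (simp only: mult_1_right) (simp only: mult_ac)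
      next
        case 2
        have "2 * ?s x * norm (dv x) powr p * \<bar>\<phi> x\<bar> \<le> 2 * L * norm (dv x) powr p * M"
          using s[of x] b(1)[of x] 2 M L by (intro mult_mono) auto
        moreover have "norm (2 * ?s x * norm (dv x) powr p * \<phi> x) = 2 * ?s x * norm (dv x) powr p * \<bar>\<phi> x\<bar>"
          using s(1)[of x] by (simp add: abs_mult)
        moreover have "(2 * L * M) * (indicator (cball 0 r - ball 0 \<delta>) x * norm (dv x) powr p) = 2 * L * norm (dv x) powr p * M" using 2 by simp
        ultimately show ?thesis using nz by linarith
      next
        case 3
        have "(2 * L * M) * (indicator (cball 0 r - ball 0 \<delta>) x * norm (dv x) powr p) \<ge> 0" using L M by simp
        then show ?thesis using nz s0(1)[OF 3] by simp
      qed
    qed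
    also have "\<dots> = \<epsilon> * (LINT x|lborel. 2 * ?s x * norm (dv x) powr p * \<zeta> x) + (2 * L * M) * E"
      unfolding E_def by (subst Bochner_Integration.integral_add) (intro integrable_mult_right iz iE, intro integrable_mult_right iz iE, simp only: integral_mult_right_zero)
    finally have "\<bar>energy_mean L \<phi>\<bar> \<le> (\<epsilon> * (LINT x|lborel. 2 * ?s x * norm (dv x) powr p * \<zeta> x) + (2 * L * M) * E) / L\<^sup>2"
      unfolding energy_mean_def abs_divide by (simp add: divide_right_mono)
    also have "\<dots> = \<epsilon> * energy_mean L \<zeta> + 2 * M * E * inverse L"
    proof -
      have "(e * X + (2 * l * m) * y) / l\<^sup>2 = e * (X / l\<^sup>2) + 2 * m * y * inverse l" if "l > 0" for e X l m y :: real
        using that by (simp add: field_simps power2_eq_square)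
      from this[OF L] show ?thesis unfolding energy_mean_def .
    qed
    finally show ?thesis .
  qed
  have "((\<lambda>L. \<epsilon> * energy_mean L \<zeta> + 2 * M * E * inverse L) \<longlongrightarrow> \<epsilon> * mass + 2 * M * E * 0) at_top"
    unfolding mass_def
    by (intro tendsto_add tendsto_mult tendsto_const energy_mean_tendsto zeta_test tendsto_inverse_0_at_top filterlim_ident)
  moreover have "((\<lambda>L. \<bar>energy_mean L \<phi>\<bar>) \<longlongrightarrow> \<bar>defect \<phi> d\<phi>\<bar>) at_top"
    by (intro tendsto_rabs energy_mean_tendsto t)
  ultimately have "\<bar>defect \<phi> d\<phi>\<bar> \<le> \<epsilon> * mass + 2 * M * E * 0"
    by (rule tendsto_le[rotated]) (auto intro: eventually_mono[OF eventually_gt_at_top[of 0]] main)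
  then show "\<bar>defect \<phi> d\<phi>\<bar> \<le> \<epsilon> * mass" by simp
qed

text \<open>Since \<zeta>(0) = 1, subtracting \<phi>(0) \<zeta> reduces to a test function vanishing
  at 0. The defect is therefore a multiple of the Dirac mass.\<close>

lemma defect_eq:
  assumes t: "C1_test (ball 0 R0) \<phi> d\<phi>"
  shows "defect \<phi> d\<phi> = mass * \<phi> 0"
proof -
  have z0: "\<zeta> 0 = 1" using zeta(4)[of 0] R0 by simp
  have T: "C1_test (ball 0 R0) (\<lambda>x. \<phi> x + (- \<phi> 0) * \<zeta> x) (\<lambda>x. d\<phi> x + (- \<phi> 0) *\<^sub>R d\<zeta> x)"
    by (intro C1_test_add C1_test_const_mult t zeta_test)
  have "defect (\<lambda>x. \<phi> x + (- \<phi> 0) * \<zeta> x) (\<lambda>x. d\<phi> x + (- \<phi> 0) *\<^sub>R d\<zeta> x) = defect \<phi> d\<phi> + (- \<phi> 0) * mass"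
  proof -
    note i = flux_integrable[OF t] and iz = flux_integrable[OF zeta_test(1)]
    have "(LINT x|lborel. p_field p (dv x) \<bullet> (d\<phi> x + (- \<phi> 0) *\<^sub>R d\<zeta> x))
      = (LINT x|lborel. p_field p (dv x) \<bullet> d\<phi> x + (- \<phi> 0) * (p_field p (dv x) \<bullet> d\<zeta> x))"
      by (simp only: inner_add_right inner_scaleR_right)
    also have "\<dots> = (LINT x|lborel. p_field p (dv x) \<bullet> d\<phi> x) + (- \<phi> 0) * (LINT x|lborel. p_field p (dv x) \<bullet> d\<zeta> x)"
      by (simp only: Bochner_Integration.integral_add[OF i(1) integrable_mult_right[OF iz(1)]] integral_mult_right_zero)
    finally have 1: "(LINT x|lborel. p_field p (dv x) \<bullet> (d\<phi> x + (- \<phi> 0) *\<^sub>R d\<zeta> x)) = \<dots>" .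
    have "(LINT x|lborel. norm (dv x) powr q * (\<phi> x + (- \<phi> 0) * \<zeta> x))
      = (LINT x|lborel. norm (dv x) powr q * \<phi> x + (- \<phi> 0) * (norm (dv x) powr q * \<zeta> x))"
      by (simp only: distrib_left mult.left_commute)
    also have "\<dots> = (LINT x|lborel. norm (dv x) powr q * \<phi> x) + (- \<phi> 0) * (LINT x|lborel. norm (dv x) powr q * \<zeta> x)"
      by (simp only: Bochner_Integration.integral_add[OF i(2) integrable_mult_right[OF iz(2)]] integral_mult_right_zero)
    finally show ?thesis unfolding defect_def mass_def 1 by (simp add: algebra_simps)
  qed
  with defect_vanishing[OF T] z0 show ?thesis by simp
qed

text \<open>Young's inequality with the conjugate exponents q / (p - 1) and q / (q + 1 - p), with a
  free parameter s on the q-term and no sharp constants.\<close>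

lemma young_absorb:
  fixes x y s :: real
  assumes "x \<ge> 0" "y \<ge> 0" "s > 0"
  shows "x powr (p - 1) * y \<le> s * x powr q + s powr (- ((p - 1) / (q + 1 - p))) * y powr (q / (q + 1 - p))"
proof (cases "y \<le> s * x powr (q + 1 - p)")
  case True
  have "x powr (p - 1) * y \<le> x powr (p - 1) * (s * x powr (q + 1 - p))" using True by (intro mult_left_mono) auto
  also have "\<dots> = s * x powr q" by (simp add: mult.left_commute flip: powr_add)
  finally show ?thesis by (simp add: add_increasing2)
next
  case False
  let ?m = "q + 1 - p"
  have m: "?m > 0" using q by simp
  have y: "y > 0" using False assms zero_le_mult_iff[of s "x powr ?m"] by (meson less_le_trans not_le order_less_le powr_ge_zero mult_nonneg_nonneg)
  have "x powr ?m \<le> y / s" using False assms by (simp add: field_simps)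
  then have "(x powr ?m) powr ((p - 1) / ?m) \<le> (y / s) powr ((p - 1) / ?m)" using m p by (intro powr_mono2) auto
  then have "x powr (p - 1) \<le> (y / s) powr ((p - 1) / ?m)" using m by (simp add: powr_powr)
  then have "x powr (p - 1) * y \<le> (y / s) powr ((p - 1) / ?m) * y" using y by (intro mult_right_mono) auto
  also have "\<dots> = s powr (- ((p - 1) / ?m)) * (y powr ((p - 1) / ?m) * y)"
    using assms by (simp add: powr_mult powr_minus divide_inverse inverse_powr)
  also have "y powr ((p - 1) / ?m) * y = y powr (q / ?m)"
  proof -
    have "(p - 1) / ?m + 1 = q / ?m" using m by (simp add: field_simps)
    then show ?thesis using powr_mult_self[of y "(p - 1) / ?m"] y by simp
  qed
  finally show ?thesis using assms by (simp add: add_increasing)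
qed

text \<open>The mass is tested with cutoffs of balls of radius \<rho>. The q-integral over a small
  ball tends to 0 for every fixed s, and the other Young term is merely bounded; letting s grow
  after \<rho> has been sent to 0 removes it. Boundedness is enough, which is why the critical
  exponent is included.\<close>

lemma mass_zero:
  assumes qc: "q \<ge> q_crit (real DIM('a)) p"
  shows "mass = 0"
proof -
  let ?N = "real DIM('a)" and ?m = "q / (q + 1 - p)" and ?\<kappa> = "(p - 1) / (q + 1 - p)"
  have N: "?N \<ge> 2" using dim2 by simp
  have m0: "q + 1 - p > 0" "?m > 0" "?\<kappa> > 0" using q p by auto
  \<comment> \<open>This is where q_c enters: q / (q + 1 - p) <= N is a rearrangement of N (p - 1)
    <= q (N - 1).\<close>
  have mN: "?m \<le> ?N"
  proof -
    have "?N * (p - 1) \<le> q * (?N - 1)" using qc N by (simp add: q_crit_def pos_divide_le_eq)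
    then have "q \<le> ?N * (q + 1 - p)" by (simp add: algebra_simps)
    then show ?thesis using m0 by (simp add: pos_divide_le_eq)
  qed
  define \<omega> where "\<omega> = unit_ball_vol ?N"
  define C where "C = 11 powr ?m * \<omega>"
  let ?g = "\<lambda>x. indicator (cball 0 (R0 / 2)) x * norm (dv x) powr q"
  have ig: "integrable lborel ?g" by (rule integrable_powr_q) (use R0 in auto)
  have est: "mass \<le> s * (LINT x|lborel. indicator (cball 0 \<rho>) x * ?g x) + s powr (- ?\<kappa>) * C"
    if s: "s > 0" and \<rho>: "0 < \<rho>" "\<rho> \<le> R0 / 2" for s \<rho>
  proof -
    let ?z = "ball_cut (\<rho> / 2) \<rho> :: 'a \<Rightarrow> real" and ?dz = "dball_cut (\<rho> / 2) \<rho> :: 'a \<Rightarrow> 'a"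
    have rr: "0 \<le> \<rho> / 2" "\<rho> / 2 < \<rho>" using \<rho> by auto
    note z = ball_cut[where 'a='a, OF rr]
    have t: "C1_test (ball 0 R0) ?z ?dz" by (rule z(1)) (use \<rho> R0 in auto)
    \<comment> \<open>With inner radius \<rho> / 2 the general bound is (32 / 3) / \<rho>, and 11
      rounds it up.\<close>
    have dz: "norm (?dz x) \<le> 11 / \<rho>" for x
    proof -
      have "8 * \<rho> / (\<rho>\<^sup>2 - (\<rho> / 2)\<^sup>2) = (32 / 3) / \<rho>" using \<rho> by (simp add: power2_eq_square field_simps)
      also have "\<dots> \<le> 11 / \<rho>" using \<rho> by (intro divide_right_mono) auto
      finally show ?thesis using z(8)[of x] by linarith
    qed
    have "mass = defect ?z ?dz" using defect_eq[OF t] z(4)[of 0] \<rho> by simp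
    also have "\<dots> \<le> (LINT x|lborel. p_field p (dv x) \<bullet> ?dz x)"
      unfolding defect_def using z(2) by (simp add: Bochner_Integration.integral_nonneg)
    also have "\<dots> \<le> (LINT x|lborel. s * (indicator (cball 0 \<rho>) x * ?g x) + s powr (- ?\<kappa>) * ((11 / \<rho>) powr ?m * indicator (cball 0 \<rho>) x))"
    proof (rule integral_mono[OF flux_integrable(1)[OF t]])
      have [measurable]: "cball (0::'a) r \<in> sets borel" for r by simp
      have i1: "integrable lborel (\<lambda>x. indicator (cball 0 \<rho>) x * ?g x)"
        by (rule integrable_by_bound[OF ig]) (measurable, auto split: split_indicator)
      have i2: "integrable lborel (indicator (cball (0::'a) \<rho>) :: 'a \<Rightarrow> real)"
        using emeasure_compact_finite[of "cball (0::'a) \<rho>"] by (intro integrable_real_indicator) auto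
      show "integrable lborel (\<lambda>x. s * (indicator (cball 0 \<rho>) x * ?g x) + s powr (- ?\<kappa>) * ((11 / \<rho>) powr ?m * indicator (cball 0 \<rho>) x))"
        by (intro Bochner_Integration.integrable_add integrable_mult_right i1 i2)
      fix x :: 'a
      show "p_field p (dv x) \<bullet> ?dz x \<le> s * (indicator (cball 0 \<rho>) x * ?g x) + s powr (- ?\<kappa>) * ((11 / \<rho>) powr ?m * indicator (cball 0 \<rho>) x)"
      proof (cases "norm x \<le> \<rho>")
        case True
        have "p_field p (dv x) \<bullet> ?dz x \<le> norm (dv x) powr (p - 1) * norm (?dz x)"
          using norm_cauchy_schwarz[of "p_field p (dv x)" "?dz x"] by (simp only: norm_p_field)
        also have "\<dots> \<le> norm (dv x) powr (p - 1) * (11 / \<rho>)" by (intro mult_left_mono dz) simp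
        also have "\<dots> \<le> s * norm (dv x) powr q + s powr (- ?\<kappa>) * (11 / \<rho>) powr ?m"
          by (rule young_absorb) (use s \<rho> in auto)
        finally show ?thesis using True \<rho> by simp
      next
        case False
        then show ?thesis using z(7)[of x] by simp
      qed
    qed
    also have "\<dots> = s * (LINT x|lborel. indicator (cball 0 \<rho>) x * ?g x) + s powr (- ?\<kappa>) * ((11 / \<rho>) powr ?m * measure lborel (cball (0::'a) \<rho>))"
    proof -
      have [measurable]: "cball (0::'a) r \<in> sets borel" for r by simp
      have i1: "integrable lborel (\<lambda>x. indicator (cball 0 \<rho>) x * ?g x)"
        by (rule integrable_by_bound[OF ig]) (measurable, auto split: split_indicator)
      have i2: "integrable lborel (indicator (cball (0::'a) \<rho>) :: 'a \<Rightarrow> real)"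
        using emeasure_compact_finite[of "cball (0::'a) \<rho>"] by (intro integrable_real_indicator) auto
      show ?thesis
        using Bochner_Integration.integral_add[OF integrable_mult_right[OF i1, of s] integrable_mult_right[OF integrable_mult_right[OF i2], of "s powr (- ?\<kappa>)" "(11 / \<rho>) powr ?m"]]
        by simp
    qed
    also have "(11 / \<rho>) powr ?m * measure lborel (cball (0::'a) \<rho>) \<le> C"
    proof -
      have "measure lborel (cball (0::'a) \<rho>) = \<rho> ^ DIM('a) * \<omega>"
        using \<rho> by (simp add: \<omega>_def content_cball mult.commute)
      also have "\<rho> ^ DIM('a) = \<rho> powr ?N" using \<rho> by (simp add: powr_realpow)
      finally have "(11 / \<rho>) powr ?m * measure lborel (cball (0::'a) \<rho>) = (11 powr ?m * \<omega>) * (\<rho> powr (?N - ?m))"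
        using \<rho> by (simp add: powr_divide powr_diff)
      also have "\<rho> powr (?N - ?m) \<le> 1" using \<rho> R0 mN by (intro powr_le1) auto
      finally show ?thesis using mult_left_mono[of "\<rho> powr (?N - ?m)" 1 "11 powr ?m * \<omega>"] by (simp add: C_def \<omega>_def)
    qed
    then have "s powr (- ?\<kappa>) * ((11 / \<rho>) powr ?m * measure lborel (cball (0::'a) \<rho>)) \<le> s powr (- ?\<kappa>) * C"
      by (intro mult_left_mono) auto
    finally show ?thesis by linarith
  qed
  \<comment> \<open>The radius tends to 0 at fixed s. Afterwards s = e^(-1 / \<kappa>) turns the
    remaining coefficient into the arbitrary e.\<close>
  have est2: "mass \<le> s powr (- ?\<kappa>) * C" if s: "s > 0" for s
  proof -
    have "(\<lambda>n. s * (LINT x|lborel. indicator (cball 0 (inverse (real (Suc n)))) x * ?g x) + s powr (- ?\<kappa>) * C) \<longlonglongrightarrow> s * 0 + s powr (- ?\<kappa>) * C"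
      by (intro tendsto_add tendsto_mult tendsto_const integral_small_balls ig)
    moreover have "\<forall>\<^sub>F n in sequentially. mass \<le> s * (LINT x|lborel. indicator (cball 0 (inverse (real (Suc n)))) x * ?g x) + s powr (- ?\<kappa>) * C"
    proof -
      have "\<forall>\<^sub>F n in sequentially. inverse (real (Suc n)) < R0 / 2"
        using R0 by (intro order_tendstoD[OF LIMSEQ_inverse_real_of_nat]) auto
      then show ?thesis by eventually_elim (rule est[OF s], auto)
    qed
    ultimately have "mass \<le> s * 0 + s powr (- ?\<kappa>) * C"
      by (rule tendsto_lowerbound) simp
    then show ?thesis by simp
  qed
  show ?thesis
  proof (rule eq_zero_if_le_mult_eps[of _ C])
    fix e :: real assume e: "e > 0"
    have "(e powr (- 1 / k)) powr (- k) = e" if "k > 0" for k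
      using that e by (simp add: powr_powr)
    from this[OF m0(3)] show "\<bar>mass\<bar> \<le> e * C" using est2[of "e powr (- 1 / ?\<kappa>)"] e mass_nonneg by simp
  qed
qed

end

subsection \<open>Comparison with \<open>p\<close>-harmonic functions\<close>

lemma p_field_scale_signed: "b \<noteq> 0 \<Longrightarrow> p_field p (b *\<^sub>R \<xi>) = (\<bar>b\<bar> powr (p - 2) * b) *\<^sub>R p_field p \<xi>"
  by (simp add: p_field_def powr_mult mult_ac)

lemma mu_unbounded_near_0:
  fixes dim :: "'a::euclidean_space itself"
  assumes "1 < p" "p \<le> real DIM('a)" "d > 0"
  obtains \<rho> where "0 < \<rho>" "\<rho> < d" "\<And>x::'a. norm x = \<rho> \<Longrightarrow> mu p x \<ge> T"
proof -
  have "\<forall>\<^sub>F x::'a in at 0. mu p x \<ge> T" using mu_tendsto[OF assms(1,2)] by (simp add: filterlim_at_top)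
  then obtain \<rho> where \<rho>: "\<rho> > 0" "\<And>x::'a. x \<noteq> 0 \<Longrightarrow> norm x < \<rho> \<Longrightarrow> mu p x \<ge> T"
    unfolding eventually_at by auto
  have m: "0 < min \<rho> d / 2" "min \<rho> d / 2 < d" "min \<rho> d / 2 < \<rho>" using \<rho>(1) assms(3) by (auto simp: min_def)
  show ?thesis
  proof (rule that[OF m(1,2)])
    fix x :: 'a assume "norm x = min \<rho> d / 2"
    with m show "mu p x \<ge> T" by (intro \<rho>(2)) auto
  qed
qed

context hj_solution
begin

text \<open>The function \<alpha> + b \<mu> is p-harmonic away from 0 and v is a supersolution, so
  the excess of the former over v is tested with its own squared positive part. Both signs of b are
  allowed: min_principle needs a negative one and the limit argument a positive one.\<close>

lemma harmonic_lower_bound: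
  assumes r: "0 < r1" "r1 < r2" "r2 \<le> R0" and b: "b \<noteq> 0"
    and bd: "\<And>x. norm x = r1 \<or> norm x = r2 \<Longrightarrow> \<alpha> + b * mu p x \<le> v x"
    and x: "r1 \<le> norm x" "norm x \<le> r2"
  shows "\<alpha> + b * mu p x \<le> v x"
proof (rule ccontr)
  assume neg: "\<not> ?thesis"
  \<comment> \<open>Half of the assumed violation. Lowering the comparison function by k makes it
    strictly smaller than v on both spheres, so the test function has compact support, while an
    excess of exactly k survives at x.\<close>
  define k where "k = (\<alpha> + b * mu p x - v x) / 2"
  have k: "k > 0" "\<alpha> + b * mu p x - v x - k = k" using neg by (auto simp: k_def field_simps)
  let ?h = "\<lambda>y. \<alpha> + b * mu p y - v y - k" and ?dh = "\<lambda>y. b *\<^sub>R dmu p y - dv y"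
  define S where "S = ball 0 r2 - cball (0::'a) r1"
  define C where "C = cball 0 r2 - ball (0::'a) r1"
  have S: "open S" "S \<subseteq> C" "C \<subseteq> U" "0 \<notin> C"
    unfolding S_def C_def using ball_subset[OF r(3)] r by (auto simp: open_Diff)
  have cC: "compact C" unfolding C_def by (simp add: compact_diff)
  have ch: "continuous_on C ?h"
    by (intro continuous_intros continuous_on_mu[OF S(4)] continuous_on_subset[OF cont_v S(3)])
  define K where "K = C \<inter> ?h -` {0..}"
  have "closed K" unfolding K_def by (rule continuous_closed_preimage[OF ch compact_imp_closed[OF cC] closed_atLeast])
  then have K: "compact K" using compact_Int_closed[OF cC, of K] by (simp add: K_def Int_absorb1 inf.left_idem)
  have KS: "K \<subseteq> S"
  proof
    fix y assume y: "y \<in> K"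
    then have "?h y \<ge> 0" "y \<in> C" by (auto simp: K_def)
    then have "norm y \<noteq> r1" "norm y \<noteq> r2" using bd[of y] k(1) by force+
    then show "y \<in> S" using \<open>y \<in> C\<close> by (auto simp: S_def C_def)
  qed
  define \<phi> where "\<phi> y = (if y \<in> S then (max 0 (?h y))\<^sup>2 else 0)" for y
  define d\<phi> where "d\<phi> y = (if y \<in> S then (2 * max 0 (?h y)) *\<^sub>R ?dh y else 0)" for y
  have gh: "GDERIV ?h y :> ?dh y" if "y \<in> S" for y
  proof -
    have y: "y \<in> U" "y \<noteq> 0" using that S by auto
    have "GDERIV ?h y :> (0 + (b *\<^sub>R dmu p y + mu p y *\<^sub>R 0)) - dv y - 0"
      by (intro GDERIV_diff GDERIV_add GDERIV_mult GDERIV_const gderiv_mu p gd y)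
    then show ?thesis by simp
  qed
  have t: "C1_test S \<phi> d\<phi>"
  proof (rule C1_testI[OF S(1) K KS])
    show "GDERIV \<phi> y :> d\<phi> y" if "y \<in> S" for y
      by (rule gderiv_transform[OF _ S(1) that, of "\<lambda>y. (max 0 (?h y))\<^sup>2"])
        (use gderiv_pos_sq[OF gh[OF that]] that in \<open>auto simp: \<phi>_def d\<phi>_def\<close>)
    have "continuous_on S (\<lambda>y. (2 * max 0 (?h y)) *\<^sub>R ?dh y)"
      by (intro continuous_intros continuous_on_subset[OF ch S(2)] continuous_on_dmu continuous_on_subset[OF cont] continuous_on_mu continuous_on_subset[OF cont_v]) (use S in auto)
    then show "continuous_on S d\<phi>" by (rule continuous_on_eq) (simp add: d\<phi>_def)
    show "\<phi> y = 0" if "y \<notin> K" for y using that S(2) by (auto simp: \<phi>_def K_def max_def)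
    show "d\<phi> y = 0" if "y \<notin> S" for y using that by (simp add: d\<phi>_def)
  qed
  have tU: "C1_test U \<phi> d\<phi>" by (rule C1_test_mono[OF t]) (use S in auto)
  let ?F = "\<lambda>y. p_field p (b *\<^sub>R dmu p y)"
  have F: "?F y = (- (\<bar>b\<bar> powr (p - 2) * b)) *\<^sub>R radial_field y" for y :: 'a
    using p_field_scale_signed[OF b, of p "dmu p y"] by (simp add: p_field_dmu p)
  \<comment> \<open>The support stays away from the origin, so the flux of the comparison function
    contributes nothing.\<close>
  have "\<phi> 0 = 0" using S by (auto simp: \<phi>_def)
  then have F0: "(LINT y|lborel. ?F y \<bullet> d\<phi> y) = 0" and iF: "integrable lborel (\<lambda>y. ?F y \<bullet> d\<phi> y)"
    unfolding F using radial_flux[OF t] by simp_all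
  let ?G = "\<lambda>y. (?F y - p_field p (dv y)) \<bullet> d\<phi> y + norm (dv y) powr q * \<phi> y"
  have i1: "integrable lborel (\<lambda>y. p_field p (dv y) \<bullet> d\<phi> y)" by (rule C1_test_integrable(1)[OF tU cont_flux])
  have i2: "integrable lborel (\<lambda>y. norm (dv y) powr q * \<phi> y)"
    by (rule C1_test_integrable(2)[OF tU cont_powr]) (use p q in auto)
  have iG: "integrable lborel ?G"
    unfolding inner_diff_left by (intro Bochner_Integration.integrable_add Bochner_Integration.integrable_diff iF i1 i2)
  have "integral\<^sup>L lborel ?G = 0"
    unfolding inner_diff_left
    by (simp add: Bochner_Integration.integral_add Bochner_Integration.integral_diff iF i1 i2 F0 weak[OF tU])
  moreover have nn: "?G y \<ge> 0" for y
  proof (cases "y \<in> S")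
    case True
    have "(?F y - p_field p (dv y)) \<bullet> ?dh y \<ge> 0" using p by (intro p_field_monotone_nonneg) simp
    then show ?thesis using True by (simp add: \<phi>_def d\<phi>_def)
  qed (simp add: \<phi>_def d\<phi>_def)
  moreover have xS: "x \<in> S"
  proof -
    have "norm x \<noteq> r1" "norm x \<noteq> r2" using bd[of x] neg by auto
    then show ?thesis using x by (auto simp: S_def)
  qed
  moreover have "continuous_on S ?G"
    by (intro continuous_intros continuous_on_p_field p continuous_on_dmu C1_testD[OF t] continuous_on_subset[OF cont_flux] continuous_on_subset[OF cont_powr] continuous_on_subset[OF cont])
      (use S p q in auto)
  \<comment> \<open>Both summands of the integrand are nonnegative and so vanish at x. The q-term
    gives \<nabla>v(x) = 0, whereupon the monotonicity term gives b \<nabla>\<mu>(x) = 0, which is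
    impossible.\<close>
  ultimately have "?G x = 0" by (intro continuous_integral_zero[OF iG nn _ S(1)]) auto
  moreover have G: "?G x = 2 * k * ((?F x - p_field p (dv x)) \<bullet> ?dh x) + norm (dv x) powr q * k\<^sup>2"
  proof -
    have mh: "max 0 (?h x) = k" using k by simp
    have "\<phi> x = k\<^sup>2" "d\<phi> x = (2 * k) *\<^sub>R ?dh x" unfolding \<phi>_def d\<phi>_def by (simp_all only: xS if_True mh)
    then show ?thesis by simp
  qed
  moreover have "(?F x - p_field p (dv x)) \<bullet> ?dh x \<ge> 0" using p by (intro p_field_monotone_nonneg) simp
  ultimately have "norm (dv x) powr q * k\<^sup>2 \<le> 0" "2 * k * ((?F x - p_field p (dv x)) \<bullet> ?dh x) \<le> 0"
    using k(1) by (smt (verit) mult_nonneg_nonneg powr_ge_zero zero_le_power2)+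
  then have dv0: "dv x = 0" using k(1) by (auto simp: mult_le_0_iff)
  then have "p_field p (b *\<^sub>R dmu p x) \<bullet> (b *\<^sub>R dmu p x) \<le> 0"
    using \<open>2 * k * ((?F x - p_field p (dv x)) \<bullet> ?dh x) \<le> 0\<close> k(1) by (simp add: mult_le_0_iff p_field_def)
  then have "norm (b *\<^sub>R dmu p x) powr p \<le> 0" by (simp only: p_field_inner_self)
  moreover have "b *\<^sub>R dmu p x \<noteq> 0"
  proof -
    have "x \<noteq> 0" using xS S by auto
    then have "norm (dmu p x) \<noteq> 0" unfolding norm_dmu by simp
    then show ?thesis using b by simp
  qed
  ultimately show False by simp
qed

definition vmin :: "real \<Rightarrow> real" where "vmin r = Inf (v ` sphere 0 r)"
definition vmax :: "real \<Rightarrow> real" where "vmax r = Sup (v ` sphere 0 r)"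

lemma sphere_extrema:
  assumes r: "0 < r" "r \<le> R0"
  shows vmin_le: "norm x = r \<Longrightarrow> vmin r \<le> v x" and vmax_ge: "norm x = r \<Longrightarrow> v x \<le> vmax r"
    and vmin_attained: "\<exists>x. norm x = r \<and> v x = vmin r" and vmin_pos: "vmin r > 0"
proof -
  have ne: "sphere (0::'a) r \<noteq> {}" using r by simp
  have sub: "sphere 0 r \<subseteq> U" using ball_subset[OF r(2)] r by auto
  have c: "compact (v ` sphere 0 r)"
    by (intro compact_continuous_image continuous_on_subset[OF cont_v sub] compact_sphere)
  then have bb: "bdd_below (v ` sphere 0 r)" "bdd_above (v ` sphere 0 r)"
    by (auto intro: bounded_imp_bdd_below bounded_imp_bdd_above compact_imp_bounded)
  show "norm x = r \<Longrightarrow> vmin r \<le> v x" unfolding vmin_def by (rule cInf_lower[OF _ bb(1)]) auto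
  show "norm x = r \<Longrightarrow> v x \<le> vmax r" unfolding vmax_def by (rule cSup_upper[OF _ bb(2)]) auto
  have "vmin r \<in> v ` sphere 0 r"
    unfolding vmin_def by (rule closed_contains_Inf[OF _ bb(1) compact_imp_closed[OF c]]) (use ne in auto)
  then show ex: "\<exists>x. norm x = r \<and> v x = vmin r" by auto
  then obtain x where "norm x = r" "v x = vmin r" by blast
  moreover from this have "x \<in> U" using subsetD[OF sub, of x] by simp
  ultimately show "vmin r > 0" using pos[of x] by simp
qed

definition mur :: "real \<Rightarrow> real" where "mur r = mu p (r *\<^sub>R (SOME b::'a. b \<in> Basis))"

lemma mur: "mu p (x::'a) = mur (norm x)"
proof -
  have "(SOME b::'a. b \<in> Basis) \<in> Basis" using nonempty_Basis by (simp add: some_in_eq)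
  then have "norm (SOME b::'a. b \<in> Basis) = 1" by simp
  then show ?thesis unfolding mur_def by (intro mu_radial) simp
qed

lemma mur_less: "0 < r \<Longrightarrow> r < s \<Longrightarrow> mur s < mur r"
proof -
  assume rs: "0 < r" "r < s"
  obtain b :: 'a where b: "b \<in> Basis" using nonempty_Basis by blast
  have "norm (r *\<^sub>R b) = r" "norm (s *\<^sub>R b) = s" using b rs by auto
  then show ?thesis using mu_less[OF p, of "r *\<^sub>R b" "s *\<^sub>R b"] mur[of "r *\<^sub>R b"] mur[of "s *\<^sub>R b"] rs by simp
qed

text \<open>The comparison function is vmin(r) - \<epsilon> (\<mu> - \<mu>(r)): it equals vmin(r) on
  the outer sphere and is negative near the origin, where v >= 0 is all that is known. Letting
  \<epsilon> tend to 0 shows that the singularity cannot lower v.\<close>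

lemma min_principle:
  assumes r: "r \<le> R0" and x: "0 < norm x" "norm x \<le> r"
  shows "vmin r \<le> v x"
proof (cases "norm x = r")
  case True
  then show ?thesis using vmin_le[of r x] r x by simp
next
  case False
  have r0: "0 < r" using x by linarith
  have main: "vmin r - v x \<le> \<epsilon> * (mu p x - mur r)" if \<epsilon>: "\<epsilon> > 0" for \<epsilon>
  proof -
    \<comment> \<open>On this inner sphere \<epsilon> \<mu> is so large that the comparison function
      is at most 0.\<close>
    obtain \<rho> where \<rho>: "0 < \<rho>" "\<rho> < norm x" "\<And>x::'a. norm x = \<rho> \<Longrightarrow> mu p x \<ge> mur r + vmin r / \<epsilon>"
      using mu_unbounded_near_0[OF p x(1)] by blast
    have "vmin r + \<epsilon> * mur r + (- \<epsilon>) * mu p x \<le> v x"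
    proof (rule harmonic_lower_bound[OF \<rho>(1) _ r])
      fix y :: 'a assume "norm y = \<rho> \<or> norm y = r"
      then show "vmin r + \<epsilon> * mur r + - \<epsilon> * mu p y \<le> v y"
      proof
        assume "norm y = \<rho>"
        then have "\<epsilon> * (mur r + vmin r / \<epsilon>) \<le> \<epsilon> * mu p y" using \<rho>(3) \<epsilon> by (intro mult_left_mono) auto
        moreover have "\<epsilon> * (mur r + vmin r / \<epsilon>) = \<epsilon> * mur r + vmin r" using \<epsilon> by (simp add: field_simps)
        ultimately show ?thesis using v_nonneg[of y] by linarith
      next
        assume "norm y = r"
        then show ?thesis using vmin_le[OF r0 r] mur[of y] by simp
      qed
    qed (use \<rho> x \<epsilon> False in auto)
    then show ?thesis by (simp add: algebra_simps)
  qed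
  show ?thesis
  proof (rule ccontr)
    assume "\<not> ?thesis"
    then have d: "vmin r - v x > 0" by simp
    have m: "mu p x - mur r > 0" using mur_less[of "norm x" r] mur[of x] x False by simp
    have "vmin r - v x \<le> (vmin r - v x) / (2 * (mu p x - mur r)) * (mu p x - mur r)"
      using d m by (intro main) auto
    also have "\<dots> = (vmin r - v x) / 2"
    proof -
      have "a / (2 * M) * M = a / 2" if "M > 0" for a M :: real using that by simp
      from this[OF m] show ?thesis .
    qed
    finally show False using d by simp
  qed
qed

end

subsection \<open>Reflections\<close>

text \<open>No determinant is computed. The integral is multiplied by the volume of the unit ball,
  written as an integral of its indicator g at \<open>T x + y\<close>; Fubini's theorem, translation
  invariance and g(T x) = g(x) then move T away from \<open>f\<close>.\<close>

lemma nn_integral_linear_reflection: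
  fixes T :: "'a::euclidean_space \<Rightarrow> 'a"
  assumes lin: "linear T" and nT: "\<And>x. norm (T x) = norm x" and TT: "\<And>x. T (T x) = x"
    and [measurable]: "f \<in> borel_measurable borel"
  shows "(\<integral>\<^sup>+x. f (T x) \<partial>lborel) = (\<integral>\<^sup>+x. f x \<partial>lborel)"
proof -
  have cT: "continuous_on UNIV T" by (rule linear_continuous_on[OF lin[unfolded linear_conv_bounded_linear]])
  have [measurable]: "T \<in> borel_measurable borel" by (rule borel_measurable_continuous_onI[OF cT])
  define g :: "'a \<Rightarrow> ennreal" where "g = indicator (ball 0 1)"
  have [measurable]: "ball (0::'a) 1 \<in> sets borel" by simp
  have [measurable]: "g \<in> borel_measurable borel" unfolding g_def by measurable
  have gT: "g (T x) = g x" for x by (simp add: g_def indicator_def nT)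
  have trans: "(\<integral>\<^sup>+y. h (c + y) \<partial>lborel) = (\<integral>\<^sup>+y. h y \<partial>lborel)" if [measurable]: "h \<in> borel_measurable borel" for h :: "'a \<Rightarrow> ennreal" and c
  proof -
    have "(\<integral>\<^sup>+y. h y \<partial>distr lborel borel ((+) c)) = (\<integral>\<^sup>+y. h (c + y) \<partial>lborel)"
      by (rule nn_integral_distr) auto
    then show ?thesis by (simp add: lborel_distr_plus)
  qed
  have refl: "(\<integral>\<^sup>+y. h (c - y) \<partial>lborel) = (\<integral>\<^sup>+y. h y \<partial>lborel)" if [measurable]: "h \<in> borel_measurable borel" for h :: "'a \<Rightarrow> ennreal" and c
  proof -
    have "lborel = distr lborel borel (\<lambda>y::'a. c - y)"
      using lborel_affine[of "-1" c] by (simp add: density_1)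
    then have "(\<integral>\<^sup>+y. h y \<partial>lborel) = (\<integral>\<^sup>+y. h y \<partial>distr lborel borel (\<lambda>y::'a. c - y))" by simp
    also have "\<dots> = (\<integral>\<^sup>+y. h (c - y) \<partial>lborel)" by (rule nn_integral_distr) auto
    finally show ?thesis by simp
  qed
  let ?\<omega> = "\<integral>\<^sup>+y. g y \<partial>lborel"
  have "(\<integral>\<^sup>+x. f (T x) \<partial>lborel) * ?\<omega> = (\<integral>\<^sup>+x. f (T x) * ?\<omega> \<partial>lborel)" by (simp add: nn_integral_multc)
  also have "\<dots> = (\<integral>\<^sup>+x. (\<integral>\<^sup>+y. f (T x) * g (T x + y) \<partial>lborel) \<partial>lborel)"
    by (simp add: nn_integral_cmult trans)
  also have "\<dots> = (\<integral>\<^sup>+y. (\<integral>\<^sup>+x. f (T x) * g (T x + y) \<partial>lborel) \<partial>lborel)"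
    by (rule lborel_pair.Fubini'[symmetric]) measurable
  \<comment> \<open>Translation of x by -T y; since T is an involution, T (x - T y) = T x - y, and
    the shift passes from g to f.\<close>
  also have "\<dots> = (\<integral>\<^sup>+y. (\<integral>\<^sup>+x. f (T x - y) * g (T x) \<partial>lborel) \<partial>lborel)"
  proof (rule nn_integral_cong)
    fix y
    have "(\<integral>\<^sup>+x. f (T x) * g (T x + y) \<partial>lborel) = (\<integral>\<^sup>+x. f (T (- T y + x)) * g (T (- T y + x) + y) \<partial>lborel)"
      using trans[of "\<lambda>x. f (T x) * g (T x + y)" "- T y"] by simp
    also have "\<dots> = (\<integral>\<^sup>+x. f (T x - y) * g (T x) \<partial>lborel)"
      by (simp add: linear_diff[OF lin] TT)
    finally show "(\<integral>\<^sup>+x. f (T x) * g (T x + y) \<partial>lborel) = (\<integral>\<^sup>+x. f (T x - y) * g (T x) \<partial>lborel)" .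
  qed
  also have "\<dots> = (\<integral>\<^sup>+x. (\<integral>\<^sup>+y. f (T x - y) * g (T x) \<partial>lborel) \<partial>lborel)"
    by (rule lborel_pair.Fubini') measurable
  also have "\<dots> = (\<integral>\<^sup>+x. f x \<partial>lborel) * ?\<omega>"
    by (simp add: nn_integral_multc refl gT nn_integral_cmult)
  finally have eq: "(\<integral>\<^sup>+x. f (T x) \<partial>lborel) * ?\<omega> = (\<integral>\<^sup>+x. f x \<partial>lborel) * ?\<omega>" .
  have w: "?\<omega> = emeasure lborel (ball (0::'a) 1)" unfolding g_def by simp
  have "?\<omega> < \<infinity>" unfolding w by (rule emeasure_lborel_ball_finite)
  moreover have "?\<omega> \<noteq> 0"
  proof
    assume "?\<omega> = 0"
    then have "measure lborel (ball (0::'a) 1) = 0" unfolding w by (simp add: measure_def)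
    then show False using content_ball_gt_0_iff[of "0::'a" 1] by simp
  qed
  ultimately have "a * ?\<omega> / ?\<omega> = a" for a
    by (intro mult_divide_eq_ennreal) (auto simp: less_top)
  then show ?thesis using eq by metis
qed

lemma distr_reflection:
  fixes T :: "'a::euclidean_space \<Rightarrow> 'a"
  assumes lin: "linear T" and nT: "\<And>x. norm (T x) = norm x" and TT: "\<And>x. T (T x) = x"
  shows "distr lborel borel (\<lambda>x. c + T x) = lborel"
proof (rule measure_eqI)
  have cT: "continuous_on UNIV T" by (rule linear_continuous_on[OF lin[unfolded linear_conv_bounded_linear]])
  have [measurable]: "T \<in> borel_measurable borel" by (rule borel_measurable_continuous_onI[OF cT])
  fix A assume "A \<in> sets (distr lborel borel (\<lambda>x. c + T x))"
  then have [measurable]: "A \<in> sets borel" by simp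
  have "emeasure (distr lborel borel (\<lambda>x. c + T x)) A = (\<integral>\<^sup>+y. indicator A y \<partial>distr lborel borel (\<lambda>x. c + T x))" by simp
  also have "\<dots> = (\<integral>\<^sup>+x. indicator A (c + T x) \<partial>lborel)" by (rule nn_integral_distr) auto
  also have "\<dots> = (\<integral>\<^sup>+x. indicator A (c + x) \<partial>lborel)"
    by (rule nn_integral_linear_reflection[OF lin nT TT, of "\<lambda>x. indicator A (c + x)"]) measurable
  also have "\<dots> = (\<integral>\<^sup>+y. indicator A y \<partial>distr lborel borel ((+) c))" by (rule nn_integral_distr[symmetric]) auto
  also have "\<dots> = emeasure lborel A" by (simp add: lborel_distr_plus)
  finally show "emeasure (distr lborel borel (\<lambda>x. c + T x)) A = emeasure lborel A" .
qed simp

text \<open>For a unit vector \<open>e\<close> this is the reflection in the hyperplane z . e =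
  \<tau>; \<open>rlin e\<close> is its linear part, which acts on gradients.\<close>

definition refl :: "'a::euclidean_space \<Rightarrow> real \<Rightarrow> 'a \<Rightarrow> 'a" where
  "refl e \<tau> x = x - (2 * (x \<bullet> e - \<tau>)) *\<^sub>R e"
definition rlin :: "'a::euclidean_space \<Rightarrow> 'a \<Rightarrow> 'a" where
  "rlin e \<xi> = \<xi> - (2 * (\<xi> \<bullet> e)) *\<^sub>R e"

lemma refl_rlin: "refl e \<tau> x = (2 * \<tau>) *\<^sub>R e + rlin e x"
  by (simp add: refl_def rlin_def algebra_simps)

lemma rlin_linear: "linear (rlin e)"
  by (rule linearI) (simp_all add: rlin_def algebra_simps)

lemma rlin_inner: "rlin e x \<bullet> y = x \<bullet> rlin e y"
  by (simp add: rlin_def inner_diff_left inner_diff_right inner_commute)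

lemma rlin_rlin: "norm e = 1 \<Longrightarrow> rlin e (rlin e x) = x"
  by (simp add: rlin_def inner_diff_left algebra_simps dot_square_norm)

lemma norm_rlin: "norm e = 1 \<Longrightarrow> norm (rlin e x) = norm x"
  unfolding norm_eq by (simp add: rlin_inner rlin_rlin)

lemma p_field_rlin: "norm e = 1 \<Longrightarrow> p_field p (rlin e x) = rlin e (p_field p x)"
  by (simp add: p_field_def norm_rlin linear_cmul[OF rlin_linear])

lemma refl_refl: "norm e = 1 \<Longrightarrow> refl e \<tau> (refl e \<tau> x) = x"
  by (simp add: refl_def inner_diff_left dot_square_norm algebra_simps)

lemma refl_inner: "norm e = 1 \<Longrightarrow> refl e \<tau> x \<bullet> e = 2 * \<tau> - x \<bullet> e"
  by (simp add: refl_def inner_diff_left dot_square_norm)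

text \<open>The sign of \<tau> (\<tau> - x . e) decides which of two mirror points is closer to the
  origin: for \<tau> > 0 it is the one with x . e < \<tau>.\<close>

lemma norm_refl:
  assumes "norm e = 1"
  shows "(norm (refl e \<tau> x))\<^sup>2 = (norm x)\<^sup>2 + 4 * \<tau> * (\<tau> - x \<bullet> e)"
proof -
  have ee: "e \<bullet> e = 1" using assms by (simp add: dot_square_norm)
  have "(x - d *\<^sub>R e) \<bullet> (x - d *\<^sub>R e) = x \<bullet> x - 2 * d * (x \<bullet> e) + d\<^sup>2 * (e \<bullet> e)" for d
    by (simp add: inner_diff_left inner_diff_right inner_commute power2_eq_square)
  from this[of "2 * (x \<bullet> e - \<tau>)"] show ?thesis
    unfolding refl_def power2_norm_eq_inner ee by (simp add: power2_eq_square algebra_simps)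
qed

lemma refl_continuous: "continuous_on S (refl e \<tau>)"
  unfolding refl_def[abs_def] by (intro continuous_intros)

lemma rlin_continuous: "continuous_on S (rlin e)"
  unfolding rlin_def[abs_def] by (intro continuous_intros)

lemma gderiv_refl:
  assumes "GDERIV f (refl e \<tau> x) :> D"
  shows "GDERIV (\<lambda>x. f (refl e \<tau> x)) x :> rlin e D"
proof -
  have "(refl e \<tau> has_derivative rlin e) (at x)"
    unfolding refl_def[abs_def] rlin_def[abs_def]
    by (auto intro!: derivative_eq_intros)
  moreover have "(f has_derivative (\<lambda>h. h \<bullet> D)) (at (refl e \<tau> x))" using assms by (simp add: gderiv_def)
  ultimately have "((\<lambda>x. f (refl e \<tau> x)) has_derivative (\<lambda>h. rlin e h \<bullet> D)) (at x)"
    by (rule has_derivative_compose)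
  then show ?thesis by (simp add: gderiv_def rlin_inner)
qed

lemma integral_refl:
  fixes G :: "'a::euclidean_space \<Rightarrow> real"
  assumes e: "norm e = 1" and [measurable]: "G \<in> borel_measurable borel"
  shows "(LINT y|lborel. G (refl e \<tau> y)) = (LINT x|lborel. G x)"
proof -
  have "distr lborel borel (\<lambda>x. (2 * \<tau>) *\<^sub>R e + rlin e x) = lborel"
    by (rule distr_reflection[OF rlin_linear norm_rlin[OF e] rlin_rlin[OF e]])
  then have d: "distr lborel borel (refl e \<tau>) = lborel" by (simp add: refl_rlin[abs_def])
  have [measurable]: "refl e \<tau> \<in> borel_measurable borel"
    by (rule borel_measurable_continuous_onI[OF refl_continuous])
  have "integral\<^sup>L (distr lborel borel (refl e \<tau>)) G = (LINT y|lborel. G (refl e \<tau> y))"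
    by (rule integral_distr) auto
  then show ?thesis unfolding d by simp
qed

text \<open>The pointwise inequality behind strict comparison: where the gradients nearly agree,
  the factor \<open>\<theta> < 1\<close> gives the sign; elsewhere monotonicity does.\<close>

lemma strict_comparison_pointwise:
  assumes p: "1 < p" and q: "0 < q" and \<theta>: "0 < \<theta>" "\<theta> < 1" and m: "0 < m" "m \<le> M"
  obtains c \<epsilon> where "c > 0" "0 < \<epsilon>"
    "\<And>(a::'a::euclidean_space) b h. m \<le> norm a \<Longrightarrow> norm a \<le> M \<Longrightarrow> 0 \<le> h \<Longrightarrow> h \<le> \<epsilon> \<Longrightarrow>
      c * h\<^sup>2 \<le> 2 * h * ((p_field p a - p_field p b) \<bullet> (a - b)) - (\<theta> * norm a powr q - norm b powr q) * h\<^sup>2"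
proof -
  \<comment> \<open>An intermediate value between \<theta> and 1. If |b|^q >= \<theta>1 |a|^q, the
    gap \<theta>1 - \<theta> gives the sign of the q-terms; otherwise |b| <= s |a| with s < 1, and
    monotonicity yields at least \<open>c3\<close>.\<close>
  define \<theta>1 where "\<theta>1 = (1 + \<theta>) / 2"
  have t1: "0 < \<theta>1" "\<theta>1 < 1" "\<theta> < \<theta>1" using \<theta> by (auto simp: \<theta>1_def)
  define s where "s = \<theta>1 powr (1 / q)"
  have s: "0 < s" "s < 1" using t1 q powr_less_mono2[of "1/q" \<theta>1 1] by (auto simp: s_def)
  have sq: "s powr q = \<theta>1" using q t1 by (simp add: s_def powr_powr)
  have sp: "s powr (p - 1) < 1" using s p powr_less_mono2[of "p - 1" s 1] by auto
  define c3 where "c3 = (1 - s powr (p - 1)) * (1 - s) * m powr p"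
  have c3: "c3 > 0" using sp s m by (simp add: c3_def)
  define c where "c = min ((\<theta>1 - \<theta>) * m powr q) c3"
  \<comment> \<open>In the second case the monotone term is linear in h and the harmful term
    quadratic, so a small bound on h lets the former win.\<close>
  define \<epsilon> where "\<epsilon> = min 1 (c3 / (M powr q + 1))"
  have Mq: "M powr q + 1 > 0" by (simp add: add_nonneg_pos)
  have \<epsilon>: "0 < \<epsilon>" "\<epsilon> \<le> 1" "\<epsilon> * (M powr q + 1) \<le> c3"
  proof -
    show "0 < \<epsilon>" "\<epsilon> \<le> 1" using c3 Mq by (auto simp: \<epsilon>_def)
    have "\<epsilon> \<le> c3 / (M powr q + 1)" by (simp add: \<epsilon>_def)
    then show "\<epsilon> * (M powr q + 1) \<le> c3" using Mq by (simp add: pos_le_divide_eq)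
  qed
  have c: "c > 0" using t1 m c3 by (simp add: c_def)
  show ?thesis
  proof (rule that[OF c \<epsilon>(1)])
    fix a b :: 'a and h :: real
    assume a: "m \<le> norm a" "norm a \<le> M" and h: "0 \<le> h" "h \<le> \<epsilon>"
    let ?X = "(p_field p a - p_field p b) \<bullet> (a - b)"
    have X: "?X \<ge> 0" using p by (intro p_field_monotone_nonneg) simp
    show "c * h\<^sup>2 \<le> 2 * h * ?X - (\<theta> * norm a powr q - norm b powr q) * h\<^sup>2"
    proof (cases "\<theta>1 * norm a powr q \<le> norm b powr q")
      case True
      have "c \<le> (\<theta>1 - \<theta>) * m powr q" by (simp add: c_def)
      also have "\<dots> \<le> (\<theta>1 - \<theta>) * norm a powr q" using a m t1 q by (intro mult_left_mono powr_mono2) auto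
      also have "\<dots> \<le> - (\<theta> * norm a powr q - norm b powr q)" using True by (simp add: algebra_simps)
      finally have "c * h\<^sup>2 \<le> - (\<theta> * norm a powr q - norm b powr q) * h\<^sup>2" by (intro mult_right_mono) auto
      moreover have "0 \<le> 2 * h * ?X" using h X by simp
      ultimately show ?thesis by linarith
    next
      case False
      have "norm b \<le> s * norm a"
      proof (rule ccontr)
        assume "\<not> ?thesis"
        then have "(s * norm a) powr q \<le> norm b powr q" using s q by (intro powr_mono2) auto
        then show False using False by (simp add: powr_mult sq)
      qed
      then have "norm b powr (p - 1) \<le> (s * norm a) powr (p - 1)" using p by (intro powr_mono2) auto
      then have d1: "(1 - s powr (p - 1)) * norm a powr (p - 1) \<le> norm a powr (p - 1) - norm b powr (p - 1)"
        by (simp add: powr_mult algebra_simps)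
      have d2: "(1 - s) * norm a \<le> norm a - norm b" using \<open>norm b \<le> s * norm a\<close> by (simp add: algebra_simps)
      have "c3 \<le> (1 - s powr (p - 1)) * (1 - s) * norm a powr p"
        unfolding c3_def using a m sp s p by (intro mult_left_mono powr_mono2) auto
      also have "norm a powr p = norm a powr (p - 1) * norm a" using powr_mult_self[of "norm a" "p - 1"] by simp
      also have "(1 - s powr (p - 1)) * (1 - s) * (norm a powr (p - 1) * norm a) = ((1 - s powr (p - 1)) * norm a powr (p - 1)) * ((1 - s) * norm a)"
        by (simp add: mult_ac)
      also have "\<dots> \<le> (norm a powr (p - 1) - norm b powr (p - 1)) * (norm a - norm b)"
      proof (rule mult_mono[OF d1 d2])
        have "0 \<le> (1 - s powr (p - 1)) * norm a powr (p - 1)" using sp by simp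
        with d1 show "0 \<le> norm a powr (p - 1) - norm b powr (p - 1)" by linarith
        show "0 \<le> (1 - s) * norm a" using s by simp
      qed
      also have "\<dots> \<le> ?X" by (rule p_field_monotone)
      finally have X3: "c3 \<le> ?X" .
      have "\<theta> * norm a powr q * h\<^sup>2 \<le> 1 * M powr q * (\<epsilon> * h)"
      proof (intro mult_mono)
        show "norm a powr q \<le> M powr q" using a q by (intro powr_mono2) auto
        show "h\<^sup>2 \<le> \<epsilon> * h" using h by (simp add: power2_eq_square mult_right_mono)
      qed (use \<theta> h in auto)
      also have "\<dots> \<le> c3 * h"
      proof -
        have "M powr q * \<epsilon> \<le> c3" using \<epsilon>(1,3) by (simp add: algebra_simps)
        from mult_right_mono[OF this h(1)] show ?thesis by (simp add: mult_ac)
      qed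
      finally have b1: "\<theta> * norm a powr q * h\<^sup>2 \<le> c3 * h" .
      have "c * h\<^sup>2 \<le> c3 * h"
      proof -
        have "h\<^sup>2 \<le> 1 * h" unfolding power2_eq_square using h \<epsilon>(2) by (intro mult_right_mono) auto
        then show ?thesis using c3 by (intro mult_mono) (auto simp: c_def)
      qed
      moreover have "2 * h * c3 \<le> 2 * h * ?X" using X3 h by (intro mult_left_mono) auto
      moreover have "0 \<le> norm b powr q * h\<^sup>2" by simp
      moreover have "2 * h * c3 = c3 * h + c3 * h" by simp
      ultimately show ?thesis using b1 unfolding left_diff_distrib by linarith
    qed
  qed
qed

context hj_solution
begin

text \<open>The equation is invariant under reflections: the change of variables preserves Lebesgue
  measure, and the p-flux commutes with linear isometries.\<close>

lemma reflected_weak: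
  assumes e: "norm e = 1" and t: "C1_test S \<phi> d\<phi>" and S: "\<And>y. y \<in> S \<Longrightarrow> refl e \<tau> y \<in> U"
  shows "(LINT y|lborel. p_field p (rlin e (dv (refl e \<tau> y))) \<bullet> d\<phi> y) = (LINT y|lborel. norm (dv (refl e \<tau> y)) powr q * \<phi> y)"
proof -
  let ?T = "refl e \<tau>"
  obtain K where K: "compact K" "K \<subseteq> S" "\<And>x. x \<notin> K \<Longrightarrow> \<phi> x = 0" "\<And>x. x \<notin> K \<Longrightarrow> d\<phi> x = 0"
    using C1_test_support[OF t] by blast
  have t2: "C1_test U (\<lambda>x. \<phi> (?T x)) (\<lambda>x. rlin e (d\<phi> (?T x)))"
    unfolding C1_test_def
  proof (intro conjI allI exI[of _ "?T ` K"] impI)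
    show "GDERIV (\<lambda>x. \<phi> (?T x)) x :> rlin e (d\<phi> (?T x))" for x by (rule gderiv_refl[OF C1_test_gderiv[OF t]])
    show "continuous_on UNIV (\<lambda>x. rlin e (d\<phi> (?T x)))"
      by (rule continuous_on_compose2[OF rlin_continuous[of UNIV] continuous_on_compose2[OF C1_test_cont_grad[OF t, of UNIV] refl_continuous]]) auto
    show "compact (?T ` K)" by (rule compact_continuous_image[OF refl_continuous K(1)])
    show "?T ` K \<subseteq> U" using K(2) S by auto
    have *: "?T x \<notin> K" if "x \<notin> ?T ` K" for x
    proof
      assume "?T x \<in> K"
      then have "?T (?T x) \<in> ?T ` K" by (rule imageI)
      with that show False by (simp add: refl_refl[OF e])
    qed
    show "\<phi> (?T x) = 0" if "x \<notin> ?T ` K" for x by (rule K(3)[OF *[OF that]])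
    show "rlin e (d\<phi> (?T x)) = 0" if "x \<notin> ?T ` K" for x using K(4)[OF *[OF that]] by (simp add: rlin_def)
  qed
  have [measurable]: "?T \<in> borel_measurable borel" "rlin e \<in> borel_measurable borel"
    by (rule borel_measurable_continuous_onI[OF refl_continuous], rule borel_measurable_continuous_onI[OF rlin_continuous])
  have [measurable]: "\<phi> \<in> borel_measurable borel" "d\<phi> \<in> borel_measurable borel"
    using C1_testD[OF t] by (auto intro: borel_measurable_continuous_onI)
  have "(LINT y|lborel. p_field p (rlin e (dv (?T y))) \<bullet> d\<phi> y) = (LINT y|lborel. p_field p (dv (?T y)) \<bullet> rlin e (d\<phi> (?T (?T y))))"
    by (simp add: refl_refl[OF e] p_field_rlin[OF e] rlin_inner)
  also have "\<dots> = (LINT x|lborel. p_field p (dv x) \<bullet> rlin e (d\<phi> (?T x)))"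
    by (rule integral_refl[OF e, of "\<lambda>x. p_field p (dv x) \<bullet> rlin e (d\<phi> (?T x))"]) measurable
  also have "\<dots> = (LINT x|lborel. norm (dv x) powr q * \<phi> (?T x))" by (rule weak[OF t2])
  also have "\<dots> = (LINT y|lborel. norm (dv (?T y)) powr q * \<phi> (?T (?T y)))"
    by (rule integral_refl[OF e, of "\<lambda>x. norm (dv x) powr q * \<phi> (?T x)", symmetric]) measurable
  finally show ?thesis by (simp add: refl_refl[OF e])
qed

text \<open>The argument of \<open>cross_term\<close> with the constant 1 in place of |\<nabla>v|.
  It handles the reflected gradient, which is only known to be bounded.\<close>

lemma deta_L1_tendsto:
  assumes r: "0 < r" "r < 1"
  shows "integrable lborel (\<lambda>x::'a. indicator (cball 0 r) x * norm (deta p (real (Suc k)) x))"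
    and "(\<lambda>k. LINT x::'a|lborel. indicator (cball 0 r) x * norm (deta p (real (Suc k)) x)) \<longlonglongrightarrow> 0"
proof -
  let ?f = "\<lambda>k (x::'a). indicator (cball 0 r) x * norm (deta p (real (Suc k)) x)"
  let ?c = "\<lambda>k (x::'a). indicator (cball 0 r) x * norm (deta p (real (Suc k)) x) powr p"
  let ?E = "indicator (cball (0::'a) r) :: 'a \<Rightarrow> real"
  obtain C where C: "\<And>L. L > 0 \<Longrightarrow> integrable lborel (\<lambda>x::'a. indicator (cball 0 r) x * norm (deta p L x) powr p)"
    "\<And>L. L > 0 \<Longrightarrow> (LINT x::'a|lborel. indicator (cball 0 r) x * norm (deta p L x) powr p) \<le> (2 / L) powr (p - 1) * C"
    using deta_capacity[OF r] by blast
  have ic: "integrable lborel (?c k)" for k by (rule C(1)) simp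
  have iE: "integrable lborel ?E" using emeasure_compact_finite[of "cball (0::'a) r"] by (intro integrable_real_indicator) auto
  show i: "integrable lborel (?f k)" for k
  proof -
    have "continuous_on (cball 0 r) (\<lambda>x::'a. norm (deta p (real (Suc k)) x))"
      by (intro continuous_intros eta_continuous) simp
    from borel_integrable_compact[OF compact_cball this] show ?thesis by simp
  qed
  have pw: "?f k x \<le> ?E x / K + K powr (p - 1) * ?c k x" if K: "K > 0" for K k x
    using young_simple[OF p(1) zero_le_one norm_ge_zero[of "deta p (real (Suc k)) x"] K] by (auto split: split_indicator)
  show "(\<lambda>k. integral\<^sup>L lborel (?f k)) \<longlonglongrightarrow> 0"
  proof (rule tendsto_zero_by_tradeoff)
    show "0 \<le> integral\<^sup>L lborel (?f k)" for k by (rule Bochner_Integration.integral_nonneg) simp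
    show "0 \<le> integral\<^sup>L lborel ?E" by (rule Bochner_Integration.integral_nonneg) simp
    show "(\<lambda>k. integral\<^sup>L lborel (?c k)) \<longlonglongrightarrow> 0" by (rule deta_capacity_tendsto[OF r])
    show "integral\<^sup>L lborel (?f k) \<le> integral\<^sup>L lborel ?E / K + K powr (p - 1) * integral\<^sup>L lborel (?c k)" if "K > 0" for k K
    proof -
      have "integral\<^sup>L lborel (?f k) \<le> (LINT x|lborel. ?E x / K + K powr (p - 1) * ?c k x)"
        by (rule integral_mono[OF i _ pw[OF that]]) (intro Bochner_Integration.integrable_add integrable_divide integrable_mult_right iE ic)
      also have "\<dots> = (LINT x|lborel. ?E x / K) + (LINT x|lborel. K powr (p - 1) * ?c k x)"
        by (rule Bochner_Integration.integral_add) (intro integrable_divide integrable_mult_right iE ic)+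
      finally show ?thesis by simp
    qed
  qed
qed

text \<open>Strict comparison of \<open>v\<close> with the multiple \<open>\<kappa> > 1\<close> of its reflection, both of which solve the equation up
  to a factor: the difference cannot have a small positive excess over a constant at points where the gradient is
  bounded below. The singularity of \<open>v\<close> at the origin is cut off by \<open>eta\<close>.\<close>

lemma no_touching:
  fixes e :: 'a and \<kappa> \<tau> k r s m M B :: real
  defines "T \<equiv> refl e \<tau>"
  defines "D \<equiv> {y. y \<bullet> e < \<tau> \<and> norm (T y) < r \<and> y \<noteq> 0}"
  defines "h \<equiv> \<lambda>y. \<kappa> * v (T y) - v y - k"
  assumes e: "norm e = 1" and \<tau>: "\<tau> > 0" and r: "0 < r" "r < R0" and \<kappa>: "\<kappa> > 1" and s: "s > 0" and B: "B > 0"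
    and c: "c > 0" and \<epsilon>: "\<epsilon> > 0"
    and sc: "\<And>(a::'a) b h. m \<le> norm a \<Longrightarrow> norm a \<le> M \<Longrightarrow> 0 \<le> h \<Longrightarrow> h \<le> \<epsilon> \<Longrightarrow>
      c * h\<^sup>2 \<le> 2 * h * ((p_field p a - p_field p b) \<bullet> (a - b)) - (\<kappa> powr (p - 1 - q) * norm a powr q - norm b powr q) * h\<^sup>2"
    and A1: "\<And>y. y \<in> D \<Longrightarrow> h y \<le> \<epsilon>"
    and A2: "\<And>y. y \<in> D \<Longrightarrow> h y > 0 \<Longrightarrow> m \<le> norm (\<kappa> *\<^sub>R dv (T y)) \<and> norm (\<kappa> *\<^sub>R dv (T y)) \<le> M \<and> norm (T y) \<le> r - s \<and> y \<bullet> e \<le> \<tau> - s \<and> v y \<le> B"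
    and y0: "y0 \<in> D"
  shows "h y0 \<le> 0"
proof (rule ccontr)
  assume neg: "\<not> ?thesis"
  let ?\<theta> = "\<kappa> powr (p - 1 - q)"
  have contT: "continuous_on S T" for S unfolding T_def by (rule refl_continuous)
  have openD: "open D"
  proof -
    have "D = {y. y \<bullet> e < \<tau>} \<inter> {y. norm (T y) < r} \<inter> - {0}" by (auto simp: D_def)
    moreover have "open {y. y \<bullet> e < \<tau>}" by (intro open_Collect_less continuous_intros)
    moreover have "open {y. norm (T y) < r}" by (intro open_Collect_less continuous_intros contT)
    ultimately show ?thesis by auto
  qed
  \<comment> \<open>Points of \<open>D\<close> lie on the origin's side of the hyperplane, so their
    mirror images are farther from 0. Hence only v(y), and not v(T y), can be singular in
    \<open>D\<close>.\<close>
  have DT: "norm y < norm (T y)" "T y \<in> U" "y \<in> U" "norm y < r" if "y \<in> D" for y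
  proof -
    have "(norm y)\<^sup>2 < (norm (T y))\<^sup>2" unfolding T_def norm_refl[OF e] using that \<tau> by (simp add: D_def)
    then show l: "norm y < norm (T y)" by (rule power_less_imp_less_base) simp
    have "T y \<noteq> 0" using l by auto
    moreover have "T y \<in> \<Omega>" using that ball_subset[of r] r by (auto simp: D_def)
    ultimately show "T y \<in> U" by simp
    show "norm y < r" using that l by (simp add: D_def)
    then show "y \<in> U" using that ball_subset[of r] r by (auto simp: D_def)
  qed
  have cv: "continuous_on D v" "continuous_on D dv" using cont_v cont DT(3) by (auto intro: continuous_on_subset)
  have cvT: "continuous_on D (\<lambda>y. v (T y))" "continuous_on D (\<lambda>y. dv (T y))"
    by (rule continuous_on_compose2[OF cont_v contT] continuous_on_compose2[OF cont contT]; use DT(2) in auto)+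
  have ch: "continuous_on D h" unfolding h_def by (intro continuous_intros cv cvT)
  define a where "a y = \<kappa> *\<^sub>R rlin e (dv (T y))" for y
  have na: "norm (a y) = norm (\<kappa> *\<^sub>R dv (T y))" for y by (simp add: a_def norm_rlin[OF e])
  have ca: "continuous_on D a" unfolding a_def
    by (intro continuous_intros continuous_on_compose2[OF rlin_continuous[of UNIV] cvT(2)]) auto
  have gh: "GDERIV h y :> a y - dv y" if "y \<in> D" for y
  proof -
    have "GDERIV (\<lambda>y. v (T y)) y :> rlin e (dv (T y))"
      unfolding T_def by (rule gderiv_refl) (use gd DT(2)[OF that] in \<open>simp add: T_def\<close>)
    then have "GDERIV h y :> (\<kappa> *\<^sub>R rlin e (dv (T y)) + v (T y) *\<^sub>R 0) - dv y - 0"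
      unfolding h_def by (intro GDERIV_diff GDERIV_mult GDERIV_const gd DT(3) that)
    then show ?thesis by (simp add: a_def)
  qed
  define hp where "hp y = (if y \<in> D then max 0 (h y) else 0)" for y
  have hp: "0 \<le> hp y" "hp y \<le> \<epsilon>" for y using A1[of y] \<epsilon> by (auto simp: hp_def)
  have chp: "continuous_on D hp"
    by (rule continuous_on_eq[of _ "\<lambda>y. max 0 (h y)"]) (auto intro!: continuous_intros ch simp: hp_def)
  let ?e = "\<lambda>n y. eta p (real (Suc n)) (y::'a)" and ?de = "\<lambda>n y. deta p (real (Suc n)) (y::'a)"
  define X where "X y = p_field p (a y) - p_field p (dv y)" for y
  have cX: "continuous_on D X" unfolding X_def by (intro continuous_intros continuous_on_p_field p ca cv)
  define Br where "Br y = 2 * hp y * (X y \<bullet> (a y - dv y)) - (?\<theta> * norm (a y) powr q - norm (dv y) powr q) * (hp y)\<^sup>2" for y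
  have q0: "q > 0" using p q by simp
  have cBr: "continuous_on D Br" unfolding Br_def
    by (intro continuous_intros chp cX ca cv continuous_on_powr') (use q0 in auto)
  have Brge: "c * (hp y)\<^sup>2 \<le> Br y" for y
  proof (cases "y \<in> D \<and> h y > 0")
    case True
    then have "c * (hp y)\<^sup>2 \<le> 2 * hp y * ((p_field p (a y) - p_field p (dv y)) \<bullet> (a y - dv y)) - (?\<theta> * norm (a y) powr q - norm (dv y) powr q) * (hp y)\<^sup>2"
      using A2[of y] hp[of y] by (intro sc) (auto simp: na)
    then show ?thesis by (simp add: Br_def X_def)
  next
    case False
    then have "hp y = 0" by (auto simp: hp_def)
    then show ?thesis by (simp add: Br_def)
  qed
  have "\<exists>\<rho>>0. \<forall>x::'a. norm x < \<rho> \<longrightarrow> ?e n x = 0 \<and> ?de n x = 0" for n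
    by (rule eta_near_0[of "real (Suc n)"]) (simp, blast)
  then obtain \<rho> where \<rho>: "\<And>n. \<rho> n > 0" "\<And>n (x::'a). norm x < \<rho> n \<Longrightarrow> ?e n x = 0" "\<And>n (x::'a). norm x < \<rho> n \<Longrightarrow> ?de n x = 0"
    by metis
  \<comment> \<open>Where the excess is positive, the hypotheses keep y away from the hyperplane and
    T y away from the sphere of radius r; the factor \<open>eta\<close> excludes the remaining
    boundary point 0.\<close>
  define K where "K n = {y. y \<bullet> e \<le> \<tau> - s \<and> norm (T y) \<le> r - s} - ball 0 (\<rho> n)" for n
  have Kout: "hp y = 0 \<or> (?e n y = 0 \<and> ?de n y = 0)" if "y \<notin> K n" for y n
  proof (cases "y \<in> D \<and> h y > 0")
    case True
    then have "norm (T y) \<le> r - s" "y \<bullet> e \<le> \<tau> - s" using A2 by auto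
    then have "norm y < \<rho> n" using that by (simp add: K_def)
    then show ?thesis using \<rho>(2,3)[of y n] by blast
  next
    case False
    then show ?thesis by (auto simp: hp_def)
  qed
  have KD: "K n \<subseteq> D" for n
  proof
    fix y assume y: "y \<in> K n"
    then have "y \<noteq> 0" using \<rho>(1)[of n] by (auto simp: K_def)
    then show "y \<in> D" using y s by (simp add: K_def D_def)
  qed
  have cK: "compact (K n)" for n
  proof -
    let ?C = "{y. y \<bullet> e \<le> \<tau> - s} \<inter> {y. norm (T y) \<le> r - s}"
    have "closed ?C" by (intro closed_Int closed_Collect_le continuous_intros contT)
    moreover have "?C \<subseteq> cball 0 (r - s + 2 * \<tau>)"
    proof
      fix y assume "y \<in> ?C"
      then have "norm (T y) \<le> r - s" by simp
      moreover have "y = T (T y)" unfolding T_def by (simp add: refl_refl[OF e])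
      then have "norm y = norm ((2 * \<tau>) *\<^sub>R e + rlin e (T y))" by (metis T_def refl_rlin)
      then have "norm y \<le> 2 * \<tau> + norm (T y)"
        using norm_triangle_ineq[of "(2 * \<tau>) *\<^sub>R e" "rlin e (T y)"] \<tau> by (simp add: norm_rlin[OF e] e)
      ultimately show "y \<in> cball 0 (r - s + 2 * \<tau>)" by simp
    qed
    ultimately have "compact ?C" by (meson bounded_cball bounded_subset compact_eq_bounded_closed)
    then have "compact (?C - ball 0 (\<rho> n))"
      by (rule compact_diff) simp
    moreover have "?C - ball 0 (\<rho> n) = K n"
      unfolding K_def by auto
    ultimately show ?thesis by simp
  qed
  define \<phi> where "\<phi> n y = (hp y)\<^sup>2 * ?e n y" for n y
  define d\<phi> where "d\<phi> n y = (hp y)\<^sup>2 *\<^sub>R ?de n y + ?e n y *\<^sub>R ((2 * hp y) *\<^sub>R (a y - dv y))" for n y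
  have Ln: "real (Suc n) > 0" for n by simp
  have t: "C1_test D (\<phi> n) (d\<phi> n)" for n
  proof (rule C1_testI[OF openD cK[of n] KD])
    show "GDERIV (\<phi> n) y :> d\<phi> n y" if "y \<in> D" for y
    proof -
      have "GDERIV (\<lambda>y. (max 0 (h y))\<^sup>2 * ?e n y) y :> (max 0 (h y))\<^sup>2 *\<^sub>R ?de n y + ?e n y *\<^sub>R ((2 * max 0 (h y)) *\<^sub>R (a y - dv y))"
        by (rule GDERIV_mult[OF gderiv_pos_sq[OF gh[OF that]] eta_gderiv[OF Ln]])
      then show ?thesis
        by (rule gderiv_transform[OF _ openD that, THEN GDERIV_subst]) (use that in \<open>auto simp: \<phi>_def d\<phi>_def hp_def\<close>)
    qed
    show "continuous_on D (d\<phi> n)" unfolding d\<phi>_def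
      by (intro continuous_intros chp eta_continuous[OF Ln] ca cv)
    show "\<phi> n y = 0" if "y \<notin> K n" for y using Kout[OF that] by (auto simp: \<phi>_def)
    show "d\<phi> n y = 0" if "y \<notin> D" for y using that by (simp add: d\<phi>_def hp_def)
  qed
  have tU: "C1_test U (\<phi> n) (d\<phi> n)" for n by (rule C1_test_mono[OF t]) (use DT(3) in auto)
  have iK: "integrable lborel g" if "continuous_on D g" "\<And>y. y \<notin> K n \<Longrightarrow> g y = 0" for g :: "'a \<Rightarrow> real" and n
    by (rule integrable_compact_support[OF cK[of n] continuous_on_subset[OF that(1) KD] that(2)])
  have iBr: "integrable lborel (\<lambda>y. Br y * ?e n y)" for n
  proof (rule iK[of _ n])
    show "continuous_on D (\<lambda>y. Br y * ?e n y)" by (rule continuous_on_mult[OF cBr eta_continuous(1)[OF Ln]])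
    show "Br y * ?e n y = 0" if "y \<notin> K n" for y using Kout[OF that] by (auto simp: Br_def)
  qed
  have iXe: "integrable lborel (\<lambda>y. (hp y)\<^sup>2 * (X y \<bullet> ?de n y))" for n
  proof (rule iK[of _ n])
    show "continuous_on D (\<lambda>y. (hp y)\<^sup>2 * (X y \<bullet> ?de n y))"
      by (intro continuous_on_mult continuous_on_power continuous_on_inner chp cX eta_continuous(2)[OF Ln])
    show "(hp y)\<^sup>2 * (X y \<bullet> ?de n y) = 0" if "y \<notin> K n" for y using Kout[OF that] by auto
  qed
  have eq: "(LINT y|lborel. Br y * ?e n y) = - (LINT y|lborel. (hp y)\<^sup>2 * (X y \<bullet> ?de n y))" for n
  proof -
    have pa: "p_field p (a y) = \<kappa> powr (p - 1) *\<^sub>R p_field p (rlin e (dv (T y)))" for y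
      unfolding a_def using \<kappa> by (intro p_field_scale) simp
    \<comment> \<open>The multiple \<kappa> v(T y) solves the equation with source \<kappa>^(p - 1 -
      q) |\<nabla>(\<kappa> v(T y))|^q. The exponent is negative and \<kappa> > 1, which produces
      the factor \<theta> < 1 of the strict comparison.\<close>
    have pq: "?\<theta> * norm (a y) powr q = \<kappa> powr (p - 1) * norm (dv (T y)) powr q" for y
      unfolding na using \<kappa> by (simp add: powr_mult mult.assoc[symmetric] flip: powr_add)
    have w1: "(LINT y|lborel. p_field p (rlin e (dv (T y))) \<bullet> d\<phi> n y) = (LINT y|lborel. norm (dv (T y)) powr q * \<phi> n y)"
      unfolding T_def by (rule reflected_weak[OF e t]) (use DT(2) in \<open>simp add: T_def\<close>)
    have w2: "(LINT y|lborel. p_field p (dv y) \<bullet> d\<phi> n y) = (LINT y|lborel. norm (dv y) powr q * \<phi> n y)"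
      by (rule weak[OF tU])
    have j1: "integrable lborel (\<lambda>y. p_field p (a y) \<bullet> d\<phi> n y)"
      by (rule C1_test_integrable(1)[OF t continuous_on_p_field[OF p(1) ca]])
    have j2: "integrable lborel (\<lambda>y. p_field p (dv y) \<bullet> d\<phi> n y)"
      by (rule C1_test_integrable(1)[OF t continuous_on_p_field[OF p(1) cv(2)]])
    have j3: "integrable lborel (\<lambda>y. (?\<theta> * norm (a y) powr q) * \<phi> n y)"
      by (rule C1_test_integrable(2)[OF t]) (intro continuous_intros ca continuous_on_powr'; use q0 in auto)
    have j4: "integrable lborel (\<lambda>y. norm (dv y) powr q * \<phi> n y)"
      by (rule C1_test_integrable(2)[OF t]) (intro continuous_intros cv continuous_on_powr'; use q0 in auto)
    have "(LINT y|lborel. p_field p (a y) \<bullet> d\<phi> n y) = (LINT y|lborel. (?\<theta> * norm (a y) powr q) * \<phi> n y)"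
      unfolding pa pq inner_scaleR_left mult.assoc integral_mult_right_zero w1 ..
    with w2 have "0 = (LINT y|lborel. p_field p (a y) \<bullet> d\<phi> n y) - (LINT y|lborel. p_field p (dv y) \<bullet> d\<phi> n y)
        - ((LINT y|lborel. (?\<theta> * norm (a y) powr q) * \<phi> n y) - (LINT y|lborel. norm (dv y) powr q * \<phi> n y))" by simp
    also have "\<dots> = (LINT y|lborel. (p_field p (a y) \<bullet> d\<phi> n y - p_field p (dv y) \<bullet> d\<phi> n y)
        - ((?\<theta> * norm (a y) powr q) * \<phi> n y - norm (dv y) powr q * \<phi> n y))"
      by (simp only: Bochner_Integration.integral_diff Bochner_Integration.integrable_diff j1 j2 j3 j4)
    also have "\<dots> = (LINT y|lborel. Br y * ?e n y + (hp y)\<^sup>2 * (X y \<bullet> ?de n y))"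
      by (rule Bochner_Integration.integral_cong)
        (simp_all add: Br_def X_def \<phi>_def d\<phi>_def inner_diff_left inner_add_right algebra_simps)
    also have "\<dots> = (LINT y|lborel. Br y * ?e n y) + (LINT y|lborel. (hp y)\<^sup>2 * (X y \<bullet> ?de n y))"
      by (rule Bochner_Integration.integral_add[OF iBr iXe])
    finally show ?thesis by simp
  qed
  have r1: "r < 1" using r R0 by simp
  note ct = cross_term[OF r, of B] and dl = deta_L1_tendsto[OF r(1) r1]
  \<comment> \<open>The total error from differentiating the origin cutoff. Where the excess is
    positive, the reflected gradient is bounded by M and v <= B, so both parts tend to 0.\<close>
  define E where "E n = \<epsilon>\<^sup>2 * (M powr (p - 1) * (LINT y|lborel. indicator (cball 0 r) y * norm (?de n y)) +
    (LINT y|lborel. indicator (low r B) y * (norm (dv y) powr (p - 1) * norm (?de n y))))" for n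
  have "(\<lambda>n. E n) \<longlonglongrightarrow> \<epsilon>\<^sup>2 * (M powr (p - 1) * 0 + 0)"
    unfolding E_def by (intro tendsto_mult tendsto_add tendsto_const dl(2) ct(2))
  then have E0: "E \<longlonglongrightarrow> 0" by simp
  have up: "(LINT y|lborel. Br y * ?e n y) \<le> E n" for n
  proof -
    have "(LINT y|lborel. Br y * ?e n y) \<le> norm (LINT y|lborel. (hp y)\<^sup>2 * (X y \<bullet> ?de n y))"
      unfolding eq by simp
    also have "\<dots> \<le> (LINT y|lborel. \<epsilon>\<^sup>2 * (M powr (p - 1) * (indicator (cball 0 r) y * norm (?de n y)) +
        indicator (low r B) y * (norm (dv y) powr (p - 1) * norm (?de n y))))"
    proof (rule Bochner_Integration.integral_norm_bound_integral[OF iXe])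
      show "integrable lborel (\<lambda>y. \<epsilon>\<^sup>2 * (M powr (p - 1) * (indicator (cball 0 r) y * norm (?de n y)) +
        indicator (low r B) y * (norm (dv y) powr (p - 1) * norm (?de n y))))"
        by (intro integrable_mult_right Bochner_Integration.integrable_add dl(1) ct(1))
      fix y
      show "norm ((hp y)\<^sup>2 * (X y \<bullet> ?de n y)) \<le> \<epsilon>\<^sup>2 * (M powr (p - 1) * (indicator (cball 0 r) y * norm (?de n y)) +
        indicator (low r B) y * (norm (dv y) powr (p - 1) * norm (?de n y)))" (is "_ \<le> ?R")
      proof (cases "y \<in> D \<and> h y > 0")
        case True
        then have y: "norm y \<le> r" "y \<in> low r B" using A2[of y] DT(4)[of y] by (auto simp: low_def)
        have "norm (X y) \<le> norm (p_field p (a y)) + norm (p_field p (dv y))" unfolding X_def by (rule norm_triangle_ineq4)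
        also have "\<dots> \<le> M powr (p - 1) + norm (dv y) powr (p - 1)"
          unfolding norm_p_field using A2[of y] True p by (intro add_mono powr_mono2) (auto simp: na)
        finally have nX: "norm (X y) \<le> M powr (p - 1) + norm (dv y) powr (p - 1)" .
        have "\<bar>X y \<bullet> ?de n y\<bar> \<le> norm (X y) * norm (?de n y)" by (rule Cauchy_Schwarz_ineq2)
        also have "\<dots> \<le> (M powr (p - 1) + norm (dv y) powr (p - 1)) * norm (?de n y)"
          by (intro mult_right_mono nX) simp
        finally have 1: "\<bar>X y \<bullet> ?de n y\<bar> \<le> (M powr (p - 1) + norm (dv y) powr (p - 1)) * norm (?de n y)" .
        have 2: "(hp y)\<^sup>2 \<le> \<epsilon>\<^sup>2" using hp[of y] by (intro power_mono) auto
        have "(hp y)\<^sup>2 * \<bar>X y \<bullet> ?de n y\<bar> \<le> \<epsilon>\<^sup>2 * ((M powr (p - 1) + norm (dv y) powr (p - 1)) * norm (?de n y))"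
          by (rule mult_mono[OF 2 1]) auto
        then show ?thesis using y by (simp add: abs_mult distrib_right)
      next
        case False
        then have "hp y = 0" by (auto simp: hp_def)
        moreover have "0 \<le> ?R" by (intro mult_nonneg_nonneg add_nonneg_nonneg) auto
        ultimately show ?thesis by simp
      qed
    qed
    also have "\<dots> = E n" unfolding E_def
      by (simp only: integral_mult_right_zero Bochner_Integration.integral_add[OF integrable_mult_right[OF dl(1)] ct(1)])
    finally show ?thesis .
  qed
  have hp0: "hp y0 > 0" using neg y0 by (simp add: hp_def)
  have y0n: "y0 \<noteq> 0" using y0 by (simp add: D_def)
  \<comment> \<open>From this index on the cutoff is positive at y0. Since it increases with n, the
    left side stays above the fixed positive number c I0 while the error tends to 0.\<close>
  obtain n0 :: nat where n0: "mu p y0 < real (Suc n0)"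
    using reals_Archimedean2[of "mu p y0"] by (metis less_trans of_nat_less_iff lessI)
  have ihp: "integrable lborel (\<lambda>y. (hp y)\<^sup>2 * ?e n y)" for n
  proof (rule iK[of _ n])
    show "continuous_on D (\<lambda>y. (hp y)\<^sup>2 * ?e n y)"
      by (intro continuous_on_mult continuous_on_power chp eta_continuous(1)[OF Ln])
    show "(hp y)\<^sup>2 * ?e n y = 0" if "y \<notin> K n" for y using Kout[OF that] by auto
  qed
  define I0 where "I0 = (LINT y|lborel. (hp y)\<^sup>2 * ?e n0 y)"
  have I0: "I0 > 0"
  proof (rule ccontr)
    assume n: "\<not> I0 > 0"
    have "(hp y0)\<^sup>2 * ?e n0 y0 = 0"
    proof (rule continuous_integral_zero[OF ihp _ _ openD _ y0])
      show "0 \<le> (hp y)\<^sup>2 * ?e n0 y" for y using eta_bounds(1) by simp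
      show "(LINT y|lborel. (hp y)\<^sup>2 * ?e n0 y) \<le> 0" using n by (simp add: I0_def)
      show "continuous_on D (\<lambda>y. (hp y)\<^sup>2 * ?e n0 y)" by (intro continuous_intros chp eta_continuous[OF Ln])
    qed
    moreover have "?e n0 y0 > 0" using n0 y0n by (simp add: eta_def)
    ultimately show False using hp0 by simp
  qed
  have low: "c * I0 \<le> (LINT y|lborel. Br y * ?e n y)" if n: "n \<ge> n0" for n
  proof -
    have "c * I0 = (LINT y|lborel. c * ((hp y)\<^sup>2 * ?e n0 y))" by (simp add: I0_def)
    also have "\<dots> \<le> (LINT y|lborel. Br y * ?e n y)"
    proof (rule integral_mono[OF integrable_mult_right[OF ihp] iBr])
      fix y :: 'a
      show "c * ((hp y)\<^sup>2 * ?e n0 y) \<le> Br y * ?e n y"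
      proof (cases "y \<in> D")
        case True
        have "mu p y \<ge> 0" using DT(4)[OF True] r1 by (intro mu_nonneg) simp
        then have "mu p y / real (Suc n) \<le> mu p y / real (Suc n0)" using n by (intro divide_left_mono) auto
        then have "(max 0 (1 - mu p y / real (Suc n0)))\<^sup>2 \<le> (max 0 (1 - mu p y / real (Suc n)))\<^sup>2"
          by (intro power_mono) auto
        then have "?e n0 y \<le> ?e n y" by (simp add: eta_def)
        have "c * ((hp y)\<^sup>2 * ?e n0 y) = (c * (hp y)\<^sup>2) * ?e n0 y" by (simp add: mult.assoc)
        also have "\<dots> \<le> (c * (hp y)\<^sup>2) * ?e n y" using \<open>?e n0 y \<le> ?e n y\<close> c by (intro mult_left_mono) auto
        also have "\<dots> \<le> Br y * ?e n y" using eta_bounds(1) by (intro mult_right_mono Brge)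
        finally show ?thesis .
      next
        case False
        then show ?thesis by (simp add: hp_def Br_def)
      qed
    qed
    finally show ?thesis .
  qed
  have "\<forall>\<^sub>F n in sequentially. E n < c * I0" using I0 c by (intro order_tendstoD[OF E0]) simp
  then obtain n1 where "\<And>n. n \<ge> n1 \<Longrightarrow> E n < c * I0" unfolding eventually_sequentially by blast
  then have "E (max n0 n1) < c * I0" by simp
  then show False using low[of "max n0 n1"] up[of "max n0 n1"] by simp
qed

end

subsection \<open>The oscillation on spheres and the limit of \<open>v / \<mu>\<^sub>p\<close>\<close>

context hj_solution
begin

text \<open>Among all pairs of a point \<open>x\<close> and its mirror image \<open>y\<close> in a hyperplane \<open>{z. z \<bullet> e = \<tau>}\<close> separating
  \<open>x\<close> from the origin, maximize \<open>\<kappa> v(x) - v(y) + c \<tau>\<close> with \<open>\<kappa> > 1\<close>. Raising \<open>\<tau>\<close> with \<open>y\<close> fixed shows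
  that \<open>\<nabla>v(x)\<close> is bounded away from \<open>0\<close> at nearly maximal pairs, so that strict comparison applies there.\<close>

lemma oscillation:
  assumes r: "0 < r" "r < R0" and xy: "0 < norm yh" "norm yh < norm xh" "norm xh < r"
  shows "v xh - v yh \<le> vmax r - vmin r"
proof (rule ccontr)
  define Kd where "Kd = vmax r - vmin r"
  define D0 where "D0 = v xh - v yh - Kd"
  assume "\<not> ?thesis"
  then have D0: "D0 > 0" by (simp add: D0_def Kd_def)
  have rR: "r \<le> R0" using r by simp
  have Kd: "Kd \<ge> 0"
  proof -
    obtain x where "norm x = r" "v x = vmin r" using vmin_attained[OF r(1) rR] by blast
    then show ?thesis using vmax_ge[OF r(1) rR, of x] by (simp add: Kd_def)
  qed
  define n where "n = norm (xh - yh)"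
  have n: "n > 0" using xy by (auto simp: n_def)
  \<comment> \<open>Unit normal and offset of the perpendicular bisector of \<open>xh\<close> and
    \<open>yh\<close>. The offset is positive because \<open>xh\<close> is farther from the
    origin.\<close>
  define e0 where "e0 = (1 / n) *\<^sub>R (xh - yh)"
  define \<tau>0 where "\<tau>0 = ((norm xh)\<^sup>2 - (norm yh)\<^sup>2) / (2 * n)"
  have \<tau>0: "\<tau>0 > 0" unfolding \<tau>0_def using n xy by (intro divide_pos_pos) (simp_all add: power_strict_mono)
  have e0: "norm e0 = 1" using n by (simp add: e0_def n_def)
  have xe: "xh \<bullet> e0 - \<tau>0 = n / 2"
  proof -
    have "n\<^sup>2 = xh \<bullet> xh - 2 * (xh \<bullet> yh) + yh \<bullet> yh"
      unfolding n_def power2_norm_eq_inner by (simp add: inner_diff_left inner_diff_right inner_commute)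
    then have "2 * (xh \<bullet> xh - xh \<bullet> yh) - (xh \<bullet> xh - yh \<bullet> yh) = n\<^sup>2" by simp
    moreover have "xh \<bullet> e0 = (xh \<bullet> xh - xh \<bullet> yh) / n" by (simp add: e0_def inner_diff_right)
    ultimately have "xh \<bullet> e0 - \<tau>0 = n\<^sup>2 / (2 * n)"
      using n by (simp add: \<tau>0_def power2_norm_eq_inner divide_simps)
    then show ?thesis using n by (simp add: power2_eq_square)
  qed
  have Tx: "refl e0 \<tau>0 xh = yh"
    unfolding refl_def xe using n by (simp add: e0_def)
  \<comment> \<open>An admissible x satisfies |x| > \<tau> >= \<tau>0, so this compact annulus
    contains it. On the annulus v and its gradient are bounded and uniformly continuous.\<close>
  define A where "A = cball 0 r - ball (0::'a) (\<tau>0 / 2)"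
  have A: "compact A" "A \<subseteq> U"
    unfolding A_def using ball_subset[OF rR] \<tau>0 by (auto simp: compact_diff)
  have cA: "continuous_on A v" "continuous_on A dv"
    using cont_v cont A(2) by (auto intro: continuous_on_subset)
  obtain B where B: "B > 0" "\<And>x. x \<in> A \<Longrightarrow> v x \<le> B"
  proof -
    have "bounded (v ` A)" by (intro compact_imp_bounded compact_continuous_image cA A)
    then obtain B where "B > 0" "\<And>x. x \<in> A \<Longrightarrow> norm (v x) \<le> B" unfolding bounded_pos by auto
    then show ?thesis by (intro that[of B]) (auto dest: abs_le_D1)
  qed
  obtain \<Lambda> where \<Lambda>: "\<Lambda> > 0" "\<And>x. x \<in> A \<Longrightarrow> norm (dv x) \<le> \<Lambda>"
  proof -
    have "bounded (dv ` A)" by (intro compact_imp_bounded compact_continuous_image cA A)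
    then show ?thesis unfolding bounded_pos using that by auto
  qed
  \<comment> \<open>The perturbations are paid from the assumed excess D0: the term c \<tau> costs
    at most D0 / 4 and the factor \<kappa> at most D0 / 8 on \<open>A\<close>.\<close>
  define c where "c = D0 / (4 * r)"
  define \<kappa> where "\<kappa> = 1 + D0 / (8 * B)"
  have c: "c > 0" "c * r = D0 / 4" using D0 r by (auto simp: c_def)
  have \<kappa>: "\<kappa> > 1" "(\<kappa> - 1) * B = D0 / 8" using D0 B(1) by (auto simp: \<kappa>_def)
  have \<kappa>v: "\<kappa> * v x \<le> v x + D0 / 8" if "x \<in> A" for x
  proof -
    have "(\<kappa> - 1) * v x \<le> (\<kappa> - 1) * B" using \<kappa>(1) B(2)[OF that] by (intro mult_left_mono) auto
    then show ?thesis using \<kappa>(2) by (simp add: algebra_simps)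
  qed
  obtain d1 where d1: "d1 > 0" "\<And>x x'. x \<in> A \<Longrightarrow> x' \<in> A \<Longrightarrow> dist x' x < d1 \<Longrightarrow> dist (v x') (v x) < D0 / 8"
    using compact_uniformly_continuous[OF cA(1) A(1)] D0 unfolding uniformly_continuous_on_def by (metis divide_pos_pos zero_less_numeral)
  have c8: "c / (8 * \<kappa>) > 0" using c \<kappa> by simp
  obtain d2 where d2: "d2 > 0" "\<And>x x'. x \<in> A \<Longrightarrow> x' \<in> A \<Longrightarrow> dist x' x < d2 \<Longrightarrow> dist (dv x') (dv x) < c / (8 * \<kappa>)"
    using compact_uniformly_continuous[OF cA(2) A(1)] c8 unfolding uniformly_continuous_on_def by metis
  define s where "s = min (d1 / 4) (\<tau>0 / 2)"
  have s: "s > 0" "2 * s < d1" "s < d1" "s \<le> \<tau>0 / 2" using d1(1) \<tau>0 by (auto simp: s_def min_def)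
  define J where "J x e \<tau> = \<kappa> * v x - v (refl e \<tau> x) + c * \<tau>" for x e :: 'a and \<tau> :: real
  define adm where "adm x e \<tau> \<longleftrightarrow> norm e = 1 \<and> \<tau>0 \<le> \<tau> \<and> \<tau> < x \<bullet> e \<and> norm x < r \<and> refl e \<tau> x \<noteq> 0" for x e :: 'a and \<tau> :: real
  define S where "S = Sup {J x e \<tau> | x e \<tau>. adm x e \<tau>}"
  have admA: "x \<in> A" "\<tau> < norm x" "\<tau> < r" "norm (refl e \<tau> x) < norm x" "0 < \<tau>" if "adm x e \<tau>" for x e \<tau>
  proof -
    have "x \<bullet> e \<le> norm x" using norm_cauchy_schwarz[of x e] that by (simp add: adm_def)
    then show 1: "\<tau> < norm x" "\<tau> < r" "x \<in> A" using that \<tau>0 by (auto simp: adm_def A_def)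
    show t: "0 < \<tau>" using that \<tau>0 by (simp add: adm_def)
    have e: "norm e = 1" using that by (simp add: adm_def)
    have "(norm (refl e \<tau> x))\<^sup>2 < (norm x)\<^sup>2"
      unfolding norm_refl[OF e] using t that by (simp add: adm_def mult_pos_neg)
    then show "norm (refl e \<tau> x) < norm x" by (rule power_less_imp_less_base) simp
  qed
  have Jub: "J x e \<tau> \<le> \<kappa> * B + c * r" if "adm x e \<tau>" for x e \<tau>
  proof -
    have "\<kappa> * v x \<le> \<kappa> * B" using B(2)[OF admA(1)[OF that]] \<kappa> by (intro mult_left_mono) auto
    moreover have "c * \<tau> \<le> c * r" using admA(3)[OF that] c by (intro mult_left_mono) auto
    ultimately show ?thesis using v_nonneg[of "refl e \<tau> x"] by (simp add: J_def)
  qed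
  have bdd: "bdd_above {J x e \<tau> | x e \<tau>. adm x e \<tau>}"
    by (rule bdd_aboveI[of _ "\<kappa> * B + c * r"]) (use Jub in blast)
  have JS: "J x e \<tau> \<le> S" if "adm x e \<tau>" for x e \<tau>
    unfolding S_def by (rule cSup_upper[OF _ bdd]) (use that in blast)
  have adm0: "adm xh e0 \<tau>0" using e0 xe n xy Tx by (auto simp: adm_def)
  have S0: "Kd + D0 \<le> S"
  proof -
    have "v xh \<le> \<kappa> * v xh" using \<kappa>(1) v_nonneg[of xh] mult_right_mono[of 1 \<kappa> "v xh"] by simp
    moreover have "0 \<le> c * \<tau>0" using c \<tau>0 by simp
    ultimately have "Kd + D0 \<le> J xh e0 \<tau>0" unfolding J_def Tx D0_def by simp
    then show ?thesis using JS[OF adm0] by simp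
  qed
  \<comment> \<open>A pair with x near the sphere of radius r has difference at most about vmax(r) -
    vmin(r), by the minimum principle for the mirror point; a pair near the hyperplane has almost
    equal values. Neither can keep more than half of the excess.\<close>
  have far: "norm x \<le> r - s \<and> \<tau> + s \<le> x \<bullet> e" if ad: "adm x e \<tau>" and J: "J x e \<tau> > Kd + D0 / 2" for x e \<tau>
  proof (rule ccontr)
    assume neg: "\<not> ?thesis"
    have xA: "x \<in> A" by (rule admA(1)[OF ad])
    have ct: "c * \<tau> \<le> D0 / 4" using admA(3)[OF ad] c(2) mult_left_mono[of \<tau> r c] c(1) by linarith
    from neg consider "norm x > r - s" | "x \<bullet> e < \<tau> + s" by linarith
    then show False
    proof cases
      case 1
      have x0: "norm x > 0" using admA(2,5)[OF ad] by linarith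
      define x' where "x' = (r / norm x) *\<^sub>R x"
      have nx': "norm x' = r" using x0 r by (simp add: x'_def)
      then have "x' \<in> A" using admA(3,5)[OF ad] ad by (auto simp: A_def adm_def)
      have "x' - x = (r / norm x - 1) *\<^sub>R x" by (simp add: x'_def scaleR_left_diff_distrib)
      then have "norm (x' - x) = \<bar>r / norm x - 1\<bar> * norm x" by simp
      also have "r / norm x - 1 = (r - norm x) / norm x" using x0 by (simp add: diff_divide_distrib)
      also have "\<bar>(r - norm x) / norm x\<bar> * norm x = r - norm x" using ad x0 by (simp add: adm_def)
      finally have "dist x' x < d1" using 1 s by (simp add: dist_norm)
      then have "\<bar>v x' - v x\<bar> < D0 / 8" using d1(2)[OF xA \<open>x' \<in> A\<close>] by (simp add: dist_real_def)
      moreover have "v x' \<le> vmax r" by (rule vmax_ge[OF r(1) rR nx'])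
      moreover have "vmin r \<le> v (refl e \<tau> x)"
        using ad admA(4)[OF ad] by (intro min_principle[OF rR]) (auto simp: adm_def)
      ultimately show False using J \<kappa>v[OF xA] ct unfolding J_def Kd_def by linarith
    next
      case 2
      let ?y = "refl e \<tau> x"
      have e: "norm e = 1" using ad by (simp add: adm_def)
      have "?y \<bullet> e \<le> norm ?y" using norm_cauchy_schwarz[of ?y e] e by simp
      then have "\<tau>0 / 2 \<le> norm ?y" unfolding refl_inner[OF e] using 2 s ad by (simp add: adm_def)
      moreover have "norm ?y \<le> r" using admA(4)[OF ad] ad by (simp add: adm_def)
      ultimately have yA: "?y \<in> A" by (simp add: A_def)
      have "dist ?y x = 2 * \<bar>x \<bullet> e - \<tau>\<bar>" unfolding dist_norm refl_def using ad by (simp add: e adm_def)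
      then have "dist ?y x < d1" using 2 s ad by (simp add: adm_def)
      then have "\<bar>v ?y - v x\<bar> < D0 / 8" using d1(2)[OF xA yA] by (simp add: dist_real_def)
      then show False using J \<kappa>v[OF xA] ct Kd D0 unfolding J_def by linarith
    qed
  qed
  define h where "h = min (s / 4) (d2 / 4)"
  have h: "h > 0" "2 * h < s" "2 * h < d2" using s d2(1) by (auto simp: h_def min_def)
  define \<delta> where "\<delta> = min (c * h / 2) (D0 / 4)"
  have \<delta>: "\<delta> > 0" "\<delta> \<le> c * h / 2" "\<delta> \<le> D0 / 4" using c h D0 by (auto simp: \<delta>_def)
  \<comment> \<open>Moving x by 2 h e and the hyperplane by h keeps the mirror point fixed and gains
    c h. As the supremum is almost attained, \<kappa> v must drop by at least c h / 2 on the way;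
    this bounds the gradient below on the segment, and uniform continuity carries half of the bound
    back to x.\<close>
  have grad: "c / 8 \<le> norm (\<kappa> *\<^sub>R dv x)" if ad: "adm x e \<tau>" and J: "J x e \<tau> > S - \<delta>" for x e \<tau>
  proof -
    have e: "norm e = 1" using ad by (simp add: adm_def)
    have ee: "e \<bullet> e = 1" using e by (simp add: dot_square_norm)
    have "J x e \<tau> > Kd + D0 / 2" using J S0 \<delta>(3) D0 by linarith
    from far[OF ad this] have x: "norm x \<le> r - s" "\<tau> + s \<le> x \<bullet> e" by auto
    define x' where "x' = x + (2 * h) *\<^sub>R e"
    have seg: "x + t *\<^sub>R ((2 * h) *\<^sub>R e) \<in> A" if t: "0 \<le> t" "t \<le> 1" for t
    proof -
      have "norm (x + t *\<^sub>R ((2 * h) *\<^sub>R e)) \<le> norm x + t * (2 * h)"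
        using norm_triangle_ineq[of x "t *\<^sub>R ((2 * h) *\<^sub>R e)"] t h e by simp
      also have "\<dots> \<le> norm x + 1 * (2 * h)" using t h by (intro add_left_mono mult_right_mono) auto
      finally have "norm (x + t *\<^sub>R ((2 * h) *\<^sub>R e)) \<le> r" using x h by simp
      moreover have "(x + t *\<^sub>R ((2 * h) *\<^sub>R e)) \<bullet> e \<le> norm (x + t *\<^sub>R ((2 * h) *\<^sub>R e))"
        using norm_cauchy_schwarz[of _ e] e by simp
      moreover have "(x + t *\<^sub>R ((2 * h) *\<^sub>R e)) \<bullet> e = x \<bullet> e + t * (2 * h)" by (simp add: inner_add_left ee)
      moreover have "t * (2 * h) \<ge> 0" using t h by simp
      moreover have "\<tau> < x \<bullet> e" "\<tau>0 \<le> \<tau>" using ad by (auto simp: adm_def)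
      ultimately have "\<tau>0 / 2 \<le> norm (x + t *\<^sub>R ((2 * h) *\<^sub>R e))" "norm (x + t *\<^sub>R ((2 * h) *\<^sub>R e)) \<le> r"
        using \<tau>0 by linarith+
      then show ?thesis by (simp add: A_def)
    qed
    have "norm x' \<le> norm x + 2 * h" unfolding x'_def using norm_triangle_ineq[of x "(2 * h) *\<^sub>R e"] h e by simp
    then have nx': "norm x' < r" using x h by simp
    have x'e: "x' \<bullet> e = x \<bullet> e + 2 * h" by (simp add: x'_def inner_add_left ee)
    have same: "refl e (\<tau> + h) x' = refl e \<tau> x"
    proof -
      have "2 * (x \<bullet> e + 2 * h - (\<tau> + h)) = 2 * (x \<bullet> e - \<tau>) + 2 * h" by simp
      then show ?thesis unfolding refl_def x'e by (simp only: x'_def scaleR_add_left) simp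
    qed
    have "adm x' e (\<tau> + h)" unfolding adm_def same x'e using ad h nx' by (simp add: adm_def)
    from JS[OF this] have "\<kappa> * v x' - v (refl e \<tau> x) + c * (\<tau> + h) \<le> S" by (simp add: J_def same)
    then have "\<kappa> * (v x' - v x) < \<delta> - c * h" using J unfolding J_def by (simp add: algebra_simps)
    then have dec: "\<kappa> * (v x' - v x) < - (c * h / 2)" using \<delta>(2) by simp
    obtain t where t: "0 < t" "t < 1" "v (x + (2 * h) *\<^sub>R e) - v x = dv (x + t *\<^sub>R ((2 * h) *\<^sub>R e)) \<bullet> ((2 * h) *\<^sub>R e)"
      using gderiv_mvt[of v x "(2 * h) *\<^sub>R e" dv] gd seg A(2) by blast
    define z where "z = x + t *\<^sub>R ((2 * h) *\<^sub>R e)"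
    have zA: "z \<in> A" unfolding z_def using seg t by simp
    have "c * h / 2 < \<kappa> * \<bar>dv z \<bullet> ((2 * h) *\<^sub>R e)\<bar>"
    proof -
      have "\<kappa> * (dv z \<bullet> ((2 * h) *\<^sub>R e)) < - (c * h / 2)" using dec t(3) by (simp add: x'_def z_def)
      moreover have "\<kappa> * (- (dv z \<bullet> ((2 * h) *\<^sub>R e))) \<le> \<kappa> * \<bar>dv z \<bullet> ((2 * h) *\<^sub>R e)\<bar>" using \<kappa> by (intro mult_left_mono) auto
      ultimately show ?thesis by linarith
    qed
    also have "\<dots> \<le> \<kappa> * (norm (dv z) * (2 * h))"
      using Cauchy_Schwarz_ineq2[of "dv z" "(2 * h) *\<^sub>R e"] \<kappa> h e by (intro mult_left_mono) auto
    also have "\<dots> = (2 * \<kappa> * norm (dv z)) * h" by simp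
    finally have "(c / 2) * h < (2 * \<kappa> * norm (dv z)) * h" by simp
    then have "c / 2 < 2 * \<kappa> * norm (dv z)" using h(1) by (simp only: mult_less_cancel_right_pos)
    then have z1: "c / 4 < \<kappa> * norm (dv z)" by simp
    have "dist z x < d2"
    proof -
      have "dist z x = t * (2 * h)" unfolding z_def dist_norm using t h e by simp
      also have "\<dots> \<le> 1 * (2 * h)" using t h by (intro mult_right_mono) auto
      finally show ?thesis using h by simp
    qed
    then have "norm (dv z - dv x) < c / (8 * \<kappa>)" using d2(2)[OF admA(1)[OF ad] zA] by (simp add: dist_norm)
    then have "\<kappa> * norm (dv z - dv x) \<le> c / 8" using \<kappa> by (simp add: pos_less_divide_eq mult.commute field_simps)
    moreover have "\<kappa> * norm (dv z) \<le> \<kappa> * (norm (dv x) + norm (dv z - dv x))"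
      using norm_triangle_sub[of "dv z" "dv x"] \<kappa> by (intro mult_left_mono) auto
    ultimately have "c / 8 \<le> \<kappa> * norm (dv x)" using z1 by (simp add: distrib_left)
    then show ?thesis using \<kappa> by simp
  qed
  have \<theta>: "0 < \<kappa> powr (p - 1 - q)" "\<kappa> powr (p - 1 - q) < 1"
    using \<kappa> q powr_less_mono[of "p - 1 - q" 0 \<kappa>] by auto
  have q0: "0 < q" using p q by simp
  have upA: "norm (\<kappa> *\<^sub>R dv x) \<le> \<kappa> * \<Lambda>" if "x \<in> A" for x using \<Lambda>(2)[OF that] \<kappa> by simp
  obtain x1 e1 \<tau>1 where ad1: "adm x1 e1 \<tau>1" "J x1 e1 \<tau>1 > S - \<delta>"
  proof -
    have "\<exists>j\<in>{J x e \<tau> | x e \<tau>. adm x e \<tau>}. S - \<delta> < j"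
      unfolding S_def by (rule less_cSupD) (use adm0 \<delta>(1) in auto)
    then show ?thesis using that by blast
  qed
  have mM: "c / 8 \<le> \<kappa> * \<Lambda>" using grad[OF ad1] upA[OF admA(1)[OF ad1(1)]] by linarith
  have c80: "0 < c / 8" using c by simp
  obtain c' \<epsilon> where sc: "c' > 0" "0 < \<epsilon>"
    "\<And>(a::'a) b h. c / 8 \<le> norm a \<Longrightarrow> norm a \<le> \<kappa> * \<Lambda> \<Longrightarrow> 0 \<le> h \<Longrightarrow> h \<le> \<epsilon> \<Longrightarrow>
      c' * h\<^sup>2 \<le> 2 * h * ((p_field p a - p_field p b) \<bullet> (a - b)) - (\<kappa> powr (p - 1 - q) * norm a powr q - norm b powr q) * h\<^sup>2"
    using strict_comparison_pointwise[OF p(1) q0 \<theta> c80 mM] by blast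
  \<comment> \<open>The final pair is within \<delta>' of the supremum and the constant k sits 2
    \<delta>' below it. Its excess is then more than \<delta>', while every excess is at most 2
    \<delta>' <= \<epsilon>, and pairs with positive excess are within \<delta> of the
    supremum.\<close>
  define \<delta>' where "\<delta>' = min (\<delta> / 2) (\<epsilon> / 2)"
  have \<delta>': "\<delta>' > 0" "2 * \<delta>' \<le> \<delta>" "2 * \<delta>' \<le> \<epsilon>" using \<delta>(1) sc(2) by (auto simp: \<delta>'_def)
  obtain x e \<tau> where ad: "adm x e \<tau>" and J: "J x e \<tau> > S - \<delta>'"
  proof -
    have "\<exists>j\<in>{J x e \<tau> | x e \<tau>. adm x e \<tau>}. S - \<delta>' < j"
      unfolding S_def by (rule less_cSupD) (use adm0 \<delta>'(1) in auto)
    then show ?thesis using that by blast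
  qed
  have e: "norm e = 1" using ad by (simp add: adm_def)
  define k where "k = S - c * \<tau> - 2 * \<delta>'"
  have k: "k \<ge> 0"
  proof -
    have "c * \<tau> \<le> D0 / 4" using admA(3)[OF ad] c(2) mult_left_mono[of \<tau> r c] c(1) by linarith
    then show ?thesis using S0 Kd D0 \<delta>' \<delta>(3) by (simp add: k_def)
  qed
  have pair: "adm (refl e \<tau> y) e \<tau>" "\<kappa> * v (refl e \<tau> y) - v y - k = J (refl e \<tau> y) e \<tau> - S + 2 * \<delta>'"
    if y: "y \<bullet> e < \<tau>" "norm (refl e \<tau> y) < r" "y \<noteq> 0" for y
    using y ad by (simp_all add: adm_def refl_refl[OF e] refl_inner[OF e] J_def k_def)
  have "\<kappa> * v (refl e \<tau> (refl e \<tau> x)) - v (refl e \<tau> x) - k \<le> 0"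
  proof (rule no_touching[OF e admA(5)[OF ad] r \<kappa>(1) s(1) _ sc(1,2,3)])
    show "0 < \<kappa> * B" using \<kappa> B by simp
    show "refl e \<tau> x \<in> {y. y \<bullet> e < \<tau> \<and> norm (refl e \<tau> y) < r \<and> y \<noteq> 0}"
      using ad by (simp add: adm_def refl_refl[OF e] refl_inner[OF e])
    fix y assume "y \<in> {y. y \<bullet> e < \<tau> \<and> norm (refl e \<tau> y) < r \<and> y \<noteq> 0}"
    then have y: "y \<bullet> e < \<tau>" "norm (refl e \<tau> y) < r" "y \<noteq> 0" by auto
    note pr = pair[OF y]
    show "\<kappa> * v (refl e \<tau> y) - v y - k \<le> \<epsilon>" unfolding pr(2) using JS[OF pr(1)] \<delta>' by simp
    assume h: "\<kappa> * v (refl e \<tau> y) - v y - k > 0"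
    then have J1: "J (refl e \<tau> y) e \<tau> > S - \<delta>" unfolding pr(2) using \<delta>' by simp
    then have J2: "J (refl e \<tau> y) e \<tau> > Kd + D0 / 2" using S0 \<delta>(3) D0 by linarith
    have xA: "refl e \<tau> y \<in> A" by (rule admA(1)[OF pr(1)])
    have "\<kappa> * v (refl e \<tau> y) \<le> \<kappa> * B" using B(2)[OF xA] \<kappa> by (intro mult_left_mono) auto
    then have "v y \<le> \<kappa> * B" using h k by linarith
    moreover have "y \<bullet> e \<le> \<tau> - s" using far[OF pr(1) J2] by (simp add: refl_inner[OF e])
    ultimately show "c / 8 \<le> norm (\<kappa> *\<^sub>R dv (refl e \<tau> y)) \<and> norm (\<kappa> *\<^sub>R dv (refl e \<tau> y)) \<le> \<kappa> * \<Lambda> \<and>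
        norm (refl e \<tau> y) \<le> r - s \<and> y \<bullet> e \<le> \<tau> - s \<and> v y \<le> \<kappa> * B"
      using grad[OF pr(1) J1] upA[OF xA] far[OF pr(1) J2] by blast
  qed
  then show False using J \<delta>'(1) by (simp add: refl_refl[OF e] J_def k_def)
qed

text \<open>\<open>oscillation\<close> requires the second point to be strictly closer to the
  origin, so the minimizer on the sphere is approached radially from inside. The bound does not
  depend on |x|.\<close>

lemma oscillation_sphere:
  assumes r: "0 < r" "r < R0" and x: "0 < norm x" "norm x < r"
  shows "v x \<le> vmin (norm x) + (vmax r - vmin r)"
proof -
  have xR: "norm x \<le> R0" using x r by simp
  obtain y where y: "norm y = norm x" "v y = vmin (norm x)" using vmin_attained[OF x(1) xR] by blast
  have yU: "y \<in> U" using y x ball_subset[OF xR] by auto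
  have "isCont v y" using cont_v openU yU by (simp add: continuous_on_eq_continuous_at)
  moreover have "(\<lambda>n. (1 - inverse (real (Suc (Suc n)))) *\<^sub>R y) \<longlonglongrightarrow> (1 - 0) *\<^sub>R y"
    by (intro tendsto_scaleR tendsto_diff tendsto_const LIMSEQ_Suc[OF LIMSEQ_inverse_real_of_nat])
  ultimately have lim: "(\<lambda>n. v ((1 - inverse (real (Suc (Suc n)))) *\<^sub>R y)) \<longlonglongrightarrow> v y"
    by (intro isCont_tendsto_compose[of y v]) auto
  have "v x - v ((1 - inverse (real (Suc (Suc n)))) *\<^sub>R y) \<le> vmax r - vmin r" for n
  proof (rule oscillation[OF r])
    let ?t = "1 - inverse (real (Suc (Suc n)))"
    have t: "0 < ?t" "?t < 1" by (auto simp: field_simps)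
    have "norm (?t *\<^sub>R y) = ?t * norm x" using t y by simp
    then show "0 < norm (?t *\<^sub>R y)" "norm (?t *\<^sub>R y) < norm x" using t x by (simp_all only: mult_pos_pos, simp)
  qed (use x in auto)
  then have "v x - (vmax r - vmin r) \<le> v ((1 - inverse (real (Suc (Suc n)))) *\<^sub>R y)" for n by (simp add: algebra_simps)
  then have "v x - (vmax r - vmin r) \<le> v y" by (intro LIMSEQ_le_const[OF lim]) blast
  then show ?thesis using y by simp
qed

text \<open>The quotient \<open>Q\<close> converges as the radius decreases, because it is monotone
  and bounded below. Since v differs from its spherical minimum by a bounded amount and \<mu> tends
  to infinity, v / \<mu> has the same limit.\<close>

lemma limit_exists:
  obtains c0 where "c0 \<ge> 0" "((\<lambda>x. v x / mu p x) \<longlongrightarrow> c0) (at 0)"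
proof -
  define R where "R = R0 / 2"
  have R: "0 < R" "R < R0" "R \<le> R0" using R0 by (auto simp: R_def)
  define Q where "Q r = (vmin r - vmin R) / (mur r - mur R)" for r
  have vr: "vmin R \<le> vmin r" if rr: "0 < r" "r < R" for r
  proof -
    have rR: "r \<le> R0" using rr R by simp
    obtain x where "norm x = r" "v x = vmin r" using vmin_attained[OF rr(1) rR] by blast
    then show ?thesis using min_principle[OF R(3), of x] rr by simp
  qed
  have den: "mur r - mur R > 0" if "0 < r" "r < R" for r using mur_less[OF that] by simp
  have Q0: "Q r \<ge> 0" if "0 < r" "r < R" for r
    unfolding Q_def using vr[OF that] den[OF that] by simp
  \<comment> \<open>The p-harmonic function with the values vmin(r') and vmin(R) on the two
    outermost spheres stays below v between them. The case of quotient 0 is separate because the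
    comparison needs a nonzero coefficient of \<mu>.\<close>
  have Qmono: "Q r' \<le> Q r" if rr: "0 < r'" "r' < r" "r < R" for r r'
  proof (cases "Q r' = 0")
    case True
    then show ?thesis using Q0[of r] rr by simp
  next
    case False
    have r'R: "r' < R" using rr by simp
    have r0R: "0 < r" "r \<le> R0" using rr R by auto
    obtain x where x: "norm x = r" "v x = vmin r" using vmin_attained[OF r0R] by blast
    have "vmin R - Q r' * mur R + Q r' * mu p x \<le> v x"
    proof (rule harmonic_lower_bound[OF rr(1) r'R R(3) False])
      fix y :: 'a assume y: "norm y = r' \<or> norm y = R"
      have "vmin R - Q r' * mur R + Q r' * mu p y = vmin R + Q r' * (mur (norm y) - mur R)"
        by (simp add: mur right_diff_distrib)
      also have "\<dots> \<le> v y"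
        using y
      proof
        assume yr: "norm y = r'"
        have "Q r' * (mur r' - mur R) = vmin r' - vmin R" using den[OF rr(1) r'R] by (simp add: Q_def)
        then show ?thesis using vmin_le[of r' y] yr rr R by simp
      next
        assume "norm y = R"
        then show ?thesis using vmin_le[OF R(1,3), of y] by simp
      qed
      finally show "vmin R - Q r' * mur R + Q r' * mu p y \<le> v y" .
    qed (use x rr in auto)
    then have "Q r' * (mur r - mur R) \<le> vmin r - vmin R" using x by (simp add: mur right_diff_distrib)
    moreover have "mur r - mur R > 0" using den[of r] rr by simp
    ultimately show ?thesis unfolding Q_def[of r] by (simp add: pos_le_divide_eq)
  qed
  define c0 where "c0 = Inf (Q ` {0<..<R})"
  have ne: "Q ` {0<..<R} \<noteq> {}" using R by auto
  have bb: "bdd_below (Q ` {0<..<R})" by (rule bdd_belowI[of _ 0]) (use Q0 in auto)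
  have c0: "c0 \<ge> 0" unfolding c0_def by (rule cInf_greatest[OF ne]) (use Q0 in auto)
  have nlim: "filterlim (norm :: 'a \<Rightarrow> real) (at_right 0) (at 0)"
    unfolding filterlim_at by (auto intro!: tendsto_eq_intros simp: eventually_at_filter)
  have "(Q \<longlongrightarrow> c0) (at_right 0)"
  proof (rule order_tendstoI)
    fix a assume "a < c0"
    then have "a < Q r" if "0 < r" "r < R" for r
      using cInf_lower[OF _ bb, of "Q r"] that by (force simp: c0_def)
    then show "\<forall>\<^sub>F r in at_right 0. a < Q r" using R by (auto simp: eventually_at_right_field)
  next
    fix a assume "c0 < a"
    then have "\<exists>z\<in>Q ` {0<..<R}. z < a" unfolding c0_def by (rule cInf_lessD[OF ne])
    then obtain r where r: "0 < r" "r < R" "Q r < a" by auto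
    then have "Q r' < a" if "0 < r'" "r' < r" for r' using Qmono[OF that r(2)] by simp
    then show "\<forall>\<^sub>F r in at_right 0. Q r < a" using r by (auto simp: eventually_at_right_field)
  qed
  from filterlim_compose[OF this nlim] have Qlim: "((\<lambda>x::'a. Q (norm x)) \<longlongrightarrow> c0) (at 0)" .
  have il: "((\<lambda>x::'a. inverse (mu p x)) \<longlongrightarrow> 0) (at 0)"
    by (rule tendsto_inverse_0_at_top[OF mu_tendsto[OF p]])
  \<comment> \<open>This is vmin(|x|) / \<mu>(x), rewritten so that its limit can be read
    off.\<close>
  let ?f = "\<lambda>x::'a. Q (norm x) * (1 - mur R * inverse (mu p x)) + vmin R * inverse (mu p x)"
  let ?K = "vmax R - vmin R"
  have fl: "(?f \<longlongrightarrow> c0 * (1 - mur R * 0) + vmin R * 0) (at 0)" by (intro tendsto_intros Qlim il)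
  have fu: "((\<lambda>x. ?f x + ?K * inverse (mu p x)) \<longlongrightarrow> c0 * (1 - mur R * 0) + vmin R * 0 + ?K * 0) (at 0)" by (intro tendsto_intros Qlim il)
  have ev: "\<forall>\<^sub>F x::'a in at 0. ?f x \<le> v x / mu p x \<and> v x / mu p x \<le> ?f x + ?K * inverse (mu p x)"
  proof -
    have "\<forall>\<^sub>F x::'a in at 0. mu p x > 0" using mu_tendsto[OF p] unfolding filterlim_at_top_dense by blast
    moreover have "\<forall>\<^sub>F x::'a in at 0. x \<noteq> 0 \<and> norm x < R" using R by (auto simp: eventually_at intro!: exI[of _ R])
    ultimately show ?thesis
    proof eventually_elim
      case (elim x)
      then have x: "0 < norm x" "norm x < R" by auto
      have "Q (norm x) * (mu p x - mur R) = vmin (norm x) - vmin R" using den[OF x] by (simp add: Q_def mur)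
      then have "vmin (norm x) = Q (norm x) * (mu p x - mur R) + vmin R" by simp
      then have f: "vmin (norm x) / mu p x = ?f x" using elim(1) by (simp add: field_simps)
      have "vmin (norm x) \<le> v x" using vmin_le[of "norm x" x] x R by simp
      then have "vmin (norm x) / mu p x \<le> v x / mu p x" using elim(1) by (simp add: divide_right_mono)
      moreover have "v x / mu p x \<le> (vmin (norm x) + ?K) / mu p x"
        using oscillation_sphere[OF R(1,2) x] elim(1) by (simp add: divide_right_mono)
      ultimately show ?case unfolding f[symmetric] by (simp add: divide_inverse distrib_right)
    qed
  qed
  have "((\<lambda>x. v x / mu p x) \<longlongrightarrow> c0) (at 0)"
    by (rule tendsto_sandwich[where f="?f" and h="\<lambda>x. ?f x + ?K * inverse (mu p x)"])
      (use ev fl fu in \<open>auto elim: eventually_mono\<close>)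
  with c0 show ?thesis by (rule that)
qed

end

lemma dominated_weight:
  fixes g :: "'a::euclidean_space \<Rightarrow> real"
  assumes g: "integrable lborel g" and h [measurable]: "\<And>L. h L \<in> borel_measurable borel"
    and b: "\<And>L x. L > 0 \<Longrightarrow> \<bar>h L x * g x\<bar> \<le> \<bar>g x\<bar>"
    and lim: "\<And>x. x \<noteq> 0 \<Longrightarrow> ((\<lambda>L::real. h L x) \<longlongrightarrow> 1) at_top"
  shows "((\<lambda>L. LINT x|lborel. h L x * g x) \<longlongrightarrow> (LINT x|lborel. g x)) at_top"
proof (rule integral_dominated_convergence_at_top[where w="\<lambda>x. \<bar>g x\<bar>"])
  show gm [measurable]: "g \<in> borel_measurable lborel" using g by auto
  have [measurable]: "h L \<in> borel_measurable lborel" for L using h[of L] by simp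
  show "(\<lambda>x. h L x * g x) \<in> borel_measurable lborel" for L by measurable
  show "integrable lborel (\<lambda>x. \<bar>g x\<bar>)" using g by simp
  show "AE x in lborel. ((\<lambda>L. h L x * g x) \<longlongrightarrow> g x) at_top"
    using AE_lborel_singleton[of "0::'a"]
  proof eventually_elim
    case (elim x)
    have "((\<lambda>L. h L x * g x) \<longlongrightarrow> 1 * g x) at_top" by (intro tendsto_mult lim elim tendsto_const)
    then show ?case by simp
  qed
  show "\<forall>\<^sub>F L in at_top. AE x in lborel. norm (h L x * g x) \<le> \<bar>g x\<bar>"
    using eventually_gt_at_top[of "0::real"] by eventually_elim (use b in \<open>auto intro!: AE_I2\<close>)
qed

text \<open>The sharp form of Young's inequality, with equality at b = s a. Here constants matter:
  with a lossy inequality the mass would be determined only up to a factor.\<close>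

lemma young_weighted:
  fixes a b s p :: real
  assumes p: "p > 1" and ab: "a \<ge> 0" "b \<ge> 0" and s: "s > 0"
  shows "a powr (p - 1) * b \<le> (1 / p) * s powr (1 - p) * b powr p + (1 - 1 / p) * s * a powr p"
proof (cases "a = 0 \<or> b = 0")
  case True
  have "0 \<le> (1 / p) * s powr (1 - p) * b powr p" "0 \<le> (1 - 1 / p) * s * a powr p" using p s by auto
  then show ?thesis using True by auto
next
  case False
  then have a: "a > 0" and b: "b > 0" using ab by auto
  define X where "X = s powr (1 - p) * b powr p"
  define Y where "Y = s * a powr p"
  have XY: "X > 0" "Y > 0" using a b s by (auto simp: X_def Y_def)
  have "X powr (1 / p) * Y powr (1 - 1 / p) \<le> (1 / p) * X + (1 - 1 / p) * Y"
    using Youngs_inequality_0[of "1 / p" "1 - 1 / p" X Y] p XY by simp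
  moreover have "X powr (1 / p) * Y powr (1 - 1 / p) = a powr (p - 1) * b"
  proof -
    have "X powr (1 / p) = s powr ((1 - p) / p) * b" using p b s by (simp add: X_def powr_mult powr_powr)
    moreover have "Y powr (1 - 1 / p) = s powr (1 - 1 / p) * a powr (p - 1)"
      using p a s by (simp add: Y_def powr_mult powr_powr right_diff_distrib)
    moreover have "s powr ((1 - p) / p) * s powr (1 - 1 / p) = 1"
    proof -
      have "(1 - p) / p + (1 - 1 / p) = 0" using p by (simp add: field_simps)
      then show ?thesis using s by (simp flip: powr_add)
    qed
    ultimately show ?thesis by (simp add: mult_ac)
  qed
  ultimately show ?thesis by (simp add: X_def Y_def mult.assoc)
qed

lemma integral_combination3:
  fixes f g h :: "'a \<Rightarrow> real"
  assumes "integrable M f" "integrable M g" "integrable M h"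
  shows "integrable M (\<lambda>x. a * f x + (b * g x + c * h x))"
    and "(LINT x|M. a * f x + (b * g x + c * h x)) = a * integral\<^sup>L M f + (b * integral\<^sup>L M g + c * integral\<^sup>L M h)"
  using assms by simp_all

context hj_solution
begin

subsection \<open>The mass in terms of the limit\<close>

definition mu_energy :: "real \<Rightarrow> real" where
  "mu_energy L = (LINT x::'a|lborel. \<zeta> x * (2 * max 0 (1 - mu p x / L) / L) * norm (dmu p x) powr p)"

lemma mu_measurable [measurable]: "(mu p :: 'a \<Rightarrow> real) \<in> borel_measurable borel"
  unfolding mu_def Let_def by measurable

lemma eta_tendsto_at_top: "x \<noteq> 0 \<Longrightarrow> ((\<lambda>L. eta p L (x::'a)) \<longlongrightarrow> 1) at_top"
proof -
  assume x: "x \<noteq> 0"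
  have "((\<lambda>L::real. (max 0 (1 - mu p x * inverse L))\<^sup>2) \<longlongrightarrow> (max 0 (1 - mu p x * 0))\<^sup>2) at_top"
    by (intro tendsto_power tendsto_max tendsto_diff tendsto_mult tendsto_const tendsto_inverse_0_at_top filterlim_ident)
  then show ?thesis using x by (simp add: eta_def divide_inverse)
qed

lemma eta_measurable: "(\<lambda>x. eta p L (x::'a)) \<in> borel_measurable borel"
  unfolding eta_def by measurable

lemma eta_dominated:
  assumes "\<And>x. norm x > R0 \<Longrightarrow> g x = 0" "L > 0"
  shows "\<bar>eta p L (x::'a) * g x\<bar> \<le> \<bar>g x\<bar>"
proof (cases "norm x > R0")
  case False
  then have "norm x \<le> 1" using R0 by simp
  then have "\<bar>eta p L x\<bar> \<le> 1" using eta_bounds[of L x] assms(2) by simp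
  then show ?thesis unfolding abs_mult by (intro mult_left_le_one_le) auto
qed (use assms in simp)

lemma eta_dominated_limit:
  assumes g: "integrable lborel g" "\<And>x. norm x > R0 \<Longrightarrow> g x = 0"
  shows "((\<lambda>L. LINT x::'a|lborel. eta p L x * g x) \<longlongrightarrow> (LINT x|lborel. g x)) at_top"
    and "L > 0 \<Longrightarrow> integrable lborel (\<lambda>x. eta p L x * g x)"
proof -
  show "((\<lambda>L. LINT x::'a|lborel. eta p L x * g x) \<longlongrightarrow> (LINT x|lborel. g x)) at_top"
    by (rule dominated_weight[where h="\<lambda>L. eta p L", OF g(1)])
      (use eta_measurable eta_dominated[of g] g(2) eta_tendsto_at_top in auto)
  assume L: "L > 0"
  show "integrable lborel (\<lambda>x. eta p L x * g x)"
  proof (rule integrable_by_bound[where w="\<lambda>x. \<bar>g x\<bar>"])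
    have "g \<in> borel_measurable borel" using g(1) borel_measurable_integrable by fastforce
    then show "(\<lambda>x. eta p L x * g x) \<in> borel_measurable borel" using eta_measurable by measurable
  qed (use g eta_dominated[of g] L in auto)
qed

lemma zeta_far: "norm x > R0 \<Longrightarrow> \<zeta> x = 0" "norm x > R0 \<Longrightarrow> d\<zeta> x = 0"
  using zeta(6,7)[of x] R0 by auto

lemma zeta_0: "\<zeta> 0 = 1" using zeta(4)[of 0] R0 by simp

lemma radial_zeta: "(LINT x|lborel. radial_field x \<bullet> d\<zeta> x) = - flux_const TYPE('a)"
  using radial_flux(1)[OF zeta_test(2)] zeta_0 by simp

text \<open>By the flux identity this energy is minus the integral of \<open>eta\<close> times the
  flux against the cutoff gradient, and \<open>eta\<close> tends to 1.\<close>

lemma mu_energy_tendsto: "(mu_energy \<longlongrightarrow> flux_const TYPE('a)) at_top"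
proof -
  have "((\<lambda>L. LINT x|lborel. eta p L x * (radial_field x \<bullet> d\<zeta> x)) \<longlongrightarrow> (LINT x|lborel. radial_field x \<bullet> d\<zeta> x)) at_top"
    by (rule eta_dominated_limit(1)[OF radial_flux(2)[OF zeta_test(2)]]) (simp add: zeta_far)
  then have "((\<lambda>L. - (LINT x|lborel. eta p L x * (radial_field x \<bullet> d\<zeta> x))) \<longlongrightarrow> flux_const TYPE('a)) at_top"
    unfolding radial_zeta by (simp add: tendsto_minus_cancel_left)
  moreover have "\<forall>\<^sub>F L in at_top. - (LINT x|lborel. eta p L x * (radial_field x \<bullet> d\<zeta> x)) = mu_energy L"
    using eventually_gt_at_top[of "0::real"]
    by eventually_elim (simp only: mu_energy_def mu_energy_identity(1)[OF zeta_test(2)])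
  ultimately show ?thesis by (rule Lim_transform_eventually)
qed

lemma dmu_annulus_integrable:
  assumes "0 < \<rho>"
  shows "integrable lborel (\<lambda>x::'a. indicator (cball 0 r - ball 0 \<rho>) x * norm (dmu p x) powr p)"
proof -
  have "continuous_on (cball 0 r - ball (0::'a) \<rho>) (dmu p :: 'a \<Rightarrow> 'a)"
    by (rule continuous_on_dmu) (use assms in auto)
  then have "continuous_on (cball 0 r - ball (0::'a) \<rho>) (\<lambda>x::'a. norm (dmu p x) powr p)"
    using p by (intro continuous_on_powr' continuous_on_norm) (auto intro: continuous_intros)
  from borel_integrable_compact[OF _ this] show ?thesis by (simp add: compact_diff)
qed

lemma max_ratio_eq: "L > 0 \<Longrightarrow> 2 * max 0 (1 - t / L) / L = 2 * max 0 (L - t) / L\<^sup>2" for L t :: real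
proof -
  assume L: "L > 0"
  have "1 - t / L = (L - t) / L" using L by (simp add: field_simps)
  moreover have "max 0 (a / L) = max 0 a / L" for a
    using L by (cases "a \<ge> 0") (auto simp: max_def divide_nonpos_pos dest: antisym)
  ultimately show ?thesis by (simp add: power2_eq_square)
qed

text \<open>Truncating b at level L corresponds to truncating a = b / s at level L / s; the factor 1
  / s is what the change of level leaves in the normalized weight.\<close>

lemma weight_compare:
  fixes a b s L :: real
  assumes s: "s > 0" and L: "L > 0" and ab: "s * a \<le> b"
  shows "2 * max 0 (L - b) / L\<^sup>2 \<le> (1 / s) * (2 * max 0 (L / s - a) / (L / s)\<^sup>2)"
proof -
  have "max 0 (L - b) \<le> max 0 (s * (L / s - a))" using ab s by (intro max.mono) (auto simp: right_diff_distrib)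
  also have "\<dots> = s * max 0 (L / s - a)"
    using s by (cases "L / s - a \<ge> 0") (auto simp: max_def zero_le_mult_iff mult_le_0_iff not_le intro: antisym)
  finally have "2 * max 0 (L - b) / L\<^sup>2 \<le> 2 * (s * max 0 (L / s - a)) / L\<^sup>2"
    by (intro divide_right_mono mult_left_mono) auto
  also have "\<dots> = (1 / s) * (2 * max 0 (L / s - a) / (L / s)\<^sup>2)" using s L by (simp add: power_divide power2_eq_square)
  finally show ?thesis .
qed

text \<open>The test function \<open>\<zeta> \<eta>\<^sub>L\<close> in the weak equation and Young's inequality; near the origin \<open>v \<le> s \<mu>\<^sub>p\<close>
  turns the \<open>\<mu>\<^sub>p\<close>-weight of the term \<open>|\<nabla>v|\<^sup>p\<close> into a \<open>v\<close>-weight.\<close>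

lemma mass_upper:
  assumes s: "s > 0" and \<rho>: "\<rho> > 0" and vs: "\<And>x. 0 < norm x \<Longrightarrow> norm x < \<rho> \<Longrightarrow> v x \<le> s * mu p x"
  shows "mass \<le> s powr (p - 1) * flux_const TYPE('a)"
proof -
  define T where "T = (LINT x|lborel. indicator (cball 0 (R0 / 2) - ball 0 \<rho>) x * norm (dv x) powr p)"
  have iT: "integrable lborel (\<lambda>x. indicator (cball 0 (R0 / 2) - ball 0 \<rho>) x * norm (dv x) powr p)"
    by (rule annulus_integrable) (use \<rho> R0 p in auto)
  \<comment> \<open>The equation tested with the cutoff at 0, before the cutoff is removed. It
    converges to the mass, and for finite L it equals a mixed energy of v and \<mu>.\<close>
  define H where "H L = (LINT x|lborel. eta p L x * (p_field p (dv x) \<bullet> d\<zeta> x)) - (LINT x|lborel. eta p L x * (norm (dv x) powr q * \<zeta> x))" for L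
  have Hlim: "(H \<longlongrightarrow> mass) at_top"
    unfolding H_def mass_def defect_def
    by (intro tendsto_diff eta_dominated_limit(1) flux_integrable[OF zeta_test(1)]) (simp_all add: zeta_far)
  have main: "H L \<le> (1 / p) * s powr (p - 1) * mu_energy L + (1 - 1 / p) * energy_mean (s * L) \<zeta> + (1 - 1 / p) / s * 2 * T * inverse L"
    if L: "L > 0" for L
  proof -
    let ?w = "\<lambda>x::'a. 2 * max 0 (1 - mu p x / L) / L"
    let ?W = "\<lambda>x. 2 * max 0 (s * L - v x) / (s * L)\<^sup>2"
    let ?e = "\<lambda>x. 2 * max 0 (s * L - v x) * norm (dv x) powr p * \<zeta> x"
    let ?m = "\<lambda>x. \<zeta> x * ?w x * norm (dmu p x) powr p"
    let ?t = "\<lambda>x. indicator (cball 0 (R0 / 2) - ball 0 \<rho>) x * norm (dv x) powr p"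
    have sL: "s * L > 0" using s L by simp
    have C: "C1_test U (\<lambda>x. eta p L x * \<zeta> x) (\<lambda>x. eta p L x *\<^sub>R d\<zeta> x + \<zeta> x *\<^sub>R deta p L x)"
      by (rule eta_C1_test[OF \<Omega>(1) zeta_test(3) L])
    have i1: "integrable lborel (\<lambda>x. eta p L x * (p_field p (dv x) \<bullet> d\<zeta> x))"
      and i2: "integrable lborel (\<lambda>x. eta p L x * (norm (dv x) powr q * \<zeta> x))"
      by (intro eta_dominated_limit(2) flux_integrable[OF zeta_test(1)] L; simp add: zeta_far)+
    have i3: "integrable lborel (\<lambda>x. p_field p (dv x) \<bullet> (eta p L x *\<^sub>R d\<zeta> x + \<zeta> x *\<^sub>R deta p L x))"
      by (rule C1_test_integrable(1)[OF C cont_flux])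
    have pt: "\<zeta> x * ?w x * (p_field p (dv x) \<bullet> dmu p x)
        = eta p L x * (p_field p (dv x) \<bullet> d\<zeta> x) - p_field p (dv x) \<bullet> (eta p L x *\<^sub>R d\<zeta> x + \<zeta> x *\<^sub>R deta p L x)" for x
      by (simp add: inner_add_right inner_diff_right deta_def)
    have i4: "integrable lborel (\<lambda>x. \<zeta> x * ?w x * (p_field p (dv x) \<bullet> dmu p x))"
      unfolding pt by (intro Bochner_Integration.integrable_diff i1 i3)
    have "H L = (LINT x|lborel. \<zeta> x * ?w x * (p_field p (dv x) \<bullet> dmu p x))"
      unfolding pt Bochner_Integration.integral_diff[OF i1 i3] weak[OF C] H_def by (simp only: mult_ac)
    also have "\<dots> \<le> (LINT x|lborel. (1 / p) * s powr (p - 1) * ?m x + ((1 - 1 / p) * (?e x / (s * L)\<^sup>2) + (1 - 1 / p) / s * 2 / L * ?t x))"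
    proof (rule integral_mono[OF i4])
      show "integrable lborel (\<lambda>x. (1 / p) * s powr (p - 1) * ?m x + ((1 - 1 / p) * (?e x / (s * L)\<^sup>2) + (1 - 1 / p) / s * 2 / L * ?t x))"
        by (rule integral_combination3(1)[OF mu_energy_identity(2)[OF zeta_test(2) L]
            integrable_divide[OF truncated_identity_origin(2)[OF zeta_test(1) sL]] iT])
      fix x :: 'a
      have z: "0 \<le> \<zeta> x" "\<zeta> x \<le> 1" using zeta(2,3)[of x] by auto
      have w0: "0 \<le> ?w x" using L by simp
      have W0: "0 \<le> ?W x" by simp
      have t0: "0 \<le> ?t x" by simp
      have p1: "0 \<le> 1 - 1 / p" "0 \<le> 1 / p" using p by auto
      \<comment> \<open>Inside the ball of radius \<rho> the hypothesis on v converts the weights;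
        outside it, where nothing is assumed, both truncation weights are O(1 / L) on the
        annulus.\<close>
      have weight: "\<zeta> x * ?w x * norm (dv x) powr p \<le> s * (\<zeta> x * ?W x * norm (dv x) powr p) + 2 / L * ?t x"
      proof (cases "x = 0")
        case True
        then show ?thesis using out(2)[of 0] p by simp
      next
        case x0: False
        show ?thesis
        proof (cases "norm x < \<rho>")
          case True
          have "(1 / s) * v x \<le> mu p x" using vs[of x] True x0 s by (simp add: pos_divide_le_eq mult.commute)
          from weight_compare[OF _ L this] s have "?w x \<le> s * ?W x"
            unfolding max_ratio_eq[OF L] by (simp add: mult.commute)
          then have "(\<zeta> x * norm (dv x) powr p) * ?w x \<le> (\<zeta> x * norm (dv x) powr p) * (s * ?W x)"
            using z by (intro mult_left_mono) auto
          moreover have "0 \<le> 2 / L * ?t x" using L by simp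
          moreover have "z * W * n \<le> k * (z * w * n) + t" if "(z * n) * W \<le> (z * n) * (k * w)" "0 \<le> t" for z W n k w t :: real
            using that by (simp add: mult_ac)
          ultimately show ?thesis by blast
        next
          case False
          have nn: "0 \<le> s * (\<zeta> x * ?W x * norm (dv x) powr p)" using s z by simp
          show ?thesis
          proof (cases "norm x \<le> R0 / 2")
            case True
            then have "max 0 (1 - mu p x / L) \<le> 1" using mu_nonneg[of x] L R0 by simp
            then have "?w x \<le> 2 * 1 / L" using L by (intro divide_right_mono mult_left_mono) auto
            then have "\<zeta> x * ?w x \<le> 1 * (2 * 1 / L)" using z w0 by (intro mult_mono) auto
            then have "\<zeta> x * ?w x * norm (dv x) powr p \<le> 2 / L * norm (dv x) powr p"
              by (intro mult_right_mono) auto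
            then show ?thesis using nn True False by simp
          next
            case f: False
            then show ?thesis using nn t0 zeta(6)[of x] L by simp
          qed
        qed
      qed
      have "p_field p (dv x) \<bullet> dmu p x \<le> norm (dv x) powr (p - 1) * norm (dmu p x)"
        using norm_cauchy_schwarz[of "p_field p (dv x)" "dmu p x"] by (simp only: norm_p_field)
      \<comment> \<open>The parameter 1 / s gives equality when |\<nabla>v| = s |\<nabla>\<mu>|, the
        relation that would hold for v = s \<mu>.\<close>
      also have "\<dots> \<le> (1 / p) * s powr (p - 1) * norm (dmu p x) powr p + (1 - 1 / p) * (1 / s) * norm (dv x) powr p"
        using young_weighted[OF p(1), of "norm (dv x)" "norm (dmu p x)" "1 / s"] s
          powr_minus_divide[of s "1 - p"] by (simp add: powr_divide)
      finally have "\<zeta> x * ?w x * (p_field p (dv x) \<bullet> dmu p x) \<le> \<zeta> x * ?w x * ((1 / p) * s powr (p - 1) * norm (dmu p x) powr p + (1 - 1 / p) * (1 / s) * norm (dv x) powr p)"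
        by (rule mult_left_mono[OF _ mult_nonneg_nonneg[OF z(1) w0]])
      also have "\<dots> = (1 / p) * s powr (p - 1) * ?m x + (1 - 1 / p) * (1 / s) * (\<zeta> x * ?w x * norm (dv x) powr p)"
      proof -
        have "z * w * (a * b * m + k * r * n) = a * b * (z * w * m) + k * r * (z * w * n)" for z w a b n k m r :: real
          by (simp only: distrib_left mult_ac)
        then show ?thesis by blast
      qed
      also have "(1 - 1 / p) * (1 / s) * (\<zeta> x * ?w x * norm (dv x) powr p)
          \<le> (1 - 1 / p) * (1 / s) * (s * (\<zeta> x * ?W x * norm (dv x) powr p) + 2 / L * ?t x)"
        using p1 s by (intro mult_left_mono weight mult_nonneg_nonneg) auto
      also have "\<dots> = (1 - 1 / p) * (?e x / (s * L)\<^sup>2) + (1 - 1 / p) / s * 2 / L * ?t x"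
      proof -
        have "k * (1 / s) * (s * (z * (W / D) * n) + 2 / L * t) = k * (W * n * z / D) + k / s * 2 / L * t" for k z W D n t :: real
          using s L by (simp add: distrib_left mult_ac)
        then show ?thesis by blast
      qed
      finally show "\<zeta> x * ?w x * (p_field p (dv x) \<bullet> dmu p x)
        \<le> (1 / p) * s powr (p - 1) * ?m x + ((1 - 1 / p) * (?e x / (s * L)\<^sup>2) + (1 - 1 / p) / s * 2 / L * ?t x)" by simp
    qed
    also have "\<dots> = (1 / p) * s powr (p - 1) * mu_energy L + ((1 - 1 / p) * energy_mean (s * L) \<zeta> + (1 - 1 / p) / s * 2 / L * T)"
    proof -
      have i: "integrable lborel (\<lambda>x. ?e x / (s * L)\<^sup>2)"
        by (rule integrable_divide) (rule truncated_identity_origin(2)[OF zeta_test(1) sL])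
      have e: "energy_mean (s * L) \<zeta> = (LINT x|lborel. ?e x / (s * L)\<^sup>2)" unfolding energy_mean_def by (rule integral_divide_zero[symmetric])
      show ?thesis unfolding mu_energy_def T_def e
        by (rule integral_combination3(2)[OF mu_energy_identity(2)[OF zeta_test(2) L] i iT])
    qed
    finally have "H L \<le> (1 / p) * s powr (p - 1) * mu_energy L + ((1 - 1 / p) * energy_mean (s * L) \<zeta> + (1 - 1 / p) / s * 2 / L * T)" .
    moreover have "k / L * T = k * T * inverse L" for k by (simp add: divide_inverse)
    ultimately show ?thesis by (simp only: add.assoc)
  qed
  have sl: "filterlim (\<lambda>L. s * L) at_top at_top"
    using s by (intro filterlim_tendsto_pos_mult_at_top[OF tendsto_const] filterlim_ident) auto
  have "((\<lambda>L. (1 / p) * s powr (p - 1) * mu_energy L + (1 - 1 / p) * energy_mean (s * L) \<zeta> + (1 - 1 / p) / s * 2 * T * inverse L)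
     \<longlongrightarrow> (1 / p) * s powr (p - 1) * flux_const TYPE('a) + (1 - 1 / p) * mass + (1 - 1 / p) / s * 2 * T * 0) at_top"
    unfolding mass_def
    by (intro tendsto_add tendsto_mult[OF tendsto_const] mu_energy_tendsto
        filterlim_compose[OF energy_mean_tendsto[OF zeta_test(1)] sl] tendsto_inverse_0_at_top filterlim_ident)
  from tendsto_le[OF _ this Hlim eventually_mono[OF eventually_gt_at_top[of 0] main]] have "mass \<le> (1 / p) * s powr (p - 1) * flux_const TYPE('a) + (1 - 1 / p) * mass"
    by (simp only: mult_zero_right add_0_right trivial_limit_at_top_linorder not_False_eq_True)
  \<comment> \<open>The mass stands on both sides, on the right with the factor 1 - 1/p; subtraction
    leaves the inequality without loss.\<close>
  then have "(1 / p) * mass \<le> (1 / p) * (s powr (p - 1) * flux_const TYPE('a))" by (simp add: algebra_simps)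
  then show ?thesis using p by (simp add: divide_le_cancel)
qed

text \<open>The field \<open>|x|\<^sup>-\<^sup>N x\<close> tested with \<open>(max 0 (L - v))\<^sup>2 \<zeta>\<close>, which vanishes near the origin since \<open>v\<close> blows up there.\<close>

lemma mass_lower:
  assumes s: "s > 0" and \<rho>: "\<rho> > 0" and vs: "\<And>x. 0 < norm x \<Longrightarrow> norm x < \<rho> \<Longrightarrow> s * mu p x \<le> v x"
  shows "s powr (p - 1) * flux_const TYPE('a) \<le> mass"
proof -
  define T where "T = (LINT x::'a|lborel. indicator (cball 0 (R0 / 2) - ball 0 \<rho>) x * norm (dmu p x) powr p)"
  note iT = dmu_annulus_integrable[OF \<rho>, of "R0 / 2"]
  define H where "H L = - (LINT x|lborel. (max 0 (L - v x) / L)\<^sup>2 * (radial_field x \<bullet> d\<zeta> x))" for L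
  have Hlim: "(H \<longlongrightarrow> flux_const TYPE('a)) at_top"
  proof -
    have "((\<lambda>L. LINT x|lborel. (max 0 (L - v x) / L)\<^sup>2 * (radial_field x \<bullet> d\<zeta> x)) \<longlongrightarrow> (LINT x|lborel. radial_field x \<bullet> d\<zeta> x)) at_top"
    proof (rule dominated_weight[where h="\<lambda>L x. (max 0 (L - v x) / L)\<^sup>2", OF radial_flux(2)[OF zeta_test(2)]])
      show "(\<lambda>x. (max 0 (L - v x) / L)\<^sup>2) \<in> borel_measurable borel" for L by measurable
      show "\<bar>(max 0 (L - v x) / L)\<^sup>2 * (radial_field x \<bullet> d\<zeta> x)\<bar> \<le> \<bar>radial_field x \<bullet> d\<zeta> x\<bar>" if "L > 0" for L x
        unfolding abs_mult using sq_ratio_bounds[OF that, of x] by (intro mult_left_le_one_le) auto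
      show "((\<lambda>L. (max 0 (L - v x) / L)\<^sup>2) \<longlongrightarrow> 1) at_top" for x
        using tendsto_power[OF tendsto_max_ratio[of "v x"], of 2] by simp
    qed
    from tendsto_minus[OF this] show ?thesis unfolding radial_zeta H_def by simp
  qed
  have main: "H L \<le> (1 / p) * s powr (1 - p) * energy_mean L \<zeta> + (1 - 1 / p) * mu_energy (L / s) + (1 - 1 / p) * s * 2 * T * inverse L"
    if L: "L > 0" for L
  proof -
    let ?W = "\<lambda>x. 2 * max 0 (L - v x) / L\<^sup>2"
    let ?w = "\<lambda>x::'a. 2 * max 0 (1 - mu p x / (L / s)) / (L / s)"
    let ?e = "\<lambda>x. 2 * max 0 (L - v x) * norm (dv x) powr p * \<zeta> x"
    let ?m = "\<lambda>x. \<zeta> x * ?w x * norm (dmu p x) powr p"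
    let ?t = "\<lambda>x::'a. indicator (cball 0 (R0 / 2) - ball 0 \<rho>) x * norm (dmu p x) powr p"
    have Ls: "L / s > 0" using s L by simp
    \<comment> \<open>The lower bound s \<mu> <= v makes v exceed L near the origin, so the
      truncation vanishes there and serves as its own cutoff.\<close>
    obtain \<rho>' where \<rho>': "0 < \<rho>'" "\<rho>' \<le> R0 / 3" "\<And>x. 0 < norm x \<Longrightarrow> norm x \<le> \<rho>' \<Longrightarrow> L \<le> v x"
    proof -
      have "\<forall>\<^sub>F x::'a in at 0. L / s \<le> mu p x"
        using mu_tendsto[OF p] unfolding filterlim_at_top by blast
      then obtain d where d: "d > 0" "\<And>x::'a. x \<noteq> 0 \<Longrightarrow> dist x 0 < d \<Longrightarrow> L / s \<le> mu p x"
        unfolding eventually_at by auto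
      show ?thesis
      proof (rule that[of "min (min (d / 2) (\<rho> / 2)) (R0 / 3)"])
        fix x :: 'a assume x: "0 < norm x" "norm x \<le> min (min (d / 2) (\<rho> / 2)) (R0 / 3)"
        have "norm x < d" "norm x < \<rho>" using x d(1) \<rho> by auto
        then have "L / s \<le> mu p x" "s * mu p x \<le> v x" using d(2)[of x] vs[of x] x by auto
        then show "L \<le> v x" using s by (simp add: pos_divide_le_eq mult.commute)
      qed (use d(1) \<rho> R0 in auto)
    qed
    have rr: "0 \<le> \<rho>' / 2" "\<rho>' / 2 < \<rho>'" using \<rho>' by auto
    let ?b = "ball_cut (\<rho>' / 2) \<rho>' :: 'a \<Rightarrow> real" and ?db = "dball_cut (\<rho>' / 2) \<rho>' :: 'a \<Rightarrow> 'a"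
    note b = ball_cut[where 'a='a, OF rr]
    have bt: "C1_test UNIV ?b ?db" by (rule b(1)) auto
    have tz: "C1_test UNIV (\<lambda>x. \<zeta> x + (- 1) * ?b x) (\<lambda>x. d\<zeta> x + (- 1) *\<^sub>R ?db x)"
      by (intro C1_test_add C1_test_const_mult bt zeta_test)
    define A where "A = cball 0 (R0 / 2) - ball (0::'a) (\<rho>' / 2)"
    \<comment> \<open>Subtracting a small cutoff makes \<zeta> vanish near 0, as test functions on
      the punctured domain must. The product with (L - v)_+^2 does not change, because the
      subtracted part lives where this factor is 0.\<close>
    have tU: "C1_test U (\<lambda>x. \<zeta> x + (- 1) * ?b x) (\<lambda>x. d\<zeta> x + (- 1) *\<^sub>R ?db x)"
    proof (rule C1_testI[OF openU])
      show "compact A" by (simp add: A_def compact_diff)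
      show "A \<subseteq> U" using ball_subset[of "R0 / 2"] R0 \<rho>' by (auto simp: A_def)
      show "GDERIV (\<lambda>x. \<zeta> x + (- 1) * ?b x) x :> d\<zeta> x + (- 1) *\<^sub>R ?db x" for x by (rule C1_test_gderiv[OF tz])
      show "continuous_on U (\<lambda>x. d\<zeta> x + (- 1) *\<^sub>R ?db x)" by (rule C1_test_cont_grad[OF tz])
      show "\<zeta> x + (- 1) * ?b x = 0" if "x \<notin> A" for x
      proof (cases "norm x \<le> R0 / 2")
        case True
        then have "norm x < \<rho>' / 2" using that by (auto simp: A_def)
        then show ?thesis using b(4)[of x] zeta(4)[of x] \<rho>' by simp
      next
        case False
        then show ?thesis using b(6)[of x] zeta(6)[of x] \<rho>' R0 by simp
      qed
      show "d\<zeta> x + (- 1) *\<^sub>R ?db x = 0" if "x \<notin> U" for x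
      proof (cases "x = 0")
        case True
        then show ?thesis using b(5)[of 0] zeta(5)[of 0] \<rho>' R0 by simp
      next
        case False
        then have "\<not> norm x \<le> R0 / 2" using that ball_subset[of "R0 / 2"] R0 by auto
        then show ?thesis using b(7)[of x] zeta(7)[of x] \<rho>' R0 by simp
      qed
    qed
    have g: "GDERIV (\<lambda>x. (max 0 (L - v x))\<^sup>2) x :> (2 * max 0 (L - v x)) *\<^sub>R (- dv x)" if "x \<in> U" for x
    proof (rule gderiv_pos_sq)
      show "GDERIV (\<lambda>x. L - v x) x :> - dv x"
        using gd[OF that] unfolding gderiv_def by (auto intro!: derivative_eq_intros)
    qed
    have C: "C1_test U (\<lambda>x. (max 0 (L - v x))\<^sup>2 * (\<zeta> x + (- 1) * ?b x))
      (\<lambda>x. (max 0 (L - v x))\<^sup>2 *\<^sub>R (d\<zeta> x + (- 1) *\<^sub>R ?db x) + (\<zeta> x + (- 1) * ?b x) *\<^sub>R ((2 * max 0 (L - v x)) *\<^sub>R (- dv x)))"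
      (is "C1_test U _ ?D")
      by (rule C1_test_mult[OF openU tU g]) (auto intro!: continuous_intros cont cont_v)
    have D0: "(LINT x|lborel. radial_field x \<bullet> ?D x) = 0"
      by (rule radial_flux_away[OF C1_test_mono[OF C]]) auto
    have iD: "integrable lborel (\<lambda>x. radial_field x \<bullet> ?D x)" by (rule radial_flux(2)[OF C])
    have i1: "integrable lborel (\<lambda>x. (max 0 (L - v x) / L)\<^sup>2 * (radial_field x \<bullet> d\<zeta> x))"
    proof (rule integrable_by_bound[where w="\<lambda>x. \<bar>radial_field x \<bullet> d\<zeta> x\<bar>"])
      have [measurable]: "(\<lambda>x. radial_field x \<bullet> d\<zeta> x) \<in> borel_measurable borel"
        using borel_measurable_integrable[OF radial_flux(2)[OF zeta_test(2)]] by simp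
      show "(\<lambda>x. (max 0 (L - v x) / L)\<^sup>2 * (radial_field x \<bullet> d\<zeta> x)) \<in> borel_measurable borel" by measurable
      show "\<bar>(max 0 (L - v x) / L)\<^sup>2 * (radial_field x \<bullet> d\<zeta> x)\<bar> \<le> \<bar>radial_field x \<bullet> d\<zeta> x\<bar>" for x
        unfolding abs_mult using sq_ratio_bounds[OF L, of x] by (intro mult_left_le_one_le) auto
    qed (use radial_flux(2)[OF zeta_test(2)] in simp)
    have pt: "\<zeta> x * ?W x * - (radial_field x \<bullet> dv x)
        = (radial_field x \<bullet> ?D x) / L\<^sup>2 - (max 0 (L - v x) / L)\<^sup>2 * (radial_field x \<bullet> d\<zeta> x)" for x
    proof -
      consider "x = 0" | "0 < norm x" "norm x \<le> \<rho>'" | "\<rho>' < norm x" by fastforce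
      then show ?thesis
      proof cases
        case 1
        then show ?thesis by (simp add: radial_field_def)
      next
        case 2
        then have "max 0 (L - v x) = 0" using \<rho>'(3)[OF 2] by simp
        then show ?thesis by simp
      next
        case 3
        then have "?b x = 0" "?db x = 0" using b(6,7)[of x] by auto
        then show ?thesis using L by (simp add: inner_diff_right power_divide diff_divide_distrib)
      qed
    qed
    have i4: "integrable lborel (\<lambda>x. \<zeta> x * ?W x * - (radial_field x \<bullet> dv x))"
      unfolding pt by (intro Bochner_Integration.integrable_diff integrable_divide iD i1)
    have "H L = (LINT x|lborel. \<zeta> x * ?W x * - (radial_field x \<bullet> dv x))"
      unfolding pt Bochner_Integration.integral_diff[OF integrable_divide[OF iD] i1] integral_divide_zero D0 H_def by simp
    also have "\<dots> \<le> (LINT x|lborel. (1 / p) * s powr (1 - p) * (?e x / L\<^sup>2) + ((1 - 1 / p) * ?m x + (1 - 1 / p) * s * 2 / L * ?t x))"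
    proof (rule integral_mono[OF i4])
      show "integrable lborel (\<lambda>x. (1 / p) * s powr (1 - p) * (?e x / L\<^sup>2) + ((1 - 1 / p) * ?m x + (1 - 1 / p) * s * 2 / L * ?t x))"
        by (rule integral_combination3(1)[OF integrable_divide[OF truncated_identity_origin(2)[OF zeta_test(1) L]]
            mu_energy_identity(2)[OF zeta_test(2) Ls] iT])
      fix x :: 'a
      have z: "0 \<le> \<zeta> x" "\<zeta> x \<le> 1" using zeta(2,3)[of x] by auto
      have w0: "0 \<le> ?w x" using L s by simp
      have W0: "0 \<le> ?W x" by simp
      have t0: "0 \<le> ?t x" by simp
      have p1: "0 \<le> 1 - 1 / p" "0 \<le> 1 / p" using p by auto
      have weight: "\<zeta> x * ?W x * norm (dmu p x) powr p \<le> (1 / s) * ?m x + 2 / L * ?t x"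
      proof (cases "x = 0")
        case True
        then show ?thesis using p by (simp add: dmu_def)
      next
        case x0: False
        show ?thesis
        proof (cases "norm x < \<rho>")
          case True
          have "s * mu p x \<le> v x" using vs[of x] True x0 by simp
          from weight_compare[OF s L this] have "?W x \<le> (1 / s) * ?w x"
            unfolding max_ratio_eq[OF Ls] .
          then have "(\<zeta> x * norm (dmu p x) powr p) * ?W x \<le> (\<zeta> x * norm (dmu p x) powr p) * ((1 / s) * ?w x)"
            using z by (intro mult_left_mono) auto
          moreover have "0 \<le> 2 / L * ?t x" using L by simp
          moreover have "z * W * n \<le> k * (z * w * n) + t" if "(z * n) * W \<le> (z * n) * (k * w)" "0 \<le> t" for z W n k w t :: real
            using that by (simp add: mult_ac)
          ultimately show ?thesis by blast
        next
          case False
          have nn: "0 \<le> (1 / s) * ?m x" using s z w0 by (intro mult_nonneg_nonneg) auto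
          show ?thesis
          proof (cases "norm x \<le> R0 / 2")
            case True
            have "max 0 (L - v x) \<le> L" using v_nonneg[of x] L by simp
            then have "?W x \<le> 2 * L / L\<^sup>2" by (intro divide_right_mono mult_left_mono) auto
            also have "2 * L / L\<^sup>2 = 2 / L" using L by (simp add: power2_eq_square)
            finally have "\<zeta> x * ?W x \<le> 1 * (2 / L)" using z W0 by (intro mult_mono) auto
            then have "\<zeta> x * ?W x * norm (dmu p x) powr p \<le> 1 * (2 / L) * norm (dmu p x) powr p"
              by (intro mult_right_mono) auto
            then show ?thesis using nn True False by simp
          next
            case f: False
            then show ?thesis using nn t0 zeta(6)[of x] L by simp
          qed
        qed
      qed
      have nr: "norm (radial_field x) = norm (dmu p x) powr (p - 1)"
        using norm_p_field[of p "dmu p x"] by (simp add: p_field_dmu[OF p(1)])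
      have "- (radial_field x \<bullet> dv x) \<le> norm (dmu p x) powr (p - 1) * norm (dv x)"
        using norm_cauchy_schwarz[of "- radial_field x" "dv x"] by (simp add: nr)
      also have "\<dots> \<le> (1 / p) * s powr (1 - p) * norm (dv x) powr p + (1 - 1 / p) * s * norm (dmu p x) powr p"
        by (rule young_weighted[OF p(1) _ _ s]) auto
      finally have "\<zeta> x * ?W x * - (radial_field x \<bullet> dv x) \<le> \<zeta> x * ?W x * ((1 / p) * s powr (1 - p) * norm (dv x) powr p + (1 - 1 / p) * s * norm (dmu p x) powr p)"
        using z W0 by (intro mult_left_mono) auto
      also have "\<dots> = (1 / p) * s powr (1 - p) * (?e x / L\<^sup>2) + (1 - 1 / p) * s * (\<zeta> x * ?W x * norm (dmu p x) powr p)"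
      proof -
        have "z * (W / D) * (a * b * n + k * s * m) = a * b * (W * n * z / D) + k * s * (z * (W / D) * m)" for z W D a b n k m :: real
          by (simp only: distrib_left times_divide_eq_right times_divide_eq_left mult_ac)
        then show ?thesis by blast
      qed
      also have "(1 - 1 / p) * s * (\<zeta> x * ?W x * norm (dmu p x) powr p)
          \<le> (1 - 1 / p) * s * ((1 / s) * ?m x + 2 / L * ?t x)"
        using p1 s by (intro mult_left_mono weight mult_nonneg_nonneg) auto
      also have "\<dots> = (1 - 1 / p) * ?m x + (1 - 1 / p) * s * 2 / L * ?t x"
      proof -
        have "k * s * ((1 / s) * m + 2 / L * t) = k * m + k * s * 2 / L * t" for k m t :: real
          using s L by (simp add: distrib_left mult_ac)
        then show ?thesis by blast
      qed
      finally show "\<zeta> x * ?W x * - (radial_field x \<bullet> dv x)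
        \<le> (1 / p) * s powr (1 - p) * (?e x / L\<^sup>2) + ((1 - 1 / p) * ?m x + (1 - 1 / p) * s * 2 / L * ?t x)" by simp
    qed
    also have "\<dots> = (1 / p) * s powr (1 - p) * energy_mean L \<zeta> + ((1 - 1 / p) * mu_energy (L / s) + (1 - 1 / p) * s * 2 / L * T)"
    proof -
      have i: "integrable lborel (\<lambda>x. ?e x / L\<^sup>2)"
        by (rule integrable_divide) (rule truncated_identity_origin(2)[OF zeta_test(1) L])
      have e: "energy_mean L \<zeta> = (LINT x|lborel. ?e x / L\<^sup>2)" unfolding energy_mean_def by (rule integral_divide_zero[symmetric])
      show ?thesis unfolding mu_energy_def T_def e
        by (rule integral_combination3(2)[OF i mu_energy_identity(2)[OF zeta_test(2) Ls] iT])
    qed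
    finally have "H L \<le> (1 / p) * s powr (1 - p) * energy_mean L \<zeta> + ((1 - 1 / p) * mu_energy (L / s) + (1 - 1 / p) * s * 2 / L * T)" .
    moreover have "k / L * T = k * T * inverse L" for k by (simp add: divide_inverse)
    ultimately show ?thesis by (simp only: add.assoc)
  qed
  have sl: "filterlim (\<lambda>L. L / s) at_top at_top"
    unfolding divide_inverse mult.commute[of _ "inverse s"]
    using s by (intro filterlim_tendsto_pos_mult_at_top[OF tendsto_const] filterlim_ident) auto
  have "((\<lambda>L. (1 / p) * s powr (1 - p) * energy_mean L \<zeta> + (1 - 1 / p) * mu_energy (L / s) + (1 - 1 / p) * s * 2 * T * inverse L)
     \<longlongrightarrow> (1 / p) * s powr (1 - p) * mass + (1 - 1 / p) * flux_const TYPE('a) + (1 - 1 / p) * s * 2 * T * 0) at_top"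
    unfolding mass_def
    by (intro tendsto_add tendsto_mult[OF tendsto_const] filterlim_compose[OF mu_energy_tendsto sl]
        energy_mean_tendsto[OF zeta_test(1)] tendsto_inverse_0_at_top filterlim_ident)
  from tendsto_le[OF _ this Hlim eventually_mono[OF eventually_gt_at_top[of 0] main]] have "flux_const TYPE('a) \<le> (1 / p) * s powr (1 - p) * mass + (1 - 1 / p) * flux_const TYPE('a)"
    by (simp only: mult_zero_right add_0_right trivial_limit_at_top_linorder not_False_eq_True)
  then have "(1 / p) * flux_const TYPE('a) \<le> (1 / p) * (s powr (1 - p) * mass)" by (simp add: algebra_simps)
  then have "flux_const TYPE('a) \<le> s powr (1 - p) * mass" using p by (simp add: divide_le_cancel)
  then have "s powr (p - 1) * flux_const TYPE('a) \<le> s powr (p - 1) * (s powr (1 - p) * mass)" by (intro mult_left_mono) auto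
  also have "s powr (p - 1) * (s powr (1 - p) * mass) = mass"
  proof -
    have "s powr (p - 1) * s powr (1 - p) = 1" using s by (simp flip: powr_add)
    then show ?thesis by (simp flip: mult.assoc)
  qed
  finally show ?thesis .
qed

text \<open>The two one-sided estimates are applied with s slightly above and slightly below the
  limit, and continuity of s^(p - 1) closes the gap. For limit 0 there is no admissible smaller s,
  and nonnegativity of the mass takes the place of the lower estimate.\<close>

lemma mass_eq:
  assumes c0: "c0 \<ge> 0" and lim: "((\<lambda>x. v x / mu p x) \<longlongrightarrow> c0) (at 0)"
  shows "mass = c0 powr (p - 1) * flux_const TYPE('a)"
proof (rule antisym)
  have near: "\<exists>\<rho>>0. \<forall>x::'a. 0 < norm x \<and> norm x < \<rho> \<longrightarrow> P x" if "\<forall>\<^sub>F x in at 0. P x" for P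
    using that unfolding eventually_at by auto
  have mup: "\<forall>\<^sub>F x::'a in at 0. mu p x > 0" using mu_tendsto[OF p] unfolding filterlim_at_top_dense by blast
  have up: "mass \<le> s powr (p - 1) * flux_const TYPE('a)" if s: "c0 < s" for s
  proof -
    have "\<forall>\<^sub>F x in at 0. v x \<le> s * mu p x"
      using order_tendstoD(2)[OF lim s] mup by eventually_elim (simp add: pos_divide_less_eq)
    from near[OF this] obtain \<rho> where "\<rho> > 0" "\<And>x. 0 < norm x \<Longrightarrow> norm x < \<rho> \<Longrightarrow> v x \<le> s * mu p x" by blast
    then show ?thesis using s c0 by (intro mass_upper) auto
  qed
  have low: "s powr (p - 1) * flux_const TYPE('a) \<le> mass" if s: "0 < s" "s < c0" for s
  proof -
    have "\<forall>\<^sub>F x in at 0. s * mu p x \<le> v x"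
      using order_tendstoD(1)[OF lim s(2)] mup by eventually_elim (simp add: pos_less_divide_eq)
    from near[OF this] obtain \<rho> where "\<rho> > 0" "\<And>x. 0 < norm x \<Longrightarrow> norm x < \<rho> \<Longrightarrow> s * mu p x \<le> v x" by blast
    then show ?thesis using s by (intro mass_lower) auto
  qed
  have cont: "((\<lambda>s. s powr (p - 1) * flux_const TYPE('a)) \<longlongrightarrow> c0 powr (p - 1) * flux_const TYPE('a)) (at c0 within {0..})"
  proof -
    have "continuous_on {0..} (\<lambda>s::real. s powr (p - 1) * flux_const TYPE('a))"
      using p by (intro continuous_on_mult continuous_on_powr' continuous_on_const continuous_on_id) auto
    then show ?thesis using c0 by (auto simp: continuous_on_def)
  qed
  show "mass \<le> c0 powr (p - 1) * flux_const TYPE('a)"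
  proof (rule tendsto_lowerbound[OF tendsto_within_subset[OF cont, of "{c0<..}"]])
    show "\<forall>\<^sub>F s in at c0 within {c0<..}. mass \<le> s powr (p - 1) * flux_const TYPE('a)"
      using up by (auto simp: eventually_at_filter)
  qed (use c0 in auto)
  show "c0 powr (p - 1) * flux_const TYPE('a) \<le> mass"
  proof (cases "c0 = 0")
    case True
    then show ?thesis using mass_nonneg by simp
  next
    case False
    then have c0': "0 < c0" using c0 by simp
    show ?thesis
    proof (rule tendsto_upperbound[OF tendsto_within_subset[OF cont, of "{0<..<c0}"]])
      show "\<forall>\<^sub>F s in at c0 within {0<..<c0}. s powr (p - 1) * flux_const TYPE('a) \<le> mass"
        using low by (auto simp: eventually_at_filter)
      show "at c0 within {0<..<c0} \<noteq> bot" using c0' by (simp add: trivial_limit_within islimpt_greaterThanLessThan2)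
    qed auto
  qed
qed


text \<open>Split \<phi> into \<phi> \<zeta>, supported in the small ball where the defect is known,
  and the rest, which vanishes near the origin and is admissible in the original equation.\<close>

lemma weak_with_mass:
  assumes t: "C1_test \<Omega> \<phi> d\<phi>"
  shows "(LINT x|lborel. p_field p (dv x) \<bullet> d\<phi> x) - (LINT x|lborel. norm (dv x) powr q * \<phi> x) = mass * \<phi> 0"
proof -
  define \<psi> where "\<psi> x = \<phi> x * \<zeta> x" for x
  define d\<psi> where "d\<psi> x = \<phi> x *\<^sub>R d\<zeta> x + \<zeta> x *\<^sub>R d\<phi> x" for x
  have T: "C1_test S \<psi> d\<psi>" if "C1_test S \<zeta> d\<zeta>" "open S" for S
    unfolding \<psi>_def d\<psi>_def
    by (rule C1_test_mult[OF that(2,1)]) (rule C1_test_gderiv[OF t], rule C1_test_cont_grad[OF t])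
  have T1: "C1_test (ball 0 R0) \<psi> d\<psi>" and T2: "C1_test \<Omega> \<psi> d\<psi>"
    using T zeta_test \<Omega>(1) by auto
  have T3: "C1_test \<Omega> (\<lambda>x. \<phi> x + (- 1) * \<psi> x) (\<lambda>x. d\<phi> x + (- 1) *\<^sub>R d\<psi> x)" (is "C1_test _ ?\<chi> ?d\<chi>")
    by (intro C1_test_add C1_test_const_mult t T2)
  have near: "?\<chi> x = 0" "?d\<chi> x = 0" if "norm x < R0 / 3" for x
    using zeta(4)[of x] zeta(5)[of x] that by (simp_all add: \<psi>_def d\<psi>_def)
  have T4: "C1_test U ?\<chi> ?d\<chi>"
  proof -
    obtain K where K: "compact K" "K \<subseteq> \<Omega>" "\<And>x. x \<notin> K \<Longrightarrow> ?\<chi> x = 0" "\<And>x. x \<notin> K \<Longrightarrow> ?d\<chi> x = 0"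
      using C1_test_support[OF T3] by blast
    have s: "?\<chi> x = 0" "?d\<chi> x = 0" if "x \<notin> K - ball 0 (R0 / 3)" for x
      using that near[of x] K(3,4)[of x] by auto
    have sub: "K - ball 0 (R0 / 3) \<subseteq> U" using K(2) R0 by auto
    have o: "?d\<chi> x = 0" if "x \<notin> U" for x using s(2)[of x] that sub by blast
    show ?thesis
      by (rule C1_testI[OF openU compact_diff[OF K(1) open_ball] sub C1_test_gderiv[OF T3] C1_test_cont_grad[OF T3] s(1) o])
  qed
  have q0: "q > 0" using p q by simp
  have i: "integrable lborel (\<lambda>x. p_field p (dv x) \<bullet> ?d\<chi> x)" "integrable lborel (\<lambda>x. norm (dv x) powr q * ?\<chi> x)"
    using C1_test_integrable(1)[OF T4 cont_flux] C1_test_integrable(2)[OF T4 cont_powr[OF q0]] by auto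
  note j = flux_integrable[OF T1]
  have "(LINT x|lborel. p_field p (dv x) \<bullet> d\<phi> x) = (LINT x|lborel. p_field p (dv x) \<bullet> ?d\<chi> x + p_field p (dv x) \<bullet> d\<psi> x)"
    by (simp flip: inner_add_right)
  also have "\<dots> = (LINT x|lborel. p_field p (dv x) \<bullet> ?d\<chi> x) + (LINT x|lborel. p_field p (dv x) \<bullet> d\<psi> x)"
    by (rule Bochner_Integration.integral_add[OF i(1) j(1)])
  finally have 1: "(LINT x|lborel. p_field p (dv x) \<bullet> d\<phi> x) = \<dots>" .
  have "(LINT x|lborel. norm (dv x) powr q * \<phi> x) = (LINT x|lborel. norm (dv x) powr q * ?\<chi> x + norm (dv x) powr q * \<psi> x)"
    by (simp flip: distrib_left)
  also have "\<dots> = (LINT x|lborel. norm (dv x) powr q * ?\<chi> x) + (LINT x|lborel. norm (dv x) powr q * \<psi> x)"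
    by (rule Bochner_Integration.integral_add[OF i(2) j(2)])
  finally have 2: "(LINT x|lborel. norm (dv x) powr q * \<phi> x) = \<dots>" .
  show ?thesis using defect_eq[OF T1] unfolding 1 2 weak[OF T4] defect_def by (simp add: \<psi>_def zeta_0)
qed

lemma set_integrable_singular:
  fixes G :: "'a \<Rightarrow> 'b::euclidean_space"
  assumes K: "compact K" "K \<subseteq> \<Omega>" and m [measurable]: "G \<in> borel_measurable borel" and c: "continuous_on U G"
    and i: "integrable lborel (\<lambda>x. indicator (cball 0 (R0 / 2)) x * norm (G x))"
  shows "set_integrable lborel K G"
proof -
  have mK: "K \<in> sets borel" using K(1) by (simp add: borel_compact)
  have "continuous_on (K - ball 0 (R0 / 2)) (\<lambda>x. norm (G x))"
    by (intro continuous_on_norm continuous_on_subset[OF c]) (use K R0 in auto)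
  from borel_integrable_compact[OF compact_diff[OF K(1) open_ball] this]
  have j: "integrable lborel (\<lambda>x. indicator (K - ball 0 (R0 / 2)) x * norm (G x))" by simp
  have "(\<lambda>x. indicator K x *\<^sub>R G x) \<in> borel_measurable borel" using mK by measurable
  then have M: "(\<lambda>x. indicator K x *\<^sub>R G x) \<in> borel_measurable lborel" by simp
  show ?thesis unfolding set_integrable_def
    by (rule Bochner_Integration.integrable_bound[OF Bochner_Integration.integrable_add[OF i j] M])
      (auto intro!: AE_I2 simp: abs_mult split: split_indicator)
qed

text \<open>Passing from v back to u = -v reverses the sign of the flux but not of the q-term, so
  the mass enters with a minus sign.\<close>

lemma distribution_equation:
  assumes u: "\<And>x. x \<in> U \<Longrightarrow> grad u x = - dv x"
  shows "distr_eq p q \<Omega> u (- mass)"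
proof -
  have q0: "q > 0" using p q by simp
  have r: "0 < R0 / 2" "R0 / 2 < R0" using R0 by auto
  have flux: "p_flux p u x = - p_field p (dv x)" "norm (grad u x) = norm (dv x)" if "x \<in> U" for x
    unfolding p_flux_eq u[OF that] by (simp_all add: p_field_minus)
  have m0: "(\<lambda>x. - p_field p (dv x)) \<in> borel_measurable borel" "(\<lambda>x. norm (dv x) powr q) \<in> borel_measurable borel"
    by measurable
  have \<Omega>m: "\<Omega> \<in> sets borel" using \<Omega>(1) by simp
  have "set_integrable lborel K (p_flux p u) \<and> set_integrable lborel K (\<lambda>x. norm (grad u x) powr q)"
    if K: "compact K" "K \<subseteq> \<Omega>" for K
  proof
    have mK: "K \<in> sets borel" using K(1) by (simp add: borel_compact)
    have s1: "set_integrable lborel K (\<lambda>x. - p_field p (dv x))"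
      by (rule set_integrable_singular[OF K m0(1)])
        (use integrable_flux[OF r] in \<open>auto intro!: continuous_on_minus cont_flux simp: norm_p_field\<close>)
    have s2: "set_integrable lborel K (\<lambda>x. norm (dv x) powr q)"
      by (rule set_integrable_singular[OF K m0(2) cont_powr[OF q0]]) (use integrable_powr_q[OF r] in simp)
    define m1 where "m1 x = indicator K x *\<^sub>R p_flux p u x" for x
    define m2 where "m2 x = indicator K x *\<^sub>R (norm (grad u x) powr q)" for x
    have [measurable]: "K \<in> sets borel" by (rule mK)
    note [measurable] = m0
    \<comment> \<open>At the origin \<open>grad u\<close> is an unspecified value. Isolating this
      point gives measurability and an equality almost everywhere.\<close>
    have b1: "m1 = (\<lambda>x. if x = 0 then m1 0 else indicator K x *\<^sub>R (- p_field p (dv x)))"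
      using K(2) flux by (auto simp: m1_def fun_eq_iff split: split_indicator)
    have b2: "m2 = (\<lambda>x. if x = 0 then m2 0 else indicator K x *\<^sub>R (norm (dv x) powr q))"
      using K(2) flux by (auto simp: m2_def fun_eq_iff split: split_indicator)
    have "m1 \<in> borel_measurable borel" by (subst b1) measurable
    then have M1: "m1 \<in> borel_measurable lborel" by simp
    have "m2 \<in> borel_measurable borel" by (subst b2) measurable
    then have M2: "m2 \<in> borel_measurable lborel" by simp
    have A1: "AE x in lborel. m1 x = indicator K x *\<^sub>R (- p_field p (dv x))"
      using AE_lborel_singleton[of "0::'a"] by eventually_elim (subst b1, simp)
    have A2: "AE x in lborel. m2 x = indicator K x *\<^sub>R (norm (dv x) powr q)"
      using AE_lborel_singleton[of "0::'a"] by eventually_elim (subst b2, simp)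
    show "set_integrable lborel K (p_flux p u)"
      using s1 integrable_cong_AE[OF M1 _ A1] unfolding set_integrable_def m1_def by simp
    show "set_integrable lborel K (\<lambda>x. norm (grad u x) powr q)"
      using s2 integrable_cong_AE[OF M2 _ A2] unfolding set_integrable_def m2_def by simp
  qed
  then have L: "L1_loc \<Omega> (p_flux p u)" "L1_loc \<Omega> (\<lambda>x. norm (grad u x) powr q)" unfolding L1_loc_def by auto
  have "neg_p_laplacian p \<Omega> u \<phi> + regular_distr \<Omega> (\<lambda>x. norm (grad u x) powr q) \<phi> = - mass * dirac0 \<phi>"
    if \<phi>: "\<phi> \<in> test_functions \<Omega>" for \<phi>
  proof -
    have t: "C1_test \<Omega> \<phi> (grad \<phi>)" by (rule test_functions_C1_test[OF \<Omega>(1) \<phi>])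
    obtain K where K: "compact K" "K \<subseteq> \<Omega>" "\<And>x. x \<notin> K \<Longrightarrow> \<phi> x = 0" "\<And>x. x \<notin> K \<Longrightarrow> grad \<phi> x = 0"
      using C1_test_support[OF t] by blast
    have o: "\<phi> x = 0" "grad \<phi> x = 0" if "x \<notin> \<Omega>" for x using K(3,4)[of x] K(2) that by auto
    have [measurable]: "grad \<phi> \<in> borel_measurable borel" "\<phi> \<in> borel_measurable borel"
      using C1_test_cont_grad[OF t] C1_test_cont[OF t] by (auto intro: borel_measurable_continuous_onI)
    note [measurable] = \<Omega>m
    define m1 where "m1 x = indicator \<Omega> x *\<^sub>R (p_flux p u x \<bullet> grad \<phi> x)" for x
    define m2 where "m2 x = indicator \<Omega> x *\<^sub>R (norm (grad u x) powr q * \<phi> x)" for x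
    have b1: "m1 = (\<lambda>x. if x = 0 then m1 0 else - (p_field p (dv x) \<bullet> grad \<phi> x))"
      using flux o by (auto simp: m1_def fun_eq_iff split: split_indicator)
    have b2: "m2 = (\<lambda>x. if x = 0 then m2 0 else norm (dv x) powr q * \<phi> x)"
      using flux o by (auto simp: m2_def fun_eq_iff split: split_indicator)
    have c1: "(\<lambda>x. - (p_field p (dv x) \<bullet> grad \<phi> x)) \<in> borel_measurable borel" by measurable
    have c2: "(\<lambda>x. norm (dv x) powr q * \<phi> x) \<in> borel_measurable borel" by measurable
    have "m1 \<in> borel_measurable borel" by (subst b1) (intro measurable_If; use c1 in simp)
    then have M1: "m1 \<in> borel_measurable lborel" by simp
    have "m2 \<in> borel_measurable borel" by (subst b2) (intro measurable_If; use c2 in simp)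
    then have M2: "m2 \<in> borel_measurable lborel" by simp
    have A1: "AE x in lborel. m1 x = - (p_field p (dv x) \<bullet> grad \<phi> x)"
      using AE_lborel_singleton[of "0::'a"] by eventually_elim (subst b1, simp)
    have A2: "AE x in lborel. m2 x = norm (dv x) powr q * \<phi> x"
      using AE_lborel_singleton[of "0::'a"] by eventually_elim (subst b2, simp)
    have "neg_p_laplacian p \<Omega> u \<phi> = (LINT x|lborel. - (p_field p (dv x) \<bullet> grad \<phi> x))"
      unfolding neg_p_laplacian_def set_lebesgue_integral_def
      using integral_cong_AE[OF M1 _ A1] c1 unfolding m1_def by simp
    moreover have "regular_distr \<Omega> (\<lambda>x. norm (grad u x) powr q) \<phi> = (LINT x|lborel. norm (dv x) powr q * \<phi> x)"
      unfolding regular_distr_def set_lebesgue_integral_def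
      using integral_cong_AE[OF M2 _ A2] c2 unfolding m2_def by simp
    ultimately show ?thesis using weak_with_mass[OF t] by (simp add: dirac0_def)
  qed
  with L show ?thesis unfolding distr_eq_def by blast
qed

end

subsection \<open>Radial solutions\<close>

lemma radial_dball_cut_nonpos:
  fixes x :: "'a::euclidean_space"
  assumes "0 \<le> r" "r < R"
  shows "radial_field x \<bullet> dball_cut r R x \<le> 0"
proof -
  have "r\<^sup>2 \<le> R\<^sup>2" using assms by (intro power_mono) auto
  then have "2 * dcut ((x \<bullet> x - r\<^sup>2) / (R\<^sup>2 - r\<^sup>2)) / (R\<^sup>2 - r\<^sup>2) \<le> 0" (is "?k \<le> 0")
    using dcut_bounds(1) by (intro divide_nonpos_nonneg) (auto simp: mult_nonneg_nonpos)
  moreover have "radial_field x \<bullet> dball_cut r R x = norm x powr (- real DIM('a)) * (?k * (x \<bullet> x))"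
    by (simp add: radial_field_def dball_cut_def)
  ultimately show ?thesis by (simp only: mult_nonneg_nonpos mult_nonpos_nonneg inner_ge_zero powr_ge_zero)
qed

text \<open>The fields x and x / |x|^N differ by the factor |x|^N, which lies between 1 and R^N on
  the layer where the cutoff from radius 1 to R varies. The divergence theorem for x gives N times
  the integral of the cutoff, and R tends to 1. The radial part needs this value to match fluxes
  with volumes of shells.\<close>

lemma flux_const_eq_volume: "flux_const TYPE('a::euclidean_space) = real DIM('a) * unit_ball_vol (real DIM('a))"
proof -
  let ?N = "real DIM('a)" and ?\<omega> = "unit_ball_vol (real DIM('a))" and ?c = "flux_const TYPE('a)"
  have divergence: "?N * (LINT x|lborel. \<phi> x) = - (LINT x|lborel. x \<bullet> d\<phi> x)"
    if t: "C1_test UNIV \<phi> d\<phi>" for \<phi> :: "'a \<Rightarrow> real" and d\<phi>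
  proof -
    have i: "integrable lborel (\<lambda>x. x \<bullet> d\<phi> x)" "integrable lborel \<phi>"
      using C1_test_integrable(1)[OF t, of "\<lambda>x. x"] C1_test_integrable(2)[OF t, of "\<lambda>_. 1"] by (auto intro: continuous_intros)
    have C: "C1_test UNIV (\<lambda>x. (x \<bullet> b) * \<phi> x) (\<lambda>x. (x \<bullet> b) *\<^sub>R d\<phi> x + \<phi> x *\<^sub>R b)" for b
      by (rule C1_test_mult[OF open_UNIV t gderiv_inner_left]) simp
    have ib: "integrable lborel (\<lambda>x. ((x \<bullet> b) *\<^sub>R d\<phi> x + \<phi> x *\<^sub>R b) \<bullet> b)" for b
      using C1_test_integrable(1)[OF C, of "\<lambda>_. b" b] by (simp add: inner_commute)
    have "0 = (\<Sum>b\<in>Basis. LINT x|lborel. ((x \<bullet> b) *\<^sub>R d\<phi> x + \<phi> x *\<^sub>R b) \<bullet> b)"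
      by (simp only: integral_gradient_zero[OF C] sum.neutral_const)
    also have "\<dots> = (LINT x|lborel. (\<Sum>b\<in>Basis. ((x \<bullet> b) *\<^sub>R d\<phi> x + \<phi> x *\<^sub>R b) \<bullet> b))"
      by (rule Bochner_Integration.integral_sum[symmetric]) (rule ib)
    also have "\<dots> = (LINT x|lborel. x \<bullet> d\<phi> x + ?N * \<phi> x)"
    proof (rule Bochner_Integration.integral_cong[OF refl])
      fix x
      have "(\<Sum>b\<in>Basis. ((x \<bullet> b) *\<^sub>R d\<phi> x + \<phi> x *\<^sub>R b) \<bullet> b) = (\<Sum>b\<in>Basis. (x \<bullet> b) * (d\<phi> x \<bullet> b)) + (\<Sum>b\<in>(Basis::'a set). \<phi> x)"
        by (simp add: inner_add_left sum.distrib)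
      then show "(\<Sum>b\<in>Basis. ((x \<bullet> b) *\<^sub>R d\<phi> x + \<phi> x *\<^sub>R b) \<bullet> b) = x \<bullet> d\<phi> x + ?N * \<phi> x"
        by (simp add: euclidean_inner[of x "d\<phi> x"])
    qed
    also have "\<dots> = (LINT x|lborel. x \<bullet> d\<phi> x) + ?N * (LINT x|lborel. \<phi> x)"
      using i by (subst Bochner_Integration.integral_add) auto
    finally show ?thesis by simp
  qed
  \<comment> \<open>\<open>T\<close> is the nonnegative flux density of the cutoff, supported in 1
    <= |x| <= R and of total integral \<open>?c\<close>; the weight |x|^N turns it into the density
    for the field x.\<close>
  have est: "?N * ?\<omega> \<le> R ^ DIM('a) * ?c \<and> ?c \<le> R ^ DIM('a) * (?N * ?\<omega>)" if R: "R > 1" for R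
  proof -
    have rr: "(0::real) \<le> 1" "1 < R" using R by auto
    let ?\<phi> = "ball_cut 1 R :: 'a \<Rightarrow> real" and ?d = "dball_cut 1 R :: 'a \<Rightarrow> 'a"
    note b = ball_cut[where 'a='a, OF rr]
    have t: "C1_test UNIV ?\<phi> ?d" by (rule b(1)) auto
    define T where "T x = - (radial_field x \<bullet> ?d x)" for x
    have xd: "- (x \<bullet> ?d x) = norm x ^ DIM('a) * T x" for x
    proof (cases "x = 0")
      case True then show ?thesis by (simp add: T_def)
    next
      case False
      then show ?thesis by (simp add: T_def radial_field_def powr_minus powr_realpow)
    qed
    have T0: "T x \<ge> 0" for x
      unfolding T_def using radial_dball_cut_nonpos[OF rr, of x] by simp
    have iT: "integrable lborel T" unfolding T_def using radial_flux(2)[OF t] by simp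
    have IT: "(LINT x|lborel. T x) = ?c" unfolding T_def using radial_flux(1)[OF t] b(4)[of 0] by simp
    have iX: "integrable lborel (\<lambda>x. norm x ^ DIM('a) * T x)"
      using C1_test_integrable(1)[OF t, of "\<lambda>x. x"] by (simp flip: xd)
    have IX: "(LINT x|lborel. norm x ^ DIM('a) * T x) = ?N * (LINT x|lborel. ?\<phi> x)"
      using divergence[OF t] by (simp flip: xd)
    have supp: "T x = 0" if "norm x < 1 \<or> R < norm x" for x using b(5,7)[of x] that by (auto simp: T_def)
    have i\<phi>: "integrable lborel ?\<phi>" using C1_test_integrable(2)[OF t, of "\<lambda>_. 1"] by simp
    have vol: "integrable lborel (indicator (cball (0::'a) r) :: 'a \<Rightarrow> real)"
      "(LINT x|lborel. indicator (cball (0::'a) r) x) = r ^ DIM('a) * ?\<omega>" if "r \<ge> 0" for r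
      using emeasure_compact_finite[of "cball (0::'a) r"] that by (auto simp: content_cball mult.commute intro!: integrable_real_indicator)
    have "?\<omega> \<le> (LINT x|lborel. ?\<phi> x)"
      using integral_mono[OF vol(1)[of 1] i\<phi>] vol(2)[of 1] b(2,4) by (auto split: split_indicator)
    moreover have "(LINT x|lborel. ?\<phi> x) \<le> R ^ DIM('a) * ?\<omega>"
      using integral_mono[OF i\<phi> vol(1)[of R]] vol(2)[of R] b(3,6) R by (auto split: split_indicator simp: not_le less_imp_le)
    moreover have "?c \<le> (LINT x|lborel. norm x ^ DIM('a) * T x)"
      unfolding IT[symmetric]
    proof (rule integral_mono[OF iT iX])
      fix x
      show "T x \<le> norm x ^ DIM('a) * T x"
        using supp[of x] mult_right_mono[OF one_le_power[of "norm x" "DIM('a)"] T0[of x]] by (cases "norm x < 1") auto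
    qed
    moreover have "(LINT x|lborel. norm x ^ DIM('a) * T x) \<le> (LINT x|lborel. R ^ DIM('a) * T x)"
    proof (rule integral_mono[OF iX integrable_mult_right[OF iT]])
      fix x
      show "norm x ^ DIM('a) * T x \<le> R ^ DIM('a) * T x"
        using supp[of x] mult_right_mono[OF power_mono[of "norm x" R "DIM('a)"] T0[of x]] by (cases "R < norm x") auto
    qed
    moreover have "(LINT x|lborel. R ^ DIM('a) * T x) = R ^ DIM('a) * ?c" unfolding IT[symmetric] by (rule integral_mult_right_zero)
    ultimately have *: "?\<omega> \<le> J" "J \<le> R ^ DIM('a) * ?\<omega>" "?c \<le> ?N * J" "?N * J \<le> R ^ DIM('a) * ?c"
      if "J = (LINT x|lborel. ?\<phi> x)" for J unfolding IX that by argo+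
    have "?N * ?\<omega> \<le> ?N * (LINT x|lborel. ?\<phi> x)" by (rule mult_left_mono[OF *(1)[OF refl]]) simp
    also have "\<dots> \<le> R ^ DIM('a) * ?c" by (rule *(4)[OF refl])
    finally have 1: "?N * ?\<omega> \<le> R ^ DIM('a) * ?c" .
    note *(3)[OF refl]
    also have "?N * (LINT x|lborel. ?\<phi> x) \<le> ?N * (R ^ DIM('a) * ?\<omega>)" by (rule mult_left_mono[OF *(2)[OF refl]]) simp
    finally have "?c \<le> ?N * (R ^ DIM('a) * ?\<omega>)" .
    with 1 show ?thesis by (simp only: mult.left_commute)
  qed
  have lim: "((\<lambda>R. R ^ DIM('a) * k) \<longlongrightarrow> 1 ^ DIM('a) * k) (at_right 1)" for k :: real
    by (intro tendsto_intros)
  have ev: "\<forall>\<^sub>F R in at_right (1::real). R > 1" by (simp add: eventually_at_filter)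
  show ?thesis
  proof (rule antisym)
    show "?c \<le> ?N * ?\<omega>"
      using tendsto_lowerbound[OF lim[of "?N * ?\<omega>"] eventually_mono[OF ev, of "\<lambda>R. ?c \<le> R ^ DIM('a) * (?N * ?\<omega>)"]] est by simp
    show "?N * ?\<omega> \<le> ?c"
      using tendsto_lowerbound[OF lim[of ?c] eventually_mono[OF ev, of "\<lambda>R. ?N * ?\<omega> \<le> R ^ DIM('a) * ?c"]] est by simp
  qed
qed

text \<open>A derivative of f with respect to g, combined with the derivative of g. With g(r) = r^N
  / N the increments of g are normalized shell volumes, so integrals over shells are differentiated
  without polar coordinates.\<close>

lemma deriv_by_comparison:
  fixes f g :: "real \<Rightarrow> real"
  assumes g: "DERIV g x :> d"
    and c: "\<And>e. e > 0 \<Longrightarrow> \<forall>\<^sub>F y in at x. \<bar>f y - f x - k * (g y - g x)\<bar> \<le> e * \<bar>g y - g x\<bar>"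
  shows "DERIV f x :> k * d"
proof -
  have E: "((\<lambda>y. (g y - g x) / (y - x)) \<longlongrightarrow> d) (at x)" using g by (simp add: has_field_derivative_iff)
  have "((\<lambda>y. (f y - f x) / (y - x) - k * ((g y - g x) / (y - x))) \<longlongrightarrow> 0) (at x)"
  proof (rule tendstoI)
    fix e :: real assume e: "e > 0"
    define e' where "e' = e / (\<bar>d\<bar> + 1)"
    have e': "e' > 0" "e' * (\<bar>d\<bar> + 1) = e" using e by (auto simp: e'_def)
    have "\<forall>\<^sub>F y in at x. \<bar>(g y - g x) / (y - x)\<bar> < \<bar>d\<bar> + 1"
      by (rule order_tendstoD(2)[OF tendsto_rabs[OF E]]) simp
    then show "\<forall>\<^sub>F y in at x. dist ((f y - f x) / (y - x) - k * ((g y - g x) / (y - x))) 0 < e"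
      using c[OF e'(1)]
    proof eventually_elim
      case (elim y)
      have "(f y - f x) / (y - x) - k * ((g y - g x) / (y - x)) = (f y - f x - k * (g y - g x)) / (y - x)"
      proof -
        have "A / D - k * (B / D) = (A - k * B) / D" for A B D :: real by (simp add: diff_divide_distrib)
        then show ?thesis .
      qed
      then have "\<bar>(f y - f x) / (y - x) - k * ((g y - g x) / (y - x))\<bar> \<le> e' * \<bar>g y - g x\<bar> / \<bar>y - x\<bar>"
        using elim(2) by (simp add: divide_right_mono)
      also have "\<dots> = e' * \<bar>(g y - g x) / (y - x)\<bar>" by simp
      also have "\<dots> < e' * (\<bar>d\<bar> + 1)" using elim(1) e'(1) by (rule mult_strict_left_mono)
      finally show ?case using e'(2) by simp
    qed
  qed
  then have "((\<lambda>y. ((f y - f x) / (y - x) - k * ((g y - g x) / (y - x))) + k * ((g y - g x) / (y - x))) \<longlongrightarrow> 0 + k * d) (at x)"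
    by (intro tendsto_add tendsto_mult tendsto_const E)
  then show ?thesis by (simp add: has_field_derivative_iff)
qed

text \<open>The absence of mass is assumed rather than a condition on q; this lets the critical and
  the supercritical case share the flux equation.\<close>

locale radial_hj = hj_solution p dim q R0 \<Omega> v dv for p :: real and dim :: "'a::euclidean_space itself"
    and q R0 :: real and \<Omega> :: "'a set" and v :: "'a \<Rightarrow> real" and dv :: "'a \<Rightarrow> 'a" +
  assumes mass0: "mass = 0"
    and radial: "\<And>x y. 0 < norm x \<Longrightarrow> norm x < R0 \<Longrightarrow> norm x = norm y \<Longrightarrow> v x = v y"
begin

definition e1 :: 'a where "e1 = (SOME b. b \<in> Basis)"
definition V :: "real \<Rightarrow> real" where "V r = v (r *\<^sub>R e1)"
definition g :: "real \<Rightarrow> real" where "g r = dv (r *\<^sub>R e1) \<bullet> e1"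
definition W :: "real \<Rightarrow> real" where "W r = - (r powr (real DIM('a) - 1) * p_field p (g r))"

lemma e1: "norm e1 = 1" unfolding e1_def by (metis norm_Basis nonempty_Basis some_in_eq)

lemma in_U: "0 < norm x \<Longrightarrow> norm x < R0 \<Longrightarrow> x \<in> U"
  using \<Omega>(2) by auto

lemma v_radial: "0 < norm x \<Longrightarrow> norm x < R0 \<Longrightarrow> v x = V (norm x)"
  unfolding V_def by (rule radial) (auto simp: e1)

lemma V_deriv: "0 < r \<Longrightarrow> r < R0 \<Longrightarrow> DERIV V r :> g r"
proof -
  assume r: "0 < r" "r < R0"
  have "r *\<^sub>R e1 \<in> U" using r by (intro in_U) (auto simp: e1)
  from gd[OF this] have "(v has_derivative (\<lambda>h. h \<bullet> dv (r *\<^sub>R e1))) (at (r *\<^sub>R e1))" unfolding gderiv_def .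
  moreover have "((\<lambda>t. t *\<^sub>R e1) has_derivative (\<lambda>h. h *\<^sub>R e1)) (at r)" by (auto intro!: derivative_eq_intros)
  ultimately have "((\<lambda>t. v (t *\<^sub>R e1)) has_derivative (\<lambda>h. (h *\<^sub>R e1) \<bullet> dv (r *\<^sub>R e1))) (at r)"
    by (rule has_derivative_compose[rotated])
  moreover have "(\<lambda>h. (h *\<^sub>R e1) \<bullet> dv (r *\<^sub>R e1)) = (\<lambda>h. (dv (r *\<^sub>R e1) \<bullet> e1) * h)" by (auto simp: fun_eq_iff inner_commute)
  ultimately show ?thesis unfolding has_field_derivative_def V_def g_def by simp
qed

lemma dv_radial:
  assumes x: "0 < norm x" "norm x < R0"
  shows "dv x = (g (norm x) / norm x) *\<^sub>R x"
proof -
  have x0: "x \<noteq> 0" using x by auto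
  have "GDERIV norm x :> (1 / norm x) *\<^sub>R x"
    unfolding gderiv_def using has_derivative_norm[OF x0] by (simp add: sgn_div_norm divide_inverse)
  then have "(norm has_derivative (\<lambda>h. h \<bullet> ((1 / norm x) *\<^sub>R x))) (at x)" unfolding gderiv_def .
  moreover have "(V has_derivative (\<lambda>h. g (norm x) * h)) (at (norm x))"
    using V_deriv[OF x] unfolding has_field_derivative_def .
  ultimately have "((\<lambda>x. V (norm x)) has_derivative (\<lambda>h. g (norm x) * (h \<bullet> ((1 / norm x) *\<^sub>R x)))) (at x)"
    by (rule has_derivative_compose)
  then have 1: "GDERIV (\<lambda>x. V (norm x)) x :> (g (norm x) / norm x) *\<^sub>R x" unfolding gderiv_def by (simp add: mult.commute)
  have "GDERIV v x :> (g (norm x) / norm x) *\<^sub>R x"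
    by (rule gderiv_transform[OF 1, of "ball 0 R0 - {0}"]) (use x x0 in \<open>auto simp: open_delete v_radial\<close>)
  then show ?thesis using gderiv_unique gd[OF in_U[OF x]] by blast
qed

lemma norm_dv_radial: "0 < norm x \<Longrightarrow> norm x < R0 \<Longrightarrow> norm (dv x) = \<bar>g (norm x)\<bar>"
  by (subst dv_radial) auto

lemma g_cont: "continuous_on {0<..<R0} g"
proof -
  have "continuous_on {0<..<R0} (\<lambda>r. dv (r *\<^sub>R e1))"
    by (rule continuous_on_compose2[OF cont]) (auto intro!: continuous_intros in_U simp: e1)
  then show ?thesis unfolding g_def by (intro continuous_intros)
qed

lemma W_cont: "continuous_on {0<..<R0} W"
  unfolding W_def by (intro continuous_intros continuous_on_p_field g_cont p) auto

lemma flux_radial: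
  assumes x: "norm x < R0"
  shows "p_field p (dv x) = - W (norm x) *\<^sub>R radial_field x"
proof (cases "x = 0")
  case True
  then show ?thesis using out(2)[of 0] by (simp add: p_field_def radial_field_def)
next
  case False
  then have x': "0 < norm x" by simp
  have "norm x powr (real DIM('a) - 1) * norm x powr (- real DIM('a)) = norm x powr (- 1)" by (simp flip: powr_add)
  then have e: "norm x powr (real DIM('a) - 1) * norm x powr (- real DIM('a)) = 1 / norm x" using x' by (simp add: powr_minus_divide)
  have "- W (norm x) *\<^sub>R radial_field x = (p_field p (g (norm x)) * (norm x powr (real DIM('a) - 1) * norm x powr (- real DIM('a)))) *\<^sub>R x"
    by (simp add: W_def radial_field_def)
  also have "\<dots> = p_field p (dv x)"
    unfolding e by (simp add: p_field_def norm_dv_radial[OF x' x]) (simp add: dv_radial[OF x' x])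
  finally show ?thesis by simp
qed

definition F :: "real \<Rightarrow> real" where "F r = (LINT x|lborel. indicator (cball 0 r) x * norm (dv x) powr q)"

lemma F_integrable: "0 < r \<Longrightarrow> r < R0 \<Longrightarrow> integrable lborel (\<lambda>x. indicator (cball 0 r) x * norm (dv x) powr q)"
  by (rule integrable_powr_q)

text \<open>The weak equation tested with cut-offs of the ball of radius \<open>r\<close> that approach its indicator; no mass sits at the origin.\<close>

lemma flux_W:
  assumes r: "0 < r" "r < R0"
  shows "flux_const TYPE('a) * W r = F r"
proof -
  let ?c = "flux_const TYPE('a)"
  have "F r - ?c * W r = 0"
  proof (rule eq_zero_if_le_mult_eps[of _ ?c])
    fix e :: real assume e: "e > 0"
    have "isCont W r" using W_cont r by (simp add: continuous_on_eq_continuous_at)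
    then obtain d where d: "d > 0" "\<And>t. \<bar>t - r\<bar> < d \<Longrightarrow> \<bar>W t - W r\<bar> < e"
      unfolding continuous_at_eps_delta using e by (auto simp: dist_real_def)
    define D where "D = min (d / 2) ((R0 - r) / 2)"
    have D: "D > 0" "D < d" "r + D < R0" using d(1) r by (auto simp: D_def min_def field_simps)
    define \<rho> where "\<rho> n = r + D * inverse (real (Suc n))" for n
    have \<rho>: "r < \<rho> n" "\<rho> n \<le> r + D" for n
    proof -
      have "inverse (real (Suc n)) \<le> 1" by (simp add: divide_simps)
      then show "r < \<rho> n" "\<rho> n \<le> r + D" using D(1) mult_left_mono[of "inverse (real (Suc n))" 1 D] by (auto simp: \<rho>_def)
    qed
    have \<rho>lim: "\<rho> \<longlonglongrightarrow> r + D * 0" unfolding \<rho>_def by (intro tendsto_intros LIMSEQ_inverse_real_of_nat)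
    let ?b = "\<lambda>n. ball_cut r (\<rho> n) :: 'a \<Rightarrow> real" and ?db = "\<lambda>n. dball_cut r (\<rho> n) :: 'a \<Rightarrow> 'a"
    have rr: "0 \<le> r" using r by simp
    note b = ball_cut[where 'a='a, OF rr \<rho>(1)]
    have t: "C1_test (ball 0 R0) (?b n) (?db n)" for n by (rule b(1)) (use \<rho>(2)[of n] D in auto)
    have bd: "\<bar>(LINT x|lborel. norm (dv x) powr q * ?b n x) - ?c * W r\<bar> \<le> e * ?c" for n
    proof -
      define T where "T x = - (radial_field x \<bullet> ?db n x)" for x
      have T0: "T x \<ge> 0" for x
        unfolding T_def using radial_dball_cut_nonpos[OF rr \<rho>(1)[of n], of x] by simp
      have iT: "integrable lborel T" unfolding T_def using radial_flux(2)[OF t] by simp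
      have IT: "(LINT x|lborel. T x) = ?c" unfolding T_def using radial_flux(1)[OF t] ball_cut(4)[where 'a='a, OF rr \<rho>(1)[of n], where x=0] r by simp
      have A: "p_field p (dv x) \<bullet> ?db n x = W (norm x) * T x" for x
      proof (cases "norm x < R0")
        case True then show ?thesis by (simp add: flux_radial T_def)
      next
        case False
        then have "\<rho> n \<le> norm x" using \<rho>(2)[of n] D by simp
        then show ?thesis using ball_cut(7)[where 'a='a, OF rr \<rho>(1)[of n], where x=x] by (simp add: T_def)
      qed
      \<comment> \<open>The cutoff is 1 at the origin, so the defect equals the mass, which is 0;
        the flux and the q-integral therefore balance exactly.\<close>
      have dz: "(LINT x|lborel. norm (dv x) powr q * ?b n x) = (LINT x|lborel. W (norm x) * T x)"
        using defect_eq[OF t, of n] mass0 unfolding defect_def A by simp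
      have iA: "integrable lborel (\<lambda>x. W (norm x) * T x)" using flux_integrable(1)[OF t, of n] unfolding A .
      have "(LINT x|lborel. W (norm x) * T x) - ?c * W r = (LINT x|lborel. W (norm x) * T x - W r * T x)"
        using iA iT IT by (simp add: mult.commute)
      also have "\<bar>\<dots>\<bar> \<le> (LINT x|lborel. e * T x)"
        unfolding real_norm_def[symmetric]
      proof (rule Bochner_Integration.integral_norm_bound_integral)
        fix x
        show "norm (W (norm x) * T x - W r * T x) \<le> e * T x"
        proof (cases "r \<le> norm x \<and> norm x \<le> \<rho> n")
          case True
          then have "\<bar>norm x - r\<bar> < d" using \<rho>(2)[of n] D by simp
          then have "\<bar>W (norm x) - W r\<bar> * T x \<le> e * T x" using d(2) T0[of x] by (intro mult_right_mono) (auto simp: less_imp_le)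
          then show ?thesis using T0[of x] by (simp add: left_diff_distrib[symmetric] abs_mult)
        next
          case False
          then have "T x = 0" using ball_cut(5)[where 'a='a, OF rr \<rho>(1)[of n], where x=x] ball_cut(7)[where 'a='a, OF rr \<rho>(1)[of n], where x=x] by (auto simp: T_def not_le less_imp_le)
          then show ?thesis by simp
        qed
      qed (use iA iT in auto)
      finally show ?thesis unfolding dz using IT by simp
    qed
    have lim: "(\<lambda>n. LINT x|lborel. norm (dv x) powr q * ?b n x) \<longlonglongrightarrow> F r"
      unfolding F_def
    proof (rule integral_dominated_convergence[where w="\<lambda>x. indicator (cball 0 (r + D)) x * norm (dv x) powr q"])
      have [measurable]: "cball (0::'a) s \<in> sets borel" for s by simp
      have "(\<lambda>x. indicator (cball 0 r) x * norm (dv x) powr q) \<in> borel_measurable borel" by measurable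
      then show "(\<lambda>x. indicator (cball 0 r) x * norm (dv x) powr q) \<in> borel_measurable lborel" by simp
      show "(\<lambda>x. norm (dv x) powr q * ?b n x) \<in> borel_measurable lborel" for n
        using flux_integrable(2)[OF t, of n] by (rule borel_measurable_integrable)
      show "integrable lborel (\<lambda>x. indicator (cball 0 (r + D)) x * norm (dv x) powr q)" by (rule F_integrable) (use r D in auto)
      show "AE x in lborel. (\<lambda>n. norm (dv x) powr q * ?b n x) \<longlonglongrightarrow> indicator (cball 0 r) x * norm (dv x) powr q"
      proof (rule AE_I2)
        fix x :: 'a
        have "(\<lambda>n. ?b n x) \<longlonglongrightarrow> indicator (cball 0 r) x"
        proof (cases "norm x \<le> r")
          case True
          then show ?thesis using b(4)[of x] by simp
        next
          case False
          have "\<forall>\<^sub>F n in sequentially. \<rho> n < norm x" by (rule order_tendstoD(2)[OF \<rho>lim]) (use False in simp)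
          then have "\<forall>\<^sub>F n in sequentially. ?b n x = 0" by eventually_elim (use b(6) in \<open>simp add: less_imp_le\<close>)
          then show ?thesis using False by (simp add: tendsto_eventually)
        qed
        then show "(\<lambda>n. norm (dv x) powr q * ?b n x) \<longlonglongrightarrow> indicator (cball 0 r) x * norm (dv x) powr q"
          by (subst mult.commute) (intro tendsto_intros)
      qed
      show "AE x in lborel. norm (norm (dv x) powr q * ?b n x) \<le> indicator (cball 0 (r + D)) x * norm (dv x) powr q" for n
      proof (rule AE_I2)
        fix x :: 'a
        show "norm (norm (dv x) powr q * ?b n x) \<le> indicator (cball 0 (r + D)) x * norm (dv x) powr q"
        proof (cases "norm x \<le> r + D")
          case True
          then show ?thesis using ball_cut(2)[where 'a='a, OF rr \<rho>(1)[of n], where x=x] ball_cut(3)[where 'a='a, OF rr \<rho>(1)[of n], where x=x] by (simp add: abs_mult mult_right_le_one_le)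
        next
          case False
          then have "?b n x = 0" using \<rho>(2)[of n] by (intro b(6)) simp
          then show ?thesis by simp
        qed
      qed
    qed
    have "\<bar>F r - ?c * W r\<bar> \<le> e * ?c"
      by (rule tendsto_upperbound[OF tendsto_rabs[OF tendsto_diff[OF lim tendsto_const]]]) (use bd in auto)
    then show "\<bar>F r - ?c * W r\<bar> \<le> e * ?c" .
  qed
  then show ?thesis by simp
qed

text \<open>The difference of the flux balances at two radii is an integral over a shell. The flux
  constant equals N times the volume of the unit ball, hence it cancels against the shell
  volume.\<close>

lemma W_increment:
  assumes ab: "0 < a" "a \<le> b" "b < R0" and k: "\<And>t. a \<le> t \<Longrightarrow> t \<le> b \<Longrightarrow> \<bar>\<bar>g t\<bar> powr q - \<kappa>\<bar> \<le> e"
  shows "\<bar>W b - W a - \<kappa> * (b ^ DIM('a) / real DIM('a) - a ^ DIM('a) / real DIM('a))\<bar> \<le> e * (b ^ DIM('a) / real DIM('a) - a ^ DIM('a) / real DIM('a))"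
proof -
  let ?c = "flux_const TYPE('a)" and ?\<omega> = "unit_ball_vol (real DIM('a))"
  let ?I = "\<lambda>x::'a. indicator (cball 0 b) x - indicator (cball 0 a) x :: real"
  let ?P = "b ^ DIM('a) / real DIM('a) - a ^ DIM('a) / real DIM('a)"
  have a0: "0 < b" "a < R0" using ab by auto
  note i = F_integrable[OF a0(1) ab(3)] F_integrable[OF ab(1) a0(2)]
  have vol: "integrable lborel (indicator (cball (0::'a) r) :: 'a \<Rightarrow> real)"
    "(LINT x|lborel. indicator (cball (0::'a) r) x) = r ^ DIM('a) * ?\<omega>" if "r \<ge> 0" for r
    using emeasure_compact_finite[of "cball (0::'a) r"] that by (auto simp: content_cball mult.commute intro!: integrable_real_indicator)
  have iI: "integrable lborel ?I" using vol(1)[of a] vol(1)[of b] ab by simp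
  have II: "(LINT x|lborel. ?I x) = ?c * ?P"
    using vol[of a] vol[of b] ab by (simp add: flux_const_eq_volume algebra_simps)
  have iF: "integrable lborel (\<lambda>x. ?I x * norm (dv x) powr q)"
    using Bochner_Integration.integrable_diff[OF i] by (simp add: left_diff_distrib)
  have FF: "F b - F a = (LINT x|lborel. ?I x * norm (dv x) powr q)"
    unfolding F_def using Bochner_Integration.integral_diff[OF i] by (simp add: left_diff_distrib)
  have "F b - F a - \<kappa> * (?c * ?P) = (LINT x|lborel. ?I x * norm (dv x) powr q - \<kappa> * ?I x)"
    unfolding FF II[symmetric] using iF iI by (subst Bochner_Integration.integral_diff) auto
  also have "\<bar>\<dots>\<bar> \<le> (LINT x|lborel. e * ?I x)"
    unfolding real_norm_def[symmetric]
  proof (rule Bochner_Integration.integral_norm_bound_integral)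
    fix x :: 'a
    show "norm (?I x * norm (dv x) powr q - \<kappa> * ?I x) \<le> e * ?I x"
    proof (cases "a < norm x \<and> norm x \<le> b")
      case True
      then have "norm (dv x) = \<bar>g (norm x)\<bar>" using ab by (intro norm_dv_radial) auto
      then show ?thesis using True k[of "norm x"] by simp
    next
      case False
      then have "?I x = 0" using ab by (auto split: split_indicator)
      then show ?thesis by simp
    qed
  qed (use iF iI in auto)
  also have "(LINT x|lborel. e * ?I x) = e * (?c * ?P)" using II by simp
  finally have "\<bar>F b - F a - \<kappa> * (?c * ?P)\<bar> \<le> ?c * (e * ?P)" by (simp add: mult.left_commute)
  moreover have "F b - F a - \<kappa> * (?c * ?P) = ?c * (W b - W a - \<kappa> * ?P)"
    using flux_W[OF a0(1) ab(3)] flux_W[OF ab(1) a0(2)] by (simp add: algebra_simps)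
  ultimately have "?c * \<bar>W b - W a - \<kappa> * ?P\<bar> \<le> ?c * (e * ?P)" by (simp add: abs_mult flux_const_pos less_imp_le)
  then show ?thesis using flux_const_pos[where 'a='a] by simp
qed

text \<open>On thin shells |V'|^q is almost constant, so \<open>W_increment\<close> compares
  increments of W with increments of r^N / N. Both sides of r are needed for a two-sided
  derivative.\<close>

lemma W_deriv:
  assumes r: "0 < r" "r < R0"
  shows "DERIV W r :> \<bar>g r\<bar> powr q * r powr (real DIM('a) - 1)"
proof (rule deriv_by_comparison[where g="\<lambda>t. t ^ DIM('a) / real DIM('a)"])
  have "DERIV (\<lambda>t::real. t ^ DIM('a) / real DIM('a)) r :> r ^ (DIM('a) - 1)" by (auto intro!: derivative_eq_intros)
  moreover have "r ^ (DIM('a) - 1) = r powr (real DIM('a) - 1)" using r DIM_positive[where 'a='a] by (simp add: of_nat_diff flip: powr_realpow)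
  ultimately show "DERIV (\<lambda>t::real. t ^ DIM('a) / real DIM('a)) r :> r powr (real DIM('a) - 1)" by simp
  fix e :: real assume e: "e > 0"
  have q0: "q > 0" using p q by simp
  have "continuous_on {0<..<R0} (\<lambda>t. \<bar>g t\<bar> powr q)" using q0 by (intro continuous_on_powr' continuous_intros g_cont) auto
  then have "isCont (\<lambda>t. \<bar>g t\<bar> powr q) r" using r by (simp add: continuous_on_eq_continuous_at)
  then obtain d where d: "d > 0" "\<And>t. \<bar>t - r\<bar> < d \<Longrightarrow> \<bar>\<bar>g t\<bar> powr q - \<bar>g r\<bar> powr q\<bar> < e"
    unfolding continuous_at_eps_delta using e by (auto simp: dist_real_def)
  have pm: "s ^ DIM('a) / real DIM('a) \<le> t ^ DIM('a) / real DIM('a)" if "0 < s" "s \<le> t" for s t :: real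
    using that by (intro divide_right_mono power_mono) auto
  have "\<forall>\<^sub>F y in at r. y \<in> {0<..<R0} \<and> \<bar>y - r\<bar> < d"
  proof -
    have "\<forall>\<^sub>F y in nhds r. y \<in> {0<..<R0} \<inter> {r - d<..<r + d}" by (rule eventually_nhds_in_open) (use r d(1) in auto)
    then show ?thesis by (rule eventually_at_filter[THEN iffD2, OF eventually_mono]) auto
  qed
  then show "\<forall>\<^sub>F y in at r. \<bar>W y - W r - \<bar>g r\<bar> powr q * (y ^ DIM('a) / real DIM('a) - r ^ DIM('a) / real DIM('a))\<bar> \<le> e * \<bar>y ^ DIM('a) / real DIM('a) - r ^ DIM('a) / real DIM('a)\<bar>"
  proof eventually_elim
    case (elim y)
    show ?case
    proof (cases "r \<le> y")
      case True
      have "\<bar>W y - W r - \<bar>g r\<bar> powr q * (y ^ DIM('a) / real DIM('a) - r ^ DIM('a) / real DIM('a))\<bar> \<le> e * (y ^ DIM('a) / real DIM('a) - r ^ DIM('a) / real DIM('a))"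
        by (rule W_increment) (use True r elim d(2) in \<open>auto intro!: less_imp_le\<close>)
      then show ?thesis using pm[OF r(1) True] by simp
    next
      case False
      have "\<bar>W r - W y - \<bar>g r\<bar> powr q * (r ^ DIM('a) / real DIM('a) - y ^ DIM('a) / real DIM('a))\<bar> \<le> e * (r ^ DIM('a) / real DIM('a) - y ^ DIM('a) / real DIM('a))"
        by (rule W_increment) (use False r elim d(2) in \<open>auto intro!: less_imp_le\<close>)
      moreover have "y ^ DIM('a) / real DIM('a) \<le> r ^ DIM('a) / real DIM('a)" using pm[of y r] False elim by simp
      moreover have "\<bar>W y - W r - k * (Y - X)\<bar> = \<bar>W r - W y - k * (X - Y)\<bar>" for k X Y
        by (subst abs_minus_commute[symmetric]) (simp add: algebra_simps abs_minus_commute)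
      ultimately show ?thesis by simp
    qed
  qed
qed

lemma W_nonneg: "0 < r \<Longrightarrow> r < R0 \<Longrightarrow> W r \<ge> 0"
proof -
  assume r: "0 < r" "r < R0"
  have "F r \<ge> 0" unfolding F_def by (intro Bochner_Integration.integral_nonneg) simp
  then show ?thesis using flux_W[OF r] flux_const_pos[where 'a='a] by (metis zero_le_mult_iff not_le order.asym)
qed

lemma W_mono: "0 < a \<Longrightarrow> a \<le> b \<Longrightarrow> b < R0 \<Longrightarrow> W a \<le> W b"
  by (rule DERIV_nonneg_imp_nondecreasing[of a b W]) (auto intro!: exI W_deriv)

lemma g_nonpos: "0 < r \<Longrightarrow> r < R0 \<Longrightarrow> g r \<le> 0"
proof (rule ccontr)
  assume r: "0 < r" "r < R0" and "\<not> g r \<le> 0"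
  then have "r powr (real DIM('a) - 1) * p_field p (g r) > 0" by (simp add: p_field_def)
  then show False using W_nonneg[OF r] by (simp add: W_def)
qed

lemma abs_g_powr: "0 < r \<Longrightarrow> r < R0 \<Longrightarrow> \<bar>g r\<bar> powr (p - 1) = W r * r powr (1 - real DIM('a))"
proof -
  assume r: "0 < r" "r < R0"
  have "W r = r powr (real DIM('a) - 1) * (\<bar>g r\<bar> powr (p - 2) * \<bar>g r\<bar>)" using g_nonpos[OF r] by (simp add: W_def p_field_def)
  also have "\<bar>g r\<bar> powr (p - 2) * \<bar>g r\<bar> = \<bar>g r\<bar> powr (p - 1)" using powr_mult_self[of "\<bar>g r\<bar>" "p - 2"] by simp
  finally have "W r * r powr (1 - real DIM('a)) = (r powr (real DIM('a) - 1) * r powr (1 - real DIM('a))) * \<bar>g r\<bar> powr (p - 1)" by simp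
  also have "r powr (real DIM('a) - 1) * r powr (1 - real DIM('a)) = 1" using r by (simp flip: powr_add)
  finally show ?thesis by simp
qed

lemma g_eq: "0 < r \<Longrightarrow> r < R0 \<Longrightarrow> g r = - ((W r * r powr (1 - real DIM('a))) powr (1 / (p - 1)))"
  using abs_g_powr[of r] g_nonpos[of r] p by (simp add: powr_powr flip: abs_g_powr)

end

section \<open>Explicit solution of the flux equation and its asymptotics\<close>

context radial_hj
begin

text \<open>The flux is nonnegative and nondecreasing, so one zero at r forces it to vanish on the
  whole interval (0, r), and V' vanishes with it.\<close>

lemma constant_near_origin:
  assumes r: "0 < r" "r < R0" "W r = 0"
  obtains c where "\<And>x. 0 < norm x \<Longrightarrow> norm x < r \<Longrightarrow> v x = c"
proof (rule that[of "V (r / 2)"])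
  have g0: "g t = 0" if "0 < t" "t < r" for t
  proof -
    have "W t = 0" using W_mono[of t r] W_nonneg[of t] that r by force
    then show ?thesis using g_eq[of t] that r by simp
  qed
  fix x :: 'a assume x: "0 < norm x" "norm x < r"
  have "V (norm x) = V (r / 2)"
  proof (rule DERIV_isconst3[of 0 r _ _ V])
    fix t assume "t \<in> {0<..<r}"
    then show "DERIV V t :> 0" using V_deriv[of t] g0[of t] r by simp
  qed (use x r in auto)
  then show "v x = V (r / 2)" using v_radial[of x] x r by simp
qed

abbreviation "sexp \<equiv> (q + 1 - p) / (p - 1)"

lemma q1p: "q + 1 - p > 0" "p - 1 > 0" "sexp > 0" "N \<ge> 2 \<Longrightarrow> N - 1 > 0" for N :: real
  using q p by auto

text \<open>The equation \<open>W' = r\<^sup>a W\<^bsup>q/(p-1)\<^esup>\<close> for the flux is separable.\<close>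

lemma W_powr_deriv:
  assumes W: "\<And>t. 0 < t \<Longrightarrow> t < R0 \<Longrightarrow> W t \<noteq> 0" and r: "0 < r" "r < R0"
  shows "DERIV (\<lambda>r. W r powr (- sexp)) r :> - sexp * r powr ((real DIM('a) - 1) * (1 - q / (p - 1)))"
proof -
  have Wr: "W r > 0" using W[OF r] W_nonneg[OF r] by simp
  have "DERIV (\<lambda>r. W r powr (- sexp)) r :> (- sexp * W r powr (- sexp - 1)) * (\<bar>g r\<bar> powr q * r powr (real DIM('a) - 1))"
    by (rule DERIV_chain2[OF has_real_derivative_powr[OF Wr] W_deriv[OF r]])
  moreover have "\<bar>g r\<bar> powr q = W r powr (q / (p - 1)) * r powr ((1 - real DIM('a)) * (q / (p - 1)))"
    unfolding g_eq[OF r] using Wr by (simp add: powr_mult powr_powr)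
  moreover have "(- sexp * W r powr (- sexp - 1)) * (W r powr (q / (p - 1)) * r powr ((1 - real DIM('a)) * (q / (p - 1))) * r powr (real DIM('a) - 1))
     = - sexp * (W r powr (- sexp - 1) * W r powr (q / (p - 1))) * (r powr ((1 - real DIM('a)) * (q / (p - 1))) * r powr (real DIM('a) - 1))"
    by (simp only: mult_ac)
  moreover have "W r powr (- sexp - 1) * W r powr (q / (p - 1)) = 1"
  proof -
    have "- sexp - 1 + q / (p - 1) = 0" using q1p(2) by (simp add: field_simps)
    then show ?thesis using Wr by (simp flip: powr_add)
  qed
  moreover have "r powr ((1 - real DIM('a)) * (q / (p - 1))) * r powr (real DIM('a) - 1) = r powr ((real DIM('a) - 1) * (1 - q / (p - 1)))"
  proof -
    have e: "(1 - n) * x + (n - 1) = (n - 1) * (1 - x)" for n x :: real by (simp add: algebra_simps)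
    show ?thesis unfolding powr_add[symmetric] e ..
  qed
  ultimately show ?thesis by (simp only: mult_1_right)
qed

text \<open>\<open>G\<close> is left open because the primitive is a power of the radius in the
  supercritical case and a logarithm in the critical one.\<close>

lemma W_powr_explicit:
  assumes W: "\<And>t. 0 < t \<Longrightarrow> t < R0 \<Longrightarrow> W t \<noteq> 0"
    and G: "\<And>t. 0 < t \<Longrightarrow> DERIV G t :> - sexp * t powr ((real DIM('a) - 1) * (1 - q / (p - 1)))"
  obtains C where "\<And>t. 0 < t \<Longrightarrow> t < R0 \<Longrightarrow> W t powr (- sexp) = C + G t"
proof (rule that[of "W (R0 / 2) powr (- sexp) - G (R0 / 2)"])
  fix t assume t: "0 < t" "t < R0"
  have "W t powr (- sexp) - G t = W (R0 / 2) powr (- sexp) - G (R0 / 2)"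
  proof (rule DERIV_isconst3[of 0 R0 _ _ "\<lambda>t. W t powr (- sexp) - G t"])
    fix x assume "x \<in> {0<..<R0}"
    then show "DERIV (\<lambda>t. W t powr (- sexp) - G t) x :> 0"
      using DERIV_diff[OF W_powr_deriv[OF W] G, of x] by simp
  qed (use t R0 in auto)
  then show "W t powr (- sexp) = W (R0 / 2) powr (- sexp) - G (R0 / 2) + G t" by simp
qed

lemma g_W_powr:
  assumes r: "0 < r" "r < R0"
  shows "g r = - ((W r powr (- sexp)) powr (- 1 / (q + 1 - p)) * r powr (- ((real DIM('a) - 1) / (p - 1))))"
proof -
  have "(- sexp) * (- 1 / (q + 1 - p)) = 1 / (p - 1)" using q1p by (simp add: field_simps)
  moreover have "(1 - real DIM('a)) / (p - 1) = - ((real DIM('a) - 1) / (p - 1))" by (simp add: minus_divide_left)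
  ultimately show ?thesis unfolding g_eq[OF r] powr_powr powr_mult by (simp only: powr_powr) simp
qed

lemma ev_right: "\<forall>\<^sub>F r in at_right (0::real). 0 < r \<and> r < R0"
  using R0 by (auto simp: eventually_at_right_field)

lemma norm_at_right: "filterlim (norm :: 'a \<Rightarrow> real) (at_right 0) (at 0)"
  unfolding filterlim_at by (auto intro!: tendsto_eq_intros simp: eventually_at_filter)

lemma radial_limit:
  assumes lim: "((\<lambda>r. h r * V r) \<longlongrightarrow> l) (at_right 0)"
  shows "((\<lambda>x::'a. h (norm x) * v x) \<longlongrightarrow> l) (at 0)"
proof (rule Lim_transform_eventually[OF filterlim_compose[OF lim norm_at_right]])
  have "\<forall>\<^sub>F x::'a in at 0. x \<noteq> 0 \<and> norm x < R0" using R0 by (auto simp: eventually_at intro!: exI[of _ R0])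
  then show "\<forall>\<^sub>F x::'a in at 0. h (norm x) * V (norm x) = h (norm x) * v x"
    by eventually_elim (simp add: v_radial)
qed

text \<open>Here W^(-s) = C + k r^(-b) with b > 0, so the integration constant C is negligible near
  0 and the leading term depends only on N, p, q. L'Hopital's rule passes from V' to V, since
  r^(-\<beta>) tends to infinity.\<close>

lemma supercritical_limit:
  assumes W: "\<And>t. 0 < t \<Longrightarrow> t < R0 \<Longrightarrow> W t \<noteq> 0"
    and qc: "q > q_crit (real DIM('a)) p" and qp: "q < p"
  shows "((\<lambda>x::'a. norm x powr beta p q * v x) \<longlongrightarrow> lambda_tilde (real DIM('a)) p q) (at 0)"
proof -
  let ?N = "real DIM('a)" and ?m = "q + 1 - p"
  \<comment> \<open>The separable equation integrates r^(-b - 1). Multiplied by p - 1, the number b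
    becomes (N - 1) q - N (p - 1), which is positive exactly when q > q_c.\<close>
  define b where "b = - ((?N - 1) * (1 - q / (p - 1))) - 1"
  define \<beta> where "\<beta> = beta p q"
  have N: "?N \<ge> 2" using dim2 by simp
  have \<beta>: "\<beta> > 0" using qp q1p(1) by (simp add: \<beta>_def beta_def)
  have \<beta>1: "\<beta> + 1 = 1 / ?m" using q1p(1) by (simp add: \<beta>_def beta_def field_simps)
  have bm: "b * (p - 1) = (?N - 1) * q - ?N * (p - 1)" using q1p(2) by (simp add: b_def field_simps)
  have "?N * (p - 1) < q * (?N - 1)" using qc N by (simp add: q_crit_def pos_divide_less_eq)
  then have "0 < b * (p - 1)" unfolding bm by (simp add: mult.commute)
  then have b: "b > 0" using q1p(2) by (simp add: zero_less_mult_iff)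
  define k where "k = sexp / b"
  have k: "k > 0" unfolding k_def by (rule divide_pos_pos[OF q1p(3) b])
  define G where "G r = k * r powr (- b)" for r
  have G': "DERIV G t :> - sexp * t powr ((?N - 1) * (1 - q / (p - 1)))" if t: "0 < t" for t
  proof -
    have "DERIV G t :> k * ((- b) * t powr (- b - 1))" unfolding G_def by (rule DERIV_cmult[OF has_real_derivative_powr[OF t]])
    moreover have "k * ((- b) * t powr (- b - 1)) = - sexp * t powr (- b - 1)" using b by (simp add: k_def)
    moreover have "- b - 1 = (?N - 1) * (1 - q / (p - 1))" by (simp add: b_def)
    ultimately show ?thesis by simp
  qed
  obtain C where C: "\<And>t. 0 < t \<Longrightarrow> t < R0 \<Longrightarrow> W t powr (- sexp) = C + G t"
    using W_powr_explicit[OF W G'] by blast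
  have gr: "g r / (- \<beta> * r powr (- \<beta> - 1)) = (C * r powr b + k) powr (- 1 / ?m) / \<beta>" if r: "0 < r" "r < R0" for r
  proof -
    have "C + G r = (C * r powr b + k) * r powr (- b)" using r by (simp add: G_def distrib_right flip: powr_add)
    then have "g r = - ((C * r powr b + k) powr (- 1 / ?m) * (r powr ((- b) * (- 1 / ?m)) * r powr (- ((?N - 1) / (p - 1)))))"
      unfolding g_W_powr[OF r] C[OF r] by (simp only: powr_mult powr_powr mult_ac)
    also have "r powr ((- b) * (- 1 / ?m)) * r powr (- ((?N - 1) / (p - 1))) = r powr (- \<beta> - 1)"
    proof -
      have "b / ?m - (?N - 1) / (p - 1) = - (1 / ?m)"
      proof -
        have "(?N - 1) / (p - 1) = (?N - 1) * ?m / (p - 1) / ?m" using q1p by simp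
        moreover have "b = (?N - 1) * ?m / (p - 1) - 1" using q1p(2) by (simp add: b_def field_simps)
        ultimately show ?thesis by (simp add: diff_divide_distrib)
      qed
      then have "(- b) * (- 1 / ?m) + - ((?N - 1) / (p - 1)) = - \<beta> - 1" using \<beta>1 by simp
      then show ?thesis unfolding powr_add[symmetric] by simp
    qed
    finally show ?thesis using r \<beta> by simp
  qed
  have "((\<lambda>r. V r / r powr (- \<beta>)) \<longlongrightarrow> k powr (- 1 / ?m) / \<beta>) (at_right 0)"
  proof (rule lhopital_right_at_top)
    show "LIM r at_right 0. r powr (- \<beta>) :> at_top" using \<beta> by real_asymp
    show "\<forall>\<^sub>F r in at_right 0. - \<beta> * r powr (- \<beta> - 1) \<noteq> 0" using ev_right by eventually_elim (use \<beta> in simp)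
    show "\<forall>\<^sub>F r in at_right 0. DERIV V r :> g r" using ev_right by eventually_elim (simp add: V_deriv)
    show "\<forall>\<^sub>F r in at_right 0. DERIV (\<lambda>r. r powr (- \<beta>)) r :> - \<beta> * r powr (- \<beta> - 1)"
      using ev_right by eventually_elim (simp only: has_real_derivative_powr)
    have "((\<lambda>r. C * r powr b + k) \<longlongrightarrow> k) (at_right 0)" using b k by real_asymp
    then have "((\<lambda>r. (C * r powr b + k) powr (- 1 / ?m) / \<beta>) \<longlongrightarrow> k powr (- 1 / ?m) / \<beta>) (at_right 0)"
      by (intro tendsto_divide tendsto_powr' tendsto_const) (use k \<beta> in auto)
    then show "((\<lambda>r. g r / (- \<beta> * r powr (- \<beta> - 1))) \<longlongrightarrow> k powr (- 1 / ?m) / \<beta>) (at_right 0)"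
      by (rule Lim_transform_eventually) (use ev_right in \<open>eventually_elim, simp only: gr\<close>)
  qed
  moreover have "(\<lambda>r. V r / r powr (- \<beta>)) = (\<lambda>r. r powr \<beta> * V r)" by (simp add: powr_minus divide_inverse mult.commute)
  moreover have "k powr (- 1 / ?m) / \<beta> = lambda_tilde ?N p q"
  proof -
    have "k powr (- 1 / ?m) = (1 / k) powr (1 / ?m)" using powr_minus_divide[of k "1 / ?m"] by (simp add: powr_divide)
    moreover have "1 / k = ?N - p - \<beta> * (p - 1)"
    proof -
      have "1 / k = b * (p - 1) / ?m" using b q1p by (simp add: k_def)
      also have "\<dots> = ((?N - 1) * q - ?N * (p - 1)) / ?m" unfolding bm ..
      also have "\<dots> = ?N - p - \<beta> * (p - 1)" using q1p(1) by (simp add: \<beta>_def beta_def field_simps)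
      finally show ?thesis .
    qed
    ultimately show ?thesis by (simp add: lambda_tilde_def \<beta>_def[symmetric] divide_inverse mult.commute)
  qed
  ultimately have "((\<lambda>r. r powr \<beta> * V r) \<longlongrightarrow> lambda_tilde ?N p q) (at_right 0)" by simp
  from radial_limit[OF this] show ?thesis by (simp add: \<beta>_def)
qed

text \<open>Now W^(-s) = C - s ln r with s = 1 / (N - 1), so V' equals, up to sign, a power of r
  times a power of the logarithm. The limit (N - 1)^\<theta> is s^(-\<theta>).\<close>

lemma critical_limit:
  assumes W: "\<And>t. 0 < t \<Longrightarrow> t < R0 \<Longrightarrow> W t \<noteq> 0"
    and qc: "q = q_crit (real DIM('a)) p" and qp: "q < p"
  shows "((\<lambda>x::'a. (- ln (norm x)) powr ((real DIM('a) - 1) / (p - 1)) * v x / mu p x)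
    \<longlongrightarrow> (real DIM('a) - 1) powr ((real DIM('a) - 1) / (p - 1))) (at 0)"
proof -
  let ?N = "real DIM('a)" and ?m = "q + 1 - p"
  have N: "?N \<ge> 2" using dim2 by simp
  have qN: "q * (?N - 1) = ?N * (p - 1)" using N by (simp add: qc q_crit_def)
  \<comment> \<open>With q = q_c the assumption q < p reads N (p - 1) < p (N - 1), that is p < N,
    which selects the power branch of \<mu>.\<close>
  have pN: "p < ?N"
  proof -
    have "q * (?N - 1) < p * (?N - 1)" using qp N by (intro mult_strict_right_mono) auto
    then show ?thesis unfolding qN by (simp add: algebra_simps)
  qed
  define \<theta> where "\<theta> = (?N - 1) / (p - 1)"
  define \<alpha> where "\<alpha> = (?N - p) / (p - 1)"
  define K where "K = (p - 1) / (?N - p)"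
  have pos: "\<theta> > 0" "\<alpha> > 0" "K > 0" "K * \<alpha> = 1" using N pN q1p(2) by (auto simp: \<theta>_def \<alpha>_def K_def)
  have \<alpha>\<theta>: "\<alpha> + 1 = \<theta>" using q1p(2) by (simp add: \<alpha>_def \<theta>_def field_simps)
  have mN: "?m * (?N - 1) = p - 1" using qN by (simp add: algebra_simps)
  have m\<theta>: "1 / ?m = \<theta>" using mN q1p by (simp add: \<theta>_def field_simps)
  have s: "sexp = 1 / (?N - 1)" using mN q1p N by (simp add: field_simps)
  have a: "(?N - 1) * (1 - q / (p - 1)) = - 1"
  proof -
    have "(?N - 1) * (1 - q / (p - 1)) = ((?N - 1) * (p - 1) - q * (?N - 1)) / (p - 1)" using q1p(2) by (simp add: field_simps)
    also have "\<dots> = - 1" unfolding qN using q1p(2) by (simp add: field_simps)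
    finally show ?thesis .
  qed
  define G where "G r = - sexp * ln r" for r
  have G': "DERIV G t :> - sexp * t powr ((?N - 1) * (1 - q / (p - 1)))" if t: "0 < t" for t
    unfolding G_def a using t by (auto intro!: derivative_eq_intros simp: powr_minus divide_inverse)
  obtain C where C: "\<And>t. 0 < t \<Longrightarrow> t < R0 \<Longrightarrow> W t powr (- sexp) = C + G t"
    using W_powr_explicit[OF W G'] by blast
  \<comment> \<open>This is \<mu> times (-ln r)^(-\<theta>), the expected profile of V. Its
    derivative \<open>H'\<close> carries the correction 1 - K \<theta> / (-ln r) from
    differentiating the logarithm, which tends to 1.\<close>
  define H where "H r = K * r powr (- \<alpha>) * (- ln r) powr (- \<theta>)" for r
  define H' where "H' r = - (r powr (- \<theta>) * (- ln r) powr (- \<theta>) * (1 - K * \<theta> / (- ln r)))" for r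
  have H': "DERIV H r :> H' r" if r: "0 < r" "r < R0" for r
  proof -
    have l: "- ln r > 0" using r R0 by simp
    have "DERIV (\<lambda>r. - ln r) r :> - (1 / r)" using r by (auto intro!: derivative_eq_intros)
    from DERIV_chain2[OF has_real_derivative_powr[OF l] this]
    have d2: "DERIV (\<lambda>r. (- ln r) powr (- \<theta>)) r :> (- \<theta> * (- ln r) powr (- \<theta> - 1)) * - (1 / r)" .
    have "DERIV (\<lambda>r. K * r powr (- \<alpha>)) r :> K * (- \<alpha> * r powr (- \<alpha> - 1))"
      by (rule DERIV_cmult[OF has_real_derivative_powr[OF r(1)]])
    from DERIV_mult[OF this d2] have "DERIV H r :> K * (- \<alpha> * r powr (- \<alpha> - 1)) * (- ln r) powr (- \<theta>)
        + (- \<theta> * (- ln r) powr (- \<theta> - 1)) * - (1 / r) * (K * r powr (- \<alpha>))" unfolding H_def .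
    moreover have "- \<alpha> - 1 = - \<theta>" using \<alpha>\<theta> by simp
    moreover have "r powr (- \<alpha>) = r * r powr (- \<theta>)"
    proof -
      have "- \<alpha> = - \<theta> + 1" using \<alpha>\<theta> by simp
      then show ?thesis using powr_mult_self[of r "- \<theta>"] r by (simp add: mult.commute)
    qed
    moreover have "(- ln r) powr (- \<theta> - 1) = (- ln r) powr (- \<theta>) / (- ln r)" using l by (simp add: powr_diff)
    moreover have "K * (- \<alpha> * X) * Y + (- \<theta> * (Y / D)) * - (1 / r) * (K * (r * X)) = - (X * Y * (1 - K * \<theta> / D))" for X Y D :: real
    proof -
      have "K * (- \<alpha> * X) * Y = - (X * Y)" using pos(4) by (metis mult.assoc mult.commute mult_minus_left mult_1)
      moreover have "(- \<theta> * (Y / D)) * - (1 / r) * (K * (r * X)) = X * Y * (K * \<theta> / D)" using r by simp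
      ultimately show ?thesis by (simp add: right_diff_distrib)
    qed
    ultimately show ?thesis unfolding H'_def by metis
  qed
  have "((\<lambda>r. V r / H r) \<longlongrightarrow> sexp powr (- \<theta>)) (at_right 0)"
  proof (rule lhopital_right_at_top)
    show "LIM r at_right 0. H r :> at_top" unfolding H_def using pos by real_asymp
    have "\<forall>\<^sub>F r in at_right 0. 1 - K * \<theta> / (- ln r) > 0" using pos by real_asymp
    with ev_right show "\<forall>\<^sub>F r in at_right 0. H' r \<noteq> 0"
    proof eventually_elim
      case (elim r)
      then have "- ln r > 0" using R0 by simp
      then have "(- ln r) powr (- \<theta>) > 0" by simp
      then show ?case using elim unfolding H'_def by simp
    qed
    show "\<forall>\<^sub>F r in at_right 0. DERIV V r :> g r" using ev_right by eventually_elim (simp add: V_deriv)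
    show "\<forall>\<^sub>F r in at_right 0. DERIV H r :> H' r" using ev_right by eventually_elim (simp add: H')
    have "((\<lambda>r. (C - sexp * ln r) powr (- \<theta>) * (- ln r) powr \<theta> / (1 - K * \<theta> / (- ln r))) \<longlongrightarrow> sexp powr (- \<theta>)) (at_right 0)"
      if "sexp = s" "s > 0" for s
      unfolding that(1) using pos that(2) by real_asymp
    from this[OF refl q1p(3)] show "((\<lambda>r. g r / H' r) \<longlongrightarrow> sexp powr (- \<theta>)) (at_right 0)"
    proof (rule Lim_transform_eventually)
      show "\<forall>\<^sub>F r in at_right 0. (C - sexp * ln r) powr (- \<theta>) * (- ln r) powr \<theta> / (1 - K * \<theta> / (- ln r)) = g r / H' r"
        using ev_right
      proof eventually_elim
        case (elim r)
        have l: "- ln r > 0" using elim R0 by simp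
        have "g r = - ((C - sexp * ln r) powr (- \<theta>) * r powr (- \<theta>))"
          unfolding g_W_powr[OF conjunct1[OF elim] conjunct2[OF elim]] C[OF conjunct1[OF elim] conjunct2[OF elim]] G_def
          using m\<theta> by (simp add: \<theta>_def)
        moreover have "(- ln r) powr (- \<theta>) = 1 / (- ln r) powr \<theta>" by (rule powr_minus_divide)
        moreover have "A * B / D = - (A * R) / - (R * (1 / B) * D)" if "R > 0" "B > 0" for A B D R :: real
          using that by (simp add: field_simps)
        ultimately show ?case unfolding H'_def using elim l by simp
      qed
    qed
  qed
  moreover have "sexp powr (- \<theta>) = (?N - 1) powr \<theta>" unfolding s using powr_minus_divide[of "?N - 1" \<theta>] by (simp add: powr_divide powr_minus_divide)
  ultimately have "((\<lambda>r. 1 / H r * V r) \<longlongrightarrow> (?N - 1) powr \<theta>) (at_right 0)" by simp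
  from radial_limit[OF this]
  have "((\<lambda>x::'a. 1 / H (norm x) * v x) \<longlongrightarrow> (?N - 1) powr \<theta>) (at 0)" .
  moreover have "(\<lambda>x::'a. 1 / H (norm x) * v x) = (\<lambda>x. (- ln (norm x)) powr \<theta> * v x / mu p x)"
  proof
    fix x :: 'a
    have "mu p x = K * norm x powr (- \<alpha>)" using pN by (simp add: mu_def Let_def K_def \<alpha>_def minus_divide_left)
    moreover have "(- ln (norm x)) powr (- \<theta>) = 1 / (- ln (norm x)) powr \<theta>" by (rule powr_minus_divide)
    ultimately show "1 / H (norm x) * v x = (- ln (norm x)) powr \<theta> * v x / mu p x" by (simp add: H_def)
  qed
  ultimately show ?thesis by (simp add: \<theta>_def)
qed

end

section \<open>From the given solution to the theorem\<close>

lemma hj_solution_of_C1_solution: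
  fixes u :: "'a::euclidean_space \<Rightarrow> real"
  assumes p: "1 < p" "p \<le> real DIM('a)" and dim: "DIM('a) \<ge> 2" and q: "q > p - 1"
    and \<Omega>: "open \<Omega>" "0 \<in> \<Omega>" and sol: "C1_solution p q (\<Omega> - {0}) u" and neg: "\<And>x. x \<in> \<Omega> - {0} \<Longrightarrow> u x < 0"
  obtains R0 where "hj_solution p q R0 \<Omega> (\<lambda>x. if x \<in> \<Omega> - {0} then - u x else 0) (\<lambda>x. if x \<in> \<Omega> - {0} then - grad u x else 0)"
proof -
  let ?U = "\<Omega> - {0}"
  define v where "v x = (if x \<in> ?U then - u x else 0)" for x
  define dv where "dv x = (if x \<in> ?U then - grad u x else 0)" for x
  obtain e where e: "e > 0" "cball 0 e \<subseteq> \<Omega>" using \<Omega> open_contains_cball by blast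
  \<comment> \<open>The cap 1/2 keeps the radius below 1, where \<mu> and -ln are
    nonnegative.\<close>
  define R0 where "R0 = min e (1 / 2)"
  have R0: "0 < R0" "R0 < 1" "cball 0 R0 \<subseteq> \<Omega>" using e by (auto simp: R0_def)
  have oU: "open ?U" using \<Omega> by (simp add: open_delete)
  have diff: "\<And>x. x \<in> ?U \<Longrightarrow> u differentiable (at x)" and cu: "continuous_on ?U (grad u)" and eq: "distr_eq p q ?U u 0"
    using sol unfolding C1_solution_def C1_on_def by auto
  have gd: "GDERIV v x :> dv x" if x: "x \<in> ?U" for x
  proof (rule gderiv_transform[OF _ oU x])
    have "GDERIV u x :> grad u x" by (rule GDERIV_grad[OF diff[OF x]])
    then show "GDERIV (\<lambda>x. - u x) x :> dv x"
      unfolding gderiv_def dv_def using x by (auto intro!: derivative_eq_intros)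
  qed (simp add: v_def)
  have cdv: "continuous_on ?U dv"
    by (rule continuous_on_eq[OF continuous_on_minus[OF cu]]) (simp add: dv_def)
  have q0: "q > 0" using p q by simp
  have w: "(LINT x|lborel. p_field p (dv x) \<bullet> grad \<phi> x) = (LINT x|lborel. norm (dv x) powr q * \<phi> x)"
    if \<phi>: "\<phi> \<in> test_functions ?U" for \<phi>
  proof -
    have "(\<lambda>x. indicator ?U x *\<^sub>R (p_flux p u x \<bullet> grad \<phi> x)) = (\<lambda>x. - (p_field p (dv x) \<bullet> grad \<phi> x))"
      by (auto simp: fun_eq_iff dv_def p_flux_eq p_field_minus p_field_def split: split_indicator)
    moreover have "(\<lambda>x. indicator ?U x *\<^sub>R (norm (grad u x) powr q * \<phi> x)) = (\<lambda>x. norm (dv x) powr q * \<phi> x)"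
      by (auto simp: fun_eq_iff dv_def split: split_indicator)
    moreover have "neg_p_laplacian p ?U u \<phi> + regular_distr ?U (\<lambda>x. norm (grad u x) powr q) \<phi> = 0"
      using eq \<phi> unfolding distr_eq_def by auto
    ultimately show ?thesis
      unfolding neg_p_laplacian_def regular_distr_def set_lebesgue_integral_def by simp
  qed
  have cF: "continuous_on ?U (\<lambda>x. p_field p (dv x))" by (rule continuous_on_p_field[OF p(1) cdv])
  have cf: "continuous_on ?U (\<lambda>x. norm (dv x) powr q)"
    using q0 by (intro continuous_on_powr' continuous_on_norm cdv continuous_on_const) auto
  have "hj_solution p q R0 \<Omega> v dv"
    by unfold_locales (use p dim q \<Omega> R0 gd cdv neg weak_equation_C1[OF oU cF cf w] in \<open>auto simp: v_def dv_def\<close>)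
  then show ?thesis using that[of R0] unfolding v_def[abs_def] dv_def[abs_def] by blast
qed

lemma regular_at_0_constant:
  assumes \<Omega>: "open \<Omega>" and r: "0 < r" "ball 0 r \<subseteq> \<Omega>" and u: "\<And>x. 0 < norm x \<Longrightarrow> norm x < r \<Longrightarrow> u x = c" and q: "q > 0"
  shows "regular_at_0 p q \<Omega> u"
proof -
  have "grad (\<lambda>x. c) x = 0" for x :: 'a by (rule grad_eqI) (simp add: gderiv_def)
  then have g: "grad (\<lambda>x::'a. c) = (\<lambda>x. 0)" by auto
  have f: "p_flux p (\<lambda>x::'a. c) = (\<lambda>x. 0)" by (auto simp: p_flux_def g)
  have "C1_solution p q (ball 0 r) (\<lambda>x::'a. c)"
    unfolding C1_solution_def C1_on_def distr_eq_def neg_p_laplacian_def regular_distr_def L1_loc_def f g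
    using q by (simp add: set_integrable_def set_lebesgue_integral_def)
  then show ?thesis unfolding regular_at_0_def
    by (intro exI[of _ "ball 0 r"] exI[of _ "\<lambda>x. c"]) (use r u in auto)
qed

theorem theoremD:
  fixes N p :: real
  defines "N \<equiv> real CARD('n::finite)"
  assumes "N \<ge> 2" and "1 < p" and "p \<le> N"
  shows "\<exists>\<gamma><0. \<forall>(q::real) (\<Omega> :: (real^'n) set) (u :: real^'n \<Rightarrow> real).
    q > p - 1 \<and> open \<Omega> \<and> connected \<Omega> \<and> 0 \<in> \<Omega> \<and>
    C1_solution p q (\<Omega> - {0}) u \<and> (\<forall>x\<in>\<Omega> - {0}. u x < 0) \<longrightarrow>
    (q < q_crit N p \<longrightarrow>
      (\<exists>c\<le>0. ((\<lambda>x. u x / mu p x) \<longlongrightarrow> c) (at 0) \<and>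
         distr_eq p q \<Omega> u (fund_const TYPE(real^'n) p * \<bar>c\<bar> powr (p - 2) * c))) \<and>
    (q > q_crit N p \<longrightarrow>
      ((\<lambda>x. u x / mu p x) \<longlongrightarrow> 0) (at 0) \<and> distr_eq p q \<Omega> u 0) \<and>
    (radial_on (\<Omega> - {0}) u \<and> q < p \<longrightarrow>
      (q = q_crit N p \<longrightarrow>
        ((\<lambda>x. (- ln (norm x)) powr ((N - 1) / (p - 1)) * u x / mu p x) \<longlongrightarrow> \<gamma>) (at 0) \<or>
        regular_at_0 p q \<Omega> u) \<and>
      (q > q_crit N p \<longrightarrow>
        ((\<lambda>x. norm x powr beta p q * u x) \<longlongrightarrow> - lambda_tilde N p q) (at 0) \<or>
        regular_at_0 p q \<Omega> u))"
proof (intro exI[of _ "- ((N - 1) powr ((N - 1) / (p - 1)))"] conjI allI)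
  show "- ((N - 1) powr ((N - 1) / (p - 1))) < 0" using assms(2) by simp
  fix q :: real and \<Omega> :: "(real^'n) set" and u :: "real^'n \<Rightarrow> real"
  have DIM: "real DIM(real^'n) = N" by (simp add: N_def)
  \<comment> \<open>The negative of the limit found in \<open>critical_limit\<close>. It must be
    given before q, \<Omega> and u are introduced, and it is a function of N and p alone.\<close>
  let ?\<gamma> = "- ((N - 1) powr ((N - 1) / (p - 1)))"
  show "q > p - 1 \<and> open \<Omega> \<and> connected \<Omega> \<and> 0 \<in> \<Omega> \<and>
    C1_solution p q (\<Omega> - {0}) u \<and> (\<forall>x\<in>\<Omega> - {0}. u x < 0) \<longrightarrow>
    (q < q_crit N p \<longrightarrow>
      (\<exists>c\<le>0. ((\<lambda>x. u x / mu p x) \<longlongrightarrow> c) (at 0) \<and>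
         distr_eq p q \<Omega> u (fund_const TYPE(real^'n) p * \<bar>c\<bar> powr (p - 2) * c))) \<and>
    (q > q_crit N p \<longrightarrow>
      ((\<lambda>x. u x / mu p x) \<longlongrightarrow> 0) (at 0) \<and> distr_eq p q \<Omega> u 0) \<and>
    (radial_on (\<Omega> - {0}) u \<and> q < p \<longrightarrow>
      (q = q_crit N p \<longrightarrow>
        ((\<lambda>x. (- ln (norm x)) powr ((N - 1) / (p - 1)) * u x / mu p x) \<longlongrightarrow> ?\<gamma>) (at 0) \<or>
        regular_at_0 p q \<Omega> u) \<and>
      (q > q_crit N p \<longrightarrow>
        ((\<lambda>x. norm x powr beta p q * u x) \<longlongrightarrow> - lambda_tilde N p q) (at 0) \<or>
        regular_at_0 p q \<Omega> u))"
    (is "?H \<longrightarrow> ?i \<and> ?ii \<and> (?rad \<longrightarrow> (_ \<longrightarrow> ?iii) \<and> (_ \<longrightarrow> ?iv))")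
  proof
    assume H: ?H
    define v where "v x = (if x \<in> \<Omega> - {0} then - u x else 0)" for x
    define dv where "dv x = (if x \<in> \<Omega> - {0} then - grad u x else 0)" for x
    have p': "1 < p" "p \<le> real DIM(real^'n)" "2 \<le> DIM(real^'n)" using assms unfolding DIM by (auto simp: N_def)
    obtain R0 where "hj_solution p q R0 \<Omega> v dv"
      using hj_solution_of_C1_solution[OF p', of q \<Omega> u] H unfolding v_def[abs_def] dv_def[abs_def] by blast
    then interpret hj_solution p "TYPE(real^'n)" q R0 \<Omega> v dv .
    have q0: "q > 0" using p q by simp
    have near: "\<forall>\<^sub>F x in at 0. v x = - u x"
    proof -
      have "\<forall>\<^sub>F x in nhds 0. x \<in> \<Omega>" using \<Omega>(1) H by (intro eventually_nhds_in_open) auto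
      then show ?thesis unfolding eventually_at_filter by eventually_elim (simp add: v_def)
    qed
    have transfer: "((\<lambda>x. f x * u x) \<longlongrightarrow> - l) (at 0)" if "((\<lambda>x. f x * v x) \<longlongrightarrow> l) (at 0)" for f l
      by (rule Lim_transform_eventually[OF tendsto_minus[OF that]]) (use near in \<open>eventually_elim, simp\<close>)
    obtain c0 where c0: "c0 \<ge> 0" and lim: "((\<lambda>x. v x / mu p x) \<longlongrightarrow> c0) (at 0)" by (rule limit_exists)
    have ulim: "((\<lambda>x. u x / mu p x) \<longlongrightarrow> - c0) (at 0)"
      using transfer[of "\<lambda>x. inverse (mu p x)" c0] lim by (simp add: divide_inverse mult.commute)
    have m: "mass = c0 powr (p - 1) * flux_const TYPE(real^'n)" by (rule mass_eq[OF c0 lim])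
    have eq: "distr_eq p q \<Omega> u (- mass)" by (rule distribution_equation) (simp add: dv_def)
    have i: ?i
    proof (intro impI exI[of _ "- c0"] conjI ulim)
      \<comment> \<open>The case c0 = 0 is included, because both sides are then 0 by the convention
        for \<open>powr\<close> at 0.\<close>
      have "c0 powr (p - 2) * c0 = c0 powr (p - 1)" using powr_mult_self[OF c0, of "p - 2"] by simp
      then have "fund_const TYPE(real^'n) p * \<bar>- c0\<bar> powr (p - 2) * - c0 = - mass"
        unfolding m fund_const_eq[OF p] using c0 by simp
      then show "distr_eq p q \<Omega> u (fund_const TYPE(real^'n) p * \<bar>- c0\<bar> powr (p - 2) * - c0)" using eq by simp
    qed (use c0 in simp)
    have mass0: "mass = 0" if "q \<ge> q_crit N p" using mass_zero that unfolding DIM .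
    have ii: ?ii
    proof
      assume "q > q_crit N p"
      then have "mass = 0" by (simp add: mass0)
      then have "c0 = 0" using m flux_const_pos[where 'a="real^'n"] by simp
      then show "((\<lambda>x. u x / mu p x) \<longlongrightarrow> 0) (at 0) \<and> distr_eq p q \<Omega> u 0" using ulim eq \<open>mass = 0\<close> by simp
    qed
    have rad: "(q = q_crit N p \<longrightarrow> ?iii) \<and> (q > q_crit N p \<longrightarrow> ?iv)" if R: ?rad
    proof (cases "q \<ge> q_crit N p")
      case False
      then show ?thesis by simp
    next
      case True
      obtain f where f: "\<And>x. x \<in> \<Omega> - {0} \<Longrightarrow> u x = f (norm x)" using R unfolding radial_on_def by blast
      interpret radial_hj p "TYPE(real^'n)" q R0 \<Omega> v dv
      proof
        show "mass = 0" by (rule mass0[OF True])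
        fix x y :: "real^'n" assume xy: "0 < norm x" "norm x < R0" "norm x = norm y"
        then have "x \<in> \<Omega> - {0}" "y \<in> \<Omega> - {0}" using \<Omega>(2) by auto
        then show "v x = v y" using f xy by (simp add: v_def)
      qed
      show ?thesis
      \<comment> \<open>The alternative of the theorem is decided by the flux: a zero makes u
        constant near the origin and thus regular, while a flux without zeros admits division in the
        separable equation.\<close>
      proof (cases "\<exists>r. 0 < r \<and> r < R0 \<and> W r = 0")
        case True
        then obtain r where r: "0 < r" "r < R0" "W r = 0" by blast
        obtain c where c: "\<And>x. 0 < norm x \<Longrightarrow> norm x < r \<Longrightarrow> v x = c" using constant_near_origin[OF r] by blast
        have sub: "ball 0 r \<subseteq> \<Omega>" using \<Omega>(2) r by auto
        have "regular_at_0 p q \<Omega> u"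
        proof (rule regular_at_0_constant[OF \<Omega>(1) r(1) sub _ q0])
          fix x :: "real^'n" assume x: "0 < norm x" "norm x < r"
          then have "x \<in> \<Omega> - {0}" using sub by auto
          then show "u x = - c" using c[OF x] by (simp add: v_def)
        qed
        then show ?thesis by blast
      next
        case False
        then have Wn: "\<And>t. 0 < t \<Longrightarrow> t < R0 \<Longrightarrow> W t \<noteq> 0" by blast
        have qp: "q < p" using R by simp
        show ?thesis
        proof (intro conjI impI disjI1)
          assume "q = q_crit N p"
          then have "((\<lambda>x. (- ln (norm x)) powr ((N - 1) / (p - 1)) * v x / mu p x) \<longlongrightarrow> (N - 1) powr ((N - 1) / (p - 1))) (at 0)"
            using critical_limit[OF Wn _ qp] unfolding DIM by blast
          then show "((\<lambda>x. (- ln (norm x)) powr ((N - 1) / (p - 1)) * u x / mu p x) \<longlongrightarrow> ?\<gamma>) (at 0)"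
            using transfer[of "\<lambda>x. (- ln (norm x)) powr ((N - 1) / (p - 1)) / mu p x"] by simp
        next
          assume "q > q_crit N p"
          then have "((\<lambda>x. norm x powr beta p q * v x) \<longlongrightarrow> lambda_tilde N p q) (at 0)"
            using supercritical_limit[OF Wn _ qp] unfolding DIM by blast
          then show "((\<lambda>x. norm x powr beta p q * u x) \<longlongrightarrow> - lambda_tilde N p q) (at 0)" by (rule transfer)
        qed
      qed
    qed
    from i ii rad show "?i \<and> ?ii \<and> (?rad \<longrightarrow> (q = q_crit N p \<longrightarrow> ?iii) \<and> (q > q_crit N p \<longrightarrow> ?iv))" by blast
  qed
qed

end
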